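(* Let $X$ be a nowhere vanishing volume-preserving vector field on a closed oriented 3-manifold $M$ with volume form $\mu$, and let $\mathcal C\subset M$ be a flow box of $X$, identified through local coordinates with $(0,1)\times\mathbb D$ in such a way that $X=\partial_t$, where $\mathbb D$ is the open unit 2-dimensional disk and $t$ is the coordinate on $(0,1)$. Let $\sigma_{\mathbb D}$ be any probability measure on $\mathbb D$. Then there are an adapted metric $g$ on $\mathcal C$ and a sequence $(r_n,\psi_n,A_n)$ of solutions, with $r_n\to\infty$, to the modified Seiberg--Witten equations with $\varpi=0$ on the flow box $\mathcal C$ (as described in the context) such that: (i) Setting $\mathcal E_n:=\int_{\mathcal C}\lambda\wedge F_{A_n}$, one has $$\frac{\lambda\wedge F_{A_n}}{\mathcal E_n}\longrightarrow\sigma_{\mathbb D}\otimes dt$$ in the sense of weak convergence of measures, where $dt$ is the Lebesgue measure on $(0,1)$. (ii) If $\sigma_{\mathbb D}$ is $d$-Frostman for some $d>0$, then the sequence of solutions can be chosen such that $$\lim_{n\to\infty}\mathcal E_n r_n^{-\theta}=0,\qquad \theta:=\min\Big\{\frac14,\ \frac{d}{2(d+1)}\Big\}.$$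
   Context: A probability measure $\sigma$ on $\mathbb D$ is $d$-Frostman if there is a constant $C$ with $\sigma(B(x,\varepsilon))\le C\varepsilon^d$ for all $\varepsilon>0$ and $x\in\mathbb D$. A 3-form $\Omega$ is identified with the signed measure $f\mapsto\int f\,\Omega$. An adapted metric is a Riemannian metric $g$ whose volume form is $\mu$ and with $g(X,X)=1$; one sets $\lambda:=g(X,\cdot)$. Modified Seiberg--Witten equations on $\mathcal C$. A spin-c structure is a pair $(\mathbb S,\sigma)$ with $\mathbb S$ a rank-2 Hermitian bundle and $\sigma:T\mathcal C\to\mathrm{End}(\mathbb S)$ satisfying $\sigma(V)\sigma(W)+\sigma(W)\sigma(V)=-2g(V,W)$ and $\sigma(e_1)\sigma(e_2)\sigma(e_3)=1$ for oriented orthonormal frames. The oriented 2-plane field $K^{-1}:=\ker\lambda$, regarded as a Hermitian line bundle, determines a distinguished spin-c structure $\mathbb S_\lambda=\underline{\mathbb C}\oplus K^{-1}$; tensoring with a Hermitian line bundle $E$ (trivial on $\mathcal C$) gives $\mathbb S=E\oplus K^{-1}E$, where $E$ and $K^{-1}E$ are the $+i$ and $-i$ eigenbundles of $\sigma(X)$. Connections on line bundles are written locally as $-iA$ with $A$ a real 1-form, and the curvature $F_A$ is the real 2-form $dA$. A connection $A$ on $E$, together with a connection $A_0$ on $K^{-1}$, determines a unique spin-c connection $\nabla_A$ on $\mathbb S$ (compatible with $\sigma$ and the Levi-Civita connection, inducing $A_0+2A$ on $\det\mathbb S$), with Dirac operator $D_A=\sigma(\nabla_A)=\sum_j\sigma(e_j)\nabla_{A,e_j}$.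 Here $A_0$ is the unique connection on $K^{-1}$ for which the section $\psi_0=(1,0)$ of $\mathbb S_\lambda$ satisfies $D_{A_0}\psi_0=0$ (with the trivial connection on $\underline{\mathbb C}$). The unknowns are a section $\psi$ of $\mathbb S$ and a connection $A$ on $E$; for a real parameter $r$ the equations (with $\varpi=0$) are $$*F_A=r(\lambda-\psi^\dagger\sigma\psi),\qquad D_A\psi=0,$$ where $\psi^\dagger\sigma\psi$ is the real 1-form $V\mapsto -i\psi^\dagger\sigma(V)\psi$. *)

theory Defs
  imports "HOL-Probability.Probability"
begin

fun Ck_on :: "nat \<Rightarrow> 'a::euclidean_space set \<Rightarrow> ('a \<Rightarrow> 'b::real_normed_vector) \<Rightarrow> bool" where
  "Ck_on 0 U f \<longleftrightarrow> continuous_on U f"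
| "Ck_on (Suc k) U f \<longleftrightarrow>
     (\<forall>p\<in>U. f differentiable (at p)) \<and>
     (\<forall>b\<in>Basis. Ck_on k U (\<lambda>p. frechet_derivative f (at p) b))"

definition smooth_on :: "'a::euclidean_space set \<Rightarrow> ('a \<Rightarrow> 'b::real_normed_vector) \<Rightarrow> bool" where
  "smooth_on U f \<longleftrightarrow> open U \<and> (\<forall>k. Ck_on k U f)"

definition pd :: "3 \<Rightarrow> (real^3 \<Rightarrow> 'b::real_normed_vector) \<Rightarrow> real^3 \<Rightarrow> 'b" where
  "pd i f p = frechet_derivative f (at p) (axis i 1)"

text \<open>A chart is a coordinate domain together with a coordinate map; values of the map outside
  the domain are irrelevant.\<close>

type_synonym 'm chart = "'m set \<times> ('m \<Rightarrow> real^3)"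

definition chart_image :: "'m chart \<Rightarrow> (real^3) set" where
  "chart_image c = snd c ` fst c"

definition is_chart :: "'m topology \<Rightarrow> 'm chart \<Rightarrow> bool" where
  "is_chart M c \<longleftrightarrow> openin M (fst c) \<and> open (chart_image c) \<and>
     homeomorphic_map (subtopology M (fst c)) (top_of_set (chart_image c)) (snd c)"

definition transition :: "'m chart \<Rightarrow> 'm chart \<Rightarrow> real^3 \<Rightarrow> real^3" where
  "transition c d = (\<lambda>x. snd d (inv_into (fst c) (snd c) x))"

definition overlap :: "'m chart \<Rightarrow> 'm chart \<Rightarrow> (real^3) set" where
  "overlap c d = snd c ` (fst c \<inter> fst d)"

definition transition_jacobian :: "'m chart \<Rightarrow> 'm chart \<Rightarrow> real^3 \<Rightarrow> real^3^3" where
  "transition_jacobian c d x = matrix (frechet_derivative (transition c d) (at x))"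

definition compatible :: "'m chart \<Rightarrow> 'm chart \<Rightarrow> bool" where
  "compatible c d \<longleftrightarrow>
     smooth_on (overlap c d) (transition c d) \<and> smooth_on (overlap d c) (transition d c) \<and>
     (\<forall>x\<in>overlap c d. det (transition_jacobian c d x) > 0)"

text \<open>Atl is the maximal oriented smooth atlas, i.e. the set of all orientation-preserving smooth
  charts. Second countability follows from compactness.\<close>

definition closed_oriented_3manifold :: "'m topology \<Rightarrow> 'm chart set \<Rightarrow> bool" where
  "closed_oriented_3manifold M Atl \<longleftrightarrow>
     compact_space M \<and> Hausdorff_space M \<and>
     (\<forall>c\<in>Atl. is_chart M c) \<and> (\<Union>c\<in>Atl. fst c) = topspace M \<and>
     (\<forall>c\<in>Atl. \<forall>d\<in>Atl. compatible c d) \<and>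
     (\<forall>c. is_chart M c \<and> (\<forall>d\<in>Atl. compatible c d) \<longrightarrow> c \<in> Atl)"

text \<open>Tensor fields are given by their components in every chart. In the chart c the volume form
  is \<mu> c dx1 \<and> dx2 \<and> dx3; it is positive because the charts are oriented.\<close>

definition volume_form :: "'m chart set \<Rightarrow> ('m chart \<Rightarrow> real^3 \<Rightarrow> real) \<Rightarrow> bool" where
  "volume_form Atl \<mu> \<longleftrightarrow>
     (\<forall>c\<in>Atl. smooth_on (chart_image c) (\<mu> c) \<and> (\<forall>x\<in>chart_image c. \<mu> c x > 0)) \<and>
     (\<forall>c\<in>Atl. \<forall>d\<in>Atl. \<forall>x\<in>overlap c d.
        \<mu> c x = det (transition_jacobian c d x) * \<mu> d (transition c d x))"

definition vector_field :: "'m chart set \<Rightarrow> ('m chart \<Rightarrow> real^3 \<Rightarrow> real^3) \<Rightarrow> bool" where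
  "vector_field Atl X \<longleftrightarrow>
     (\<forall>c\<in>Atl. smooth_on (chart_image c) (X c)) \<and>
     (\<forall>c\<in>Atl. \<forall>d\<in>Atl. \<forall>x\<in>overlap c d.
        X d (transition c d x) = transition_jacobian c d x *v X c x)"

definition nowhere_vanishing :: "'m chart set \<Rightarrow> ('m chart \<Rightarrow> real^3 \<Rightarrow> real^3) \<Rightarrow> bool" where
  "nowhere_vanishing Atl X \<longleftrightarrow> (\<forall>c\<in>Atl. \<forall>x\<in>chart_image c. X c x \<noteq> 0)"

text \<open>The Lie derivative of \<mu> along X is d(i_X \<mu>), whose coefficient in a chart is the sum of the
  derivatives of the products of \<mu> with the components of X.\<close>

definition volume_preserving ::
  "'m chart set \<Rightarrow> ('m chart \<Rightarrow> real^3 \<Rightarrow> real) \<Rightarrow> ('m chart \<Rightarrow> real^3 \<Rightarrow> real^3) \<Rightarrow> bool" where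
  "volume_preserving Atl \<mu> X \<longleftrightarrow>
     (\<forall>c\<in>Atl. \<forall>x\<in>chart_image c. (\<Sum>i\<in>UNIV. pd i (\<lambda>y. \<mu> c y * X c y $ i) x) = 0)"

definition disk :: "(real^2) set" where
  "disk = ball 0 1"

definition box_point :: "real \<Rightarrow> real^2 \<Rightarrow> real^3" where
  "box_point t z = vector [t, z $ 1, z $ 2]"

definition box :: "(real^3) set" where
  "box = {box_point t z | t z. 0 < t \<and> t < 1 \<and> z \<in> disk}"

definition dt_field :: "real^3" where
  "dt_field = axis 1 1"

definition flow_box :: "'m chart set \<Rightarrow> ('m chart \<Rightarrow> real^3 \<Rightarrow> real^3) \<Rightarrow> 'm chart \<Rightarrow> bool" where
  "flow_box Atl X c \<longleftrightarrow> c \<in> Atl \<and> chart_image c = box \<and> (\<forall>p\<in>box. X c p = dt_field)"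

text \<open>In the flow box coordinates, a 1-form is the vector of its components, a 2-form the
  antisymmetric matrix of its values on pairs of coordinate fields, and a 3-form its coefficient
  with respect to dx1 \<and> dx2 \<and> dx3, where x1 is the coordinate t.\<close>

definition ext_d :: "(real^3 \<Rightarrow> real^3) \<Rightarrow> real^3 \<Rightarrow> real^3^3" where
  "ext_d A p = (\<chi> i j. pd i (\<lambda>q. A q $ j) p - pd j (\<lambda>q. A q $ i) p)"

definition wedge_1_2 :: "real^3 \<Rightarrow> real^3^3 \<Rightarrow> real" where
  "wedge_1_2 a F = a $ 1 * F $ 2 $ 3 + a $ 2 * F $ 3 $ 1 + a $ 3 * F $ 1 $ 2"

definition gprod :: "(real^3 \<Rightarrow> real^3^3) \<Rightarrow> real^3 \<Rightarrow> real^3 \<Rightarrow> real^3 \<Rightarrow> real" where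
  "gprod g p V W = V \<bullet> (g p *v W)"

definition riemannian_metric :: "(real^3 \<Rightarrow> real^3^3) \<Rightarrow> bool" where
  "riemannian_metric g \<longleftrightarrow> smooth_on box g \<and>
     (\<forall>p\<in>box. transpose (g p) = g p \<and> (\<forall>V. V \<noteq> 0 \<longrightarrow> gprod g p V V > 0))"

definition adapted_metric :: "(real^3 \<Rightarrow> real) \<Rightarrow> (real^3 \<Rightarrow> real^3^3) \<Rightarrow> bool" where
  "adapted_metric \<mu> g \<longleftrightarrow> riemannian_metric g \<and>
     (\<forall>p\<in>box. sqrt (det (g p)) = \<mu> p \<and> gprod g p dt_field dt_field = 1)"

definition lam :: "(real^3 \<Rightarrow> real^3^3) \<Rightarrow> real^3 \<Rightarrow> real^3" where
  "lam g p = (\<chi> i. gprod g p dt_field (axis i 1))"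

text \<open>Raise both indices of F with g, then contract with the volume form.\<close>

definition hodge_2 :: "(real^3 \<Rightarrow> real^3^3) \<Rightarrow> real^3 \<Rightarrow> real^3^3 \<Rightarrow> real^3" where
  "hodge_2 g p F =
     (let F' = matrix_inv (g p) ** F ** transpose (matrix_inv (g p))
      in sqrt (det (g p)) *\<^sub>R vector [F' $ 2 $ 3, F' $ 3 $ 1, F' $ 1 $ 2])"

definition christoffel :: "(real^3 \<Rightarrow> real^3^3) \<Rightarrow> real^3 \<Rightarrow> 3 \<Rightarrow> 3 \<Rightarrow> 3 \<Rightarrow> real" where
  "christoffel g p k i j = (1/2) * (\<Sum>l\<in>UNIV. matrix_inv (g p) $ k $ l *
     (pd i (\<lambda>q. g q $ j $ l) p + pd j (\<lambda>q. g q $ i $ l) p - pd l (\<lambda>q. g q $ i $ j) p))"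

definition levi_civita ::
  "(real^3 \<Rightarrow> real^3^3) \<Rightarrow> real^3 \<Rightarrow> (real^3 \<Rightarrow> real^3) \<Rightarrow> real^3 \<Rightarrow> real^3" where
  "levi_civita g V W p = frechet_derivative W (at p) V +
     (\<chi> k. \<Sum>i\<in>UNIV. \<Sum>j\<in>UNIV. christoffel g p k i j * V $ i * W p $ j)"

text \<open>Hermitian line bundles on the flow box are trivial. The bundle S is the sum of E and
  K^{-1}E, and each summand is trivialised by a unit section, so that S is the trivial bundle with
  fibre complex^2. Clifford multiplication by V at p is the matrix S p V.\<close>

definition hadj :: "complex^2^2 \<Rightarrow> complex^2^2" where
  "hadj B = (\<chi> i j. cnj (B $ j $ i))"

definition hprod :: "complex^2 \<Rightarrow> complex^2 \<Rightarrow> complex" where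
  "hprod \<phi> \<psi> = (\<Sum>i\<in>UNIV. cnj (\<phi> $ i) * \<psi> $ i)"

definition oriented_orthonormal :: "(real^3 \<Rightarrow> real^3^3) \<Rightarrow> real^3 \<Rightarrow> (3 \<Rightarrow> real^3) \<Rightarrow> bool" where
  "oriented_orthonormal g p e \<longleftrightarrow>
     (\<forall>i j. gprod g p (e i) (e j) = (if i = j then 1 else 0)) \<and> det (\<chi> i. e i) > 0"

definition spinc_structure ::
  "(real^3 \<Rightarrow> real^3^3) \<Rightarrow> (real^3 \<Rightarrow> real^3 \<Rightarrow> complex^2^2) \<Rightarrow> bool" where
  "spinc_structure g S \<longleftrightarrow>
     (\<forall>V. smooth_on box (\<lambda>p. S p V)) \<and>
     (\<forall>p\<in>box. linear (S p) \<and>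
        (\<forall>V. hadj (S p V) = - S p V) \<and>
        (\<forall>V W. S p V ** S p W + S p W ** S p V = mat (complex_of_real (- 2 * gprod g p V W))) \<and>
        (\<forall>e. oriented_orthonormal g p e \<longrightarrow> S p (e 1) ** S p (e 2) ** S p (e 3) = mat 1))"

text \<open>The first and second coordinates span the eigenbundles E and K^{-1}E of S p X for the
  eigenvalues i and -i. Taking E to be the trivial bundle with section 1, the map sending V to
  S p V (1,0) is then an isometry of ker \<lambda> onto the second summand, which turns the oriented
  quarter turn of ker \<lambda> into multiplication by i; this is the identification of K^{-1} with
  ker \<lambda>.\<close>

definition eigen_split :: "(real^3 \<Rightarrow> real^3 \<Rightarrow> complex^2^2) \<Rightarrow> bool" where
  "eigen_split S \<longleftrightarrow>
     (\<forall>p\<in>box. S p dt_field = vector [vector [\<i>, 0], vector [0, - \<i>]])"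

text \<open>A connection on S is written d + B, where B p V is a matrix depending linearly on V.\<close>

definition cov_deriv ::
  "(real^3 \<Rightarrow> real^3 \<Rightarrow> complex^2^2) \<Rightarrow> real^3 \<Rightarrow> (real^3 \<Rightarrow> complex^2) \<Rightarrow> real^3 \<Rightarrow> complex^2" where
  "cov_deriv B V \<psi> p = frechet_derivative \<psi> (at p) V + B p V *v \<psi> p"

text \<open>A0 and A are the real 1-forms of connections d - i A0 on K^{-1} and d - i A on E. The
  connection induced on det S has connection form trace B.\<close>

definition spinc_connection ::
  "(real^3 \<Rightarrow> real^3^3) \<Rightarrow> (real^3 \<Rightarrow> real^3 \<Rightarrow> complex^2^2) \<Rightarrow>
   (real^3 \<Rightarrow> real^3) \<Rightarrow> (real^3 \<Rightarrow> real^3) \<Rightarrow> (real^3 \<Rightarrow> real^3 \<Rightarrow> complex^2^2) \<Rightarrow> bool" where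
  "spinc_connection g S A0 A B \<longleftrightarrow>
     (\<forall>V. smooth_on box (\<lambda>p. B p V)) \<and>
     (\<forall>p\<in>box. linear (B p) \<and> (\<forall>V. hadj (B p V) = - B p V)) \<and>
     (\<forall>W \<psi>. smooth_on box W \<and> smooth_on box \<psi> \<longrightarrow>
        (\<forall>p\<in>box. \<forall>V. cov_deriv B V (\<lambda>q. S q (W q) *v \<psi> q) p =
           S p (levi_civita g V W p) *v \<psi> p + S p (W p) *v cov_deriv B V \<psi> p)) \<and>
     (\<forall>p\<in>box. \<forall>V. trace (B p V) = - \<i> * complex_of_real ((A0 p + 2 *\<^sub>R A p) \<bullet> V))"

text \<open>The sum of S(e_j) \<nabla>_(e_j) over a g-orthonormal frame e, written in coordinate fields:
  the sum of the tensors e_j \<otimes> e_j is the inverse metric.\<close>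

definition dirac ::
  "(real^3 \<Rightarrow> real^3^3) \<Rightarrow> (real^3 \<Rightarrow> real^3 \<Rightarrow> complex^2^2) \<Rightarrow>
   (real^3 \<Rightarrow> real^3 \<Rightarrow> complex^2^2) \<Rightarrow> (real^3 \<Rightarrow> complex^2) \<Rightarrow> real^3 \<Rightarrow> complex^2" where
  "dirac g S B \<psi> p = (\<Sum>i\<in>UNIV. \<Sum>j\<in>UNIV.
     matrix_inv (g p) $ i $ j *\<^sub>R (S p (axis i 1) *v cov_deriv B (axis j 1) \<psi> p))"

text \<open>The trivial connection on the trivial bundle E is the 1-form 0.\<close>

definition canonical_connection ::
  "(real^3 \<Rightarrow> real^3^3) \<Rightarrow> (real^3 \<Rightarrow> real^3 \<Rightarrow> complex^2^2) \<Rightarrow> (real^3 \<Rightarrow> real^3) \<Rightarrow> bool" where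
  "canonical_connection g S A0 \<longleftrightarrow> smooth_on box A0 \<and>
     (\<exists>B. spinc_connection g S A0 (\<lambda>p. 0) B \<and>
        (\<forall>p\<in>box. dirac g S B (\<lambda>q. vector [1, 0]) p = 0))"

definition spinor_form ::
  "(real^3 \<Rightarrow> real^3 \<Rightarrow> complex^2^2) \<Rightarrow> (real^3 \<Rightarrow> complex^2) \<Rightarrow> real^3 \<Rightarrow> real^3" where
  "spinor_form S \<psi> p = (\<chi> j. Re (- \<i> * hprod (\<psi> p) (S p (axis j 1) *v \<psi> p)))"

definition sw_solution ::
  "(real^3 \<Rightarrow> real^3^3) \<Rightarrow> (real^3 \<Rightarrow> real^3 \<Rightarrow> complex^2^2) \<Rightarrow>
   real \<Rightarrow> (real^3 \<Rightarrow> complex^2) \<Rightarrow> (real^3 \<Rightarrow> real^3) \<Rightarrow> bool" where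
  "sw_solution g S r \<psi> A \<longleftrightarrow> smooth_on box \<psi> \<and> smooth_on box A \<and>
     (\<forall>p\<in>box. hodge_2 g p (ext_d A p) = r *\<^sub>R (lam g p - spinor_form S \<psi> p)) \<and>
     (\<exists>A0 B. canonical_connection g S A0 \<and> spinc_connection g S A0 A B \<and>
        (\<forall>p\<in>box. dirac g S B \<psi> p = 0))"

definition energy_density :: "(real^3 \<Rightarrow> real^3^3) \<Rightarrow> (real^3 \<Rightarrow> real^3) \<Rightarrow> real^3 \<Rightarrow> real" where
  "energy_density g A p = wedge_1_2 (lam g p) (ext_d A p)"

definition energy :: "(real^3 \<Rightarrow> real^3^3) \<Rightarrow> (real^3 \<Rightarrow> real^3) \<Rightarrow> real" where
  "energy g A = (LINT p:box|lborel. energy_density g A p)"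

text \<open>The integrability and non-vanishing conditions make the energies and the normalised signed
  measures well defined.\<close>

definition normalized_energy_converges ::
  "(real^3 \<Rightarrow> real^3^3) \<Rightarrow> (nat \<Rightarrow> real^3 \<Rightarrow> real^3) \<Rightarrow> (real^2) measure \<Rightarrow> bool" where
  "normalized_energy_converges g A \<sigma> \<longleftrightarrow>
     (\<forall>n. set_integrable lborel box (energy_density g (A n)) \<and> energy g (A n) \<noteq> 0) \<and>
     (\<forall>f :: real^3 \<Rightarrow> real. continuous_on box f \<and> bounded (f ` box) \<longrightarrow>
        (\<lambda>n. LINT p:box|lborel. f p * (energy_density g (A n) p / energy g (A n)))
        \<longlonglongrightarrow> (\<integral>(z, t). f (box_point t z) \<partial>(\<sigma> \<Otimes>\<^sub>M restrict_space lborel {0<..<1})))"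

definition probability_on_disk :: "(real^2) measure \<Rightarrow> bool" where
  "probability_on_disk \<sigma> \<longleftrightarrow> prob_space \<sigma> \<and> sets \<sigma> = sets (restrict_space borel disk)"

definition frostman :: "real \<Rightarrow> (real^2) measure \<Rightarrow> bool" where
  "frostman d \<sigma> \<longleftrightarrow>
     (\<exists>C. \<forall>x\<in>disk. \<forall>\<epsilon>>0. measure \<sigma> (ball x \<epsilon> \<inter> disk) \<le> C * \<epsilon> powr d)"

end

(* Since X preserves the volume, the density m of the volume form on the flow box does not depend
   on t. With Y a primitive of m in the third coordinate, (t, x, y) |-> (t, x, Y) turns the volume
   form into the Euclidean one, and the pullback of the Euclidean metric is an adapted metric for
   which the t-invariant Seiberg-Witten equations are the vortex equations on the plane.

   Given points w_1, ..., w_N and r > 0, the vortex equation is the Kazdan-Warner equation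
   laplace u = 2 r (Q exp u - 1) + g0 with bounded smooth data Q and g0. It is solved by monotone
   iteration between a sub- and a supersolution, each step inverting c - laplace by convolution
   with an integral of Gaussians. As r tends to infinity the curvature concentrates at the
   points w_i with a universal mass each. Choosing the points to approximate the given measure and
   r at least exp N yields both the weak convergence and the energy bound for every positive
   exponent. *)
theory Submission
  imports Defs "HOL-Real_Asymp.Real_Asymp"
begin

section \<open>Gaussian averages in the plane\<close>

text \<open>Everything rests on one device, Gaussian integration by parts (Stein's identity), which
  trades a derivative for a factor Z in the average. It makes the resolvent gain derivatives, so
  that the limit of the iteration is smooth. It also handles the concentration: the curvature and
  the explicit function g0 differ by the Laplacian of u, and after averaging no derivative of u is
  left to estimate. What is known of u is then enough: it lies between 0 and N ln (8 N) whatever r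
  is, and it tends to 0 away from the points w_i as r grows.

  The vortices live on the whole plane, so there is no boundary condition and the points may lie
  outside the image of the disk. The price is a maximum principle on an unbounded domain, met by a
  quadratic penalty, and a separate proof that no curvature escapes to infinity.

  The total curvature is exactly proportional to N and independent of r. Hence r can be chosen after
  N and the points, as late as concentration and the bound exp N demand, which makes the energy at
  most of order ln r.\<close>

definition gauss :: "real measure" where
  "gauss = density lborel (\<lambda>x. ennreal (std_normal_density x))"

definition gauss2 :: "(real \<times> real) measure" where
  "gauss2 = gauss \<Otimes>\<^sub>M gauss"

lemma sets_gauss [simp, measurable_cong]: "sets gauss = sets borel"
  by (simp add: gauss_def)

lemma space_gauss [simp]: "space gauss = UNIV"
  by (simp add: gauss_def)

lemma sets_gauss2 [simp, measurable_cong]: "sets gauss2 = sets borel"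
  unfolding gauss2_def borel_prod[symmetric] by (intro sets_pair_measure_cong) simp_all

lemma space_gauss2 [simp]: "space gauss2 = UNIV"
  by (simp add: gauss2_def space_pair_measure)

lemma borel_measurable_fst_snd [measurable]:
  "fst \<in> borel_measurable (borel :: ('a::second_countable_topology \<times> 'b::second_countable_topology) measure)"
  "snd \<in> borel_measurable (borel :: ('a \<times> 'b) measure)"
  by (intro borel_measurable_continuous_onI continuous_intros)+

interpretation gauss: prob_space gauss
  unfolding gauss_def by (rule prob_space_normal_density) simp

interpretation gauss_pair: pair_prob_space gauss gauss ..

interpretation gauss2: prob_space gauss2
  unfolding gauss2_def by (rule gauss_pair.prob_space_axioms)

lemma integral_gauss:
  fixes f :: "real \<Rightarrow> real"
  assumes [measurable]: "f \<in> borel_measurable borel"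
  shows "(\<integral>x. f x \<partial>gauss) = (\<integral>x. std_normal_density x * f x \<partial>lborel)"
    and "integrable gauss f \<longleftrightarrow> integrable lborel (\<lambda>x. std_normal_density x * f x)"
  unfolding gauss_def by (simp_all add: integral_density integrable_density)

lemma integrable_gauss_power: "integrable gauss (\<lambda>x. \<bar>x\<bar> ^ k)"
  by (subst integral_gauss) (simp_all add: integrable_std_normal_moment_abs)

text \<open>Quadratic growth is what arises in Stein's identity, where a function of linear growth
  is multiplied by the coordinate.\<close>

lemma integrable_gauss_quadratic_bound:
  fixes f :: "real \<Rightarrow> real"
  assumes [measurable]: "f \<in> borel_measurable borel" and "\<And>x. \<bar>f x\<bar> \<le> K * (1 + \<bar>x\<bar>)^2"
  shows "integrable gauss f"
proof (rule Bochner_Integration.integrable_bound)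
  have "integrable gauss (\<lambda>x. K * (1 + 2 * \<bar>x\<bar>^1 + \<bar>x\<bar>^2))"
    by (intro integrable_mult_right Bochner_Integration.integrable_add integrable_gauss_power) auto
  then show "integrable gauss (\<lambda>x. K * (1 + \<bar>x\<bar>)^2)"
    by (simp add: power2_sum algebra_simps)
qed (use assms(2) in \<open>auto intro!: AE_I2 order_trans[OF assms(2)]\<close>)

lemma one_plus_abs_le_square: "1 + \<bar>x\<bar> \<le> (1 + \<bar>x\<bar>)^2" for x :: real
  by (rule self_le_power) auto

lemma std_normal_density_deriv:
  "(std_normal_density has_real_derivative - x * std_normal_density x) (at x)"
  unfolding std_normal_density_def
  by (rule derivative_eq_intros refl | simp)+

lemma std_normal_density_tendsto_0:
  assumes "\<And>x. \<bar>f x\<bar> \<le> K * (1 + \<bar>x\<bar>)"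
  shows "((\<lambda>x. f x * std_normal_density x) \<longlongrightarrow> 0) at_top"
    and "((\<lambda>x. f x * std_normal_density x) \<longlongrightarrow> 0) at_bot"
proof -
  have 1: "((\<lambda>x::real. (K * (1 + x)) * std_normal_density x) \<longlongrightarrow> 0) at_top"
    unfolding std_normal_density_def by real_asymp
  have 2: "((\<lambda>x::real. (K * (1 - x)) * std_normal_density x) \<longlongrightarrow> 0) at_bot"
    unfolding std_normal_density_def by real_asymp
  show "((\<lambda>x. f x * std_normal_density x) \<longlongrightarrow> 0) at_top"
    by (rule Lim_null_comparison[OF _ 1], rule eventually_mono[OF eventually_ge_at_top[of 0]])
      (use assms in \<open>auto simp: abs_mult intro!: mult_right_mono order_trans[OF assms]\<close>)
  show "((\<lambda>x. f x * std_normal_density x) \<longlongrightarrow> 0) at_bot"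
    by (rule Lim_null_comparison[OF _ 2], rule eventually_mono[OF eventually_le_at_bot[of 0]])
      (use assms in \<open>auto simp: abs_mult intro!: mult_right_mono order_trans[OF assms]\<close>)
qed

text \<open>Integration by parts against the normal density, whose derivative is - x times itself:
  the difference of the two integrands is the derivative of f times the density, and linear growth
  of f lets that product vanish at both ends.\<close>

lemma stein:
  fixes f f' :: "real \<Rightarrow> real"
  assumes der: "\<And>x. (f has_real_derivative f' x) (at x)"
    and cont: "continuous_on UNIV f'"
    and bf: "\<And>x. \<bar>f x\<bar> \<le> K * (1 + \<bar>x\<bar>)" and bf': "\<And>x. \<bar>f' x\<bar> \<le> K * (1 + \<bar>x\<bar>)"
  shows "(\<integral>x. f' x \<partial>gauss) = (\<integral>x. x * f x \<partial>gauss)"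
proof -
  have cf: "continuous_on UNIV f"
    using der by (meson DERIV_isCont continuous_at_imp_continuous_on)
  have [measurable]: "f \<in> borel_measurable borel" "f' \<in> borel_measurable borel"
    using cf cont by (auto intro: borel_measurable_continuous_onI)
  have K: "K \<ge> 0" using bf[of 0] by auto
  have i1: "integrable gauss f'"
    by (rule integrable_gauss_quadratic_bound[of _ K])
      (auto intro!: order_trans[OF bf'] mult_left_mono K one_plus_abs_le_square)
  have i2: "integrable gauss (\<lambda>x. x * f x)"
  proof (rule integrable_gauss_quadratic_bound[of _ K])
    fix x :: real
    have "\<bar>x * f x\<bar> \<le> (1 + \<bar>x\<bar>) * (K * (1 + \<bar>x\<bar>))"
      unfolding abs_mult by (intro mult_mono bf) auto
    then show "\<bar>x * f x\<bar> \<le> K * (1 + \<bar>x\<bar>)^2" by (simp add: power2_eq_square algebra_simps)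
  qed simp
  define h where "h x = f' x * std_normal_density x - x * f x * std_normal_density x" for x
  have ih: "integrable lborel h"
    using i1 i2 unfolding h_def by (auto simp: integral_gauss mult_ac)
  have "(LBINT x=-\<infinity>..\<infinity>. h x) = 0 - 0"
  proof (rule interval_integral_FTC_integrable)
    show "((\<lambda>x. f x * std_normal_density x) has_vector_derivative h x) (at x)" for x
      unfolding has_real_derivative_iff_has_vector_derivative[symmetric] h_def
      by (auto intro!: derivative_eq_intros der std_normal_density_deriv)
    show "isCont h x" for x
      using cf cont unfolding h_def std_normal_density_def
      by (intro continuous_intros) (auto simp: continuous_on_eq_continuous_at)
    show "set_integrable lborel (einterval (- \<infinity>) \<infinity>) h"
      using ih by (simp add: set_integrable_def)
  qed (use std_normal_density_tendsto_0[of f K] bf in \<open>auto simp: ereal_tendsto_simps\<close>)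
  then have "(\<integral>x. h x \<partial>lborel) = 0"
    by (simp add: interval_lebesgue_integral_def set_lebesgue_integral_def)
  moreover have "(\<integral>x. h x \<partial>lborel) = (\<integral>x. f' x \<partial>gauss) - (\<integral>x. x * f x \<partial>gauss)"
    using i1 i2 unfolding h_def
    by (subst Bochner_Integration.integral_diff) (auto simp: integral_gauss mult_ac)
  ultimately show ?thesis by simp
qed

section \<open>Gradients and Stein's identity in the plane\<close>

definition has_grad :: "(real \<times> real \<Rightarrow> real) \<Rightarrow> (real \<times> real \<Rightarrow> real) \<Rightarrow> (real \<times> real \<Rightarrow> real) \<Rightarrow> bool" where
  "has_grad f f1 f2 \<longleftrightarrow> (\<forall>p. (f has_derivative (\<lambda>h. fst h * f1 p + snd h * f2 p)) (at p))"

lemma has_gradD: "has_grad f f1 f2 \<Longrightarrow> (f has_derivative (\<lambda>h. fst h * f1 p + snd h * f2 p)) (at p)"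
  unfolding has_grad_def by blast

lemma has_grad_compose:
  assumes "has_grad f f1 f2" "(g has_derivative g') (at x within S)"
  shows "((\<lambda>x. f (g x)) has_derivative (\<lambda>h. fst (g' h) * f1 (g x) + snd (g' h) * f2 (g x))) (at x within S)"
  by (rule has_derivative_compose[OF assms(2) has_gradD[OF assms(1)]])

lemma has_grad_unique:
  assumes "has_grad f a b" "has_grad f a' b'"
  shows "a = a'" "b = b'"
proof -
  have "(\<lambda>h. fst h * a p + snd h * b p) = (\<lambda>h. fst h * a' p + snd h * b' p)" for p
    by (rule has_derivative_unique[OF has_gradD[OF assms(1)] has_gradD[OF assms(2)]])
  then show "a = a'" "b = b'"
    by (simp_all add: fun_eq_iff del: split_paired_All) (metis fst_conv snd_conv mult_1 mult_zero_left add_0 add_0_right)+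
qed

lemma has_grad_continuous: "has_grad f f1 f2 \<Longrightarrow> continuous_on UNIV f"
  by (meson continuous_at_imp_continuous_on has_derivative_continuous has_grad_def)

text \<open>Fubini reduces each identity to \<open>stein\<close> on lines, where the growth in the
  other coordinate is a constant. Growth is allowed because f will later be a bounded function times
  \<open>fst z\<close> or \<open>snd z\<close>.\<close>

lemma stein2:
  assumes g: "has_grad f f1 f2" and c: "continuous_on UNIV f1" "continuous_on UNIV f2"
    and K: "\<And>p. \<bar>f p\<bar> \<le> K * (1 + \<bar>fst p\<bar>) * (1 + \<bar>snd p\<bar>)"
      "\<And>p. \<bar>f1 p\<bar> \<le> K * (1 + \<bar>fst p\<bar>) * (1 + \<bar>snd p\<bar>)"
      "\<And>p. \<bar>f2 p\<bar> \<le> K * (1 + \<bar>fst p\<bar>) * (1 + \<bar>snd p\<bar>)"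
  shows "(\<integral>z. f1 z \<partial>gauss2) = (\<integral>z. fst z * f z \<partial>gauss2)"
    and "(\<integral>z. f2 z \<partial>gauss2) = (\<integral>z. snd z * f z \<partial>gauss2)"
proof -
  have cf: "continuous_on UNIV f" by (rule has_grad_continuous[OF g])
  have m[measurable]: "f \<in> borel_measurable borel" "f1 \<in> borel_measurable borel" "f2 \<in> borel_measurable borel"
    using cf c by (auto intro: borel_measurable_continuous_onI)
  have K0: "K \<ge> 0" using K(1)[of 0] by auto
  have int: "integrable (gauss \<Otimes>\<^sub>M gauss) h"
    if [measurable]: "h \<in> borel_measurable borel" and h: "\<And>p. \<bar>h p\<bar> \<le> K * (1 + \<bar>fst p\<bar>)^2 * (1 + \<bar>snd p\<bar>)^2" for h :: "real \<times> real \<Rightarrow> real"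
  proof (rule Bochner_Integration.integrable_bound)
    have q: "integrable gauss (\<lambda>x. (1 + \<bar>x\<bar>)^2)"
      by (rule integrable_gauss_quadratic_bound[of _ 1]) auto
    have "integrable (gauss \<Otimes>\<^sub>M gauss) (\<lambda>p. (1 + \<bar>fst p\<bar>)^2 * (1 + \<bar>snd p\<bar>)^2)"
      by (rule gauss_pair.Fubini_integrable) (auto intro!: integrable_mult_left integrable_mult_right q simp: abs_mult)
    then show "integrable (gauss \<Otimes>\<^sub>M gauss) (\<lambda>p. K * (1 + \<bar>fst p\<bar>)^2 * (1 + \<bar>snd p\<bar>)^2)"
      by (simp add: mult.assoc)
    show "h \<in> borel_measurable (gauss \<Otimes>\<^sub>M gauss)"
      using that(1) by (simp add: gauss2_def[symmetric])
  qed (use h in \<open>auto intro!: AE_I2 order_trans[OF h]\<close>)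
  have b1: "K * (1 + \<bar>x\<bar>) * (1 + \<bar>y\<bar>) \<le> K * (1 + \<bar>x\<bar>)^2 * (1 + \<bar>y\<bar>)^2" for x y :: real
    using K0 by (intro mult_mono mult_nonneg_nonneg one_plus_abs_le_square) auto
  have b2: "\<bar>x\<bar> * (K * (1 + \<bar>x\<bar>) * (1 + \<bar>y\<bar>)) \<le> K * (1 + \<bar>x\<bar>)^2 * (1 + \<bar>y\<bar>)^2" for x y :: real
  proof -
    have "(K * (1 + \<bar>x\<bar>) * (1 + \<bar>y\<bar>)) * \<bar>x\<bar> \<le> (K * (1 + \<bar>x\<bar>) * (1 + \<bar>y\<bar>)) * ((1 + \<bar>x\<bar>) * (1 + \<bar>y\<bar>))"
      using K0 by (intro mult_left_mono) (auto simp: algebra_simps)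
    then show ?thesis by (simp add: power2_eq_square mult_ac)
  qed
  have b3: "\<bar>y\<bar> * (K * (1 + \<bar>x\<bar>) * (1 + \<bar>y\<bar>)) \<le> K * (1 + \<bar>x\<bar>)^2 * (1 + \<bar>y\<bar>)^2" for x y :: real
    using b2[of y x] by (simp add: mult_ac)
  have I: "integrable (gauss \<Otimes>\<^sub>M gauss) f1" "integrable (gauss \<Otimes>\<^sub>M gauss) f2"
    by (auto intro!: int order_trans[OF K(2) b1] order_trans[OF K(3) b1])
  have I1: "integrable (gauss \<Otimes>\<^sub>M gauss) (\<lambda>z. fst z * f z)"
    by (rule int) (auto simp: abs_mult intro!: order_trans[OF mult_left_mono[OF K(1)] b2])
  have I2: "integrable (gauss \<Otimes>\<^sub>M gauss) (\<lambda>z. snd z * f z)"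
    by (rule int) (auto simp: abs_mult intro!: order_trans[OF mult_left_mono[OF K(1)] b3])
  have d1: "((\<lambda>x. f (x, y)) has_real_derivative f1 (x, y)) (at x)" for x y
    unfolding has_field_derivative_def
    by (rule has_derivative_eq_rhs[OF has_grad_compose[OF g]]) (auto intro!: derivative_eq_intros simp: fun_eq_iff)
  have d2: "((\<lambda>y. f (x, y)) has_real_derivative f2 (x, y)) (at y)" for x y
    unfolding has_field_derivative_def
    by (rule has_derivative_eq_rhs[OF has_grad_compose[OF g]]) (auto intro!: derivative_eq_intros simp: fun_eq_iff)
  have "(\<integral>z. f1 z \<partial>gauss2) = (\<integral>y. \<integral>x. f1 (x, y) \<partial>gauss \<partial>gauss)"
    unfolding gauss2_def by (subst gauss_pair.integral_snd) (auto simp: I)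
  also have "\<dots> = (\<integral>y. \<integral>x. x * f (x, y) \<partial>gauss \<partial>gauss)"
  proof (rule Bochner_Integration.integral_cong[OF refl], rule stein[OF d1, where K="K * (1 + \<bar>y\<bar>)" for y])
    fix x y show "\<bar>f (x, y)\<bar> \<le> K * (1 + \<bar>y\<bar>) * (1 + \<bar>x\<bar>)" "\<bar>f1 (x, y)\<bar> \<le> K * (1 + \<bar>y\<bar>) * (1 + \<bar>x\<bar>)"
      using K(1,2)[of "(x,y)"] by (auto simp: mult_ac)
  next
    fix y show "continuous_on UNIV (\<lambda>x. f1 (x, y))"
      by (rule continuous_on_compose2[OF c(1)]) (auto intro!: continuous_intros)
  qed
  also have "\<dots> = (\<integral>z. fst z * f z \<partial>gauss2)"
    unfolding gauss2_def using gauss_pair.integral_snd[of "\<lambda>x y. x * f (x, y)"] I1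
    by (simp add: case_prod_unfold)
  finally show "(\<integral>z. f1 z \<partial>gauss2) = (\<integral>z. fst z * f z \<partial>gauss2)" .
  have "(\<integral>z. f2 z \<partial>gauss2) = (\<integral>x. \<integral>y. f2 (x, y) \<partial>gauss \<partial>gauss)"
    unfolding gauss2_def by (subst gauss_pair.integral_fst) (auto simp: I)
  also have "\<dots> = (\<integral>x. \<integral>y. y * f (x, y) \<partial>gauss \<partial>gauss)"
  proof (rule Bochner_Integration.integral_cong[OF refl], rule stein[OF d2, where K="K * (1 + \<bar>x\<bar>)" for x])
    fix x y show "\<bar>f (x, y)\<bar> \<le> K * (1 + \<bar>x\<bar>) * (1 + \<bar>y\<bar>)" "\<bar>f2 (x, y)\<bar> \<le> K * (1 + \<bar>x\<bar>) * (1 + \<bar>y\<bar>)"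
      using K(1,3)[of "(x,y)"] by (auto simp: mult_ac)
  next
    fix x show "continuous_on UNIV (\<lambda>y. f2 (x, y))"
      by (rule continuous_on_compose2[OF c(2)]) (auto intro!: continuous_intros)
  qed
  also have "\<dots> = (\<integral>z. snd z * f z \<partial>gauss2)"
    unfolding gauss2_def using gauss_pair.integral_fst[of "\<lambda>x y. y * f (x, y)"] I2
    by (simp add: case_prod_unfold)
  finally show "(\<integral>z. f2 z \<partial>gauss2) = (\<integral>z. snd z * f z \<partial>gauss2)" .
qed

lemma abs_fst_le_norm: "\<bar>fst h\<bar> \<le> norm h" and abs_snd_le_norm: "\<bar>snd h\<bar> \<le> norm h" for h :: "real \<times> real"
  using norm_fst_le[of "fst h" "snd h"] norm_snd_le[of "snd h" "fst h"] by simp_all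

lemma has_grad_lipschitz:
  assumes g: "has_grad g g1 g2" and "\<And>p. \<bar>g1 p\<bar> \<le> K" "\<And>p. \<bar>g2 p\<bar> \<le> K"
  shows "\<bar>g q - g p\<bar> \<le> 2 * K * norm (q - p)"
proof -
  have "norm (g q - g p) \<le> 2 * K * norm (q - p)"
  proof (rule differentiable_bound[OF convex_UNIV])
    fix x :: "real \<times> real"
    show "(g has_derivative (\<lambda>h. fst h * g1 x + snd h * g2 x)) (at x within UNIV)"
      using has_gradD[OF g] by simp
    show "onorm (\<lambda>h. fst h * g1 x + snd h * g2 x) \<le> 2 * K"
    proof (rule onorm_le)
      fix h :: "real \<times> real"
      have "norm (fst h * g1 x + snd h * g2 x) \<le> \<bar>fst h\<bar> * \<bar>g1 x\<bar> + \<bar>snd h\<bar> * \<bar>g2 x\<bar>"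
        by (simp add: abs_mult[symmetric])
      also have "\<dots> \<le> norm h * K + norm h * K"
        by (intro add_mono mult_mono assms abs_fst_le_norm abs_snd_le_norm) auto
      finally show "norm (fst h * g1 x + snd h * g2 x) \<le> 2 * K * norm h" by simp
    qed
  qed auto
  then show ?thesis by simp
qed

section \<open>Bounded continuous functions and weighted averages of their translates\<close>

definition bcont :: "('a::topological_space \<Rightarrow> real) \<Rightarrow> bool" where
  "bcont g \<longleftrightarrow> continuous_on UNIV g \<and> bounded (range g)"

lemma bcontD:
  assumes "bcont g"
  obtains K where "continuous_on UNIV g" "\<And>p. \<bar>g p\<bar> \<le> K" "K \<ge> 0" "g \<in> borel_measurable borel"
proof -
  obtain K where "\<forall>x\<in>range g. norm x \<le> K" using assms by (auto simp: bcont_def bounded_iff)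
  then show ?thesis
    using assms that[of "max K 0"] by (auto simp: bcont_def le_max_iff_disj intro: borel_measurable_continuous_onI)
qed

lemma bcontI: "continuous_on UNIV g \<Longrightarrow> (\<And>p. \<bar>g p\<bar> \<le> K) \<Longrightarrow> bcont g"
  by (auto simp: bcont_def bounded_iff)

text \<open>One pattern for all averaging operators below: Gaussian averages, the resolvent and its
  partial derivatives differ only in the weight, which may change sign, and in the law of the
  translation. Continuity and differentiation are proved once for all of them.\<close>

definition transl :: "'b measure \<Rightarrow> ('b \<Rightarrow> real) \<Rightarrow> ('b \<Rightarrow> 'a::real_normed_vector) \<Rightarrow> ('a \<Rightarrow> real) \<Rightarrow> 'a \<Rightarrow> real" where
  "transl M \<kappa> T g p = (\<integral>x. \<kappa> x * g (p + T x) \<partial>M)"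

locale translates =
  fixes M :: "'b measure" and \<kappa> :: "'b \<Rightarrow> real" and T :: "'b \<Rightarrow> real \<times> real"
  assumes weight_integrable: "integrable M \<kappa>"
    and T_measurable [measurable]: "T \<in> borel_measurable M"
begin

lemma \<kappa>_measurable [measurable]: "\<kappa> \<in> borel_measurable M"
  using weight_integrable by auto

lemma integrable_transl:
  assumes [measurable]: "g \<in> borel_measurable borel" and g: "\<And>p. \<bar>g p\<bar> \<le> K"
  shows "integrable M (\<lambda>x. \<kappa> x * g (p + T x))"
proof (rule Bochner_Integration.integrable_bound)
  show "integrable M (\<lambda>x. \<kappa> x * K)" by (simp add: weight_integrable)
  show "AE x in M. norm (\<kappa> x * g (p + T x)) \<le> norm (\<kappa> x * K)"
    using g by (auto simp: abs_mult intro!: AE_I2 mult_left_mono order_trans[OF g])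
qed measurable

lemma transl_abs_le:
  assumes [measurable]: "g \<in> borel_measurable borel" and g: "\<And>p. \<bar>g p\<bar> \<le> K"
  shows "\<bar>transl M \<kappa> T g p\<bar> \<le> (\<integral>x. \<bar>\<kappa> x\<bar> \<partial>M) * K"
proof -
  have "norm (transl M \<kappa> T g p) \<le> (\<integral>x. \<bar>\<kappa> x\<bar> * K \<partial>M)"
    unfolding transl_def
    by (rule order_trans[OF integral_norm_bound integral_mono])
      (auto intro!: integrable_norm integrable_transl[OF assms] integrable_mult_left integrable_abs weight_integrable mult_left_mono g simp: abs_mult
        simp del: real_norm_def, auto intro!: mult_left_mono g simp: abs_mult)
  then show ?thesis by simp
qed

lemma transl_tendsto:
  assumes [measurable]: "\<And>n. g n \<in> borel_measurable borel" and g: "\<And>n p. \<bar>g n p\<bar> \<le> K"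
    and lim: "\<And>q. (\<lambda>n. g n q) \<longlonglongrightarrow> g' q"
  shows "(\<lambda>n. transl M \<kappa> T (g n) p) \<longlonglongrightarrow> transl M \<kappa> T g' p"
  unfolding transl_def
proof (rule integral_dominated_convergence)
  have [measurable]: "g' \<in> borel_measurable borel"
    by (rule borel_measurable_LIMSEQ_real[OF lim]) measurable
  show "(\<lambda>x. \<kappa> x * g' (p + T x)) \<in> borel_measurable M" by measurable
  show "integrable M (\<lambda>x. \<bar>\<kappa> x\<bar> * K)" by (auto intro!: integrable_abs weight_integrable)
qed (auto intro!: AE_I2 tendsto_mult lim mult_left_mono g simp: abs_mult)

lemma bcont_transl:
  assumes "bcont g"
  shows "bcont (transl M \<kappa> T g)"
proof -
  obtain K where K: "continuous_on UNIV g" "\<And>p. \<bar>g p\<bar> \<le> K" "K \<ge> 0"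
    and [measurable]: "g \<in> borel_measurable borel" by (rule bcontD[OF assms]) blast
  have "isCont (transl M \<kappa> T g) p" for p
    unfolding continuous_at_sequentially o_def
  proof (intro allI impI)
    fix q assume q: "q \<longlonglongrightarrow> p"
    show "(\<lambda>n. transl M \<kappa> T g (q n)) \<longlonglongrightarrow> transl M \<kappa> T g p"
      unfolding transl_def
    proof (rule integral_dominated_convergence)
      show "integrable M (\<lambda>x. \<bar>\<kappa> x\<bar> * K)" by (auto intro!: integrable_abs weight_integrable)
      have "(\<lambda>n. g (q n + y)) \<longlonglongrightarrow> g (p + y)" for y
        by (rule continuous_on_tendsto_compose[OF K(1)]) (auto intro!: tendsto_add q)
      then show "AE x in M. (\<lambda>n. \<kappa> x * g (q n + T x)) \<longlonglongrightarrow> \<kappa> x * g (p + T x)"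
        by (intro AE_I2 tendsto_mult tendsto_const)
    qed (auto intro!: AE_I2 mult_left_mono K simp: abs_mult)
  qed
  then show ?thesis
    using transl_abs_le[OF \<open>g \<in> borel_measurable borel\<close> K(2)]
    by (intro bcontI[of _ "(\<integral>x. \<bar>\<kappa> x\<bar> \<partial>M) * K"]) (auto intro: continuous_at_imp_continuous_on)
qed

text \<open>Differentiation under the integral: the Lipschitz bound of g dominates the difference
  quotients, so dominated convergence applies along every sequence of increments tending to
  0.\<close>

lemma has_grad_transl:
  assumes g: "has_grad g g1 g2" and "bcont g" "bcont g1" "bcont g2"
  shows "has_grad (transl M \<kappa> T g) (transl M \<kappa> T g1) (transl M \<kappa> T g2)"
  unfolding has_grad_def
proof
  fix p :: "real \<times> real"
  let ?F = "transl M \<kappa> T"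
  obtain K0 K1 K2 where K: "\<And>p. \<bar>g p\<bar> \<le> K0" "\<And>p. \<bar>g1 p\<bar> \<le> K1" "\<And>p. \<bar>g2 p\<bar> \<le> K2" "K1 \<ge> 0" "K2 \<ge> 0"
    and m[measurable]: "g \<in> borel_measurable borel" "g1 \<in> borel_measurable borel" "g2 \<in> borel_measurable borel"
    using assms(2-4) by (metis bcontD)
  define L where "L = K1 + K2"
  have KL: "\<bar>g1 p\<bar> \<le> L" "\<bar>g2 p\<bar> \<le> L" "L \<ge> 0" for p
    using K(2)[of p] K(3)[of p] K(4,5) by (auto simp: L_def)
  note int = integrable_transl[OF m(1) K(1)] integrable_transl[OF m(2) K(2)] integrable_transl[OF m(3) K(3)]
  let ?D = "\<lambda>h. fst h * ?F g1 p + snd h * ?F g2 p"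
  let ?e = "\<lambda>q h. g (q + h) - g q - (fst h * g1 q + snd h * g2 q)"
  \<comment> \<open>Half of the constant comes from the Lipschitz bound of g, half from the linear
    part.\<close>
  have e: "\<bar>?e q h\<bar> \<le> 4 * L * norm h" for q h
  proof -
    have "\<bar>g (q + h) - g q\<bar> \<le> 2 * L * norm h"
      using has_grad_lipschitz[OF g KL(1) KL(2), of "q + h" q] by simp
    moreover have "\<bar>fst h * g1 q + snd h * g2 q\<bar> \<le> norm h * L + norm h * L"
      unfolding abs_mult[symmetric]
      by (intro order_trans[OF abs_triangle_ineq] add_mono; unfold abs_mult;
          intro mult_mono abs_fst_le_norm abs_snd_le_norm KL) auto
    ultimately show ?thesis
      using abs_triangle_ineq4[of "g (q + h) - g q" "fst h * g1 q + snd h * g2 q"] by (simp add: mult_ac)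
  qed
  have "((\<lambda>h. norm (?F g (p + h) - ?F g p - ?D h) / norm h) \<longlongrightarrow> 0) (at 0)"
    unfolding tendsto_at_iff_sequentially
  proof (intro allI impI)
    fix h :: "nat \<Rightarrow> real \<times> real" assume h: "\<forall>i. h i \<in> UNIV - {0}" "h \<longlonglongrightarrow> 0"
    have eq: "norm (?F g (p + h n) - ?F g p - ?D (h n)) / norm (h n)
        = \<bar>\<integral>x. \<kappa> x * (?e (p + T x) (h n) / norm (h n)) \<partial>M\<bar>" for n
    proof -
      have "?F g (p + h n) - ?F g p - ?D (h n) = (\<integral>x. \<kappa> x * g (p + h n + T x) - \<kappa> x * g (p + T x) - (fst (h n) * (\<kappa> x * g1 (p + T x)) + snd (h n) * (\<kappa> x * g2 (p + T x))) \<partial>M)"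
        unfolding transl_def by (simp add: int)
      also have "\<dots> = norm (h n) * (\<integral>x. \<kappa> x * (?e (p + T x) (h n) / norm (h n)) \<partial>M)"
        using h(1) by (subst integral_mult_right_zero[symmetric], intro Bochner_Integration.integral_cong)
          (auto simp: field_simps add_ac)
      finally show ?thesis using h(1) by (simp add: abs_mult)
    qed
    have "(\<lambda>n. \<integral>x. \<kappa> x * (?e (p + T x) (h n) / norm (h n)) \<partial>M) \<longlonglongrightarrow> (\<integral>x. \<kappa> x * 0 \<partial>M)"
    proof (rule integral_dominated_convergence)
      show "integrable M (\<lambda>x. \<bar>\<kappa> x\<bar> * (4 * L))" by (auto intro!: integrable_abs weight_integrable)
      have "(\<lambda>n. ?e q (h n) / norm (h n)) \<longlonglongrightarrow> 0" for q
      proof -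
        have "((\<lambda>h. norm (?e q h) / norm h) \<longlongrightarrow> 0) (at 0)"
          using has_gradD[OF g, of q] unfolding has_derivative_at by simp
        then have "(\<lambda>n. norm (?e q (h n)) / norm (h n)) \<longlonglongrightarrow> 0"
          using h unfolding tendsto_at_iff_sequentially o_def by blast
        then show ?thesis
          using tendsto_norm_zero_iff[of "\<lambda>n. ?e q (h n) / norm (h n)"] by (simp add: abs_divide)
      qed
      then show "AE x in M. (\<lambda>n. \<kappa> x * (?e (p + T x) (h n) / norm (h n))) \<longlonglongrightarrow> \<kappa> x * 0"
        by (intro AE_I2 tendsto_mult tendsto_const)
      show "AE x in M. norm (\<kappa> x * (?e (p + T x) (h n) / norm (h n))) \<le> \<bar>\<kappa> x\<bar> * (4 * L)" for n
    proof (intro AE_I2)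
      fix x
      have "\<bar>?e (p + T x) (h n)\<bar> / norm (h n) \<le> 4 * L"
        using h(1) e[of "p + T x" "h n"] by (simp add: divide_le_eq)
      from mult_left_mono[OF this abs_ge_zero[of "\<kappa> x"]]
      show "norm (\<kappa> x * (?e (p + T x) (h n) / norm (h n))) \<le> \<bar>\<kappa> x\<bar> * (4 * L)"
        by (simp add: abs_mult)
    qed
    qed measurable
    then show "((\<lambda>h. norm (?F g (p + h) - ?F g p - ?D h) / norm h) \<circ> h) \<longlonglongrightarrow> 0"
      unfolding o_def eq by (intro tendsto_rabs_zero) (simp only: mult_zero_right Bochner_Integration.integral_zero)
  qed
  then show "(?F g has_derivative ?D) (at p)"
    unfolding has_derivative_at
    by (auto intro!: bounded_linear_add bounded_linear_mult_left bounded_linear_compose[OF bounded_linear_mult_left] bounded_linear_fst bounded_linear_snd)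
qed

end

text \<open>Boundedness is demanded of the derivatives of every order up to k, since this is what
  lets averages commute with derivatives.\<close>

fun Cb :: "nat \<Rightarrow> (real \<times> real \<Rightarrow> real) \<Rightarrow> bool" where
  "Cb 0 g = bcont g"
| "Cb (Suc k) g = (bcont g \<and> (\<exists>g1 g2. has_grad g g1 g2 \<and> Cb k g1 \<and> Cb k g2))"

lemma Cb_SucI: "has_grad g g1 g2 \<Longrightarrow> bcont g \<Longrightarrow> Cb k g1 \<Longrightarrow> Cb k g2 \<Longrightarrow> Cb (Suc k) g"
  unfolding Cb.simps(2) by (intro conjI exI)

lemma Cb_SucE:
  assumes "Cb (Suc k) g"
  obtains g1 g2 where "has_grad g g1 g2" "bcont g" "Cb k g1" "Cb k g2"
  using assms unfolding Cb.simps(2) by (elim conjE exE)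

lemma Cb_bcont: "Cb k g \<Longrightarrow> bcont g"
  by (cases k) auto

lemma Cb_SucD: "Cb (Suc k) g \<Longrightarrow> Cb k g"
proof (induction k arbitrary: g)
  case (Suc k)
  from Suc.prems obtain g1 g2 where "has_grad g g1 g2" "bcont g" "Cb (Suc k) g1" "Cb (Suc k) g2"
    by (rule Cb_SucE)
  with Suc.IH show ?case by (intro Cb_SucI)
qed simp

lemma Cb_gradD: "Cb (Suc k) g \<Longrightarrow> has_grad g g1 g2 \<Longrightarrow> Cb k g1 \<and> Cb k g2"
  by (metis Cb_SucE has_grad_unique(1) has_grad_unique(2))

section \<open>Closure properties of bounded differentiable functions\<close>

lemma bcont_const: "bcont (\<lambda>_. a)"
  by (auto simp: bcont_def)

lemma bcont_add: "bcont f \<Longrightarrow> bcont g \<Longrightarrow> bcont (\<lambda>x. f x + g x)"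
  by (auto simp: bcont_def intro!: continuous_intros bounded_plus_comp)

lemma bcont_mult: "bcont f \<Longrightarrow> bcont g \<Longrightarrow> bcont (\<lambda>x. f x * g x)"
proof (elim bcontD)
  fix K L assume *: "\<And>p. \<bar>f p\<bar> \<le> K" "\<And>p. \<bar>g p\<bar> \<le> L" "0 \<le> K" "continuous_on UNIV f" "continuous_on UNIV g"
  show "bcont (\<lambda>x. f x * g x)"
    by (rule bcontI[of _ "K * L"]) (use * in \<open>auto simp: abs_mult intro!: mult_mono continuous_intros\<close>)
qed

lemma bcont_exp: "bcont f \<Longrightarrow> bcont (\<lambda>x. exp (f x))"
proof (elim bcontD)
  fix K assume *: "\<And>p. \<bar>f p\<bar> \<le> K" "continuous_on UNIV f"
  show "bcont (\<lambda>x. exp (f x))"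
    by (rule bcontI[of _ "exp K"]) (use * in \<open>auto intro!: continuous_intros intro: abs_le_D1\<close>)
qed

lemma has_grad_const: "has_grad (\<lambda>_. a) (\<lambda>_. 0) (\<lambda>_. 0)"
  by (simp add: has_grad_def)

lemma has_grad_add:
  "has_grad f f1 f2 \<Longrightarrow> has_grad g g1 g2 \<Longrightarrow> has_grad (\<lambda>x. f x + g x) (\<lambda>x. f1 x + g1 x) (\<lambda>x. f2 x + g2 x)"
  unfolding has_grad_def
  by (intro allI, rule has_derivative_eq_rhs[OF has_derivative_add], (erule spec)+) (simp add: algebra_simps)

lemma has_grad_mult:
  "has_grad f f1 f2 \<Longrightarrow> has_grad g g1 g2 \<Longrightarrow>
    has_grad (\<lambda>x. f x * g x) (\<lambda>x. f x * g1 x + f1 x * g x) (\<lambda>x. f x * g2 x + f2 x * g x)"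
  unfolding has_grad_def
  by (intro allI, rule has_derivative_eq_rhs[OF has_derivative_mult], (erule spec)+) (simp add: algebra_simps)

lemma has_grad_chain:
  assumes "has_grad f f1 f2" "\<And>p. (h has_real_derivative h' p) (at (f p))"
  shows "has_grad (\<lambda>p. h (f p)) (\<lambda>p. h' p * f1 p) (\<lambda>p. h' p * f2 p)"
  unfolding has_grad_def
proof
  fix p
  show "((\<lambda>p. h (f p)) has_derivative (\<lambda>k. fst k * (h' p * f1 p) + snd k * (h' p * f2 p))) (at p)"
    by (rule has_derivative_eq_rhs[OF has_derivative_compose[OF has_gradD[OF assms(1)] assms(2)[of p, unfolded has_field_derivative_def]]])
      (simp add: algebra_simps)
qed

lemma has_grad_sum:
  "(\<And>i. i \<in> I \<Longrightarrow> has_grad (f i) (f1 i) (f2 i)) \<Longrightarrow>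
    has_grad (\<lambda>x. \<Sum>i\<in>I. f i x) (\<lambda>x. \<Sum>i\<in>I. f1 i x) (\<lambda>x. \<Sum>i\<in>I. f2 i x)"
  by (induction I rule: infinite_finite_induct) (auto intro!: has_grad_const has_grad_add)

lemma Cb_const: "Cb k (\<lambda>_. a)"
proof (induction k arbitrary: a)
  case (Suc k)
  then show ?case by (intro Cb_SucI[OF has_grad_const] bcont_const)
qed (simp add: bcont_const)

lemma Cb_add: "Cb k f \<Longrightarrow> Cb k g \<Longrightarrow> Cb k (\<lambda>x. f x + g x)"
proof (induction k arbitrary: f g)
  case (Suc k)
  obtain f1 f2 g1 g2 where "has_grad f f1 f2" "has_grad g g1 g2" "Cb k f1" "Cb k f2" "Cb k g1" "Cb k g2"
    using Suc.prems by (elim Cb_SucE)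
  then show ?case
    by (intro Cb_SucI[OF has_grad_add] bcont_add Suc.IH Cb_bcont[OF Suc.prems(1)] Cb_bcont[OF Suc.prems(2)])
qed (auto intro: bcont_add)

lemma Cb_mult: "Cb k f \<Longrightarrow> Cb k g \<Longrightarrow> Cb k (\<lambda>x. f x * g x)"
proof (induction k arbitrary: f g)
  case (Suc k)
  obtain f1 f2 g1 g2 where *: "has_grad f f1 f2" "has_grad g g1 g2" "Cb k f1" "Cb k f2" "Cb k g1" "Cb k g2"
    using Suc.prems by (elim Cb_SucE)
  show ?case
    by (intro Cb_SucI[OF has_grad_mult[OF *(1,2)]] bcont_mult Cb_add Suc.IH * Cb_SucD[OF Suc.prems(1)]
        Cb_SucD[OF Suc.prems(2)] Cb_bcont[OF Suc.prems(1)] Cb_bcont[OF Suc.prems(2)])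
qed (auto intro: bcont_mult)

lemma Cb_cmult: "Cb k f \<Longrightarrow> Cb k (\<lambda>x. a * f x)"
  by (rule Cb_mult[OF Cb_const])

lemma Cb_diff: "Cb k f \<Longrightarrow> Cb k g \<Longrightarrow> Cb k (\<lambda>x. f x - g x)"
  using Cb_add[of k f "\<lambda>x. (-1) * g x"] Cb_cmult[of k g "-1"] by simp

lemma Cb_sum: "(\<And>i. i \<in> I \<Longrightarrow> Cb k (f i)) \<Longrightarrow> Cb k (\<lambda>x. \<Sum>i\<in>I. f i x)"
  by (induction I rule: infinite_finite_induct) (auto intro!: Cb_const Cb_add)

lemma Cb_prod: "(\<And>i. i \<in> I \<Longrightarrow> Cb k (f i)) \<Longrightarrow> Cb k (\<lambda>x. \<Prod>i\<in>I. f i x)"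
  by (induction I rule: infinite_finite_induct) (auto intro!: Cb_const Cb_mult)

lemma Cb_exp: "Cb k f \<Longrightarrow> Cb k (\<lambda>x. exp (f x))"
proof (induction k arbitrary: f)
  case (Suc k)
  obtain f1 f2 where *: "has_grad f f1 f2" "Cb k f1" "Cb k f2"
    using Suc.prems by (elim Cb_SucE)
  show ?case
    by (rule Cb_SucI[OF has_grad_chain[OF *(1) DERIV_exp]])
      (intro bcont_exp Cb_mult * Suc.IH Cb_SucD[OF Suc.prems] Cb_bcont[OF Suc.prems])+
qed (auto intro: bcont_exp)

lemma (in translates) Cb_transl: "Cb k g \<Longrightarrow> Cb k (transl M \<kappa> T g)"
proof (induction k arbitrary: g)
  case (Suc k)
  obtain g1 g2 where *: "has_grad g g1 g2" "Cb k g1" "Cb k g2"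
    using Suc.prems by (elim Cb_SucE)
  show ?case
    by (intro Cb_SucI[OF has_grad_transl[OF *(1)]] Suc.IH * bcont_transl Cb_bcont[OF Suc.prems] Cb_bcont[OF *(2)] Cb_bcont[OF *(3)])
qed (auto intro: bcont_transl)

lemma prob_gauss2_UNIV [simp]: "measure gauss2 UNIV = 1"
  using gauss2.prob_space by simp

text \<open>The Lipschitz bound K at s0 dominates the difference quotients and is inherited by their
  limit f', which is therefore integrable too.\<close>

lemma has_real_derivative_integral:
  fixes f :: "real \<Rightarrow> 'b \<Rightarrow> real"
  assumes [measurable]: "\<And>s. f s \<in> borel_measurable M" "f' \<in> borel_measurable M"
    and int: "\<And>s. integrable M (f s)"
    and der: "\<And>x. ((\<lambda>s. f s x) has_real_derivative f' x) (at s0)"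
    and lip: "\<And>s x. \<bar>f s x - f s0 x\<bar> \<le> K x * \<bar>s - s0\<bar>" and K: "integrable M K"
  shows "((\<lambda>s. \<integral>x. f s x \<partial>M) has_real_derivative (\<integral>x. f' x \<partial>M)) (at s0)"
  unfolding has_field_derivative_def has_derivative_at
proof (intro conjI bounded_linear_mult_right)
  have f'K: "\<bar>f' x\<bar> \<le> K x" for x
  proof (rule tendsto_upperbound)
    show "((\<lambda>h. \<bar>(f (s0 + h) x - f s0 x) / h\<bar>) \<longlongrightarrow> \<bar>f' x\<bar>) (at 0)"
      using der[of x] unfolding has_field_derivative_iff by (intro tendsto_rabs) (simp add: LIM_offset_zero_iff)
    show "\<forall>\<^sub>F h in at 0. \<bar>(f (s0 + h) x - f s0 x) / h\<bar> \<le> K x"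
      by (rule eventually_at_filter[THEN iffD2], rule always_eventually)
        (use lip[of "s0 + h" x for h] in \<open>auto simp: divide_le_eq\<close>)
  qed simp
  have f': "integrable M f'"
    by (rule Bochner_Integration.integrable_bound[OF K]) (auto intro!: AE_I2 order_trans[OF f'K])
  show "(\<lambda>h. norm ((\<integral>x. f (s0 + h) x \<partial>M) - (\<integral>x. f s0 x \<partial>M) - (\<integral>x. f' x \<partial>M) * h) / norm h) \<midarrow>0\<rightarrow> 0"
    unfolding tendsto_at_iff_sequentially
  proof (intro allI impI)
    fix h :: "nat \<Rightarrow> real" assume h: "\<forall>i. h i \<in> UNIV - {0}" "h \<longlonglongrightarrow> 0"
    have "(\<lambda>n. \<integral>x. (f (s0 + h n) x - f s0 x) / h n - f' x \<partial>M) \<longlonglongrightarrow> (\<integral>x. 0 \<partial>M)"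
    proof (rule integral_dominated_convergence)
      show "integrable M (\<lambda>x. 2 * K x)" using K by simp
      show "AE x in M. (\<lambda>n. (f (s0 + h n) x - f s0 x) / h n - f' x) \<longlonglongrightarrow> 0"
      proof (intro AE_I2 LIM_zero)
        fix x
        have "((\<lambda>h. (f (s0 + h) x - f s0 x) / h) \<longlongrightarrow> f' x) (at 0)"
          using der[of x] unfolding has_field_derivative_iff by (simp add: LIM_offset_zero_iff)
        then show "(\<lambda>n. (f (s0 + h n) x - f s0 x) / h n) \<longlonglongrightarrow> f' x"
          using h unfolding tendsto_at_iff_sequentially o_def by blast
      qed
      show "AE x in M. norm ((f (s0 + h n) x - f s0 x) / h n - f' x) \<le> 2 * K x" for n
      proof (intro AE_I2)
        fix x
        have "\<bar>(f (s0 + h n) x - f s0 x) / h n\<bar> \<le> K x"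
          using lip[of "s0 + h n" x] h(1) by (simp add: divide_le_eq)
        then show "norm ((f (s0 + h n) x - f s0 x) / h n - f' x) \<le> 2 * K x"
          using f'K[of x] abs_triangle_ineq4[of "(f (s0 + h n) x - f s0 x) / h n" "f' x"] by simp
      qed
    qed measurable
    moreover have "norm ((\<integral>x. f (s0 + h n) x \<partial>M) - (\<integral>x. f s0 x \<partial>M) - (\<integral>x. f' x \<partial>M) * h n) / norm (h n)
       = \<bar>\<integral>x. (f (s0 + h n) x - f s0 x) / h n - f' x \<partial>M\<bar>" for n
      using h(1) int f' by (simp add: abs_divide[symmetric] diff_divide_distrib)
    ultimately show "((\<lambda>h. norm ((\<integral>x. f (s0 + h) x \<partial>M) - (\<integral>x. f s0 x \<partial>M) - (\<integral>x. f' x \<partial>M) * h) / norm h) \<circ> h) \<longlonglongrightarrow> 0"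
      unfolding o_def by (simp only: tendsto_rabs_zero_iff Bochner_Integration.integral_zero)
  qed
qed

lemma integrable_pair_mult:
  fixes f g :: "_ \<Rightarrow> real"
  assumes "sigma_finite_measure M" "sigma_finite_measure N" "integrable M f" "integrable N g"
  shows "integrable (M \<Otimes>\<^sub>M N) (\<lambda>x. f (fst x) * g (snd x))"
proof -
  interpret M: sigma_finite_measure M by fact
  interpret N: sigma_finite_measure N by fact
  interpret pair_sigma_finite M N ..
  have [measurable]: "f \<in> borel_measurable M" "g \<in> borel_measurable N"
    using assms by auto
  show ?thesis
    by (rule Fubini_integrable)
      (use assms in \<open>auto intro!: integrable_mult_left integrable_norm simp: norm_mult simp del: real_norm_def\<close>)
qed

lemma integrable_gauss2_coord:
  "integrable gauss2 (\<lambda>z. fst z)" "integrable gauss2 (\<lambda>z. snd z)"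
  "integrable gauss2 (\<lambda>z. (fst z)^2)" "integrable gauss2 (\<lambda>z. (snd z)^2)"
proof -
  note s = gauss.sigma_finite_measure_axioms
  have "integrable gauss (\<lambda>x. x)"
    by (rule integrable_gauss_quadratic_bound[of _ 1]) (auto intro: order_trans[OF _ one_plus_abs_le_square])
  then show "integrable gauss2 (\<lambda>z. fst z)" "integrable gauss2 (\<lambda>z. snd z)"
    using integrable_pair_mult[OF s s, of "\<lambda>x. x" "\<lambda>_. 1"] integrable_pair_mult[OF s s, of "\<lambda>x. 1" "\<lambda>x. x"]
    unfolding gauss2_def by simp_all
  have "integrable gauss (\<lambda>x. x^2)"
    using integrable_gauss_power[of 2] by simp
  then show "integrable gauss2 (\<lambda>z. (fst z)^2)" "integrable gauss2 (\<lambda>z. (snd z)^2)"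
    using integrable_pair_mult[OF s s, of "\<lambda>x. x^2" "\<lambda>_. 1"] integrable_pair_mult[OF s s, of "\<lambda>x. 1" "\<lambda>x. x^2"]
    unfolding gauss2_def by simp_all
qed

definition halfgauss :: "real \<Rightarrow> real measure" where
  "halfgauss c = density lborel (\<lambda>s. ennreal (indicator {0<..} s * exp (- (c * s\<^sup>2 / 2))))"

lemma sets_halfgauss [simp, measurable_cong]: "sets (halfgauss c) = sets borel"
  by (simp add: halfgauss_def)

lemma integral_halfgauss:
  fixes f :: "real \<Rightarrow> real"
  assumes [measurable]: "f \<in> borel_measurable borel"
  shows "(\<integral>x. f x \<partial>halfgauss c) = (\<integral>x. indicator {0<..} x * exp (- (c * x\<^sup>2 / 2)) * f x \<partial>lborel)"
    and "integrable (halfgauss c) f \<longleftrightarrow> integrable lborel (\<lambda>x. indicator {0<..} x * exp (- (c * x\<^sup>2 / 2)) * f x)"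
  unfolding halfgauss_def by (simp_all add: integral_density integrable_density)

text \<open>With s exp (- c s^2 / 2) as weight, averaging over kern c gives the resolvent of the Laplacian:
  it is the integral of exp (- c t) times the heat semigroup, in which t = s^2 / 2.\<close>

definition kern :: "real \<Rightarrow> (real \<times> real \<times> real) measure" where
  "kern c = halfgauss c \<Otimes>\<^sub>M gauss2"

lemma sets_kern [simp, measurable_cong]: "sets (kern c) = sets borel"
proof -
  have "sets (kern c) = sets (borel \<Otimes>\<^sub>M borel)"
    unfolding kern_def by (intro sets_pair_measure_cong) simp_all
  then show ?thesis by (simp only: borel_prod)
qed

definition gauss_avg :: "real \<Rightarrow> (real \<times> real \<Rightarrow> real) \<Rightarrow> real \<times> real \<Rightarrow> real" where
  "gauss_avg s g p = (\<integral>z. g (p + s *\<^sub>R z) \<partial>gauss2)"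

lemma has_grad_affine:
  assumes "has_grad g g1 g2"
  shows "has_grad (\<lambda>z. g (p + s *\<^sub>R z)) (\<lambda>z. s * g1 (p + s *\<^sub>R z)) (\<lambda>z. s * g2 (p + s *\<^sub>R z))"
  unfolding has_grad_def
  by (rule allI, rule has_derivative_eq_rhs[OF has_grad_compose[OF assms]])
    (auto intro!: derivative_eq_intros simp: fun_eq_iff algebra_simps)

lemma gauss_integrable_bound:
  assumes "bcont g"
  shows "integrable gauss2 (\<lambda>z. g (p + s *\<^sub>R z))"
    "integrable gauss2 (\<lambda>z. fst z * g (p + s *\<^sub>R z))" "integrable gauss2 (\<lambda>z. snd z * g (p + s *\<^sub>R z))"
    "integrable gauss2 (\<lambda>z. (fst z)^2 * g (p + s *\<^sub>R z))" "integrable gauss2 (\<lambda>z. (snd z)^2 * g (p + s *\<^sub>R z))"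
proof -
  obtain K where K: "\<And>p. \<bar>g p\<bar> \<le> K" and m: "g \<in> borel_measurable borel"
    by (rule bcontD[OF assms]) blast
  have "integrable gauss2 (\<lambda>z. \<kappa> z * g (p + s *\<^sub>R z))" if "integrable gauss2 \<kappa>" for \<kappa>
  proof -
    interpret translates gauss2 \<kappa> "\<lambda>z. s *\<^sub>R z" by standard (use that in auto)
    show ?thesis by (rule integrable_transl[OF m K])
  qed
  from this[OF integrable_gauss2_coord(1)] this[OF integrable_gauss2_coord(2)] this[of "\<lambda>_. 1"]
    this[OF integrable_gauss2_coord(3)] this[OF integrable_gauss2_coord(4)]
  show "integrable gauss2 (\<lambda>z. g (p + s *\<^sub>R z))"
    "integrable gauss2 (\<lambda>z. fst z * g (p + s *\<^sub>R z))" "integrable gauss2 (\<lambda>z. snd z * g (p + s *\<^sub>R z))"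
    "integrable gauss2 (\<lambda>z. (fst z)^2 * g (p + s *\<^sub>R z))" "integrable gauss2 (\<lambda>z. (snd z)^2 * g (p + s *\<^sub>R z))"
    by simp_all
qed

text \<open>Stein's identity for z mapped to g (p + s z), whose gradient is s times that of g. The
  right sides contain no derivative of g.\<close>

lemma stein_gauss_avg:
  assumes g: "has_grad g g1 g2" "bcont g" "bcont g1" "bcont g2"
  shows "s * gauss_avg s g1 p = (\<integral>z. fst z * g (p + s *\<^sub>R z) \<partial>gauss2)"
    and "s * gauss_avg s g2 p = (\<integral>z. snd z * g (p + s *\<^sub>R z) \<partial>gauss2)"
proof -
  obtain K0 K1 K2 where K: "\<And>p. \<bar>g p\<bar> \<le> K0" "\<And>p. \<bar>g1 p\<bar> \<le> K1" "\<And>p. \<bar>g2 p\<bar> \<le> K2"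
    "K0 \<ge> 0" "K1 \<ge> 0" "K2 \<ge> 0" and c: "continuous_on UNIV g1" "continuous_on UNIV g2"
    using assms(2-4) by (metis bcontD)
  define L where "L = K0 + \<bar>s\<bar> * K1 + \<bar>s\<bar> * K2"
  have L: "\<bar>y\<bar> \<le> L * (1 + \<bar>a\<bar>) * (1 + \<bar>b\<bar>)" if "\<bar>y\<bar> \<le> L" for y a b :: real
  proof -
    have "L * 1 * 1 \<le> L * (1 + \<bar>a\<bar>) * (1 + \<bar>b\<bar>)"
      using that by (intro mult_mono mult_nonneg_nonneg) auto
    with that show ?thesis by simp
  qed
  have *: "K0 \<le> L" "\<bar>s\<bar> * K1 \<le> L" "\<bar>s\<bar> * K2 \<le> L"
    using K(4-6) by (auto simp: L_def intro!: add_nonneg_nonneg)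
  have "\<bar>g (p + s *\<^sub>R z)\<bar> \<le> L" "\<bar>s * g1 (p + s *\<^sub>R z)\<bar> \<le> L" "\<bar>s * g2 (p + s *\<^sub>R z)\<bar> \<le> L" for z
    using K(1)[of "p + s *\<^sub>R z"] mult_left_mono[OF K(2)[of "p + s *\<^sub>R z"] abs_ge_zero[of s]]
      mult_left_mono[OF K(3)[of "p + s *\<^sub>R z"] abs_ge_zero[of s]] *
    by (simp_all add: abs_mult)
  note stein2[OF has_grad_affine[OF g(1)] _ _ L[OF this(1)] L[OF this(2)] L[OF this(3)]]
  moreover have "continuous_on UNIV (\<lambda>z. s * g1 (p + s *\<^sub>R z))" "continuous_on UNIV (\<lambda>z. s * g2 (p + s *\<^sub>R z))"
    using c by (auto intro!: continuous_intros intro: continuous_on_compose2)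
  ultimately show "s * gauss_avg s g1 p = (\<integral>z. fst z * g (p + s *\<^sub>R z) \<partial>gauss2)"
    "s * gauss_avg s g2 p = (\<integral>z. snd z * g (p + s *\<^sub>R z) \<partial>gauss2)"
    by (auto simp: gauss_avg_def)
qed

lemma isCont_gauss_avg:
  assumes "bcont g"
  shows "isCont (\<lambda>s. gauss_avg s g p) s"
  unfolding continuous_at_sequentially o_def
proof (intro allI impI)
  fix q assume q: "q \<longlonglongrightarrow> s"
  obtain K where K: "continuous_on UNIV g" "\<And>p. \<bar>g p\<bar> \<le> K" and [measurable]: "g \<in> borel_measurable borel"
    by (rule bcontD[OF assms]) blast
  show "(\<lambda>n. gauss_avg (q n) g p) \<longlonglongrightarrow> gauss_avg s g p"
    unfolding gauss_avg_def
  proof (rule integral_dominated_convergence)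
    show "integrable gauss2 (\<lambda>_. K)" by simp
    have "(\<lambda>n. g (p + q n *\<^sub>R z)) \<longlonglongrightarrow> g (p + s *\<^sub>R z)" for z
      by (rule continuous_on_tendsto_compose[OF K(1)]) (auto intro!: tendsto_intros q)
    then show "AE z in gauss2. (\<lambda>n. g (p + q n *\<^sub>R z)) \<longlonglongrightarrow> g (p + s *\<^sub>R z)" by (intro AE_I2)
  qed (use K in auto)
qed

lemma gauss_avg_deriv:
  assumes w: "has_grad w w1 w2" "bcont w" "bcont w1" "bcont w2"
  shows "((\<lambda>s. gauss_avg s w p) has_real_derivative
    (\<integral>z. fst z * w1 (p + s *\<^sub>R z) + snd z * w2 (p + s *\<^sub>R z) \<partial>gauss2)) (at s)"
proof -
  obtain K1 K2 where K: "\<And>p. \<bar>w1 p\<bar> \<le> K1" "\<And>p. \<bar>w2 p\<bar> \<le> K2" "K1 \<ge> 0" "K2 \<ge> 0"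
    and [measurable]: "w1 \<in> borel_measurable borel" "w2 \<in> borel_measurable borel" "w \<in> borel_measurable borel"
    using assms(2-4) by (metis bcontD)
  show ?thesis
    unfolding gauss_avg_def
  proof (rule has_real_derivative_integral)
    show "integrable gauss2 (\<lambda>z. w (p + s *\<^sub>R z))" for s
      by (rule gauss_integrable_bound[OF w(2)])
    show "((\<lambda>s. w (p + s *\<^sub>R z)) has_real_derivative fst z * w1 (p + s *\<^sub>R z) + snd z * w2 (p + s *\<^sub>R z)) (at s)" for z
      unfolding has_field_derivative_def
      by (rule has_derivative_eq_rhs[OF has_grad_compose[OF w(1)]])
        (auto intro!: derivative_eq_intros simp: fun_eq_iff algebra_simps)
    show "\<bar>w (p + s' *\<^sub>R z) - w (p + s *\<^sub>R z)\<bar> \<le> (2 * (K1 + K2) * (\<bar>fst z\<bar> + \<bar>snd z\<bar>)) * \<bar>s' - s\<bar>" for s' z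
    proof -
      have "\<bar>w (p + s' *\<^sub>R z) - w (p + s *\<^sub>R z)\<bar> \<le> 2 * (K1 + K2) * norm ((p + s' *\<^sub>R z) - (p + s *\<^sub>R z))"
        by (rule has_grad_lipschitz[OF w(1)]) (auto intro!: order_trans[OF K(1)] order_trans[OF K(2)] K)
      also have "norm ((p + s' *\<^sub>R z) - (p + s *\<^sub>R z)) = \<bar>s' - s\<bar> * norm z"
        by (simp add: scaleR_left_diff_distrib[symmetric] del: scaleR_left_diff_distrib)
      also have "2 * (K1 + K2) * (\<bar>s' - s\<bar> * norm z) \<le> 2 * (K1 + K2) * (\<bar>s' - s\<bar> * (\<bar>fst z\<bar> + \<bar>snd z\<bar>))"
        using norm_Pair_le[of "fst z" "snd z"] K(3,4) by (intro mult_left_mono) auto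
      finally have "\<bar>w (p + s' *\<^sub>R z) - w (p + s *\<^sub>R z)\<bar> \<le> 2 * (K1 + K2) * (\<bar>s' - s\<bar> * (\<bar>fst z\<bar> + \<bar>snd z\<bar>))"
        .
      then show ?thesis by (simp add: mult_ac)
    qed
    show "integrable gauss2 (\<lambda>z. 2 * (K1 + K2) * (\<bar>fst z\<bar> + \<bar>snd z\<bar>))"
      by (intro integrable_mult_right Bochner_Integration.integrable_add integrable_abs integrable_gauss2_coord)
  qed measurable
qed

lemma integrable_halfgauss_power:
  assumes "c > 0"
  shows "integrable (halfgauss c) (\<lambda>s. \<bar>s\<bar> ^ k)"
proof (subst integral_halfgauss)
  \<comment> \<open>The weight is a multiple of the normal density of standard deviation 1 / sqrt c,
    whose moments are finite.\<close>
  have "integrable lborel (\<lambda>s. sqrt (2 * pi / c) * (normal_density 0 (1 / sqrt c) s * \<bar>s - 0\<bar> ^ k))"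
    using assms by (intro integrable_mult_right integrable_normal_moment_abs) auto
  moreover have "sqrt (2 * pi / c) * (normal_density 0 (1 / sqrt c) s * \<bar>s - 0\<bar> ^ k) = exp (- (c * s\<^sup>2 / 2)) * \<bar>s\<bar> ^ k" for s
    using assms by (simp add: normal_density_def power_divide real_sqrt_divide field_simps)
  ultimately have "integrable lborel (\<lambda>s. exp (- (c * s\<^sup>2 / 2)) * \<bar>s\<bar> ^ k)" by (simp only:)
  then show "integrable lborel (\<lambda>s. indicator {0<..} s * exp (- (c * s\<^sup>2 / 2)) * \<bar>s\<bar> ^ k)"
    by (rule Bochner_Integration.integrable_bound) (auto intro!: AE_I2 split: split_indicator)
qed simp

lemma halfgauss_AE_pos: "AE s in halfgauss c. s > 0"
  unfolding halfgauss_def by (subst AE_density) (auto intro!: AE_I2 split: split_indicator)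

lemma sigma_finite_halfgauss: "c > 0 \<Longrightarrow> sigma_finite_measure (halfgauss c)"
proof -
  assume "c > 0"
  then have "integrable (halfgauss c) (\<lambda>s. 1::real)" using integrable_halfgauss_power[of c 0] by simp
  then have "finite_measure (halfgauss c)"
    by (intro finite_measureI) (auto simp: integrable_iff_bounded)
  then show ?thesis by (simp add: finite_measure_def)
qed

section \<open>The resolvent of the Laplacian\<close>

locale resolvent =
  fixes c :: real
  assumes c_pos: "c > 0"
begin

sublocale pair_sigma_finite "halfgauss c" gauss2
  using sigma_finite_halfgauss[OF c_pos] gauss2.sigma_finite_measure_axioms
  by (simp add: pair_sigma_finite_def)

text \<open>The weight is |s| and not s: they agree almost everywhere under
  \<open>halfgauss\<close>, and a weight that is non-negative everywhere makes \<open>R_mono\<close>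
  immediate.\<close>

sublocale R: translates "kern c" "\<lambda>x. \<bar>fst x\<bar>" "\<lambda>x. fst x *\<^sub>R snd x"
proof
  show "integrable (kern c) (\<lambda>x. \<bar>fst x\<bar>)"
    using integrable_pair_mult[OF sigma_finite_halfgauss[OF c_pos] gauss2.sigma_finite_measure_axioms integrable_halfgauss_power[OF c_pos, of 1], of "\<lambda>_. 1"]
    by (simp add: kern_def)
qed measurable

text \<open>Here and in \<open>R2\<close> a Gaussian coordinate replaces s in the weight; by Stein's
  identity these operators are the partial derivatives of R.\<close>

sublocale R1: translates "kern c" "\<lambda>x. fst (snd x)" "\<lambda>x. fst x *\<^sub>R snd x"
proof
  show "integrable (kern c) (\<lambda>x. fst (snd x))"
    using integrable_pair_mult[OF sigma_finite_halfgauss[OF c_pos] gauss2.sigma_finite_measure_axioms integrable_halfgauss_power[OF c_pos, of 0] integrable_gauss2_coord(1)]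
    by (simp add: kern_def)
qed measurable

sublocale R2: translates "kern c" "\<lambda>x. snd (snd x)" "\<lambda>x. fst x *\<^sub>R snd x"
proof
  show "integrable (kern c) (\<lambda>x. snd (snd x))"
    using integrable_pair_mult[OF sigma_finite_halfgauss[OF c_pos] gauss2.sigma_finite_measure_axioms integrable_halfgauss_power[OF c_pos, of 0] integrable_gauss2_coord(2)]
    by (simp add: kern_def)
qed measurable

abbreviation R where "R \<equiv> transl (kern c) (\<lambda>x. \<bar>fst x\<bar>) (\<lambda>x. fst x *\<^sub>R snd x)"
abbreviation R1 where "R1 \<equiv> transl (kern c) (\<lambda>x. fst (snd x)) (\<lambda>x. fst x *\<^sub>R snd x)"
abbreviation R2 where "R2 \<equiv> transl (kern c) (\<lambda>x. snd (snd x)) (\<lambda>x. fst x *\<^sub>R snd x)"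

lemma R_iterated:
  assumes "bcont g"
  shows "R g p = (\<integral>s. \<bar>s\<bar> * gauss_avg s g p \<partial>halfgauss c)"
    and "integrable (halfgauss c) (\<lambda>s. \<bar>s\<bar> * gauss_avg s g p)"
    and "R1 g p = (\<integral>s. (\<integral>z. fst z * g (p + s *\<^sub>R z) \<partial>gauss2) \<partial>halfgauss c)"
    and "R2 g p = (\<integral>s. (\<integral>z. snd z * g (p + s *\<^sub>R z) \<partial>gauss2) \<partial>halfgauss c)"
proof -
  obtain K where K: "\<And>p. \<bar>g p\<bar> \<le> K" and m: "g \<in> borel_measurable borel"
    by (rule bcontD[OF assms]) blast
  note i = R.integrable_transl[OF m K, of p, unfolded kern_def]
    R1.integrable_transl[OF m K, of p, unfolded kern_def] R2.integrable_transl[OF m K, of p, unfolded kern_def]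
  show "R g p = (\<integral>s. \<bar>s\<bar> * gauss_avg s g p \<partial>halfgauss c)"
    unfolding transl_def gauss_avg_def using integral_fst'[OF i(1)] by (simp add: kern_def)
  show "integrable (halfgauss c) (\<lambda>s. \<bar>s\<bar> * gauss_avg s g p)"
    unfolding gauss_avg_def using integrable_fst'[OF i(1)] by simp
  show "R1 g p = (\<integral>s. (\<integral>z. fst z * g (p + s *\<^sub>R z) \<partial>gauss2) \<partial>halfgauss c)"
    unfolding transl_def using integral_fst'[OF i(2)] by (simp add: kern_def)
  show "R2 g p = (\<integral>s. (\<integral>z. snd z * g (p + s *\<^sub>R z) \<partial>gauss2) \<partial>halfgauss c)"
    unfolding transl_def using integral_fst'[OF i(3)] by (simp add: kern_def)
qed

lemma borel_measurable_gauss_integral: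
  assumes [measurable]: "(\<lambda>x. h (fst x) (snd x)) \<in> borel_measurable (borel :: (real \<times> real \<times> real) measure)"
  shows "(\<lambda>s. \<integral>z. h s z \<partial>gauss2 :: real) \<in> borel_measurable (halfgauss c)"
proof -
  have "sets (halfgauss c \<Otimes>\<^sub>M gauss2) = sets borel" using sets_kern[of c] unfolding kern_def .
  then have "case_prod h \<in> borel_measurable (halfgauss c \<Otimes>\<^sub>M gauss2)"
    using assms unfolding case_prod_unfold by (subst measurable_cong_sets[OF _ refl])
  then show ?thesis by (rule gauss2.borel_measurable_lebesgue_integral)
qed

text \<open>The factor s in the weight of R is exactly the one that Stein's identity consumes. Since
  R1 and R2 act on g itself, the resolvent gains one derivative.\<close>

lemma R_grad:
  assumes g: "has_grad g g1 g2" "bcont g" "bcont g1" "bcont g2"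
  shows "R g1 = R1 g" "R g2 = R2 g"
proof -
  have [measurable]: "g \<in> borel_measurable borel" "g1 \<in> borel_measurable borel" "g2 \<in> borel_measurable borel"
    using assms by (metis bcontD)+
  note [measurable] = borel_measurable_gauss_integral
  show "R g1 = R1 g"
    unfolding fun_eq_iff R_iterated(1)[OF g(3)] R_iterated(3)[OF g(2)] stein_gauss_avg(1)[OF g, symmetric]
    by (intro allI integral_cong_AE, unfold gauss_avg_def)
      (measurable, rule eventually_mono[OF halfgauss_AE_pos], simp)
  show "R g2 = R2 g"
    unfolding fun_eq_iff R_iterated(1)[OF g(4)] R_iterated(4)[OF g(2)] stein_gauss_avg(2)[OF g, symmetric]
    by (intro allI integral_cong_AE, unfold gauss_avg_def)
      (measurable, rule eventually_mono[OF halfgauss_AE_pos], simp)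
qed

text \<open>The Gaussian average of w at scale s has s-derivative s times the average of the
  Laplacian of w, which is the heat equation in t = s^2 / 2. Hence the integrand of the resolvent is
  the derivative of - exp (- c s^2 / 2) times the average of w, a function that runs from - w p at s
  = 0 to 0 at infinity.\<close>

lemma R_inverse:
  assumes w: "has_grad w w1 w2" "has_grad w1 w11 w12" "has_grad w2 w21 w22"
    and b: "bcont w" "bcont w1" "bcont w2" "bcont w11" "bcont w12" "bcont w21" "bcont w22"
  shows "R (\<lambda>p. c * w p - (w11 p + w22 p)) p = w p"
proof -
  let ?L = "\<lambda>p. w11 p + w22 p" and ?g = "\<lambda>p. c * w p - (w11 p + w22 p)"
  have bL: "bcont ?L" by (rule bcont_add[OF b(4) b(7)])
  have bg: "bcont ?g" using bcont_add[OF bcont_mult[OF bcont_const[of c] b(1)] bcont_mult[OF bcont_const[of "-1"] bL]]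
    by (simp add: algebra_simps)
  note i = gauss_integrable_bound[of _ p]
  have avg: "gauss_avg s ?g p = c * gauss_avg s w p - gauss_avg s ?L p" for s
    unfolding gauss_avg_def using i(1)[OF b(1), of s] i(1)[OF b(4), of s] i(1)[OF b(7), of s] by simp
  have der: "((\<lambda>s. gauss_avg s w p) has_real_derivative s * gauss_avg s ?L p) (at s)" for s
  proof -
    have "(\<integral>z. fst z * w1 (p + s *\<^sub>R z) + snd z * w2 (p + s *\<^sub>R z) \<partial>gauss2) = s * gauss_avg s ?L p"
      using stein_gauss_avg(1)[OF w(2) b(2,4,5), of s p] stein_gauss_avg(2)[OF w(3) b(3,6,7), of s p]
        i(2)[OF b(2), of s] i(3)[OF b(3), of s] i(1)[OF b(4), of s] i(1)[OF b(7), of s]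
      by (simp add: gauss_avg_def algebra_simps)
    with gauss_avg_deriv[OF w(1) b(1-3), of p s] show ?thesis by simp
  qed
  define F where "F s = - exp (- (c * s\<^sup>2 / 2)) * gauss_avg s w p" for s
  have dF: "(F has_real_derivative exp (- (c * s\<^sup>2 / 2)) * (s * gauss_avg s ?g p)) (at s)" for s
    unfolding F_def avg by (rule derivative_eq_intros der refl | simp add: algebra_simps)+
  obtain K where K: "\<And>p. \<bar>w p\<bar> \<le> K" "K \<ge> 0" by (rule bcontD[OF b(1)]) blast
  have "\<bar>gauss_avg s w p\<bar> \<le> K" for s
  proof -
    have "norm (gauss_avg s w p) \<le> (\<integral>z. K \<partial>gauss2)"
      unfolding gauss_avg_def
      by (rule order_trans[OF integral_norm_bound integral_mono]) (auto intro!: K i(1)[OF b(1)] integrable_norm simp del: real_norm_def, simp add: K)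
    then show ?thesis by simp
  qed
  then have absF: "\<bar>F s\<bar> \<le> exp (- (c * s\<^sup>2 / 2)) * K" for s
    by (simp add: F_def abs_mult)
  have "((\<lambda>s. exp (- (c * s\<^sup>2 / 2)) * K) \<longlongrightarrow> 0) at_top"
    using c_pos by real_asymp
  then have Flim: "(F \<longlongrightarrow> 0) at_top"
    by (rule Lim_null_comparison[rotated]) (use absF in auto)
  have [measurable]: "w \<in> borel_measurable borel" "?g \<in> borel_measurable borel"
    using b(1) bg by (metis bcontD)+
  have "(\<lambda>s. gauss_avg s ?g p) \<in> borel_measurable (halfgauss c)"
    unfolding gauss_avg_def by (rule borel_measurable_gauss_integral) measurable
  then have m[measurable]: "(\<lambda>s. gauss_avg s ?g p) \<in> borel_measurable borel"
    by (simp add: measurable_cong_sets[OF sets_halfgauss refl])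
  have "(LBINT s=0..\<infinity>. exp (- (c * s\<^sup>2 / 2)) * (s * gauss_avg s ?g p)) = 0 - F 0"
  proof (rule interval_integral_FTC_integrable)
    show "(F has_vector_derivative exp (- (c * s\<^sup>2 / 2)) * (s * gauss_avg s ?g p)) (at s)" for s
      using dF by (simp add: has_real_derivative_iff_has_vector_derivative)
    show "isCont (\<lambda>s. exp (- (c * s\<^sup>2 / 2)) * (s * gauss_avg s ?g p)) s" for s
      by (intro continuous_intros isCont_gauss_avg bg) auto
    have "integrable lborel (\<lambda>s. indicator {0<..} s * exp (- (c * s\<^sup>2 / 2)) * (\<bar>s\<bar> * gauss_avg s ?g p))"
      using R_iterated(2)[OF bg, of p] by (subst integral_halfgauss(2)[symmetric]) auto
    then show "set_integrable lborel (einterval 0 \<infinity>) (\<lambda>s. exp (- (c * s\<^sup>2 / 2)) * (s * gauss_avg s ?g p))"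
      unfolding set_integrable_def
      by (rule Bochner_Integration.integrable_cong[OF refl, THEN iffD1, rotated])
        (auto simp: einterval_def zero_ereal_def split: split_indicator)
    show "((F \<circ> real_of_ereal) \<longlongrightarrow> 0) (at_left \<infinity>)"
      using Flim by (simp add: ereal_tendsto_simps)
    have "isCont F 0" using dF DERIV_isCont by blast
    then have "(F \<longlongrightarrow> F 0) (at_right 0)"
      by (auto simp: isCont_def intro: tendsto_mono[OF at_le])
    then show "((F \<circ> real_of_ereal) \<longlongrightarrow> F 0) (at_right 0)"
      by (simp add: ereal_tendsto_simps zero_ereal_def)
  qed auto
  moreover have "(LBINT s=0..\<infinity>. exp (- (c * s\<^sup>2 / 2)) * (s * gauss_avg s ?g p)) = R ?g p"
    unfolding R_iterated(1)[OF bg] interval_lebesgue_integral_def set_lebesgue_integral_def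
    by (subst integral_halfgauss(1))
      (auto intro!: Bochner_Integration.integral_cong simp: einterval_def zero_ereal_def split: split_indicator)
  moreover have "F 0 = - w p" by (simp add: F_def gauss_avg_def)
  ultimately show ?thesis by simp
qed

lemma R_mono:
  assumes "bcont g" "bcont h" and le: "\<And>p. g p \<le> h p"
  shows "R g p \<le> R h p"
proof -
  obtain K where K: "\<And>p. \<bar>g p\<bar> \<le> K" "g \<in> borel_measurable borel" by (rule bcontD[OF assms(1)]) blast
  obtain L where L: "\<And>p. \<bar>h p\<bar> \<le> L" "h \<in> borel_measurable borel" by (rule bcontD[OF assms(2)]) blast
  show ?thesis
    unfolding transl_def
    by (intro integral_mono R.integrable_transl[OF K(2,1)] R.integrable_transl[OF L(2,1)] mult_left_mono le) simp
qed

end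

section \<open>Second derivative test and limits of gradients\<close>

lemma second_derivative_test:
  fixes \<phi> :: "real \<Rightarrow> real"
  assumes d: "d > 0" and der: "\<And>s. \<bar>s\<bar> < d \<Longrightarrow> (\<phi> has_real_derivative \<phi>' s) (at s)"
    and der2: "(\<phi>' has_real_derivative D) (at 0)" and max: "\<And>s. \<bar>s\<bar> < d \<Longrightarrow> \<phi> s \<le> \<phi> 0"
  shows "D \<le> 0"
proof (rule ccontr)
  assume "\<not> D \<le> 0"
  have "\<phi>' 0 = 0"
    by (rule DERIV_local_max[OF der d]) (use d max in auto)
  moreover obtain e where e: "e > 0" "\<And>h. 0 < h \<Longrightarrow> h < e \<Longrightarrow> \<phi>' 0 < \<phi>' (0 + h)"
    using DERIV_pos_inc_right[OF der2] \<open>\<not> D \<le> 0\<close> by auto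
  ultimately have pos: "\<phi>' h > 0" if "0 < h" "h < e" for h using that by simp
  define h where "h = min (d/2) (e/2)"
  have h: "0 < h" "h < d" "h < e" using d e by (auto simp: h_def)
  obtain z where z: "0 < z" "z < h" "\<phi> h - \<phi> 0 = (h - 0) * \<phi>' z"
    using MVT2[OF h(1), of \<phi> \<phi>'] der h by force
  then have "\<phi> h - \<phi> 0 > 0" using pos[of z] h by simp
  with max[of h] h show False by simp
qed

text \<open>A common Lipschitz constant of the gradients gives all f k the same quadratic Taylor
  remainder, and this inequality passes to pointwise limits.\<close>

lemma has_grad_limit:
  assumes g: "\<And>k. has_grad (f k) (a k) (b k)"
    and lip: "\<And>k p q. \<bar>a k p - a k q\<bar> \<le> C * norm (p - q)" "\<And>k p q. \<bar>b k p - b k q\<bar> \<le> C * norm (p - q)"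
    and lim: "\<And>p. (\<lambda>k. f k p) \<longlonglongrightarrow> f' p" "\<And>p. (\<lambda>k. a k p) \<longlonglongrightarrow> a' p" "\<And>p. (\<lambda>k. b k p) \<longlonglongrightarrow> b' p"
  shows "has_grad f' a' b'"
  unfolding has_grad_def
proof
  fix p
  have C: "C \<ge> 0" using lip(1)[of 0 "(1,0)" 0] by (auto intro: order_trans[OF abs_ge_zero])
  have taylor: "\<bar>f k q - f k p - (fst (q - p) * a k p + snd (q - p) * b k p)\<bar> \<le> 2 * C * norm (q - p) * norm (q - p)" for k q
  proof -
    let ?\<phi> = "\<lambda>q. f k q - (fst q * a k p + snd q * b k p)"
    have "norm (?\<phi> q - ?\<phi> p) \<le> (2 * C * norm (q - p)) * norm (q - p)"
    proof (rule differentiable_bound[of "cball p (norm (q - p))"])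
      fix x assume x: "x \<in> cball p (norm (q - p))"
      show "(?\<phi> has_derivative (\<lambda>h. fst h * (a k x - a k p) + snd h * (b k x - b k p))) (at x within cball p (norm (q - p)))"
        by (rule has_derivative_eq_rhs[OF has_derivative_diff[OF has_derivative_at_withinI[OF has_gradD[OF g]]]])
          (auto intro!: derivative_eq_intros simp: fun_eq_iff algebra_simps)
      have n: "C * norm (x - p) \<le> C * norm (q - p)"
        using x C by (intro mult_left_mono) (auto simp: dist_norm norm_minus_commute)
      show "onorm (\<lambda>h. fst h * (a k x - a k p) + snd h * (b k x - b k p)) \<le> 2 * C * norm (q - p)"
      proof (rule onorm_le)
        fix h :: "real \<times> real"
        have "norm (fst h * (a k x - a k p) + snd h * (b k x - b k p)) \<le> \<bar>fst h\<bar> * \<bar>a k x - a k p\<bar> + \<bar>snd h\<bar> * \<bar>b k x - b k p\<bar>"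
          by (simp add: abs_mult[symmetric])
        also have "\<dots> \<le> norm h * (C * norm (q - p)) + norm h * (C * norm (q - p))"
          by (intro add_mono mult_mono abs_fst_le_norm abs_snd_le_norm order_trans[OF lip(1) n] order_trans[OF lip(2) n]) auto
        finally show "norm (fst h * (a k x - a k p) + snd h * (b k x - b k p)) \<le> 2 * C * norm (q - p) * norm h"
          by (simp add: mult_ac)
      qed
    qed (auto simp: dist_norm norm_minus_commute)
    then show ?thesis by (simp add: algebra_simps)
  qed
  have taylor': "\<bar>f' q - f' p - (fst (q - p) * a' p + snd (q - p) * b' p)\<bar> \<le> 2 * C * norm (q - p) * norm (q - p)" for q
  proof (rule LIMSEQ_le_const2)
    show "(\<lambda>k. \<bar>f k q - f k p - (fst (q - p) * a k p + snd (q - p) * b k p)\<bar>)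
      \<longlonglongrightarrow> \<bar>f' q - f' p - (fst (q - p) * a' p + snd (q - p) * b' p)\<bar>"
      by (intro tendsto_intros lim)
  qed (use taylor in blast)
  show "(f' has_derivative (\<lambda>h. fst h * a' p + snd h * b' p)) (at p)"
    unfolding has_derivative_at
  proof
    have "((\<lambda>h::real \<times> real. 2 * C * norm h) \<longlongrightarrow> 2 * C * norm (0 :: real \<times> real)) (at 0)"
      by (intro tendsto_intros)
    then have "((\<lambda>h::real \<times> real. 2 * C * norm h) \<longlongrightarrow> 0) (at 0)" by simp
    then show "(\<lambda>h. norm (f' (p + h) - f' p - (fst h * a' p + snd h * b' p)) / norm h) \<midarrow>0\<rightarrow> 0"
    proof (rule Lim_null_comparison[rotated])
      show "\<forall>\<^sub>F h in at 0. norm (norm (f' (p + h) - f' p - (fst h * a' p + snd h * b' p)) / norm h) \<le> 2 * C * norm h"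
      proof (rule eventually_at_filter[THEN iffD2], intro always_eventually allI impI)
        fix h :: "real \<times> real" assume "h \<noteq> 0"
        then show "norm (norm (f' (p + h) - f' p - (fst h * a' p + snd h * b' p)) / norm h) \<le> 2 * C * norm h"
          using taylor'[of "p + h"] by (simp add: divide_le_eq)
      qed
    qed
  qed (auto intro!: bounded_linear_add bounded_linear_mult_left bounded_linear_compose[OF bounded_linear_mult_left] bounded_linear_fst bounded_linear_snd)
qed

section \<open>Regularised logarithmic potentials\<close>

definition sqd :: "real \<times> real \<Rightarrow> real \<times> real \<Rightarrow> real" where
  "sqd a p = (fst p - fst a)\<^sup>2 + (snd p - snd a)\<^sup>2"

text \<open>Twice \<open>ratx\<close> and \<open>raty\<close> form the gradient of ln (|p - a|^2 +
  m). The partials of the three functions are polynomials in the three, so smoothness of all orders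
  comes out of one induction.\<close>

definition rat :: "real \<Rightarrow> real \<times> real \<Rightarrow> real \<times> real \<Rightarrow> real" where
  "rat m a p = 1 / (sqd a p + m)"

definition ratx :: "real \<Rightarrow> real \<times> real \<Rightarrow> real \<times> real \<Rightarrow> real" where
  "ratx m a p = (fst p - fst a) * rat m a p"

definition raty :: "real \<Rightarrow> real \<times> real \<Rightarrow> real \<times> real \<Rightarrow> real" where
  "raty m a p = (snd p - snd a) * rat m a p"

lemma sqd_nonneg [simp]: "sqd a p \<ge> 0"
  by (simp add: sqd_def)

lemma sqd_eq_0_iff: "sqd a p = 0 \<longleftrightarrow> p = a"
  by (auto simp: sqd_def prod_eq_iff add_nonneg_eq_0_iff)

lemma has_grad_sqd: "has_grad (sqd a) (\<lambda>p. 2 * (fst p - fst a)) (\<lambda>p. 2 * (snd p - snd a))"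
  unfolding has_grad_def sqd_def
  by (auto intro!: derivative_eq_intros simp: fun_eq_iff algebra_simps)

lemma rat_pos: "m > 0 \<Longrightarrow> rat m a p > 0"
  by (simp add: rat_def add_nonneg_pos)

lemma rat_le: "m > 0 \<Longrightarrow> rat m a p \<le> 1 / m"
  by (simp add: rat_def frac_le)

lemma sqd_add_pos: "m > 0 \<Longrightarrow> sqd a p + m > 0"
  by (simp add: add_nonneg_pos)

lemma has_grad_rat:
  assumes "m > 0"
  shows "has_grad (rat m a) (\<lambda>p. -2 * (ratx m a p * rat m a p)) (\<lambda>p. -2 * (raty m a p * rat m a p))"
proof -
  have eq: "rat m a = (\<lambda>p. 1 / (sqd a p + m))" by (simp add: rat_def[abs_def])
  have "has_grad (\<lambda>p. 1 / (sqd a p + m)) (\<lambda>p. - (rat m a p)\<^sup>2 * (2 * (fst p - fst a))) (\<lambda>p. - (rat m a p)\<^sup>2 * (2 * (snd p - snd a)))"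
    by (rule has_grad_chain[OF has_grad_sqd, where h="\<lambda>y. 1 / (y + m)"])
      (use sqd_add_pos[OF assms, of a] in \<open>auto intro!: derivative_eq_intros simp: rat_def power2_eq_square order_less_imp_not_eq2\<close>)
  then show ?thesis
    unfolding eq[symmetric] by (simp add: ratx_def[abs_def] raty_def[abs_def] power2_eq_square algebra_simps)
qed

lemma has_grad_ratx:
  assumes "m > 0"
  shows "has_grad (ratx m a) (\<lambda>p. rat m a p - 2 * (ratx m a p * ratx m a p)) (\<lambda>p. -2 * (ratx m a p * raty m a p))"
proof -
  have *: "has_grad (\<lambda>p. fst p - fst a) (\<lambda>p. 1) (\<lambda>p. 0)"
    unfolding has_grad_def by (auto intro!: derivative_eq_intros)
  show ?thesis
    using has_grad_mult[OF * has_grad_rat[OF assms, of a]]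
    by (simp add: ratx_def[abs_def] raty_def[abs_def] mult_ac)
qed

lemma has_grad_raty:
  assumes "m > 0"
  shows "has_grad (raty m a) (\<lambda>p. -2 * (ratx m a p * raty m a p)) (\<lambda>p. rat m a p - 2 * (raty m a p * raty m a p))"
proof -
  have *: "has_grad (\<lambda>p. snd p - snd a) (\<lambda>p. 0) (\<lambda>p. 1)"
    unfolding has_grad_def by (auto intro!: derivative_eq_intros)
  show ?thesis
    using has_grad_mult[OF * has_grad_rat[OF assms, of a]]
    by (simp add: ratx_def[abs_def] raty_def[abs_def] mult_ac)
qed

lemma has_grad_ln_sqd:
  assumes "m > 0"
  shows "has_grad (\<lambda>p. ln (sqd a p + m)) (\<lambda>p. 2 * ratx m a p) (\<lambda>p. 2 * raty m a p)"
proof -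
  have "has_grad (\<lambda>p. ln (sqd a p + m)) (\<lambda>p. 1 / (sqd a p + m) * (2 * (fst p - fst a))) (\<lambda>p. 1 / (sqd a p + m) * (2 * (snd p - snd a)))"
    by (rule has_grad_chain[OF has_grad_sqd, where h="\<lambda>y. ln (y + m)"])
      (use sqd_add_pos[OF assms, of a] in \<open>auto intro!: derivative_eq_intros\<close>)
  then show ?thesis
    by (simp add: rat_def[abs_def] ratx_def[abs_def] raty_def[abs_def] mult_ac)
qed

lemma abs_mult_inverse_quadratic_le:
  fixes x y m :: real
  assumes "m > 0" "y \<ge> 0"
  shows "\<bar>x * (1 / (x\<^sup>2 + y + m))\<bar> \<le> 1 + 1 / m"
proof -
  have pos: "x\<^sup>2 + y + m > 0" using assms by (auto intro: add_nonneg_pos)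
  have "\<bar>x\<bar> \<le> 1 + x\<^sup>2"
  proof -
    have "0 \<le> (\<bar>x\<bar> - 1)^2" by simp
    then have "2 * \<bar>x\<bar> \<le> 1 + x\<^sup>2" by (simp add: power2_diff)
    then show ?thesis by simp
  qed
  also have "\<dots> \<le> (1 + 1 / m) * (x\<^sup>2 + y + m)"
  proof -
    have "0 \<le> y + m + x\<^sup>2 / m + y / m" using assms by (auto intro!: add_nonneg_nonneg)
    then show ?thesis using assms by (simp add: algebra_simps)
  qed
  finally show ?thesis using pos by (simp add: abs_mult divide_le_eq)
qed

lemma bcont_rat:
  assumes "m > 0"
  shows "bcont (rat m a)" "bcont (ratx m a)" "bcont (raty m a)"
proof -
  show "bcont (rat m a)"
    using assms by (intro bcontI[OF has_grad_continuous[OF has_grad_rat], of m _ "1 / m"]) (auto simp: abs_of_pos[OF rat_pos] rat_le)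
  show "bcont (ratx m a)"
    using assms by (intro bcontI[OF has_grad_continuous[OF has_grad_ratx], of m _ "1 + 1 / m"])
      (use abs_mult_inverse_quadratic_le[of m "(snd p - snd a)\<^sup>2" "fst p - fst a" for p] in \<open>auto simp: ratx_def rat_def sqd_def\<close>)
  show "bcont (raty m a)"
    using assms by (intro bcontI[OF has_grad_continuous[OF has_grad_raty], of m _ "1 + 1 / m"])
      (use abs_mult_inverse_quadratic_le[of m "(fst p - fst a)\<^sup>2" "snd p - snd a" for p] in \<open>auto simp: raty_def rat_def sqd_def add_ac\<close>)
qed

text \<open>Proved jointly, because the gradient of each function involves the others.\<close>

lemma Cb_rat:
  assumes "m > 0"
  shows "Cb k (rat m a) \<and> Cb k (ratx m a) \<and> Cb k (raty m a)"
proof (induction k)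
  case (Suc k)
  then have IH: "Cb k (rat m a)" "Cb k (ratx m a)" "Cb k (raty m a)" by auto
  show ?case
    by (intro conjI Cb_SucI[OF has_grad_rat[OF assms]] Cb_SucI[OF has_grad_ratx[OF assms]] Cb_SucI[OF has_grad_raty[OF assms]]
        Cb_cmult Cb_mult Cb_diff IH bcont_rat[OF assms])
qed (use bcont_rat[OF assms] in auto)

text \<open>The left side is the Laplacian of ln (|p - a|^2 + m) in the shape produced by
  \<open>has_grad_ln_sqd\<close>, \<open>has_grad_ratx\<close> and \<open>has_grad_raty\<close>. For
  m = 0 and p away from a it says that the logarithm is harmonic.\<close>

lemma laplacian_ln_sqd:
  assumes "sqd a p + m \<noteq> 0"
  shows "2 * (rat m a p - 2 * (ratx m a p * ratx m a p)) + 2 * (rat m a p - 2 * (raty m a p * raty m a p))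
    = 4 * m * (rat m a p)\<^sup>2"
proof -
  have "sqd a p * (rat m a p)\<^sup>2 + m * (rat m a p)\<^sup>2 = rat m a p"
    using assms unfolding rat_def distrib_right[symmetric] by (simp add: power2_eq_square)
  moreover have "ratx m a p * ratx m a p + raty m a p * raty m a p = sqd a p * (rat m a p)\<^sup>2"
    by (simp add: ratx_def raty_def sqd_def power2_eq_square algebra_simps)
  ultimately show ?thesis by (simp add: algebra_simps)
qed

section \<open>The vortex equation\<close>

locale vortex_config =
  fixes w :: "nat \<Rightarrow> real \<times> real" and N :: nat and r :: real
  assumes N_pos: "N \<ge> 1" and r_pos: "r > 0"
begin

text \<open>Chosen so that 0 is a subsolution: 4 / \<mu> = 2 r / N, so N summands of g0 together are
  paid for by 2 r (\<open>g0_le\<close>).\<close>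

definition \<mu> :: real where "\<mu> = 2 * N / r"
text \<open>Chosen with 1 / \<epsilon> = 2 r: within distance sqrt \<epsilon> of a zero the bump of
  width sqrt \<epsilon> is at least 2 r (\<open>super_ineq\<close>).\<close>

definition \<epsilon> :: real where "\<epsilon> = 1 / (2 * r)"
text \<open>The upper bound for \<open>super\<close>, and so for u. It depends on N only; the limit
  of large r in \<open>err_tendsto_0\<close> relies on that.\<close>

definition B :: real where "B = N * ln (8 * N)"

text \<open>The zeros are split off by the substitution |a|^2 = Q exp u, so that u is smooth and g0 absorbs
  the Laplacian of the logarithmic potential.\<close>

definition Q :: "real \<times> real \<Rightarrow> real" where
  "Q p = (\<Prod>i<N. 1 - \<mu> * rat \<mu> (w i) p)"

definition g0 :: "real \<times> real \<Rightarrow> real" where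
  "g0 p = (\<Sum>i<N. 4 * \<mu> * (rat \<mu> (w i) p)\<^sup>2)"

text \<open>Multiplying Q by exp super replaces \<mu> by the smaller \<epsilon> in every factor and
  doubles it (\<open>Q_exp_super\<close>). The doubling makes each factor at least 1 at distance
  sqrt \<epsilon> or more from its zero.\<close>

definition super :: "real \<times> real \<Rightarrow> real" where
  "super p = (\<Sum>i<N. ln 2 + (ln (sqd (w i) p + \<mu>) - ln (sqd (w i) p + \<epsilon>)))"

text \<open>Bounds the slope of 2 r Q exp u as long as u stays below B, so that \<open>G\<close> is
  increasing in u there.\<close>

definition c :: real where "c = 2 * r * exp B"

text \<open>The Kazdan-Warner equation reads (c - laplace) u = G u, that is u = R (G u).\<close>

definition G :: "(real \<times> real \<Rightarrow> real) \<Rightarrow> real \<times> real \<Rightarrow> real" where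
  "G u p = c * u p - 2 * r * (Q p * exp (u p) - 1) - g0 p"

lemma \<mu>_pos: "\<mu> > 0" and \<epsilon>_pos: "\<epsilon> > 0" and \<mu>_eq: "\<mu> = 4 * N * \<epsilon>" and c_pos: "c > 0"
  using N_pos r_pos by (auto simp: \<mu>_def \<epsilon>_def c_def)

lemma B_nonneg: "B \<ge> 0"
  using N_pos by (auto simp: B_def intro!: mult_nonneg_nonneg ln_ge_zero)

sublocale resolvent c by standard (rule c_pos)

lemma factor_eq: "1 - \<mu> * rat \<mu> a p = sqd a p * rat \<mu> a p"
proof -
  have "sqd a p * rat \<mu> a p + \<mu> * rat \<mu> a p = 1"
    using sqd_add_pos[OF \<mu>_pos, of a p] unfolding rat_def distrib_right[symmetric] by simp
  then show ?thesis by simp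
qed

lemma factor_bounds: "0 \<le> 1 - \<mu> * rat \<mu> a p" "1 - \<mu> * rat \<mu> a p \<le> 1"
  using rat_pos[OF \<mu>_pos, of a p] \<mu>_pos by (simp_all add: factor_eq) (simp add: factor_eq[symmetric])

lemma Q_nonneg: "0 \<le> Q p" and Q_le_1: "Q p \<le> 1"
  unfolding Q_def by (intro prod_nonneg prod_le_1 conjI ballI factor_bounds)+

lemma Q_le_factor:
  assumes "i < N"
  shows "Q p \<le> 1 - \<mu> * rat \<mu> (w i) p"
proof -
  have "Q p = (1 - \<mu> * rat \<mu> (w i) p) * (\<Prod>j\<in>{..<N}-{i}. 1 - \<mu> * rat \<mu> (w j) p)"
    unfolding Q_def using assms by (intro prod.remove) auto
  also have "\<dots> \<le> (1 - \<mu> * rat \<mu> (w i) p) * 1"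
    by (intro mult_left_mono prod_le_1 conjI factor_bounds)
  finally show ?thesis by simp
qed

lemma Cb_Q: "Cb k Q"
  unfolding Q_def[abs_def] by (intro Cb_prod Cb_diff Cb_const Cb_cmult) (use Cb_rat[OF \<mu>_pos] in auto)

lemma Cb_g0: "Cb k g0"
  unfolding g0_def[abs_def] power2_eq_square by (intro Cb_sum Cb_cmult Cb_mult) (use Cb_rat[OF \<mu>_pos] in auto)

lemma Cb_G: "Cb k u \<Longrightarrow> Cb k (G u)"
  unfolding G_def[abs_def] by (intro Cb_diff Cb_cmult Cb_mult Cb_exp Cb_Q Cb_g0 Cb_const)

text \<open>This says that 0 is a subsolution. In 4 \<mu> J^2, with J the value of
  \<open>rat\<close>, one factor J is at most 1 / \<mu>, and \<mu> J is at most 1 - Q because Q is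
  at most each of its factors.\<close>

lemma g0_le: "g0 p \<le> 2 * r * (1 - Q p)"
proof -
  have "4 * \<mu> * (rat \<mu> (w i) p)\<^sup>2 \<le> 2 * r / N * (1 - Q p)" if "i < N" for i
  proof -
    let ?J = "rat \<mu> (w i) p"
    have "4 * \<mu> * ?J\<^sup>2 = (4 * ?J) * (\<mu> * ?J)" by (simp add: power2_eq_square)
    also have "\<dots> \<le> (4 * (1 / \<mu>)) * (1 - Q p)"
      using Q_le_factor[OF that, of p] rat_pos[OF \<mu>_pos, of "w i" p] rat_le[OF \<mu>_pos, of "w i" p] \<mu>_pos
      by (intro mult_mono) auto
    also have "4 * (1 / \<mu>) = 2 * r / N" using r_pos N_pos by (simp add: \<mu>_def)
    finally show ?thesis .
  qed
  then have "g0 p \<le> (\<Sum>i<N. 2 * r / N * (1 - Q p))"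
    unfolding g0_def by (intro sum_mono) auto
  then show ?thesis using N_pos by simp
qed

lemma has_grad_super:
  "has_grad super (\<lambda>p. \<Sum>i<N. 0 + (2 * ratx \<mu> (w i) p + (-1) * (2 * ratx \<epsilon> (w i) p)))
     (\<lambda>p. \<Sum>i<N. 0 + (2 * raty \<mu> (w i) p + (-1) * (2 * raty \<epsilon> (w i) p)))"
proof -
  have "has_grad (\<lambda>p. \<Sum>i<N. ln 2 + (ln (sqd (w i) p + \<mu>) + (-1) * ln (sqd (w i) p + \<epsilon>)))
     (\<lambda>p. \<Sum>i<N. 0 + (2 * ratx \<mu> (w i) p + ((-1) * (2 * ratx \<epsilon> (w i) p) + 0 * ln (sqd (w i) p + \<epsilon>))))
     (\<lambda>p. \<Sum>i<N. 0 + (2 * raty \<mu> (w i) p + ((-1) * (2 * raty \<epsilon> (w i) p) + 0 * ln (sqd (w i) p + \<epsilon>))))"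
    by (intro has_grad_sum has_grad_add has_grad_const has_grad_mult has_grad_ln_sqd \<mu>_pos \<epsilon>_pos)
  then show ?thesis by (simp add: super_def[abs_def])
qed

text \<open>From \<mu> = 4 N \<epsilon> follow \<epsilon> \<le> \<mu> and |p - a|^2 + \<mu> \<le> 4
  N (|p - a|^2 + \<epsilon>); the summand ln 2 turns 4 N into 8 N.\<close>

lemma super_factor_bounds:
  "ln 2 \<le> ln 2 + (ln (sqd a p + \<mu>) - ln (sqd a p + \<epsilon>))" "ln 2 + (ln (sqd a p + \<mu>) - ln (sqd a p + \<epsilon>)) \<le> ln (8 * N)"
proof -
  have le: "\<epsilon> \<le> \<mu>" using \<mu>_eq \<epsilon>_pos N_pos by (simp add: mult_le_cancel_right1)
  have pos: "sqd a p + \<mu> > 0" "sqd a p + \<epsilon> > 0" using sqd_add_pos \<mu>_pos \<epsilon>_pos by auto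
  show "ln 2 \<le> ln 2 + (ln (sqd a p + \<mu>) - ln (sqd a p + \<epsilon>))"
    using pos le by simp
  have "sqd a p * 1 \<le> sqd a p * (4 * N)" using N_pos by (intro mult_left_mono) auto
  then have "sqd a p + \<mu> \<le> 4 * N * (sqd a p + \<epsilon>)"
    by (simp add: \<mu>_eq algebra_simps)
  then have "ln (sqd a p + \<mu>) \<le> ln (4 * N * (sqd a p + \<epsilon>))" using pos N_pos by (simp add: less_imp_le)
  also have "\<dots> = ln (4 * N) + ln (sqd a p + \<epsilon>)" using pos N_pos by (subst ln_mult) auto
  finally have "ln 2 + (ln (sqd a p + \<mu>) - ln (sqd a p + \<epsilon>)) \<le> ln 2 + ln (4 * N)" by simp
  also have "\<dots> = ln (8 * N)" using N_pos by (subst ln_mult_pos[symmetric]) auto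
  finally show "ln 2 + (ln (sqd a p + \<mu>) - ln (sqd a p + \<epsilon>)) \<le> ln (8 * N)" .
qed

lemma super_bounds: "0 \<le> super p" "super p \<le> B"
proof -
  show "0 \<le> super p" unfolding super_def
    by (intro sum_nonneg order_trans[OF _ super_factor_bounds(1)]) simp
  have "super p \<le> (\<Sum>i<N. ln (8 * N))" unfolding super_def by (intro sum_mono super_factor_bounds)
  then show "super p \<le> B" by (simp add: B_def)
qed

lemma bcont_super: "bcont super"
  by (rule bcontI[OF has_grad_continuous[OF has_grad_super], of B]) (simp add: super_bounds)

lemma Q_exp_super: "Q p * exp (super p) = (\<Prod>i<N. 2 * (sqd (w i) p * rat \<epsilon> (w i) p))"
proof -
  have "(1 - \<mu> * rat \<mu> a p) * exp (ln 2 + (ln (sqd a p + \<mu>) - ln (sqd a p + \<epsilon>))) = 2 * (sqd a p * rat \<epsilon> a p)" for a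
    using sqd_add_pos[OF \<mu>_pos, of a p] sqd_add_pos[OF \<epsilon>_pos, of a p]
    unfolding factor_eq by (simp add: exp_add exp_diff rat_def divide_simps)
  then show ?thesis
    unfolding Q_def super_def exp_sum[OF finite_lessThan] prod.distrib[symmetric] by simp
qed

text \<open>This says that \<open>super\<close> is a supersolution. Close to a zero its own bump
  alone reaches 2 r, which is all that the left side can be; away from all zeros every factor in
  \<open>Q_exp_super\<close> is at least 1 and the left side is not positive.\<close>

lemma super_ineq: "2 * r * (1 - Q p * exp (super p)) \<le> (\<Sum>i<N. 4 * \<epsilon> * (rat \<epsilon> (w i) p)\<^sup>2)"
proof (cases "\<exists>i<N. sqd (w i) p < \<epsilon>")
  case True
  then obtain i where i: "i < N" "sqd (w i) p < \<epsilon>" by auto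
  have "1 / (2 * \<epsilon>) \<le> rat \<epsilon> (w i) p"
    unfolding rat_def using i sqd_add_pos[OF \<epsilon>_pos, of "w i" p] by (intro divide_left_mono) (auto simp: \<epsilon>_pos)
  then have "(1 / (2 * \<epsilon>))\<^sup>2 \<le> (rat \<epsilon> (w i) p)\<^sup>2"
    using \<epsilon>_pos by (intro power_mono) auto
  then have "4 * \<epsilon> * (1 / (2 * \<epsilon>))\<^sup>2 \<le> 4 * \<epsilon> * (rat \<epsilon> (w i) p)\<^sup>2"
    using \<epsilon>_pos by (intro mult_left_mono) auto
  moreover have "4 * \<epsilon> * (1 / (2 * \<epsilon>))\<^sup>2 = 2 * r"
    using r_pos by (simp add: \<epsilon>_def power2_eq_square)
  moreover have "4 * \<epsilon> * (rat \<epsilon> (w i) p)\<^sup>2 \<le> (\<Sum>i<N. 4 * \<epsilon> * (rat \<epsilon> (w i) p)\<^sup>2)"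
    using i \<epsilon>_pos by (intro member_le_sum) auto
  moreover have "2 * r * (1 - Q p * exp (super p)) \<le> 2 * r * 1"
    using r_pos Q_nonneg[of p] by (intro mult_left_mono) auto
  ultimately show ?thesis by linarith
next
  case False
  have "1 \<le> 2 * (sqd (w i) p * rat \<epsilon> (w i) p)" if "i < N" for i
  proof -
    have "\<epsilon> \<le> sqd (w i) p" using False that by (metis linorder_not_less)
    then show ?thesis using sqd_add_pos[OF \<epsilon>_pos, of "w i" p] by (simp add: rat_def le_divide_eq)
  qed
  then have "1 \<le> Q p * exp (super p)"
    unfolding Q_exp_super by (intro prod_ge_1) auto
  then have "2 * r * (1 - Q p * exp (super p)) \<le> 0"
    using r_pos by (simp add: mult_nonneg_nonpos)
  also have "0 \<le> (\<Sum>i<N. 4 * \<epsilon> * (rat \<epsilon> (w i) p)\<^sup>2)"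
    using \<epsilon>_pos by (intro sum_nonneg) auto
  finally show ?thesis .
qed

text \<open>By convexity of exp, the nonlinear term grows by at most 2 r exp B times the growth of
  u, and c u compensates exactly that.\<close>

lemma G_mono:
  assumes "u p \<le> v p" "v p \<le> B"
  shows "G u p \<le> G v p"
proof -
  have "exp (v p) * (1 + (u p - v p)) \<le> exp (v p) * exp (u p - v p)"
    by (intro mult_left_mono exp_ge_add_one_self) simp
  also have "\<dots> = exp (u p)" by (simp add: exp_diff)
  finally have "exp (v p) - exp (u p) \<le> exp (v p) * (v p - u p)" by (simp add: algebra_simps)
  also have "\<dots> \<le> exp B * (v p - u p)" using assms by (intro mult_right_mono) auto
  finally have "Q p * (exp (v p) - exp (u p)) \<le> 1 * (exp B * (v p - u p))"
    using assms Q_nonneg Q_le_1 by (intro mult_mono) auto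
  then have "2 * r * (Q p * (exp (v p) - exp (u p))) \<le> 2 * r * (exp B * (v p - u p))"
    using r_pos by (intro mult_left_mono) auto
  then show ?thesis by (simp add: G_def c_def algebra_simps)
qed

text \<open>Since \<open>super\<close> is explicit, (c - laplace) super can be computed and
  dominates \<open>G super\<close> by \<open>super_ineq\<close>. Applying the monotone R and then
  \<open>R_inverse\<close> finishes.\<close>

lemma R_G_super_le: "R (G super) p \<le> super p"
proof -
  let ?x = "\<lambda>p. \<Sum>i<N. 2 * ratx \<mu> (w i) p + (-1) * (2 * ratx \<epsilon> (w i) p)"
  let ?y = "\<lambda>p. \<Sum>i<N. 2 * raty \<mu> (w i) p + (-1) * (2 * raty \<epsilon> (w i) p)"
  let ?xx = "\<lambda>p. \<Sum>i<N. 2 * (rat \<mu> (w i) p - 2 * (ratx \<mu> (w i) p * ratx \<mu> (w i) p)) + (-1) * (2 * (rat \<epsilon> (w i) p - 2 * (ratx \<epsilon> (w i) p * ratx \<epsilon> (w i) p)))"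
  let ?yy = "\<lambda>p. \<Sum>i<N. 2 * (rat \<mu> (w i) p - 2 * (raty \<mu> (w i) p * raty \<mu> (w i) p)) + (-1) * (2 * (rat \<epsilon> (w i) p - 2 * (raty \<epsilon> (w i) p * raty \<epsilon> (w i) p)))"
  let ?xy = "\<lambda>p. \<Sum>i<N. 2 * (- 2 * (ratx \<mu> (w i) p * raty \<mu> (w i) p)) + (-1) * (2 * (- 2 * (ratx \<epsilon> (w i) p * raty \<epsilon> (w i) p)))"
  have cm: "has_grad f f1 f2 \<Longrightarrow> has_grad (\<lambda>p. a * f p) (\<lambda>p. a * f1 p) (\<lambda>p. a * f2 p)" for f f1 f2 and a :: real
    using has_grad_mult[OF has_grad_const[of a], of f f1 f2] by simp
  have s1: "has_grad super ?x ?y" using has_grad_super by simp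
  have s2: "has_grad ?x ?xx ?xy"
    by (intro has_grad_sum has_grad_add cm has_grad_ratx \<mu>_pos \<epsilon>_pos)
  have s3: "has_grad ?y ?xy ?yy"
    by (intro has_grad_sum has_grad_add cm has_grad_raty \<mu>_pos \<epsilon>_pos)
  have C: "Cb 0 ?x" "Cb 0 ?y" "Cb 0 ?xx" "Cb 0 ?yy" "Cb 0 ?xy"
    by (intro Cb_sum Cb_add Cb_cmult Cb_diff Cb_mult Cb_const;
        simp only: Cb_rat[OF \<mu>_pos] Cb_rat[OF \<epsilon>_pos])+
  have lap: "?xx p + ?yy p = g0 p - (\<Sum>i<N. 4 * \<epsilon> * (rat \<epsilon> (w i) p)\<^sup>2)" for p
  proof -
    have "(2 * (rat \<mu> (w i) p - 2 * (ratx \<mu> (w i) p * ratx \<mu> (w i) p)) + (-1) * (2 * (rat \<epsilon> (w i) p - 2 * (ratx \<epsilon> (w i) p * ratx \<epsilon> (w i) p)))) +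
      (2 * (rat \<mu> (w i) p - 2 * (raty \<mu> (w i) p * raty \<mu> (w i) p)) + (-1) * (2 * (rat \<epsilon> (w i) p - 2 * (raty \<epsilon> (w i) p * raty \<epsilon> (w i) p))))
      = 4 * \<mu> * (rat \<mu> (w i) p)\<^sup>2 - 4 * \<epsilon> * (rat \<epsilon> (w i) p)\<^sup>2" for i
      using laplacian_ln_sqd[of "w i" p \<mu>] laplacian_ln_sqd[of "w i" p \<epsilon>] sqd_add_pos[OF \<mu>_pos, of "w i" p] sqd_add_pos[OF \<epsilon>_pos, of "w i" p]
      by simp
    then show ?thesis unfolding g0_def sum.distrib[symmetric] sum_subtractf[symmetric] by simp
  qed
  have "R (G super) p \<le> R (\<lambda>p. c * super p - (?xx p + ?yy p)) p"
  proof (rule R_mono)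
    show "bcont (G super)"
      using Cb_G[of 0 super] bcont_super by simp
    have "Cb 0 super" using bcont_super by simp
    then have "Cb 0 (\<lambda>p. c * super p - (?xx p + ?yy p))"
      by (intro Cb_add Cb_cmult Cb_diff C)
    then show "bcont (\<lambda>p. c * super p - (?xx p + ?yy p))" by (rule Cb_bcont)
    show "G super p \<le> c * super p - (?xx p + ?yy p)" for p
      using super_ineq[of p] unfolding lap G_def by (simp add: algebra_simps)
  qed
  also have "\<dots> = super p"
    using C by (intro R_inverse[OF s1 s2 s3] bcont_super) simp_all
  finally show ?thesis .
qed

end

section \<open>Monotone iteration and regularity of its limit\<close>

context vortex_config
begin

primrec iter :: "nat \<Rightarrow> real \<times> real \<Rightarrow> real" where
  "iter 0 = (\<lambda>_. 0)"
| "iter (Suc k) = R (G (iter k))"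

lemma Cb_iter: "Cb j (iter k)"
  by (induction k) (simp_all add: Cb_const R.Cb_transl Cb_G del: Cb.simps)

lemmas bcont_G_iter = Cb_bcont[OF Cb_G[OF Cb_iter]]

text \<open>The bounds have to go together: comparing consecutive values of \<open>G\<close> needs
  both the order of the iterates and the ceiling B, which is inherited from
  \<open>super\<close>.\<close>

lemma iter_bounds: "0 \<le> iter k p \<and> iter k p \<le> super p \<and> iter k p \<le> iter (Suc k) p"
proof (induction k arbitrary: p)
  case 0
  have "R (\<lambda>_. 0) p \<le> R (G (iter 0)) p"
    by (rule R_mono[OF bcont_const bcont_G_iter]) (use g0_le in \<open>simp add: G_def algebra_simps\<close>)
  then show ?case using super_bounds(1) by (simp add: transl_def)
next
  case (Suc k)
  have le: "iter (Suc k) p \<le> super p" for p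
  proof -
    have "R (G (iter k)) p \<le> R (G super) p"
    proof (rule R_mono)
      show "bcont (G super)" using Cb_G[of 0 super] bcont_super by simp
      show "G (iter k) p \<le> G super p" for p
        by (rule G_mono) (use Suc.IH[of p] super_bounds in auto)
    qed (rule bcont_G_iter)
    then show ?thesis using R_G_super_le[of p] by simp
  qed
  have "R (G (iter k)) p \<le> R (G (iter (Suc k))) p"
  proof (rule R_mono[OF bcont_G_iter bcont_G_iter])
    show "G (iter k) p \<le> G (iter (Suc k)) p" for p
      by (rule G_mono) (use Suc.IH[of p] order_trans[OF le[of p] super_bounds(2)] in auto)
  qed
  then show ?case using Suc.IH[of p] le[of p] by (auto intro: order_trans)
qed

lemma iter_abs_le: "\<bar>iter k p\<bar> \<le> B"
  using iter_bounds[of k p] super_bounds(2)[of p] by simp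

definition u :: "real \<times> real \<Rightarrow> real" where
  "u p = lim (\<lambda>k. iter k p)"

lemma iter_tendsto: "(\<lambda>k. iter k p) \<longlonglongrightarrow> u p"
proof -
  have "incseq (\<lambda>k. iter k p)" by (rule incseq_SucI) (use iter_bounds in blast)
  then have "convergent (\<lambda>k. iter k p)"
    using iter_abs_le by (intro Bseq_monoseq_convergent BseqI'[of _ B]) (auto simp: monoseq_iff)
  then show ?thesis by (simp add: u_def convergent_LIMSEQ_iff)
qed

lemma u_bounds: "0 \<le> u p" "u p \<le> B"
proof -
  show "0 \<le> u p" by (rule LIMSEQ_le_const[OF iter_tendsto]) (use iter_bounds in blast)
  show "u p \<le> B" by (rule LIMSEQ_le_const2[OF iter_tendsto]) (use abs_le_D1[OF iter_abs_le] in blast)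
qed

lemma G_iter_tendsto: "(\<lambda>k. G (iter k) p) \<longlonglongrightarrow> G u p"
  unfolding G_def by (intro tendsto_intros iter_tendsto)

lemma G_iter_measurable: "G (iter k) \<in> borel_measurable borel"
  by (rule bcontD[OF bcont_G_iter]) blast

lemma G_iter_bound: "\<exists>K. \<forall>k p. \<bar>G (iter k) p\<bar> \<le> K"
proof -
  obtain K where K: "\<And>p. \<bar>g0 p\<bar> \<le> K" using Cb_bcont[OF Cb_g0[of 0]] by (rule bcontD) blast
  have "\<bar>G (iter k) p\<bar> \<le> c * B + 2 * r * (exp B + 1) + K" for k p
  proof -
    have "\<bar>c * iter k p\<bar> \<le> c * B"
      using iter_abs_le c_pos by (simp add: abs_mult mult_left_mono)
    moreover have "\<bar>2 * r * (Q p * exp (iter k p) - 1)\<bar> \<le> 2 * r * (exp B + 1)"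
    proof -
      have "Q p * exp (iter k p) \<le> 1 * exp B"
        using Q_nonneg Q_le_1 abs_le_D1[OF iter_abs_le] by (intro mult_mono) auto
      moreover have "0 \<le> Q p * exp (iter k p)" using Q_nonneg by simp
      ultimately have "\<bar>Q p * exp (iter k p) - 1\<bar> \<le> exp B + 1" by linarith
      then show ?thesis using r_pos by (simp add: abs_mult mult_left_mono)
    qed
    ultimately show ?thesis using K[of p] unfolding G_def by linarith
  qed
  then show ?thesis by blast
qed

lemma u_eq: "u p = R (G u) p"
proof -
  obtain K where K: "\<And>k p. \<bar>G (iter k) p\<bar> \<le> K" using G_iter_bound by blast
  have "(\<lambda>k. R (G (iter k)) p) \<longlonglongrightarrow> R (G u) p"
    by (rule R.transl_tendsto[OF G_iter_measurable K G_iter_tendsto])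
  moreover have "(\<lambda>k. R (G (iter k)) p) \<longlonglongrightarrow> u p"
    using LIMSEQ_Suc[OF iter_tendsto[of p]] by simp
  ultimately show ?thesis by (rule LIMSEQ_unique[rotated])
qed

lemma has_grad_R: "Cb (Suc 0) g \<Longrightarrow> has_grad (R g) (R1 g) (R2 g)"
proof (erule Cb_SucE)
  fix g1 g2 assume g: "has_grad g g1 g2" "bcont g" "Cb 0 g1" "Cb 0 g2"
  then have b: "bcont g1" "bcont g2" by simp_all
  show "has_grad (R g) (R1 g) (R2 g)"
    using R.has_grad_transl[OF g(1,2) b] unfolding R_grad[OF g(1,2) b] .
qed

lemma G_grad:
  obtains Q1 Q2 a1 a2 where "has_grad Q Q1 Q2" "has_grad g0 a1 a2" "bcont Q1" "bcont Q2" "bcont a1" "bcont a2"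
    "\<And>v v1 v2. has_grad v v1 v2 \<Longrightarrow> has_grad (G v)
      (\<lambda>p. c * v1 p - 2 * r * (Q p * (exp (v p) * v1 p) + Q1 p * exp (v p)) - a1 p)
      (\<lambda>p. c * v2 p - 2 * r * (Q p * (exp (v p) * v2 p) + Q2 p * exp (v p)) - a2 p)"
proof -
  obtain Q1 Q2 where Q: "has_grad Q Q1 Q2" "Cb 0 Q1" "Cb 0 Q2" using Cb_Q by (rule Cb_SucE)
  obtain a1 a2 where a: "has_grad g0 a1 a2" "Cb 0 a1" "Cb 0 a2" using Cb_g0 by (rule Cb_SucE)
  have "has_grad (G v)
      (\<lambda>p. c * v1 p - 2 * r * (Q p * (exp (v p) * v1 p) + Q1 p * exp (v p)) - a1 p)
      (\<lambda>p. c * v2 p - 2 * r * (Q p * (exp (v p) * v2 p) + Q2 p * exp (v p)) - a2 p)"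
    if v: "has_grad v v1 v2" for v v1 v2
  proof -
    have e: "has_grad (\<lambda>p. exp (v p)) (\<lambda>p. exp (v p) * v1 p) (\<lambda>p. exp (v p) * v2 p)"
      by (rule has_grad_chain[OF v DERIV_exp])
    have "has_grad (\<lambda>p. c * v p + ((-2 * r) * (Q p * exp (v p) + (-1)) + (-1) * g0 p))
      (\<lambda>p. (c * v1 p + 0 * v p) + (((-2 * r) * ((Q p * (exp (v p) * v1 p) + Q1 p * exp (v p)) + 0) + 0 * (Q p * exp (v p) + (-1))) + ((-1) * a1 p + 0 * g0 p)))
      (\<lambda>p. (c * v2 p + 0 * v p) + (((-2 * r) * ((Q p * (exp (v p) * v2 p) + Q2 p * exp (v p)) + 0) + 0 * (Q p * exp (v p) + (-1))) + ((-1) * a2 p + 0 * g0 p)))"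
      by (intro has_grad_add has_grad_mult has_grad_const v e Q a)
    then show ?thesis unfolding G_def[abs_def] by (simp add: algebra_simps)
  qed
  with Q a that show ?thesis by simp
qed

text \<open>The gradients of the iterates are R1 and R2 of the uniformly bounded functions G (iter
  k), hence uniformly bounded. So are then the gradients of the next G (iter k), and R1 and R2 of
  these bound the second derivatives. Thus \<open>has_grad_limit\<close> applies.\<close>

lemma has_grad_u: "has_grad u (R1 (G u)) (R2 (G u))"
proof -
  obtain Q1 Q2 a1 a2 where Q: "has_grad Q Q1 Q2" "has_grad g0 a1 a2" "bcont Q1" "bcont Q2" "bcont a1" "bcont a2"
    and dG: "\<And>v v1 v2. has_grad v v1 v2 \<Longrightarrow> has_grad (G v)
      (\<lambda>p. c * v1 p - 2 * r * (Q p * (exp (v p) * v1 p) + Q1 p * exp (v p)) - a1 p)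
      (\<lambda>p. c * v2 p - 2 * r * (Q p * (exp (v p) * v2 p) + Q2 p * exp (v p)) - a2 p)"
    by (rule G_grad) blast
  obtain KQ1 where KQ1: "\<And>p. \<bar>Q1 p\<bar> \<le> KQ1" using Q(3) by (rule bcontD) blast
  obtain KQ2 where KQ2: "\<And>p. \<bar>Q2 p\<bar> \<le> KQ2" using Q(4) by (rule bcontD) blast
  obtain Ka1 where Ka1: "\<And>p. \<bar>a1 p\<bar> \<le> Ka1" using Q(5) by (rule bcontD) blast
  obtain Ka2 where Ka2: "\<And>p. \<bar>a2 p\<bar> \<le> Ka2" using Q(6) by (rule bcontD) blast
  obtain K where K: "\<And>k p. \<bar>G (iter k) p\<bar> \<le> K" using G_iter_bound by blast
  define V1 where "V1 k = R1 (G (iter k))" for k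
  define V2 where "V2 k = R2 (G (iter k))" for k
  define L1 where "L1 = (\<integral>x. \<bar>fst (snd x)\<bar> \<partial>kern c)"
  define L2 where "L2 = (\<integral>x. \<bar>snd (snd x)\<bar> \<partial>kern c)"
  have L: "L1 \<ge> 0" "L2 \<ge> 0" by (auto simp: L1_def L2_def)
  have V1: "\<bar>V1 k p\<bar> \<le> L1 * K" for k p
    unfolding V1_def L1_def by (rule R1.transl_abs_le[OF G_iter_measurable K])
  have V2: "\<bar>V2 k p\<bar> \<le> L2 * K" for k p
    unfolding V2_def L2_def by (rule R2.transl_abs_le[OF G_iter_measurable K])
  have gI: "has_grad (iter (Suc k)) (V1 k) (V2 k)" for k
    unfolding iter.simps V1_def V2_def by (rule has_grad_R) (rule Cb_G[OF Cb_iter])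
  define D1 where "D1 k p = c * V1 k p - 2 * r * (Q p * (exp (iter (Suc k) p) * V1 k p) + Q1 p * exp (iter (Suc k) p)) - a1 p" for k p
  define D2 where "D2 k p = c * V2 k p - 2 * r * (Q p * (exp (iter (Suc k) p) * V2 k p) + Q2 p * exp (iter (Suc k) p)) - a2 p" for k p
  have gG: "has_grad (G (iter (Suc k))) (D1 k) (D2 k)" for k
    using dG[OF gI[of k]] unfolding D1_def[abs_def] D2_def[abs_def] by simp
  have bD: "bcont (D1 k)" "bcont (D2 k)" for k
    using Cb_gradD[OF Cb_G[OF Cb_iter] gG, of 0 k] by auto
  have E: "exp (iter k p) \<le> exp B" for k p using abs_le_D1[OF iter_abs_le] by simp
  have bound: "\<bar>c * x - 2 * r * (Q p * (exp (iter k p) * x) + y * exp (iter k p)) - z\<bar>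
      \<le> c * X + 2 * r * (exp B * X + Y * exp B) + Z"
    if "\<bar>x\<bar> \<le> X" "\<bar>y\<bar> \<le> Y" "\<bar>z\<bar> \<le> Z" for x y z X Y Z k p
  proof -
    have "\<bar>Q p * (exp (iter k p) * x)\<bar> \<le> 1 * (exp B * X)"
      unfolding abs_mult using Q_nonneg Q_le_1 E that by (intro mult_mono) auto
    moreover have "\<bar>y * exp (iter k p)\<bar> \<le> Y * exp B"
      unfolding abs_mult using E that by (intro mult_mono) auto
    ultimately have "\<bar>Q p * (exp (iter k p) * x) + y * exp (iter k p)\<bar> \<le> exp B * X + Y * exp B" by linarith
    then have "\<bar>2 * r * (Q p * (exp (iter k p) * x) + y * exp (iter k p))\<bar> \<le> 2 * r * (exp B * X + Y * exp B)"
      using r_pos by (simp add: abs_mult mult_left_mono)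
    moreover have "\<bar>c * x\<bar> \<le> c * X" using c_pos that by (simp add: abs_mult mult_left_mono)
    ultimately show ?thesis using that(3) by linarith
  qed
  define K1 where "K1 = c * (L1 * K) + 2 * r * (exp B * (L1 * K) + KQ1 * exp B) + Ka1"
  define K2 where "K2 = c * (L2 * K) + 2 * r * (exp B * (L2 * K) + KQ2 * exp B) + Ka2"
  define K' where "K' = max K1 K2"
  have "\<bar>D1 k p\<bar> \<le> K1" for k p
    unfolding D1_def K1_def by (rule bound[OF V1 KQ1 Ka1])
  moreover have "\<bar>D2 k p\<bar> \<le> K2" for k p
    unfolding D2_def K2_def by (rule bound[OF V2 KQ2 Ka2])
  ultimately have D: "\<bar>D1 k p\<bar> \<le> K'" "\<bar>D2 k p\<bar> \<le> K'" for k p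
    unfolding K'_def le_max_iff_disj by blast+
  have mD: "D1 k \<in> borel_measurable borel" "D2 k \<in> borel_measurable borel" for k
    using bD by (metis bcontD)+
  have K'0: "K' \<ge> 0" using D(1)[of 0 0] by simp
  define C where "C = 2 * ((L1 + L2) * K')"
  have le: "L1 * K' \<le> (L1 + L2) * K'" "L2 * K' \<le> (L1 + L2) * K'"
    using L K'0 by (auto intro!: mult_right_mono)
  show ?thesis
  proof (rule has_grad_limit)
    \<comment> \<open>The shift by two leaves one step for the bound on the gradient and one for its
      Lipschitz constant.\<close>
    show "has_grad (iter (Suc (Suc k))) (V1 (Suc k)) (V2 (Suc k))" for k by (rule gI)
    show "\<bar>V1 (Suc k) p - V1 (Suc k) q\<bar> \<le> C * norm (p - q)" for k p q
      unfolding C_def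
      by (rule has_grad_lipschitz)
        (unfold V1_def, rule R1.has_grad_transl[OF gG bcont_G_iter bD],
          (intro order_trans[OF R1.transl_abs_le[OF mD(1) D(1)]] order_trans[OF R1.transl_abs_le[OF mD(2) D(2)]],
           use le in \<open>simp add: L1_def\<close>)+)
    show "\<bar>V2 (Suc k) p - V2 (Suc k) q\<bar> \<le> C * norm (p - q)" for k p q
      unfolding C_def
      by (rule has_grad_lipschitz)
        (unfold V2_def, rule R2.has_grad_transl[OF gG bcont_G_iter bD],
          (intro order_trans[OF R2.transl_abs_le[OF mD(1) D(1)]] order_trans[OF R2.transl_abs_le[OF mD(2) D(2)]],
           use le in \<open>simp add: L2_def\<close>)+)
    show "(\<lambda>k. iter (Suc (Suc k)) p) \<longlonglongrightarrow> u p" for p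
      by (rule LIMSEQ_Suc[OF LIMSEQ_Suc[OF iter_tendsto]])
    show "(\<lambda>k. V1 (Suc k) p) \<longlonglongrightarrow> R1 (G u) p" for p
      unfolding V1_def by (rule LIMSEQ_Suc[OF R1.transl_tendsto[OF G_iter_measurable K G_iter_tendsto]])
    show "(\<lambda>k. V2 (Suc k) p) \<longlonglongrightarrow> R2 (G u) p" for p
      unfolding V2_def by (rule LIMSEQ_Suc[OF R2.transl_tendsto[OF G_iter_measurable K G_iter_tendsto]])
  qed
qed

text \<open>Bootstrapping: G u is as smooth as u, and the gradient of u consists of R1 and R2 of G
  u, so each round gains an order.\<close>

lemma Cb_u: "Cb k u"
proof (induction k)
  case 0
  show ?case
    using bcontI[OF has_grad_continuous[OF has_grad_u], of B] u_bounds by simp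
next
  case (Suc k)
  show ?case
    by (rule Cb_SucI[OF has_grad_u Cb_bcont[OF Suc]])
      (rule R1.Cb_transl[OF Cb_G[OF Suc]] R2.Cb_transl[OF Cb_G[OF Suc]])+
qed

text \<open>\<open>R_inverse\<close> says that R undoes c - laplace, while here c - laplace has to
  undo R. As derivatives commute with R, (c - laplace) R (G u) equals R ((c - laplace) (G u)), and
  \<open>R_inverse\<close> is applied to G u instead of u.\<close>

lemma laplacian_u:
  assumes "has_grad u u1 u2" "has_grad u1 u11 u12" "has_grad u2 u21 u22"
  shows "u11 p + u22 p = 2 * r * (Q p * exp (u p) - 1) + g0 p"
proof -
  obtain g1 g2 where g: "has_grad (G u) g1 g2" "bcont (G u)" "Cb (Suc 0) g1" "Cb (Suc 0) g2"
    using Cb_G[OF Cb_u[of "Suc (Suc 0)"]] by (rule Cb_SucE)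
  obtain g11 g12 where g1: "has_grad g1 g11 g12" "bcont g1" "Cb 0 g11" "Cb 0 g12"
    using g(3) by (rule Cb_SucE)
  obtain g21 g22 where g2: "has_grad g2 g21 g22" "bcont g2" "Cb 0 g21" "Cb 0 g22"
    using g(4) by (rule Cb_SucE)
  have b: "bcont g11" "bcont g12" "bcont g21" "bcont g22" using g1 g2 by simp_all
  have u: "u = R (G u)" by (rule ext, rule u_eq)
  have "has_grad u (R g1) (R g2)"
    using R.has_grad_transl[OF g(1,2) g1(2) g2(2)] u by simp
  then have 1: "u1 = R g1" "u2 = R g2" using assms(1) has_grad_unique by blast+
  have 2: "u11 = R g11" "u22 = R g22"
    using has_grad_unique[OF assms(2)[unfolded 1] R.has_grad_transl[OF g1(1,2) b(1,2)]]
      has_grad_unique[OF assms(3)[unfolded 1] R.has_grad_transl[OF g2(1,2) b(3,4)]] by auto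
  obtain K0 where K0: "\<And>p. \<bar>G u p\<bar> \<le> K0" "G u \<in> borel_measurable borel" using g(2) by (rule bcontD) blast
  obtain K1 where K1: "\<And>p. \<bar>g11 p\<bar> \<le> K1" "g11 \<in> borel_measurable borel" using b(1) by (rule bcontD) blast
  obtain K2 where K2: "\<And>p. \<bar>g22 p\<bar> \<le> K2" "g22 \<in> borel_measurable borel" using b(4) by (rule bcontD) blast
  have "c * u p - (u11 p + u22 p) = R (\<lambda>p. c * G u p - (g11 p + g22 p)) p"
  proof -
    let ?T = "\<lambda>x. p + fst x *\<^sub>R snd x"
    have "R (\<lambda>p. c * G u p - (g11 p + g22 p)) p
        = (\<integral>x. c * (\<bar>fst x\<bar> * G u (?T x)) - (\<bar>fst x\<bar> * g11 (?T x) + \<bar>fst x\<bar> * g22 (?T x)) \<partial>kern c)"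
      unfolding transl_def by (intro Bochner_Integration.integral_cong refl) (simp add: algebra_simps)
    also have "\<dots> = c * R (G u) p - (R g11 p + R g22 p)"
      unfolding transl_def
      using R.integrable_transl[OF K0(2,1), of p] R.integrable_transl[OF K1(2,1), of p] R.integrable_transl[OF K2(2,1), of p]
      by simp
    finally show ?thesis unfolding 2 u_eq[of p] by simp
  qed
  also have "\<dots> = G u p"
    by (rule R_inverse[OF g(1) g1(1) g2(1) g(2) g1(2) g2(2) b])
  finally show ?thesis by (simp add: G_def)
qed

end

section \<open>Maximum principle for the vortex density\<close>

lemma ln_quadratic_derivs:
  fixes x a m s :: real
  assumes "(x + s - a)\<^sup>2 + m > 0"
  shows "((\<lambda>s. ln ((x + s - a)\<^sup>2 + m)) has_real_derivative 2 * (x + s - a) / ((x + s - a)\<^sup>2 + m)) (at s)"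
    and "((\<lambda>s. 2 * (x + s - a) / ((x + s - a)\<^sup>2 + m)) has_real_derivative
      2 * (1 / ((x + s - a)\<^sup>2 + m) - 2 * ((x + s - a) * (1 / ((x + s - a)\<^sup>2 + m))) * ((x + s - a) * (1 / ((x + s - a)\<^sup>2 + m))))) (at s)"
  using assms
  by (auto intro!: derivative_eq_intros simp: divide_simps power2_eq_square)

lemma log_potential_max:
  fixes U U' :: "real \<Rightarrow> real" and x :: real
  assumes d: "d > 0" and U: "\<And>s. \<bar>s\<bar> < d \<Longrightarrow> (U has_real_derivative U' s) (at s)"
    and U': "(U' has_real_derivative U2) (at 0)" and m: "m > 0"
    and pos: "\<And>s i. \<bar>s\<bar> < d \<Longrightarrow> i \<in> I \<Longrightarrow> (x + s - a i)\<^sup>2 + b i > 0"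
    and F: "\<And>s. F s = (U s - \<delta> * ((x + s)\<^sup>2 + K)) + (\<Sum>i\<in>I. ln ((x + s - a i)\<^sup>2 + b i) - ln ((x + s - a i)\<^sup>2 + (b i + m)))"
    and max: "\<And>s. \<bar>s\<bar> < d \<Longrightarrow> F s \<le> F 0"
  shows "(U2 - 2 * \<delta>) + (\<Sum>i\<in>I. 2 * (1 / ((x + 0 - a i)\<^sup>2 + b i) - 2 * ((x + 0 - a i) * (1 / ((x + 0 - a i)\<^sup>2 + b i))) * ((x + 0 - a i) * (1 / ((x + 0 - a i)\<^sup>2 + b i))))
     - 2 * (1 / ((x + 0 - a i)\<^sup>2 + (b i + m)) - 2 * ((x + 0 - a i) * (1 / ((x + 0 - a i)\<^sup>2 + (b i + m)))) * ((x + 0 - a i) * (1 / ((x + 0 - a i)\<^sup>2 + (b i + m)))))) \<le> 0"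
proof (rule second_derivative_test[OF d, where \<phi> = F and
    \<phi>' = "\<lambda>s. (U' s - \<delta> * (2 * (x + s))) + (\<Sum>i\<in>I. 2 * (x + s - a i) / ((x + s - a i)\<^sup>2 + b i)
        - 2 * (x + s - a i) / ((x + s - a i)\<^sup>2 + (b i + m)))"])
  have pos': "(x + s - a i)\<^sup>2 + (b i + m) > 0" if "\<bar>s\<bar> < d" "i \<in> I" for s i
    using pos[OF that] m by linarith
  have q: "((\<lambda>s. \<delta> * ((x + s)\<^sup>2 + K)) has_real_derivative \<delta> * (2 * (x + s))) (at s)"
    "((\<lambda>s. \<delta> * (2 * (x + s))) has_real_derivative 2 * \<delta>) (at s)" for s
    by (auto intro!: derivative_eq_intros)
  show "(F has_real_derivative (U' s - \<delta> * (2 * (x + s))) + (\<Sum>i\<in>I. 2 * (x + s - a i) / ((x + s - a i)\<^sup>2 + b i)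
        - 2 * (x + s - a i) / ((x + s - a i)\<^sup>2 + (b i + m)))) (at s)" if "\<bar>s\<bar> < d" for s
    unfolding F[abs_def] by (intro DERIV_add DERIV_diff DERIV_sum ln_quadratic_derivs U q that pos[OF that] pos'[OF that])
  have d0: "\<bar>0\<bar> < d" using d by simp
  show "((\<lambda>s. (U' s - \<delta> * (2 * (x + s))) + (\<Sum>i\<in>I. 2 * (x + s - a i) / ((x + s - a i)\<^sup>2 + b i)
        - 2 * (x + s - a i) / ((x + s - a i)\<^sup>2 + (b i + m)))) has_real_derivative
     (U2 - 2 * \<delta>) + (\<Sum>i\<in>I. 2 * (1 / ((x + 0 - a i)\<^sup>2 + b i) - 2 * ((x + 0 - a i) * (1 / ((x + 0 - a i)\<^sup>2 + b i))) * ((x + 0 - a i) * (1 / ((x + 0 - a i)\<^sup>2 + b i))))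
     - 2 * (1 / ((x + 0 - a i)\<^sup>2 + (b i + m)) - 2 * ((x + 0 - a i) * (1 / ((x + 0 - a i)\<^sup>2 + (b i + m)))) * ((x + 0 - a i) * (1 / ((x + 0 - a i)\<^sup>2 + (b i + m))))))) (at 0)"
    by (intro DERIV_add DERIV_diff DERIV_sum ln_quadratic_derivs U' q pos[OF d0] pos'[OF d0])
qed (rule max)

context vortex_config
begin

text \<open>Off the zeros the function to be maximised is the exponential of H, whose Laplacian is
  that of u, minus 4 \<delta>, minus g0, because ln |q - w i|^2 is harmonic there. At a maximum it
  cannot be positive.\<close>

lemma laplacian_at_max_le:
  assumes u: "has_grad u u1 u2" "has_grad u1 u11 u12" "has_grad u2 u21 u22"
    and Q: "Q p > 0" and max: "\<And>q. Q q * exp (u q - \<delta> * (norm q)\<^sup>2) \<le> Q p * exp (u p - \<delta> * (norm p)\<^sup>2)"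
  shows "u11 p + u22 p - g0 p \<le> 4 * \<delta>"
proof -
  have pos: "sqd (w i) p > 0" if "i < N" for i
  proof -
    have "1 - \<mu> * rat \<mu> (w i) p > 0" using Q Q_le_factor[OF that, of p] by simp
    then show ?thesis
      using sqd_nonneg[of "w i" p] by (auto simp: factor_eq less_le)
  qed
  define H where "H q = (u q - \<delta> * ((fst q)\<^sup>2 + (snd q)\<^sup>2)) + (\<Sum>i<N. ln (sqd (w i) q) - ln (sqd (w i) q + \<mu>))" for q
  have norm_sq: "(norm q)\<^sup>2 = (fst q)\<^sup>2 + (snd q)\<^sup>2" for q :: "real \<times> real"
    by (cases q) (simp add: norm_Pair)
  have expH: "exp (H q) = Q q * exp (u q - \<delta> * (norm q)\<^sup>2)" if "\<And>i. i < N \<Longrightarrow> sqd (w i) q > 0" for q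
  proof -
    have "exp (\<Sum>i<N. ln (sqd (w i) q) - ln (sqd (w i) q + \<mu>)) = Q q"
      unfolding exp_sum[OF finite_lessThan] Q_def factor_eq
      using that sqd_add_pos[OF \<mu>_pos, of "w _" q] by (intro prod.cong refl) (simp add: exp_diff rat_def)
    then show ?thesis by (simp add: H_def exp_add norm_sq)
  qed
  have Hle: "H q \<le> H p" if "\<And>i. i < N \<Longrightarrow> sqd (w i) q > 0" for q
  proof -
    have "exp (H q) = Q q * exp (u q - \<delta> * (norm q)\<^sup>2)" by (rule expH) (rule that)
    moreover have "exp (H p) = Q p * exp (u p - \<delta> * (norm p)\<^sup>2)" by (rule expH) (rule pos)
    ultimately have "exp (H q) \<le> exp (H p)" using max[of q] by (simp only:)
    then show ?thesis by simp
  qed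
  \<comment> \<open>No factor vanishes at p, so H is differentiable on a whole disc around
    p.\<close>
  have "\<forall>\<^sub>F q in nhds p. \<forall>i\<in>{..<N}. sqd (w i) q > 0"
  proof (intro eventually_ball_finite ballI)
    fix i assume i: "i \<in> {..<N}"
    have "isCont (sqd (w i)) p"
      using has_grad_continuous[OF has_grad_sqd, of "w i"] unfolding continuous_on_eq_continuous_at[OF open_UNIV] by blast
    then have "(sqd (w i) \<longlongrightarrow> sqd (w i) p) (nhds p)" by (simp add: isCont_def tendsto_at_iff_tendsto_nhds)
    from order_tendstoD(1)[OF this, of 0] pos[of i] i show "\<forall>\<^sub>F q in nhds p. sqd (w i) q > 0" by simp
  qed simp
  then obtain d where d: "d > 0" and dpos: "\<And>q i. dist q p < d \<Longrightarrow> i < N \<Longrightarrow> sqd (w i) q > 0"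
    unfolding eventually_nhds_metric by auto
  have ev: "sqd (w i) (p + s *\<^sub>R e) > 0" if "\<bar>s\<bar> < d" "i < N" "norm e = 1" for s i and e :: "real \<times> real"
    using dpos[of "p + s *\<^sub>R e" i] that by (simp add: dist_norm)
  obtain x y where p: "p = (x, y)" by (cases p)
  define a b where "a i = fst (w i)" and "b i = snd (w i)" for i
  have sq: "sqd (w i) (x, y) = (x - a i)\<^sup>2 + (y - b i)\<^sup>2" for i x y by (simp add: sqd_def a_def b_def)
  define Dx where "Dx m i = 2 * (rat m (w i) p - 2 * (ratx m (w i) p * ratx m (w i) p))" for m i
  define Dy where "Dy m i = 2 * (rat m (w i) p - 2 * (raty m (w i) p * raty m (w i) p))" for m i
  have Dx: "Dx m i = 2 * (1 / ((x + 0 - a i)\<^sup>2 + ((y - b i)\<^sup>2 + m)) - 2 * ((x + 0 - a i) * (1 / ((x + 0 - a i)\<^sup>2 + ((y - b i)\<^sup>2 + m)))) * ((x + 0 - a i) * (1 / ((x + 0 - a i)\<^sup>2 + ((y - b i)\<^sup>2 + m)))))" for m i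
    by (simp add: Dx_def rat_def ratx_def p sq a_def add.assoc)
  have Dy: "Dy m i = 2 * (1 / ((y + 0 - b i)\<^sup>2 + ((x - a i)\<^sup>2 + m)) - 2 * ((y + 0 - b i) * (1 / ((y + 0 - b i)\<^sup>2 + ((x - a i)\<^sup>2 + m)))) * ((y + 0 - b i) * (1 / ((y + 0 - b i)\<^sup>2 + ((x - a i)\<^sup>2 + m)))))" for m i
    by (simp add: Dy_def rat_def raty_def p sq b_def add.assoc add.left_commute)
  have "(u11 p - 2 * \<delta>) + (\<Sum>i<N. Dx 0 i - Dx \<mu> i) \<le> 0"
    unfolding Dx add_0_right[of "(y - b _)\<^sup>2"]
  proof (rule log_potential_max[OF d _ _ \<mu>_pos, where U="\<lambda>s. u (x + s, y)" and U'="\<lambda>s. u1 (x + s, y)" and F="\<lambda>s. H (x + s, y)" and K="y\<^sup>2"])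
    show "((\<lambda>s. u (x + s, y)) has_real_derivative u1 (x + s, y)) (at s)" for s
      unfolding has_field_derivative_def
      by (rule has_derivative_eq_rhs[OF has_grad_compose[OF u(1)]]) (auto intro!: derivative_eq_intros simp: fun_eq_iff)
    show "((\<lambda>s. u1 (x + s, y)) has_real_derivative u11 p) (at 0)"
      unfolding has_field_derivative_def p
      by (rule has_derivative_eq_rhs[OF has_grad_compose[OF u(2)]]) (auto intro!: derivative_eq_intros simp: fun_eq_iff)
    show "(x + s - a i)\<^sup>2 + (y - b i)\<^sup>2 > 0" if "\<bar>s\<bar> < d" "i \<in> {..<N}" for s i
      using ev[OF that(1), of i "(1, 0)"] that(2) by (simp add: p sq)
    show "H (x + s, y) = (u (x + s, y) - \<delta> * ((x + s)\<^sup>2 + y\<^sup>2)) + (\<Sum>i<N. ln ((x + s - a i)\<^sup>2 + (y - b i)\<^sup>2) - ln ((x + s - a i)\<^sup>2 + ((y - b i)\<^sup>2 + \<mu>)))" for s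
      unfolding H_def sq fst_conv snd_conv add.assoc[of "(_ - _)\<^sup>2" _ \<mu>] ..
    show "H (x + s, y) \<le> H (x + 0, y)" if "\<bar>s\<bar> < d" for s
      using Hle[of "(x + s, y)"] ev[OF that, of _ "(1, 0)"] by (simp add: p)
  qed
  moreover have "(u22 p - 2 * \<delta>) + (\<Sum>i<N. Dy 0 i - Dy \<mu> i) \<le> 0"
    unfolding Dy add_0_right[of "(x - a _)\<^sup>2"]
  proof (rule log_potential_max[OF d _ _ \<mu>_pos, where U="\<lambda>s. u (x, y + s)" and U'="\<lambda>s. u2 (x, y + s)" and F="\<lambda>s. H (x, y + s)" and K="x\<^sup>2"])
    show "((\<lambda>s. u (x, y + s)) has_real_derivative u2 (x, y + s)) (at s)" for s
      unfolding has_field_derivative_def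
      by (rule has_derivative_eq_rhs[OF has_grad_compose[OF u(1)]]) (auto intro!: derivative_eq_intros simp: fun_eq_iff)
    show "((\<lambda>s. u2 (x, y + s)) has_real_derivative u22 p) (at 0)"
      unfolding has_field_derivative_def p
      by (rule has_derivative_eq_rhs[OF has_grad_compose[OF u(3)]]) (auto intro!: derivative_eq_intros simp: fun_eq_iff)
    show "(y + s - b i)\<^sup>2 + (x - a i)\<^sup>2 > 0" if "\<bar>s\<bar> < d" "i \<in> {..<N}" for s i
      using ev[OF that(1), of i "(0, 1)"] that(2) by (simp add: p sq add.commute)
    show "H (x, y + s) = (u (x, y + s) - \<delta> * ((y + s)\<^sup>2 + x\<^sup>2)) + (\<Sum>i<N. ln ((y + s - b i)\<^sup>2 + (x - a i)\<^sup>2) - ln ((y + s - b i)\<^sup>2 + ((x - a i)\<^sup>2 + \<mu>)))" for s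
      unfolding H_def sq fst_conv snd_conv by (simp only: add_ac)
    show "H (x, y + s) \<le> H (x, y + 0)" if "\<bar>s\<bar> < d" for s
      using Hle[of "(x, y + s)"] ev[OF that, of _ "(0, 1)"] by (simp add: p)
  qed
  moreover have "(\<Sum>i<N. Dx 0 i - Dx \<mu> i) + (\<Sum>i<N. Dy 0 i - Dy \<mu> i) = - g0 p"
    unfolding sum.distrib[symmetric] g0_def sum_negf[symmetric]
  proof (intro sum.cong refl)
    fix i assume "i \<in> {..<N}"
    then show "Dx 0 i - Dx \<mu> i + (Dy 0 i - Dy \<mu> i) = - (4 * \<mu> * (rat \<mu> (w i) p)\<^sup>2)"
      using laplacian_ln_sqd[of "w i" p 0] laplacian_ln_sqd[of "w i" p \<mu>] pos[of i] sqd_add_pos[OF \<mu>_pos, of "w i" p]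
      by (simp add: Dx_def Dy_def)
  qed
  ultimately show ?thesis by linarith
qed

text \<open>Where Q exp u = |a|^2 is largest, its logarithm has non-positive Laplacian, that is 2 r
  (|a|^2 - 1) \<le> 0. On the unbounded plane a maximum is forced by the penalty \<delta> |q|^2,
  which costs 4 \<delta> and disappears in the limit.\<close>

lemma Q_exp_u_le_1: "Q p0 * exp (u p0) \<le> 1"
proof -
  obtain u1 u2 where u: "has_grad u u1 u2" "Cb (Suc 0) u1" "Cb (Suc 0) u2" using Cb_u by (rule Cb_SucE)
  obtain u11 u12 where u1: "has_grad u1 u11 u12" using u(2) by (rule Cb_SucE)
  obtain u21 u22 where u2: "has_grad u2 u21 u22" using u(3) by (rule Cb_SucE)
  define t where "t = Q p0 * exp (u p0)"
  have key: "2 * r * (t * exp (- (\<delta> * (norm p0)\<^sup>2)) - 1) \<le> 4 * \<delta>" if "\<delta> > 0" "t > 0" for \<delta>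
  proof -
    define \<Psi> where "\<Psi> q = Q q * exp (u q - \<delta> * (norm q)\<^sup>2)" for q
    have \<Psi>0: "\<Psi> p0 = t * exp (- (\<delta> * (norm p0)\<^sup>2))" by (simp add: \<Psi>_def t_def exp_diff exp_minus field_simps)
    have \<Psi>0_pos: "\<Psi> p0 > 0" using that by (simp add: \<Psi>0)
    have "continuous_on UNIV Q" "continuous_on UNIV u"
      using Cb_bcont[OF Cb_Q[of 0]] Cb_bcont[OF Cb_u[of 0]] by (auto simp: bcont_def)
    then have cont: "continuous_on A \<Psi>" for A
      unfolding \<Psi>_def by (intro continuous_intros) (auto intro: continuous_on_subset)
    have "((\<lambda>s. exp (B - \<delta> * s\<^sup>2)) \<longlongrightarrow> 0) at_top"
      using that by real_asymp
    then have "\<forall>\<^sub>F s in at_top. exp (B - \<delta> * s\<^sup>2) < \<Psi> p0"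
      using \<Psi>0_pos by (rule order_tendstoD)
    then obtain \<rho> where \<rho>: "\<And>s. s \<ge> \<rho> \<Longrightarrow> exp (B - \<delta> * s\<^sup>2) < \<Psi> p0"
      by (auto simp: eventually_at_top_linorder)
    \<comment> \<open>Beyond radius \<rho> the penalty beats the bound u \<le> B; the ball is
      enlarged so that it contains p0 as well.\<close>
    define \<rho>' where "\<rho>' = max \<rho> (norm p0)"
    obtain p1 where p1: "p1 \<in> cball 0 \<rho>'" "\<And>q. q \<in> cball 0 \<rho>' \<Longrightarrow> \<Psi> q \<le> \<Psi> p1"
      using continuous_attains_sup[OF compact_cball _ cont, of 0 \<rho>'] by (force simp: \<rho>'_def le_max_iff_disj)
    have ge: "\<Psi> p0 \<le> \<Psi> p1" by (rule p1) (simp add: \<rho>'_def)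
    have max: "\<Psi> q \<le> \<Psi> p1" for q
    proof (cases "q \<in> cball 0 \<rho>'")
      case False
      then have "norm q \<ge> \<rho>" by (simp add: \<rho>'_def)
      have "\<Psi> q \<le> 1 * exp (B - \<delta> * (norm q)\<^sup>2)"
        unfolding \<Psi>_def using Q_nonneg Q_le_1 u_bounds(2) by (intro mult_mono) auto
      also have "\<dots> < \<Psi> p0" using \<rho>[OF \<open>norm q \<ge> \<rho>\<close>] by simp
      finally show ?thesis using ge by simp
    qed (rule p1)
    have "Q p1 > 0"
      using order.strict_trans2[OF \<Psi>0_pos ge] by (simp add: \<Psi>_def zero_less_mult_iff)
    from laplacian_at_max_le[OF u(1) u1 u2 this max[unfolded \<Psi>_def]]
    have "2 * r * (Q p1 * exp (u p1) - 1) \<le> 4 * \<delta>"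
      unfolding laplacian_u[OF u(1) u1 u2] by simp
    moreover have "\<Psi> p1 \<le> Q p1 * exp (u p1)"
      unfolding \<Psi>_def using that Q_nonneg by (intro mult_left_mono) auto
    then have "2 * r * (\<Psi> p0 - 1) \<le> 2 * r * (Q p1 * exp (u p1) - 1)"
      using ge r_pos by (intro mult_left_mono) auto
    ultimately show ?thesis unfolding \<Psi>0 by linarith
  qed
  have "t \<le> 1"
  proof (cases "t > 0")
    case True
    have lim: "((\<lambda>\<delta>. 2 * r * (t * exp (- (\<delta> * (norm p0)\<^sup>2)) - 1)) \<longlongrightarrow> 2 * r * (t * exp (- (0 * (norm p0)\<^sup>2)) - 1)) (at_right 0)"
      "((\<lambda>\<delta>::real. 4 * \<delta>) \<longlongrightarrow> 4 * 0) (at_right 0)"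
      by (intro tendsto_intros)+
    have "2 * r * (t * exp (- (0 * (norm p0)\<^sup>2)) - 1) \<le> 4 * 0"
      by (rule tendsto_le[OF trivial_limit_at_right_real lim(2,1)])
        (rule eventually_mono[OF eventually_at_right_less], rule key[OF _ True])
    then show ?thesis using r_pos by (simp add: mult_le_0_iff)
  qed simp
  then show ?thesis by (simp add: t_def)
qed

end

section \<open>Scaling of planar integrals and the Gaussian density\<close>

lemma lborel_affine_integral:
  fixes f :: "real \<times> real \<Rightarrow> real"
  assumes [measurable]: "f \<in> borel_measurable borel" and "s \<noteq> 0"
  shows "(\<integral>y. f y \<partial>lborel) = s\<^sup>2 * (\<integral>z. f (t + s *\<^sub>R z) \<partial>lborel)"
    and "integrable lborel f \<longleftrightarrow> integrable lborel (\<lambda>z. f (t + s *\<^sub>R z))"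
proof -
  have L: "(lborel :: (real \<times> real) measure) = density (distr lborel borel (\<lambda>z. t + s *\<^sub>R z)) (\<lambda>_. ennreal (s\<^sup>2))"
    using lborel_affine[OF assms(2), of t] by (simp add: ennreal_power[symmetric] power2_eq_square)
  show "(\<integral>y. f y \<partial>lborel) = s\<^sup>2 * (\<integral>z. f (t + s *\<^sub>R z) \<partial>lborel)"
    by (subst L) (simp add: integral_density integral_distr)
  show "integrable lborel f \<longleftrightarrow> integrable lborel (\<lambda>z. f (t + s *\<^sub>R z))"
    by (subst L) (use assms(2) in \<open>simp add: integrable_density integrable_distr_eq\<close>)
qed

lemma gauss2_density: "gauss2 = density lborel (\<lambda>z. ennreal (1 / (2 * pi) * exp (- (norm z)\<^sup>2 / 2)))"
proof -
  have "gauss2 = density (lborel \<Otimes>\<^sub>M lborel) (\<lambda>(x, y). ennreal (std_normal_density x) * ennreal (std_normal_density y))"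
    unfolding gauss2_def gauss_def
    by (rule pair_measure_density) (auto intro: gauss.sigma_finite_measure_axioms[unfolded gauss_def] sigma_finite_lborel)
  also have "\<dots> = density lborel (\<lambda>z. ennreal (1 / (2 * pi) * exp (- (norm z)\<^sup>2 / 2)))"
    unfolding lborel_prod
  proof (rule density_cong)
    show "AE z in lborel. (case z of (x, y) \<Rightarrow> ennreal (std_normal_density x) * ennreal (std_normal_density y))
      = ennreal (1 / (2 * pi) * exp (- (norm z)\<^sup>2 / 2))"
    proof (intro AE_I2)
      fix z :: "real \<times> real"
      obtain x y where z: "z = (x, y)" by (cases z)
      have "std_normal_density x * std_normal_density y = 1 / (2 * pi) * exp (- (norm z)\<^sup>2 / 2)"
        by (simp add: std_normal_density_def z norm_Pair mult_exp_exp add_divide_distrib flip: exp_add)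
      then show "(case z of (x, y) \<Rightarrow> ennreal (std_normal_density x) * ennreal (std_normal_density y))
        = ennreal (1 / (2 * pi) * exp (- (norm z)\<^sup>2 / 2))"
        by (simp add: z ennreal_mult''[symmetric])
    qed
  qed measurable
  finally show ?thesis .
qed

lemma integral_gauss2:
  fixes f :: "real \<times> real \<Rightarrow> real"
  assumes [measurable]: "f \<in> borel_measurable borel"
  shows "(\<integral>z. f z \<partial>gauss2) = (\<integral>z. 1 / (2 * pi) * exp (- (norm z)\<^sup>2 / 2) * f z \<partial>lborel)"
    and "integrable gauss2 f \<longleftrightarrow> integrable lborel (\<lambda>z. 1 / (2 * pi) * exp (- (norm z)\<^sup>2 / 2) * f z)"
  unfolding gauss2_density by (simp_all add: integral_density integrable_density)

lemma AE_gauss2_finite: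
  assumes "finite A"
  shows "AE z in gauss2. z \<notin> A"
proof -
  have "A \<in> null_sets lborel" using assms by (rule finite_imp_null_set_lborel)
  then have "AE z in lborel. z \<notin> A" by (rule AE_not_in)
  then show ?thesis unfolding gauss2_density by (subst AE_density) (auto elim: eventually_mono)
qed

section \<open>Concentration of the curvature\<close>

text \<open>The Laplacian of ln (|z|^2 + 1).\<close>

definition bump :: "real \<times> real \<Rightarrow> real" where
  "bump z = 4 * (rat 1 0 z)\<^sup>2"

text \<open>The mass 4 pi carried by one zero. Normalising by it only takes its positivity, so the
  value is never computed.\<close>

definition kappa :: real where
  "kappa = (\<integral>z. bump z \<partial>lborel)"

lemma bump_pos: "bump z > 0"
  using rat_pos[of 1 0 z] by (simp add: bump_def)

lemma bump_nonneg [simp]: "0 \<le> bump z"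
  using bump_pos[of z] by simp

lemma borel_measurable_rat [measurable]: "rat m a \<in> borel_measurable borel"
  unfolding rat_def[abs_def] sqd_def by measurable

lemma borel_measurable_bump [measurable]: "bump \<in> borel_measurable borel"
  unfolding bump_def[abs_def] by measurable

lemma integrable_bump: "integrable lborel bump"
proof -
  have i: "integrable lborel (\<lambda>x::real. inverse (1 + x\<^sup>2))"
    using integrable_inverse_1_plus_square by (simp add: set_integrable_def)
  \<comment> \<open>The majorant is a product of one-dimensional integrable functions: (1 + x^2) (1
    + y^2) \<le> (1 + x^2 + y^2)^2.\<close>
  have "integrable (lborel \<Otimes>\<^sub>M lborel) (\<lambda>z :: real \<times> real. 4 * (inverse (1 + (fst z)\<^sup>2) * inverse (1 + (snd z)\<^sup>2)))"
    by (intro integrable_mult_right integrable_pair_mult sigma_finite_lborel i)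
  then have "integrable lborel (\<lambda>z :: real \<times> real. 4 * (inverse (1 + (fst z)\<^sup>2) * inverse (1 + (snd z)\<^sup>2)))"
    by (simp add: lborel_prod)
  then show ?thesis
  proof (rule Bochner_Integration.integrable_bound)
    show "AE z in lborel. norm (bump z) \<le> norm (4 * (inverse (1 + (fst z)\<^sup>2) * inverse (1 + (snd z)\<^sup>2)))"
    proof (intro AE_I2)
      fix z :: "real \<times> real"
      have "(1 + (fst z)\<^sup>2) * (1 + (snd z)\<^sup>2) \<le> (1 + (fst z)\<^sup>2 + (snd z)\<^sup>2)\<^sup>2"
      proof -
        have "(1 + X) * (1 + Y) \<le> (1 + X + Y)\<^sup>2" if "X \<ge> 0" "Y \<ge> 0" for X Y :: real
          using that mult_nonneg_nonneg[OF that] by (simp add: power2_eq_square algebra_simps)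
        then show ?thesis by simp
      qed
      moreover have "0 < (1 + (fst z)\<^sup>2) * (1 + (snd z)\<^sup>2)"
        by (intro mult_pos_pos add_pos_nonneg) auto
      ultimately have "inverse ((1 + (fst z)\<^sup>2 + (snd z)\<^sup>2)\<^sup>2) \<le> inverse ((1 + (fst z)\<^sup>2) * (1 + (snd z)\<^sup>2))"
        by (rule le_imp_inverse_le)
      moreover have "bump z = 4 * inverse ((1 + (fst z)\<^sup>2 + (snd z)\<^sup>2)\<^sup>2)"
        by (simp add: bump_def rat_def sqd_def inverse_eq_divide power_divide add_ac)
      ultimately have "bump z \<le> 4 * (inverse (1 + (fst z)\<^sup>2) * inverse (1 + (snd z)\<^sup>2))"
        by (simp add: inverse_mult_distrib)
      then show "norm (bump z) \<le> norm (4 * (inverse (1 + (fst z)\<^sup>2) * inverse (1 + (snd z)\<^sup>2)))"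
        using bump_pos[of z] by simp
    qed
  qed measurable
qed

lemma kappa_pos: "kappa > 0"
proof -
  have "kappa \<ge> 0" unfolding kappa_def by (intro Bochner_Integration.integral_nonneg) simp
  moreover have "kappa \<noteq> 0"
  proof
    assume "kappa = 0"
    then have "AE z in lborel. bump z = 0"
      unfolding kappa_def by (subst (asm) integral_nonneg_eq_0_iff_AE[OF integrable_bump]) auto
    then have "AE z in (lborel :: (real \<times> real) measure). False"
      by (rule eventually_mono) (use bump_pos in \<open>auto simp: less_le\<close>)
    then show False by (simp add: AE_iff_null null_sets_def emeasure_lborel_UNIV)
  qed
  ultimately show ?thesis by simp
qed

text \<open>The summands of g0 are copies of \<open>bump\<close> rescaled to width sqrt m about
  their zeros, of equal mass whatever m is.\<close>

lemma rat_bump: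
  assumes "m > 0"
  shows "m * (4 * m * (rat m a (a + sqrt m *\<^sub>R z))\<^sup>2) = bump z"
proof -
  have "sqd a (a + sqrt m *\<^sub>R z) + m = m * (sqd 0 z + 1)"
    using assms by (simp add: sqd_def power_mult_distrib algebra_simps)
  then show ?thesis using assms by (simp add: rat_def bump_def power2_eq_square divide_simps)
qed

lemma concentrated_bump_integral:
  assumes m: "m > 0" and [measurable]: "\<zeta> \<in> borel_measurable borel"
  shows "(\<integral>y. \<zeta> y * (4 * m * (rat m a y)\<^sup>2) \<partial>lborel) = (\<integral>z. \<zeta> (a + sqrt m *\<^sub>R z) * bump z \<partial>lborel)"
    and "integrable lborel (\<lambda>y. 4 * m * (rat m a y)\<^sup>2)"
proof -
  have s: "sqrt m \<noteq> 0" "(sqrt m)\<^sup>2 = m" using m by auto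
  have *: "bump z = m * (4 * m * (rat m a (a + sqrt m *\<^sub>R z))\<^sup>2)" for z by (rule rat_bump[OF m, symmetric])
  have "(\<integral>y. \<zeta> y * (4 * m * (rat m a y)\<^sup>2) \<partial>lborel) = m * (\<integral>z. \<zeta> (a + sqrt m *\<^sub>R z) * (4 * m * (rat m a (a + sqrt m *\<^sub>R z))\<^sup>2) \<partial>lborel)"
    by (subst lborel_affine_integral(1)[OF _ s(1), where t=a]) (simp_all add: s)
  also have "\<dots> = (\<integral>z. \<zeta> (a + sqrt m *\<^sub>R z) * bump z \<partial>lborel)"
    unfolding * integral_mult_right_zero[symmetric] by (intro Bochner_Integration.integral_cong) (simp_all add: mult_ac)
  finally show "(\<integral>y. \<zeta> y * (4 * m * (rat m a y)\<^sup>2) \<partial>lborel) = (\<integral>z. \<zeta> (a + sqrt m *\<^sub>R z) * bump z \<partial>lborel)" .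
  have "integrable lborel (\<lambda>z. (1 / m) * bump z)" by (intro integrable_mult_right integrable_bump)
  then have "integrable lborel (\<lambda>z. 4 * m * (rat m a (a + sqrt m *\<^sub>R z))\<^sup>2)"
    using m by (simp add: *)
  then show "integrable lborel (\<lambda>y. 4 * m * (rat m a y)\<^sup>2)"
    by (subst lborel_affine_integral(2)[OF _ s(1), where t=a]) simp_all
qed

text \<open>Outside a large ball P has little mass and \<zeta> is bounded; inside it s z is short
  and uniform continuity applies. The estimate serves both for the Gaussian measure and for the
  measure with density \<open>bump\<close>.\<close>

lemma finite_measure_average_uniform:
  fixes \<zeta> :: "real \<times> real \<Rightarrow> real"
  assumes "finite_measure P" and sets [measurable_cong]: "sets P = sets borel"
    and uc: "uniformly_continuous_on UNIV \<zeta>" and Z: "\<And>y. \<bar>\<zeta> y\<bar> \<le> Z" and e: "e > 0"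
  shows "\<exists>d>0. \<forall>s a. \<bar>s\<bar> < d \<longrightarrow> \<bar>(\<integral>z. \<zeta> (a + s *\<^sub>R z) \<partial>P) - measure P UNIV * \<zeta> a\<bar> \<le> e"
proof -
  interpret P: finite_measure P by fact
  have space: "space P = UNIV" using sets_eq_imp_space_eq[OF sets] by simp
  have [measurable]: "\<zeta> \<in> borel_measurable borel"
    using uniformly_continuous_imp_continuous[OF uc] by (rule borel_measurable_continuous_onI)
  have Z0: "Z \<ge> 0" using Z[of 0] by simp
  define m where "m = measure P UNIV"
  have m: "m \<ge> 0" by (simp add: m_def)
  define e' where "e' = e / (2 * (m + 1))"
  have e': "e' > 0" "e' * m \<le> e / 2" using e m by (auto simp: e'_def field_simps)
  have "(\<lambda>n. measure P {z. norm z > real n}) \<longlonglongrightarrow> measure P (\<Inter>n. {z. norm z > real n})"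
    by (rule P.finite_Lim_measure_decseq) (auto simp: decseq_def sets)
  also have "(\<Inter>n. {z :: real \<times> real. norm z > real n}) = {}"
    by (auto simp del: split_paired_All) (metis reals_Archimedean2 order_less_asym)
  finally have "(\<lambda>n. measure P {z. norm z > real n}) \<longlonglongrightarrow> 0" by simp
  \<comment> \<open>With this tail the outer part is at most 2 Z e / (4 (Z + 1)), hence at most e /
    2; the choice of e' reserves the other half for the inner part.\<close>
  then have "\<forall>\<^sub>F n in sequentially. measure P {z. norm z > real n} < e / (4 * (Z + 1))"
    using e Z0 by (intro order_tendstoD) auto
  then obtain n where n: "measure P {z. norm z > real n} < e / (4 * (Z + 1))"
    by (auto simp: eventually_sequentially)
  obtain d where d: "d > 0" "\<And>x y. dist x y < d \<Longrightarrow> dist (\<zeta> x) (\<zeta> y) < e'"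
    using uc e'(1) unfolding uniformly_continuous_on_def by (metis UNIV_I)
  have int: "integrable P (\<lambda>z. \<zeta> (a + s *\<^sub>R z))" for a s
    by (rule P.integrable_const_bound[of _ Z]) (use Z in auto)
  have "\<bar>(\<integral>z. \<zeta> (a + s *\<^sub>R z) \<partial>P) - m * \<zeta> a\<bar> \<le> e" if s: "\<bar>s\<bar> < d / (n + 1)" for s a
  proof -
    have pt: "\<bar>\<zeta> (a + s *\<^sub>R z) - \<zeta> a\<bar> \<le> e' + 2 * Z * indicator {z. norm z > real n} z" for z
    proof (cases "norm z > real n")
      case True
      then show ?thesis using Z[of "a + s *\<^sub>R z"] Z[of a] e' by simp
    next
      case False
      have "\<bar>s\<bar> * norm z \<le> \<bar>s\<bar> * (n + 1)" using False by (intro mult_left_mono) auto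
      also have "\<dots> < d" using s by (simp add: field_simps)
      finally have "dist (a + s *\<^sub>R z) a < d" by (simp add: dist_norm)
      from d(2)[OF this] show ?thesis using False by (simp add: dist_real_def)
    qed
    have ind: "integrable P (indicator {z. norm z > real n} :: _ \<Rightarrow> real)"
      by (rule P.integrable_const_bound[of _ 1]) auto
    then have ib: "integrable P (\<lambda>z. e' + 2 * Z * indicator {z. norm z > real n} z)" by simp
    have "(\<integral>z. \<zeta> (a + s *\<^sub>R z) \<partial>P) - m * \<zeta> a = (\<integral>z. \<zeta> (a + s *\<^sub>R z) - \<zeta> a \<partial>P)"
      using int by (simp add: m_def space)
    also have "\<bar>\<dots>\<bar> \<le> (\<integral>z. e' + 2 * Z * indicator {z. norm z > real n} z \<partial>P)"
      by (rule order_trans[OF integral_abs_bound integral_mono])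
        (auto intro!: integrable_abs Bochner_Integration.integrable_diff int ib pt simp del: split_paired_All)
    also have "\<dots> = e' * m + 2 * Z * measure P {z. norm z > real n}"
      using ind by (simp add: m_def space mult.commute)
    also have "2 * Z * measure P {z. norm z > real n} \<le> 2 * Z * (e / (4 * (Z + 1)))"
      using n Z0 by (intro mult_left_mono) auto
    also have "\<dots> \<le> e / 2" using Z0 e by (simp add: field_simps)
    finally show ?thesis using e' by linarith
  qed
  moreover have "d / (n + 1) > 0" using d by simp
  ultimately show ?thesis unfolding m_def by blast
qed

context vortex_config
begin

text \<open>Twice the planar curvature r (1 - |a|^2); by the equation for u it is also g0 minus the
  Laplacian of u.\<close>

definition D :: "real \<times> real \<Rightarrow> real" where
  "D p = 2 * r * (1 - Q p * exp (u p))"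

lemma D_nonneg: "0 \<le> D p"
  using Q_exp_u_le_1[of p] r_pos by (simp add: D_def)

lemma Cb_D: "Cb k D"
  unfolding D_def[abs_def] by (intro Cb_cmult Cb_diff Cb_const Cb_mult Cb_Q Cb_exp Cb_u)

lemma measurable_u_D_g0 [measurable]:
  "u \<in> borel_measurable borel" "D \<in> borel_measurable borel" "g0 \<in> borel_measurable borel"
  using Cb_bcont[OF Cb_u[of 0]] Cb_bcont[OF Cb_D[of 0]] Cb_bcont[OF Cb_g0[of 0]]
  by (auto simp: bcont_def intro: borel_measurable_continuous_onI)

text \<open>From Q exp u \<le> 1, u is at most - ln Q, the sum of ln (1 + \<mu> / |p - w i|^2), and
  ln (1 + x) \<le> x. The proof states this with exponentials.\<close>

lemma u_le_decay:
  assumes "\<And>i. i < N \<Longrightarrow> p \<noteq> w i"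
  shows "u p \<le> (\<Sum>i<N. \<mu> / sqd (w i) p)"
proof -
  have pos: "sqd (w i) p > 0" if "i < N" for i
    using assms[OF that] sqd_nonneg[of "w i" p] sqd_eq_0_iff[of "w i" p] by linarith
  have "1 \<le> (\<Prod>i<N. (1 - \<mu> * rat \<mu> (w i) p) * exp (\<mu> / sqd (w i) p))"
  proof (intro prod_ge_1)
    fix i assume "i \<in> {..<N}"
    then have p: "sqd (w i) p > 0" using pos by simp
    have "1 = rat \<mu> (w i) p * (sqd (w i) p + \<mu>)"
      using sqd_add_pos[OF \<mu>_pos, of "w i" p] by (simp add: rat_def)
    also have "\<dots> = (1 - \<mu> * rat \<mu> (w i) p) * (1 + \<mu> / sqd (w i) p)"
      unfolding factor_eq using p by (simp add: field_simps)
    also have "\<dots> \<le> (1 - \<mu> * rat \<mu> (w i) p) * exp (\<mu> / sqd (w i) p)"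
      by (intro mult_left_mono factor_bounds exp_ge_add_one_self)
    finally show "1 \<le> (1 - \<mu> * rat \<mu> (w i) p) * exp (\<mu> / sqd (w i) p)" .
  qed
  also have "\<dots> = Q p * exp (\<Sum>i<N. \<mu> / sqd (w i) p)"
    by (simp add: Q_def prod.distrib exp_sum)
  finally have 1: "1 \<le> Q p * exp (\<Sum>i<N. \<mu> / sqd (w i) p)" .
  then have "Q p * exp (u p) \<le> Q p * exp (\<Sum>i<N. \<mu> / sqd (w i) p)"
    using Q_exp_u_le_1[of p] by linarith
  moreover have "Q p > 0"
    using 1 Q_nonneg[of p] by (cases "Q p = 0") auto
  ultimately show ?thesis by simp
qed

text \<open>D is g0 minus the Laplacian of u, and Stein's identity used twice turns the average of
  the Laplacian into the average of u itself against the second order Hermite weight (|z|^2 - 2) /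
  s^2.\<close>

lemma D_gauss_avg:
  assumes "s \<noteq> 0"
  shows "gauss_avg s D p = gauss_avg s g0 p - (1 / s\<^sup>2) * (\<integral>z. u (p + s *\<^sub>R z) * ((norm z)\<^sup>2 - 2) \<partial>gauss2)"
proof -
  obtain u1 u2 where u: "has_grad u u1 u2" "Cb (Suc 0) u1" "Cb (Suc 0) u2" using Cb_u by (rule Cb_SucE)
  obtain u11 u12 where u1: "has_grad u1 u11 u12" "Cb 0 u11" "Cb 0 u12" using u(2) by (rule Cb_SucE)
  obtain u21 u22 where u2: "has_grad u2 u21 u22" "Cb 0 u21" "Cb 0 u22" using u(3) by (rule Cb_SucE)
  have b: "bcont u" "bcont u1" "bcont u2" "bcont u11" "bcont u12" "bcont u21" "bcont u22" "bcont g0"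
    using u1 u2 Cb_bcont[OF u(2)] Cb_bcont[OF u(3)] Cb_bcont[OF Cb_u] Cb_bcont[OF Cb_g0] by auto
  obtain K where K: "\<And>p. \<bar>u p\<bar> \<le> K" "K \<ge> 0" by (rule bcontD[OF b(1)]) blast
  obtain K1 where K1: "\<And>p. \<bar>u1 p\<bar> \<le> K1" "K1 \<ge> 0" by (rule bcontD[OF b(2)]) blast
  obtain K2 where K2: "\<And>p. \<bar>u2 p\<bar> \<le> K2" "K2 \<ge> 0" by (rule bcontD[OF b(3)]) blast
  have c: "continuous_on UNIV u" "continuous_on UNIV u1" "continuous_on UNIV u2" using b by (auto simp: bcont_def)
  note i = gauss_integrable_bound[of _ p s]
  let ?y = "\<lambda>z. p + s *\<^sub>R z"
  define L where "L = K + \<bar>s\<bar> * K1 + \<bar>s\<bar> * K2"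
  have L: "\<bar>t\<bar> \<le> L * (1 + \<bar>x\<bar>) * (1 + \<bar>y\<bar>)" if "\<bar>t\<bar> \<le> L * (1 + \<bar>x\<bar>)" for t x y :: real
    using mult_left_mono[of 1 "1 + \<bar>y\<bar>" "L * (1 + \<bar>x\<bar>)"] order_trans[OF abs_ge_zero that] that by simp
  have bnd: "\<bar>a * u q\<bar> \<le> L * (1 + \<bar>a\<bar>)" "\<bar>u q + a * (s * u1 q)\<bar> \<le> L * (1 + \<bar>a\<bar>)" "\<bar>a * (s * u2 q)\<bar> \<le> L * (1 + \<bar>a\<bar>)"
    "\<bar>u q + a * (s * u2 q)\<bar> \<le> L * (1 + \<bar>a\<bar>)" "\<bar>a * (s * u1 q)\<bar> \<le> L * (1 + \<bar>a\<bar>)" for a q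
  proof -
    have 0: "\<bar>a * u q\<bar> \<le> \<bar>a\<bar> * K" using K by (simp add: abs_mult mult_left_mono)
    have 1: "\<bar>a * (s * u1 q)\<bar> \<le> \<bar>a\<bar> * (\<bar>s\<bar> * K1)" using K1 by (simp add: abs_mult mult_left_mono)
    have 2: "\<bar>a * (s * u2 q)\<bar> \<le> \<bar>a\<bar> * (\<bar>s\<bar> * K2)" using K2 by (simp add: abs_mult mult_left_mono)
    have n: "0 \<le> \<bar>s\<bar> * K1" "0 \<le> \<bar>s\<bar> * K2" "0 \<le> \<bar>a\<bar> * K" "0 \<le> \<bar>a\<bar> * (\<bar>s\<bar> * K1)" "0 \<le> \<bar>a\<bar> * (\<bar>s\<bar> * K2)"
      using K K1 K2 by auto
    have e: "L * (1 + \<bar>a\<bar>) = K + \<bar>s\<bar> * K1 + \<bar>s\<bar> * K2 + \<bar>a\<bar> * K + \<bar>a\<bar> * (\<bar>s\<bar> * K1) + \<bar>a\<bar> * (\<bar>s\<bar> * K2)"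
      by (simp add: L_def algebra_simps)
    show "\<bar>a * u q\<bar> \<le> L * (1 + \<bar>a\<bar>)" "\<bar>u q + a * (s * u1 q)\<bar> \<le> L * (1 + \<bar>a\<bar>)" "\<bar>a * (s * u2 q)\<bar> \<le> L * (1 + \<bar>a\<bar>)"
      "\<bar>u q + a * (s * u2 q)\<bar> \<le> L * (1 + \<bar>a\<bar>)" "\<bar>a * (s * u1 q)\<bar> \<le> L * (1 + \<bar>a\<bar>)"
      unfolding e using 0 1 2 n K(1)[of q] K(2) by linarith+
  qed
  have g: "has_grad (\<lambda>z. fst z * u (?y z)) (\<lambda>z. u (?y z) + fst z * (s * u1 (?y z))) (\<lambda>z. fst z * (s * u2 (?y z)))"
    "has_grad (\<lambda>z. snd z * u (?y z)) (\<lambda>z. snd z * (s * u1 (?y z))) (\<lambda>z. u (?y z) + snd z * (s * u2 (?y z)))"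
  proof -
    have f: "has_grad fst (\<lambda>_. 1) (\<lambda>_. 0)" "has_grad snd (\<lambda>_. 0) (\<lambda>_. 1)"
      unfolding has_grad_def by (auto intro!: derivative_eq_intros)
    show "has_grad (\<lambda>z. fst z * u (?y z)) (\<lambda>z. u (?y z) + fst z * (s * u1 (?y z))) (\<lambda>z. fst z * (s * u2 (?y z)))"
      using has_grad_mult[OF f(1) has_grad_affine[OF u(1)]] by (simp add: add.commute)
    show "has_grad (\<lambda>z. snd z * u (?y z)) (\<lambda>z. snd z * (s * u1 (?y z))) (\<lambda>z. u (?y z) + snd z * (s * u2 (?y z)))"
      using has_grad_mult[OF f(2) has_grad_affine[OF u(1)]] by (simp add: add.commute)
  qed
  have cy: "continuous_on UNIV (\<lambda>z. f (?y z))" if "continuous_on UNIV f" for f :: "real \<times> real \<Rightarrow> real"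
    by (rule continuous_on_compose2[OF that]) (auto intro!: continuous_intros)
  \<comment> \<open>Stein's identity for the product z1 u (p + s z). The product rule leaves one
    plain u per coordinate, and these two make up the - 2 in the weight.\<close>
  have 1: "(\<integral>z. u (?y z) + fst z * (s * u1 (?y z)) \<partial>gauss2) = (\<integral>z. fst z * (fst z * u (?y z)) \<partial>gauss2)"
    by (rule stein2(1)[OF g(1), of L]) (intro continuous_intros cy c L bnd)+
  have 2: "(\<integral>z. u (?y z) + snd z * (s * u2 (?y z)) \<partial>gauss2) = (\<integral>z. snd z * (snd z * u (?y z)) \<partial>gauss2)"
  proof (rule stein2(2)[OF g(2), of L])
    have L': "\<bar>t\<bar> \<le> L * (1 + \<bar>x\<bar>) * (1 + \<bar>y\<bar>)" if "\<bar>t\<bar> \<le> L * (1 + \<bar>y\<bar>)" for t x y :: real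
      using L[OF that, of x] by (simp add: mult_ac)
    show "\<bar>snd p * u (?y p)\<bar> \<le> L * (1 + \<bar>fst p\<bar>) * (1 + \<bar>snd p\<bar>)"
      "\<bar>snd p * (s * u1 (?y p))\<bar> \<le> L * (1 + \<bar>fst p\<bar>) * (1 + \<bar>snd p\<bar>)"
      "\<bar>u (?y p) + snd p * (s * u2 (?y p))\<bar> \<le> L * (1 + \<bar>fst p\<bar>) * (1 + \<bar>snd p\<bar>)" for p
      by (intro L' bnd)+
  qed (intro continuous_intros cy c)+
  have 3: "(\<integral>z. u (?y z) + fst z * (s * u1 (?y z)) \<partial>gauss2) = (\<integral>z. u (?y z) \<partial>gauss2) + s * (s * gauss_avg s u11 p)"
    unfolding stein_gauss_avg(1)[OF u1(1) b(2,4,5)] using i(1)[OF b(1)] i(2)[OF b(2)]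
    by (simp add: mult.left_commute[of _ s])
  have 4: "(\<integral>z. u (?y z) + snd z * (s * u2 (?y z)) \<partial>gauss2) = (\<integral>z. u (?y z) \<partial>gauss2) + s * (s * gauss_avg s u22 p)"
    unfolding stein_gauss_avg(2)[OF u2(1) b(3,6,7)] using i(1)[OF b(1)] i(3)[OF b(3)]
    by (simp add: mult.left_commute[of _ s])
  have "(\<integral>z. u (?y z) * ((norm z)\<^sup>2 - 2) \<partial>gauss2)
      = (\<integral>z. (fst z)\<^sup>2 * u (?y z) + (snd z)\<^sup>2 * u (?y z) - 2 * u (?y z) \<partial>gauss2)"
    by (intro Bochner_Integration.integral_cong refl) (auto simp: norm_prod_def algebra_simps)
  also have "\<dots> = (\<integral>z. fst z * (fst z * u (?y z)) \<partial>gauss2) + (\<integral>z. snd z * (snd z * u (?y z)) \<partial>gauss2) - 2 * (\<integral>z. u (?y z) \<partial>gauss2)"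
    using i(1)[OF b(1)] i(4)[OF b(1)] i(5)[OF b(1)] by (simp add: power2_eq_square mult.assoc)
  also have "\<dots> = s\<^sup>2 * (gauss_avg s u11 p + gauss_avg s u22 p)"
    using 1 2 3 4 by (simp add: power2_eq_square algebra_simps)
  finally have 5: "(\<integral>z. u (?y z) * ((norm z)\<^sup>2 - 2) \<partial>gauss2) = s\<^sup>2 * (gauss_avg s u11 p + gauss_avg s u22 p)" .
  have "D = (\<lambda>q. g0 q - (u11 q + u22 q))"
  proof
    fix q show "D q = g0 q - (u11 q + u22 q)"
      using laplacian_u[OF u(1) u1(1) u2(1), of q] by (simp add: D_def right_diff_distrib)
  qed
  then have "gauss_avg s D p = gauss_avg s g0 p - (gauss_avg s u11 p + gauss_avg s u22 p)"
    unfolding gauss_avg_def using i(1)[OF b(8)] i(1)[OF b(4)] i(1)[OF b(7)] by simp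
  then show ?thesis unfolding 5 using assms by simp
qed

end

lemma integrable_bcont_mult:
  fixes h :: "_ \<Rightarrow> real"
  assumes "bcont f" "integrable lborel h"
  shows "integrable lborel (\<lambda>y. f y * h y)"
proof -
  obtain K where K: "\<And>p. \<bar>f p\<bar> \<le> K" and [measurable]: "f \<in> borel_measurable borel"
    by (rule bcontD[OF assms(1)]) blast
  have [measurable]: "h \<in> borel_measurable borel" using assms(2) by auto
  show ?thesis
  proof (rule Bochner_Integration.integrable_bound)
    show "integrable lborel (\<lambda>y. K * norm (h y))" using assms(2) by simp
    show "AE y in lborel. norm (f y * h y) \<le> norm (K * norm (h y))"
      by (intro AE_I2) (use K in \<open>auto simp: abs_mult intro!: mult_right_mono order_trans[OF K]\<close>)
  qed measurable
qed

text \<open>Fubini and translation invariance. The sign of - s is kept as it arises, since averages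
  at negative scales are covered by \<open>D_gauss_avg\<close> as well.\<close>

lemma gauss_avg_adjoint:
  assumes "bcont f" "bcont h" "integrable lborel f" "integrable lborel h"
  shows "(\<integral>y. gauss_avg s f y * h y \<partial>lborel) = (\<integral>y. f y * gauss_avg (- s) h y \<partial>lborel)"
proof -
  interpret pair_sigma_finite gauss2 "lborel :: (real \<times> real) measure"
    by (intro pair_sigma_finite.intro gauss2.sigma_finite_measure_axioms sigma_finite_lborel)
  obtain K where K: "\<And>p. \<bar>f p\<bar> \<le> K" and [measurable]: "f \<in> borel_measurable borel"
    by (rule bcontD[OF assms(1)]) blast
  obtain L where L: "\<And>p. \<bar>h p\<bar> \<le> L" and [measurable]: "h \<in> borel_measurable borel"
    by (rule bcontD[OF assms(2)]) blast
  have i1: "integrable (gauss2 \<Otimes>\<^sub>M lborel) (\<lambda>(z, y). f (y + s *\<^sub>R z) * h y)"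
  proof (rule Bochner_Integration.integrable_bound)
    show "integrable (gauss2 \<Otimes>\<^sub>M lborel) (\<lambda>x. (\<lambda>_. K) (fst x) * (\<lambda>y. \<bar>h y\<bar>) (snd x))"
      using assms(4) by (intro integrable_pair_mult gauss2.sigma_finite_measure_axioms sigma_finite_lborel) auto
    show "AE x in gauss2 \<Otimes>\<^sub>M lborel. norm (case x of (z, y) \<Rightarrow> f (y + s *\<^sub>R z) * h y) \<le> norm ((\<lambda>_. K) (fst x) * (\<lambda>y. \<bar>h y\<bar>) (snd x))"
      by (intro AE_I2) (auto simp: case_prod_unfold abs_mult simp del: split_paired_All intro!: mult_right_mono order_trans[OF K])
  qed measurable
  have i2: "integrable (gauss2 \<Otimes>\<^sub>M lborel) (\<lambda>(z, y). f y * h (y + (- s) *\<^sub>R z))"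
  proof (rule Bochner_Integration.integrable_bound)
    show "integrable (gauss2 \<Otimes>\<^sub>M lborel) (\<lambda>x. (\<lambda>_. L) (fst x) * (\<lambda>y. \<bar>f y\<bar>) (snd x))"
      using assms(3) by (intro integrable_pair_mult gauss2.sigma_finite_measure_axioms sigma_finite_lborel) auto
    show "AE x in gauss2 \<Otimes>\<^sub>M lborel. norm (case x of (z, y) \<Rightarrow> f y * h (y + (- s) *\<^sub>R z)) \<le> norm ((\<lambda>_. L) (fst x) * (\<lambda>y. \<bar>f y\<bar>) (snd x))"
      by (intro AE_I2, subst mult.commute[of L for L :: real])
        (auto simp: case_prod_unfold abs_mult simp del: split_paired_All intro!: mult_left_mono order_trans[OF L])
  qed measurable
  have "(\<integral>y. gauss_avg s f y * h y \<partial>lborel) = (\<integral>y. \<integral>z. f (y + s *\<^sub>R z) * h y \<partial>gauss2 \<partial>lborel)"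
    by (simp add: gauss_avg_def)
  also have "\<dots> = (\<integral>z. \<integral>y. f (y + s *\<^sub>R z) * h y \<partial>lborel \<partial>gauss2)"
    by (rule Fubini_integral[OF i1])
  also have "\<dots> = (\<integral>z. \<integral>y. f y * h (y + (- s) *\<^sub>R z) \<partial>lborel \<partial>gauss2)"
  proof (rule Bochner_Integration.integral_cong[OF refl])
    fix z
    have "(\<integral>y. f (y + s *\<^sub>R z) * h y \<partial>lborel)
        = 1\<^sup>2 * (\<integral>y. f (((- s) *\<^sub>R z + 1 *\<^sub>R y) + s *\<^sub>R z) * h ((- s) *\<^sub>R z + 1 *\<^sub>R y) \<partial>lborel)"
      by (rule lborel_affine_integral(1)) auto
    then show "(\<integral>y. f (y + s *\<^sub>R z) * h y \<partial>lborel) = (\<integral>y. f y * h (y + (- s) *\<^sub>R z) \<partial>lborel)"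
      by (simp add: algebra_simps)
  qed
  also have "\<dots> = (\<integral>y. \<integral>z. f y * h (y + (- s) *\<^sub>R z) \<partial>gauss2 \<partial>lborel)"
    by (rule Fubini_integral[OF i2, symmetric])
  finally show ?thesis by (simp add: gauss_avg_def)
qed

lemma bcont_gauss_avg: "bcont g \<Longrightarrow> bcont (gauss_avg s g)"
proof -
  assume g: "bcont g"
  interpret translates gauss2 "\<lambda>_. 1" "\<lambda>z. s *\<^sub>R z" by standard auto
  have "gauss_avg s g = transl gauss2 (\<lambda>_. 1) (\<lambda>z. s *\<^sub>R z) g"
    by (simp add: gauss_avg_def[abs_def] transl_def[abs_def])
  then show ?thesis using bcont_transl[OF g] by simp
qed

text \<open>The substitution y = s z turns a Gaussian cut-off of width s into an average at the
  origin.\<close>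

lemma integral_gaussian_weight:
  assumes "bcont h" "s > 0"
  shows "(\<integral>y. h y * exp (- (norm y)\<^sup>2 / (2 * s\<^sup>2)) \<partial>lborel) = 2 * pi * s\<^sup>2 * gauss_avg s h 0"
    and "integrable lborel (\<lambda>y. h y * exp (- (norm y)\<^sup>2 / (2 * s\<^sup>2)))"
proof -
  have [measurable]: "h \<in> borel_measurable borel" by (rule bcontD[OF assms(1)]) blast
  have eq: "h (0 + s *\<^sub>R z) * exp (- (norm (0 + s *\<^sub>R z))\<^sup>2 / (2 * s\<^sup>2)) = 2 * pi * (1 / (2 * pi) * exp (- (norm z)\<^sup>2 / 2) * h (0 + s *\<^sub>R z))" for z
    using assms(2) by (simp add: power_mult_distrib)
  show "(\<integral>y. h y * exp (- (norm y)\<^sup>2 / (2 * s\<^sup>2)) \<partial>lborel) = 2 * pi * s\<^sup>2 * gauss_avg s h 0"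
    unfolding gauss_avg_def
    by (subst lborel_affine_integral(1)[where s=s and t=0])
      (use assms(2) in \<open>simp_all only: eq integral_mult_right_zero, simp_all add: integral_gauss2(1)\<close>)
  show "integrable lborel (\<lambda>y. h y * exp (- (norm y)\<^sup>2 / (2 * s\<^sup>2)))"
  proof (rule lborel_affine_integral(2)[where s=s and t=0, THEN iffD2])
    show "integrable lborel (\<lambda>z. h (0 + s *\<^sub>R z) * exp (- (norm (0 + s *\<^sub>R z))\<^sup>2 / (2 * s\<^sup>2)))"
      unfolding eq
      by (intro integrable_mult_right integral_gauss2(2)[THEN iffD1] gauss_integrable_bound(1)[OF assms(1)]) measurable
  qed (use assms(2) in auto)
qed

context vortex_config
begin

lemma g0_integral:
  assumes [measurable]: "\<zeta> \<in> borel_measurable borel" and "\<And>y. \<bar>\<zeta> y\<bar> \<le> Z"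
  shows "(\<integral>y. \<zeta> y * g0 y \<partial>lborel) = (\<Sum>i<N. \<integral>z. \<zeta> (w i + sqrt \<mu> *\<^sub>R z) * bump z \<partial>lborel)"
proof -
  have "integrable lborel (\<lambda>y. \<zeta> y * (4 * \<mu> * (rat \<mu> (w i) y)\<^sup>2))" for i
  proof (rule Bochner_Integration.integrable_bound)
    show "integrable lborel (\<lambda>y. Z * (4 * \<mu> * (rat \<mu> (w i) y)\<^sup>2))"
      by (intro integrable_mult_right concentrated_bump_integral(2)[OF \<mu>_pos, of \<zeta>] assms(1))
    show "AE y in lborel. norm (\<zeta> y * (4 * \<mu> * (rat \<mu> (w i) y)\<^sup>2)) \<le> norm (Z * (4 * \<mu> * (rat \<mu> (w i) y)\<^sup>2))"
    proof (intro AE_I2)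
      fix y
      have "\<bar>\<zeta> y\<bar> \<le> \<bar>Z\<bar>" using assms(2)[of y] by simp
      then show "norm (\<zeta> y * (4 * \<mu> * (rat \<mu> (w i) y)\<^sup>2)) \<le> norm (Z * (4 * \<mu> * (rat \<mu> (w i) y)\<^sup>2))"
        unfolding real_norm_def abs_mult[of _ "_ * _"] by (rule mult_right_mono) simp
    qed
  qed measurable
  then show ?thesis
    unfolding g0_def sum_distrib_left
    by (subst Bochner_Integration.integral_sum) (auto intro!: sum.cong concentrated_bump_integral(1) \<mu>_pos)
qed

lemma g0_mass: "integrable lborel g0" "(\<integral>y. g0 y \<partial>lborel) = N * kappa"
proof -
  show "integrable lborel g0"
    unfolding g0_def[abs_def] by (intro Bochner_Integration.integrable_sum concentrated_bump_integral(2)[OF \<mu>_pos, of "\<lambda>_. 0"]) auto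
  show "(\<integral>y. g0 y \<partial>lborel) = N * kappa"
    using g0_integral[of "\<lambda>_. 1" 1] by (simp add: kappa_def)
qed

text \<open>A ray leaves every zero behind, so the bound of \<open>u_le_decay\<close> tends to 0
  along it.\<close>

lemma u_scaled_tendsto_0:
  assumes "z \<noteq> 0"
  shows "(\<lambda>n. u (real (Suc n) *\<^sub>R z)) \<longlonglongrightarrow> 0"
proof -
  have inf: "filterlim (\<lambda>n. sqd (w i) (real (Suc n) *\<^sub>R z)) at_top sequentially" for i
  proof -
    have sq: "sqd a p = (norm (p - a))\<^sup>2" for a p by (cases a; cases p) (simp add: sqd_def norm_Pair)
    have "filterlim (\<lambda>n. real (Suc n) * norm z + (- norm (w i))) at_top sequentially"
    proof -
      have "filterlim (\<lambda>n. real (Suc n) * a + b) at_top sequentially" if "a > 0" for a b :: real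
        using that by real_asymp
      from this[of "norm z" "- norm (w i)"] show ?thesis using assms by simp
    qed
    then have "filterlim (\<lambda>n. norm (real (Suc n) *\<^sub>R z - w i)) at_top sequentially"
      by (rule filterlim_at_top_mono)
        (auto intro!: always_eventually order_trans[OF _ norm_triangle_ineq2] simp del: of_nat_Suc)
    then show ?thesis unfolding sq by (rule filterlim_pow_at_top[rotated]) simp
  qed
  have "\<forall>\<^sub>F n in sequentially. \<forall>i\<in>{..<N}. sqd (w i) (real (Suc n) *\<^sub>R z) > 0"
    using inf by (intro eventually_ball_finite ballI) (auto simp: filterlim_at_top_dense)
  then have "\<forall>\<^sub>F n in sequentially. norm (u (real (Suc n) *\<^sub>R z)) \<le> (\<Sum>i<N. \<mu> / sqd (w i) (real (Suc n) *\<^sub>R z))"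
  proof eventually_elim
    case (elim n)
    have "u (real (Suc n) *\<^sub>R z) \<le> (\<Sum>i<N. \<mu> / sqd (w i) (real (Suc n) *\<^sub>R z))"
    proof (rule u_le_decay)
      fix i assume "i < N"
      then have "sqd (w i) (real (Suc n) *\<^sub>R z) > 0" using elim by blast
      then have "sqd (w i) (real (Suc n) *\<^sub>R z) \<noteq> 0" by (rule less_imp_neq[symmetric])
      then show "real (Suc n) *\<^sub>R z \<noteq> w i" unfolding sqd_eq_0_iff .
    qed
    then show ?case using u_bounds(1) by simp
  qed
  moreover have "(\<lambda>n. \<Sum>i<N. \<mu> / sqd (w i) (real (Suc n) *\<^sub>R z)) \<longlonglongrightarrow> (\<Sum>i<N. 0)"
    by (intro tendsto_sum tendsto_divide_0[OF tendsto_const] filterlim_at_top_imp_at_infinity inf)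
  ultimately show ?thesis unfolding sum.neutral_const by (rule Lim_null_comparison)
qed

text \<open>The Laplacian of u has total integral 0. Under a Gaussian cut-off it contributes the
  mean of u (n Z) (|Z|^2 - 2), which tends to 0 by decay at infinity and the bound B. Since D is
  non-negative, monotone convergence removes the cut-off and yields integrability together with the
  value.\<close>

lemma D_mass: "integrable lborel D" "(\<integral>y. D y \<partial>lborel) = N * kappa"
proof -
  define f where "f n y = D y * exp (- (norm y)\<^sup>2 / (2 * (real (Suc n))\<^sup>2))" for n y
  have bD: "bcont D" "bcont g0" "bcont u" using Cb_bcont[OF Cb_D] Cb_bcont[OF Cb_g0] Cb_bcont[OF Cb_u] by auto
  have elim: "(\<lambda>n. exp (- (norm y)\<^sup>2 / (2 * (real (Suc n))\<^sup>2))) \<longlonglongrightarrow> 1" for y :: "real \<times> real"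
    by real_asymp
  \<comment> \<open>The factor s^2 of \<open>integral_gaussian_weight\<close> cancels the 1 / s^2 of
    \<open>D_gauss_avg\<close>, so nothing grows with n.\<close>
  have int_f: "(\<integral>y. f n y \<partial>lborel) = (\<integral>y. g0 y * exp (- (norm y)\<^sup>2 / (2 * (real (Suc n))\<^sup>2)) \<partial>lborel)
      - 2 * pi * (\<integral>z. u (real (Suc n) *\<^sub>R z) * ((norm z)\<^sup>2 - 2) \<partial>gauss2)" for n
    unfolding f_def
    by (subst integral_gaussian_weight(1)[OF bD(1)], simp, subst integral_gaussian_weight(1)[OF bD(2)], simp,
        subst D_gauss_avg) (simp_all add: right_diff_distrib del: of_nat_Suc)
  have "(\<lambda>n. \<integral>y. g0 y * exp (- (norm y)\<^sup>2 / (2 * (real (Suc n))\<^sup>2)) \<partial>lborel) \<longlonglongrightarrow> (\<integral>y. g0 y * 1 \<partial>lborel)"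
  proof (rule integral_dominated_convergence)
    show "integrable lborel (\<lambda>y. norm (g0 y))" using g0_mass(1) by simp
    show "AE y in lborel. (\<lambda>n. g0 y * exp (- (norm y)\<^sup>2 / (2 * (real (Suc n))\<^sup>2))) \<longlonglongrightarrow> g0 y * 1"
      by (intro AE_I2 tendsto_mult tendsto_const elim)
    show "AE y in lborel. norm (g0 y * exp (- (norm y)\<^sup>2 / (2 * (real (Suc n))\<^sup>2))) \<le> norm (g0 y)" for n
      by (intro AE_I2) (simp add: abs_mult mult_left_le del: of_nat_Suc)
  qed measurable
  moreover have "(\<lambda>n. \<integral>z. u (real (Suc n) *\<^sub>R z) * ((norm z)\<^sup>2 - 2) \<partial>gauss2) \<longlonglongrightarrow> (\<integral>z. 0 \<partial>gauss2)"
  proof (rule integral_dominated_convergence)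
    have "integrable gauss2 (\<lambda>z. B * ((fst z)\<^sup>2 + (snd z)\<^sup>2 + 2))"
      by (intro integrable_mult_right Bochner_Integration.integrable_add integrable_gauss2_coord) simp
    then show "integrable gauss2 (\<lambda>z. B * ((norm z)\<^sup>2 + 2))"
      by (simp add: norm_prod_def)
    show "AE z in gauss2. (\<lambda>n. u (real (Suc n) *\<^sub>R z) * ((norm z)\<^sup>2 - 2)) \<longlonglongrightarrow> 0"
    proof (rule eventually_mono[OF AE_gauss2_finite[of "{0}"]])
      fix z :: "real \<times> real" assume "z \<notin> {0}"
      then have "(\<lambda>n. u (real (Suc n) *\<^sub>R z) * ((norm z)\<^sup>2 - 2)) \<longlonglongrightarrow> 0 * ((norm z)\<^sup>2 - 2)"
        by (intro tendsto_mult u_scaled_tendsto_0 tendsto_const) simp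
      then show "(\<lambda>n. u (real (Suc n) *\<^sub>R z) * ((norm z)\<^sup>2 - 2)) \<longlonglongrightarrow> 0" by simp
    qed simp
    show "AE z in gauss2. norm (u (real (Suc n) *\<^sub>R z) * ((norm z)\<^sup>2 - 2)) \<le> B * ((norm z)\<^sup>2 + 2)" for n
    proof (intro AE_I2)
      fix z :: "real \<times> real"
      have "\<bar>(norm z)\<^sup>2 - 2\<bar> \<le> (norm z)\<^sup>2 + 2" using zero_le_power2[of "norm z"] by linarith
      then show "norm (u (real (Suc n) *\<^sub>R z) * ((norm z)\<^sup>2 - 2)) \<le> B * ((norm z)\<^sup>2 + 2)"
        unfolding real_norm_def abs_mult using u_bounds B_nonneg by (intro mult_mono) auto
    qed
  qed measurable
  ultimately have lim: "(\<lambda>n. \<integral>y. f n y \<partial>lborel) \<longlonglongrightarrow> N * kappa - 2 * pi * 0"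
    unfolding int_f using g0_mass(2) by (intro tendsto_diff tendsto_mult tendsto_const) simp_all
  have 1: "integrable lborel (f n)" for n
    unfolding f_def by (rule integral_gaussian_weight(2)[OF bD(1)]) simp
  have 2: "mono (\<lambda>n. f n y)" for y
    unfolding f_def by (intro monoI mult_left_mono D_nonneg)
      (auto intro!: divide_left_mono power_mono mult_pos_pos)
  have 3: "(\<lambda>n. f n y) \<longlonglongrightarrow> D y" for y
    using tendsto_mult[OF tendsto_const elim, of "D y" y] by (simp add: f_def)
  show "integrable lborel D"
    by (rule integrable_monotone_convergence[OF 1 _ _ lim]) (use 2 3 in auto)
  show "(\<integral>y. D y \<partial>lborel) = N * kappa"
    using integral_monotone_convergence[OF 1 _ _ lim, of D] 2 3 by simp
qed

text \<open>Majorant of the Laplacian term: the weight |z|^2 - 2 is replaced by |z|^2 + 2 and the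
  test function by a ball that carries it. As no test function occurs, r can be chosen before one is
  given.\<close>

definition err :: "real \<Rightarrow> real \<Rightarrow> real" where
  "err s \<rho> = (\<integral>y. indicator (cball 0 \<rho>) y * (\<integral>z. u (y + (- s) *\<^sub>R z) * ((norm z)\<^sup>2 + 2) \<partial>gauss2) \<partial>lborel)"

text \<open>By Stein's identity the Laplacian of u, which is the difference of D and g0, becomes a
  quadratic weight on u after averaging, so it suffices that u tends to 0 in mean on bounded sets.\<close>

lemma test_D:
  assumes \<zeta>: "bcont \<zeta>" "integrable lborel \<zeta>" "\<And>y. \<bar>\<zeta> y\<bar> \<le> Z" "\<And>y. norm y > \<rho> \<Longrightarrow> \<zeta> y = 0"
    and s: "s \<noteq> 0" and \<eta>: "\<And>y. \<bar>gauss_avg s \<zeta> y - \<zeta> y\<bar> \<le> \<eta>"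
  shows "\<bar>(\<integral>y. \<zeta> y * D y \<partial>lborel) - (\<integral>y. \<zeta> y * g0 y \<partial>lborel)\<bar> \<le> 2 * \<eta> * (N * kappa) + Z / s\<^sup>2 * err s \<rho>"
proof -
  have b: "bcont D" "bcont g0" "bcont u" "bcont (gauss_avg s \<zeta>)"
    using Cb_bcont[OF Cb_D] Cb_bcont[OF Cb_g0] Cb_bcont[OF Cb_u] bcont_gauss_avg[OF \<zeta>(1)] by auto
  have [measurable]: "\<zeta> \<in> borel_measurable borel" by (rule bcontD[OF \<zeta>(1)]) blast
  have Z: "Z \<ge> 0" using \<zeta>(3)[of 0] by simp
  \<comment> \<open>Replacing \<zeta> by its Gaussian average costs \<eta> times the mass of h. It
    is done for D and for g0, both of mass N kappa, whence the factor 2 in the claim.\<close>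
  have smooth: "\<bar>(\<integral>y. \<zeta> y * h y \<partial>lborel) - (\<integral>y. gauss_avg s \<zeta> y * h y \<partial>lborel)\<bar> \<le> \<eta> * (\<integral>y. h y \<partial>lborel)"
    if h: "integrable lborel h" "\<And>y. h y \<ge> 0" for h
  proof -
    note i = integrable_bcont_mult[OF \<zeta>(1) h(1)] integrable_bcont_mult[OF b(4) h(1)]
    have "(\<integral>y. \<zeta> y * h y \<partial>lborel) - (\<integral>y. gauss_avg s \<zeta> y * h y \<partial>lborel) = (\<integral>y. \<zeta> y * h y - gauss_avg s \<zeta> y * h y \<partial>lborel)"
      using i by simp
    also have "\<bar>\<dots>\<bar> \<le> (\<integral>y. \<eta> * h y \<partial>lborel)"
    proof (rule order_trans[OF integral_abs_bound integral_mono])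
      show "\<bar>\<zeta> y * h y - gauss_avg s \<zeta> y * h y\<bar> \<le> \<eta> * h y" for y
        using mult_right_mono[OF \<eta>[of y] h(2)[of y]] h(2)[of y]
        by (simp add: left_diff_distrib[symmetric] abs_mult abs_minus_commute)
    qed (use i h in auto)
    finally show ?thesis using h by simp
  qed
  have "\<bar>(\<integral>y. gauss_avg s \<zeta> y * D y \<partial>lborel) - (\<integral>y. gauss_avg s \<zeta> y * g0 y \<partial>lborel)\<bar> \<le> Z / s\<^sup>2 * err s \<rho>"
  proof -
    define E where "E y = (\<integral>z. u (y + (- s) *\<^sub>R z) * ((norm z)\<^sup>2 - 2) \<partial>gauss2)" for y
    define F where "F y = (\<integral>z. u (y + (- s) *\<^sub>R z) * ((norm z)\<^sup>2 + 2) \<partial>gauss2)" for y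
    have q: "integrable gauss2 (\<lambda>z. (norm z)\<^sup>2)"
      using Bochner_Integration.integrable_add[OF integrable_gauss2_coord(3,4)] by (simp add: norm_prod_def)
    have iu: "integrable gauss2 (\<lambda>z. u (y + (- s) *\<^sub>R z) * ((norm z)\<^sup>2 + a))" for y a
    proof -
      interpret translates gauss2 "\<lambda>z. (norm z)\<^sup>2 + a" "\<lambda>z. (- s) *\<^sub>R z"
        by standard (use q in auto)
      have "\<bar>u p\<bar> \<le> B" for p using u_bounds[of p] by simp
      from integrable_transl[OF measurable_u_D_g0(1) this] show ?thesis by (simp add: mult.commute)
    qed
    have EF: "\<bar>E y\<bar> \<le> F y" for y
      unfolding E_def F_def
    proof (rule order_trans[OF integral_abs_bound integral_mono])
      show "\<bar>u (y + (- s) *\<^sub>R z) * ((norm z)\<^sup>2 - 2)\<bar> \<le> u (y + (- s) *\<^sub>R z) * ((norm z)\<^sup>2 + 2)" for z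
      proof -
        have "\<bar>(norm z)\<^sup>2 - 2\<bar> \<le> (norm z)\<^sup>2 + 2" using zero_le_power2[of "norm z"] by linarith
        then show ?thesis
          using u_bounds(1)[of "y + (- s) *\<^sub>R z"] by (simp only: abs_mult abs_of_nonneg mult_left_mono)
      qed
    qed (use iu[of y "-2"] iu[of y 2] in auto)
    have avg: "gauss_avg (- s) D y = gauss_avg (- s) g0 y - (1 / s\<^sup>2) * E y" for y
      using D_gauss_avg[of "- s" y] s by (simp add: E_def)
    have iD: "integrable lborel (\<lambda>y. \<zeta> y * gauss_avg (- s) D y)" "integrable lborel (\<lambda>y. \<zeta> y * gauss_avg (- s) g0 y)"
      using integrable_bcont_mult[OF bcont_gauss_avg[OF b(1)] \<zeta>(2)] integrable_bcont_mult[OF bcont_gauss_avg[OF b(2)] \<zeta>(2)]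
      by (simp_all add: mult.commute)
    have "(\<integral>y. gauss_avg s \<zeta> y * D y \<partial>lborel) - (\<integral>y. gauss_avg s \<zeta> y * g0 y \<partial>lborel)
        = (\<integral>y. \<zeta> y * gauss_avg (- s) D y - \<zeta> y * gauss_avg (- s) g0 y \<partial>lborel)"
      using iD gauss_avg_adjoint[OF \<zeta>(1) b(1) \<zeta>(2) D_mass(1), of s] gauss_avg_adjoint[OF \<zeta>(1) b(2) \<zeta>(2) g0_mass(1), of s]
      by simp
    also have "\<bar>\<dots>\<bar> \<le> (\<integral>y. Z / s\<^sup>2 * (indicator (cball 0 \<rho>) y * F y) \<partial>lborel)"
    proof (rule order_trans[OF integral_abs_bound integral_mono])
      show "integrable lborel (\<lambda>y. \<bar>\<zeta> y * gauss_avg (- s) D y - \<zeta> y * gauss_avg (- s) g0 y\<bar>)" using iD by simp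
      interpret translates gauss2 "\<lambda>z. (norm z)\<^sup>2 + 2" "\<lambda>z. (- s) *\<^sub>R z"
        by standard (use q in auto)
      have "F = transl gauss2 (\<lambda>z. (norm z)\<^sup>2 + 2) (\<lambda>z. (- s) *\<^sub>R z) u"
        by (simp add: F_def[abs_def] transl_def[abs_def] mult.commute)
      then have "bcont F" using bcont_transl[OF b(3)] by simp
      moreover have "integrable lborel (indicator (cball 0 \<rho>) :: real \<times> real \<Rightarrow> real)"
        by (intro integrable_real_indicator emeasure_lborel_cball_finite) simp
      ultimately have "integrable lborel (\<lambda>y. F y * indicator (cball 0 \<rho>) y)"
        by (rule integrable_bcont_mult)
      then show "integrable lborel (\<lambda>y. Z / s\<^sup>2 * (indicator (cball 0 \<rho>) y * F y))"
        by (simp add: mult.commute)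
      show "\<bar>\<zeta> y * gauss_avg (- s) D y - \<zeta> y * gauss_avg (- s) g0 y\<bar> \<le> Z / s\<^sup>2 * (indicator (cball 0 \<rho>) y * F y)" for y
      proof (cases "norm y > \<rho>")
        case True
        then show ?thesis using \<zeta>(4)[of y] by simp
      next
        case False
        have "\<bar>\<zeta> y * ((1 / s\<^sup>2) * E y)\<bar> \<le> Z * ((1 / s\<^sup>2) * F y)"
          unfolding abs_mult using \<zeta>(3) EF Z by (intro mult_mono) auto
        with False show ?thesis by (simp add: avg right_diff_distrib)
      qed
    qed
    finally show ?thesis by (simp add: err_def F_def)
  qed
  with smooth[OF D_mass(1) D_nonneg] smooth[OF g0_mass(1)] show ?thesis
    unfolding D_mass(2) g0_mass(2) using \<mu>_pos by (simp add: g0_def sum_nonneg abs_le_iff)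
qed

end

text \<open>The zeros stay fixed while r grows: \<mu> = 2 N / r tends to 0, so u tends to 0 off the
  zeros by \<open>u_le_decay\<close>, and the ceiling B is free of r. Dominated convergence applies
  first in z, then in y.\<close>

lemma err_tendsto_0:
  assumes N: "N \<ge> 1" and s: "s \<noteq> 0"
  shows "(\<lambda>k. vortex_config.err w N (real (Suc k)) s \<rho>) \<longlonglongrightarrow> 0"
proof -
  \<comment> \<open>No assumption of the locale mentions w, so its predicate takes N and r
    only.\<close>
  have vc: "vortex_config N (real (Suc k))" for k using N by unfold_locales auto
  define U where "U k = vortex_config.u w N (real (Suc k))" for k
  define B where "B = real N * ln (8 * real N)"
  have U: "0 \<le> U k p" "U k p \<le> B" for k p
    using vortex_config.u_bounds[OF vc, of w k p] by (simp_all add: U_def B_def vortex_config.B_def[OF vc] del: of_nat_Suc)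
  have B: "B \<ge> 0" using U[of 0 0] by linarith
  have [measurable]: "U k \<in> borel_measurable borel" for k
    unfolding U_def by (rule vortex_config.measurable_u_D_g0(1)[OF vc])
  have decay: "(\<lambda>k. U k p) \<longlonglongrightarrow> 0" if p: "p \<notin> w ` {..<N}" for p
  proof (rule Lim_null_comparison)
    show "\<forall>\<^sub>F k in sequentially. norm (U k p) \<le> (\<Sum>i<N. (2 * real N / real (Suc k)) / sqd (w i) p)"
    proof (intro always_eventually allI)
      fix k
      have "U k p \<le> (\<Sum>i<N. (2 * real N / real (Suc k)) / sqd (w i) p)"
        using vortex_config.u_le_decay[OF vc, of p w k] p
        by (auto simp: U_def vortex_config.\<mu>_def[OF vc] simp del: of_nat_Suc)
      then show "norm (U k p) \<le> (\<Sum>i<N. (2 * real N / real (Suc k)) / sqd (w i) p)" using U(1)[of k p] by simp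
    qed
    have "(\<lambda>k. \<Sum>i<N. (2 * real N / real (Suc k)) / sqd (w i) p) \<longlonglongrightarrow> (\<Sum>i<N. 0 / sqd (w i) p)"
    proof (intro tendsto_sum tendsto_divide tendsto_const)
      show "(\<lambda>k. 2 * real N / real (Suc k)) \<longlonglongrightarrow> 0" by real_asymp
      show "sqd (w i) p \<noteq> 0" if "i \<in> {..<N}" for i using p that by (auto simp: sqd_eq_0_iff)
    qed
    then show "(\<lambda>k. \<Sum>i<N. (2 * real N / real (Suc k)) / sqd (w i) p) \<longlonglongrightarrow> 0" by simp
  qed
  have q: "integrable gauss2 (\<lambda>z. (norm z)\<^sup>2)"
    using Bochner_Integration.integrable_add[OF integrable_gauss2_coord(3,4)] by (simp add: norm_prod_def)
  have q2: "integrable gauss2 (\<lambda>z. B * ((norm z)\<^sup>2 + 2))"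
    using q by (intro integrable_mult_right Bochner_Integration.integrable_add) auto
  define F where "F k y = (\<integral>z. U k (y + (- s) *\<^sub>R z) * ((norm z)\<^sup>2 + 2) \<partial>gauss2)" for k y
  define C where "C = (\<integral>z. B * ((norm z)\<^sup>2 + 2) \<partial>gauss2)"
  have dom: "norm (U k (y + (- s) *\<^sub>R z) * ((norm z)\<^sup>2 + 2)) \<le> B * ((norm z)\<^sup>2 + 2)" for k y z
    using U[of k "y + (- s) *\<^sub>R z"] by (simp add: abs_mult mult_right_mono)
  have FC: "\<bar>F k y\<bar> \<le> C" for k y
    unfolding F_def C_def
  proof (rule order_trans[OF integral_abs_bound integral_mono[OF integrable_abs q2]])
    show "integrable gauss2 (\<lambda>z. U k (y + (- s) *\<^sub>R z) * ((norm z)\<^sup>2 + 2))"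
      by (rule Bochner_Integration.integrable_bound[OF q2])
        (measurable, intro AE_I2 order_trans[OF dom], simp only: real_norm_def abs_ge_self)
    show "\<bar>U k (y + (- s) *\<^sub>R z) * ((norm z)\<^sup>2 + 2)\<bar> \<le> B * ((norm z)\<^sup>2 + 2)" for z
      using dom[of k y z] by (simp only: real_norm_def)
  qed
  have F0: "(\<lambda>k. F k y) \<longlonglongrightarrow> 0" for y
  proof -
    have "(\<lambda>k. F k y) \<longlonglongrightarrow> (\<integral>z. 0 \<partial>gauss2)"
      unfolding F_def
    proof (rule integral_dominated_convergence)
      show "integrable gauss2 (\<lambda>z. B * ((norm z)\<^sup>2 + 2))" by (rule q2)
      let ?A = "(\<lambda>i. (1 / s) *\<^sub>R (y - w i)) ` {..<N}"
      show "AE z in gauss2. (\<lambda>k. U k (y + (- s) *\<^sub>R z) * ((norm z)\<^sup>2 + 2)) \<longlonglongrightarrow> 0"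
      proof (rule eventually_mono[OF AE_gauss2_finite[of ?A]])
        fix z assume z: "z \<notin> ?A"
        have "y + (- s) *\<^sub>R z \<notin> w ` {..<N}"
        proof
          assume "y + (- s) *\<^sub>R z \<in> w ` {..<N}"
          then obtain i where i: "i < N" "w i = y - s *\<^sub>R z" by auto
          then have "z = (1 / s) *\<^sub>R (y - w i)" using s by simp
          with i z show False by blast
        qed
        from tendsto_mult[OF decay[OF this] tendsto_const[of "(norm z)\<^sup>2 + 2"]]
        show "(\<lambda>k. U k (y + (- s) *\<^sub>R z) * ((norm z)\<^sup>2 + 2)) \<longlonglongrightarrow> 0" by simp
      qed simp
    qed (use dom in auto)
    then show ?thesis by simp
  qed
  have [measurable]: "F k \<in> borel_measurable borel" for k
  proof -
    interpret translates gauss2 "\<lambda>z. (norm z)\<^sup>2 + 2" "\<lambda>z. (- s) *\<^sub>R z"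
      by standard (use q in auto)
    have "F k = transl gauss2 (\<lambda>z. (norm z)\<^sup>2 + 2) (\<lambda>z. (- s) *\<^sub>R z) (U k)"
      by (simp add: F_def[abs_def] transl_def[abs_def] mult.commute)
    moreover have "bcont (U k)" unfolding U_def by (rule Cb_bcont[OF vortex_config.Cb_u[OF vc]])
    ultimately show ?thesis using bcont_transl by (auto elim: bcontD)
  qed
  have "(\<lambda>k. \<integral>y. indicator (cball 0 \<rho>) y * F k y \<partial>lborel) \<longlonglongrightarrow> (\<integral>y. 0 \<partial>(lborel :: (real \<times> real) measure))"
  proof (rule integral_dominated_convergence)
    show "integrable lborel (\<lambda>y :: real \<times> real. C * indicator (cball 0 \<rho>) y)"
      by (intro integrable_mult_right integrable_real_indicator emeasure_lborel_cball_finite) simp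
    show "AE y in lborel. (\<lambda>k. indicator (cball 0 \<rho>) y * F k y) \<longlonglongrightarrow> 0"
      using tendsto_mult[OF tendsto_const F0] by (intro AE_I2) simp
    show "AE y in lborel. norm (indicator (cball 0 \<rho>) y * F k y) \<le> C * indicator (cball 0 \<rho>) y" for k
      using FC by (intro AE_I2) (simp split: split_indicator)
  qed (auto intro!: borel_measurable_times borel_measurable_indicator)
  then show ?thesis
    unfolding vortex_config.err_def[OF vc] F_def U_def by simp
qed

section \<open>Approximation of measures by curvatures\<close>

text \<open>Riemann sums over cells of side 1 / (n + 1), sampled at their lower left corners.
  Indices up to (n + 1)^2 reach coordinates up to n + 1, so the window is finite for each n and in
  the end contains every point.\<close>

lemma grid_approximation:
  fixes P :: "(real \<times> real) measure"
  assumes "prob_space P" and sets [measurable_cong]: "sets P = sets borel"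
  defines "cell \<equiv> \<lambda>n ab. {x :: real \<times> real. (\<lfloor>real (Suc n) * fst x\<rfloor>, \<lfloor>real (Suc n) * snd x\<rfloor>) = ab}"
    and "pt \<equiv> \<lambda>n ab :: int \<times> int. (real_of_int (fst ab) / real (Suc n), real_of_int (snd ab) / real (Suc n))"
    and "I \<equiv> \<lambda>n. {- (int (Suc n))\<^sup>2 .. (int (Suc n))\<^sup>2} \<times> {- (int (Suc n))\<^sup>2 .. (int (Suc n))\<^sup>2}"
  assumes \<zeta>: "continuous_on UNIV \<zeta>" "\<And>y. \<bar>\<zeta> y\<bar> \<le> (Z :: real)"
  shows "(\<lambda>n. \<Sum>ab\<in>I n. measure P (cell n ab) * \<zeta> (pt n ab)) \<longlonglongrightarrow> (\<integral>y. \<zeta> y \<partial>P)"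
proof -
  interpret P: prob_space P by fact
  have Z: "Z \<ge> 0" using \<zeta>(2)[of 0] by simp
  have [measurable]: "\<zeta> \<in> borel_measurable borel" using \<zeta>(1) by (rule borel_measurable_continuous_onI)
  have cellm [measurable]: "cell n ab \<in> sets borel" for n ab
  proof -
    have "cell n ab = {x \<in> space borel. \<lfloor>real (Suc n) * fst x\<rfloor> = fst ab \<and> \<lfloor>real (Suc n) * snd x\<rfloor> = snd ab}"
      by (cases ab) (auto simp: cell_def)
    also have "\<dots> \<in> sets borel" by measurable
    finally show ?thesis .
  qed
  define g where "g n x = (\<Sum>ab\<in>I n. indicator (cell n ab) x * \<zeta> (pt n ab))" for n x
  have finI: "finite (I n)" for n by (simp add: I_def)
  define idx where "idx n x = (\<lfloor>real (Suc n) * fst x\<rfloor>, \<lfloor>real (Suc n) * snd x\<rfloor>)" for n and x :: "real \<times> real"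
  have g_eq: "g n x = (if idx n x \<in> I n then \<zeta> (pt n (idx n x)) else 0)" for n x
  proof -
    have "g n x = (\<Sum>ab\<in>I n. if ab = idx n x then \<zeta> (pt n ab) else 0)"
      unfolding g_def by (intro sum.cong refl) (auto simp: cell_def idx_def indicator_def)
    then show ?thesis using finI by (simp add: sum.delta')
  qed
  have "(\<integral>x. g n x \<partial>P) = (\<Sum>ab\<in>I n. measure P (cell n ab) * \<zeta> (pt n ab))" for n
  proof -
    have i: "integrable P (\<lambda>x. indicator (cell n ab) x * \<zeta> (pt n ab) :: real)" for ab
      by (intro integrable_mult_left) (auto intro!: P.integrable_const_bound[of _ 1])
    have "(\<integral>x. g n x \<partial>P) = (\<Sum>ab\<in>I n. \<integral>x. indicator (cell n ab) x * \<zeta> (pt n ab) \<partial>P)"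
      unfolding g_def by (rule Bochner_Integration.integral_sum) (rule i)
    also have "\<dots> = (\<Sum>ab\<in>I n. measure P (cell n ab) * \<zeta> (pt n ab))"
      by (intro sum.cong refl) (simp add: sets_eq_imp_space_eq[OF sets])
    finally show ?thesis .
  qed
  moreover have "(\<lambda>n. \<integral>x. g n x \<partial>P) \<longlonglongrightarrow> (\<integral>x. \<zeta> x \<partial>P)"
  proof (rule integral_dominated_convergence)
    show "integrable P (\<lambda>_. Z)" by simp
    show "g n \<in> borel_measurable P" for n
      unfolding g_def[abs_def] by measurable
    show "AE x in P. norm (g n x) \<le> Z" for n
      using \<zeta>(2) Z by (intro AE_I2) (simp add: g_eq)
    show "AE x in P. (\<lambda>n. g n x) \<longlonglongrightarrow> \<zeta> x"
    proof (intro AE_I2)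
      fix x :: "real \<times> real"
      have fl: "(\<lambda>n. real_of_int \<lfloor>real (Suc n) * t\<rfloor> / real (Suc n)) \<longlonglongrightarrow> t" for t :: real
      proof (rule real_tendsto_sandwich)
        show "\<forall>\<^sub>F n in sequentially. t - 1 / real (Suc n) \<le> real_of_int \<lfloor>real (Suc n) * t\<rfloor> / real (Suc n)"
        proof (intro always_eventually allI)
          fix n
          have "real (Suc n) * t - 1 \<le> real_of_int \<lfloor>real (Suc n) * t\<rfloor>" by linarith
          from divide_right_mono[OF this, of "real (Suc n)"]
          show "t - 1 / real (Suc n) \<le> real_of_int \<lfloor>real (Suc n) * t\<rfloor> / real (Suc n)" by (simp add: diff_divide_distrib del: of_nat_Suc)
        qed
        show "\<forall>\<^sub>F n in sequentially. real_of_int \<lfloor>real (Suc n) * t\<rfloor> / real (Suc n) \<le> t"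
        proof (intro always_eventually allI)
          fix n
          have "real_of_int \<lfloor>real (Suc n) * t\<rfloor> \<le> real (Suc n) * t" by linarith
          from divide_right_mono[OF this, of "real (Suc n)"]
          show "real_of_int \<lfloor>real (Suc n) * t\<rfloor> / real (Suc n) \<le> t" by (simp del: of_nat_Suc)
        qed
        show "(\<lambda>n. t - 1 / real (Suc n)) \<longlonglongrightarrow> t" by real_asymp
      qed simp
      have "(\<lambda>n. pt n (idx n x)) \<longlonglongrightarrow> (fst x, snd x)"
        unfolding pt_def idx_def fst_conv snd_conv by (intro tendsto_Pair fl)
      then have lim: "(\<lambda>n. \<zeta> (pt n (idx n x))) \<longlonglongrightarrow> \<zeta> x"
        using \<zeta>(1) by (intro continuous_on_tendsto_compose[OF \<zeta>(1)]) auto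
      have inI: "\<forall>\<^sub>F n in sequentially. \<lfloor>real (Suc n) * t\<rfloor> \<in> {- (int (Suc n))\<^sup>2 .. (int (Suc n))\<^sup>2}" for t :: real
      proof -
        have "\<forall>\<^sub>F n in sequentially. \<bar>t\<bar> \<le> real n" by (rule eventually_sequentiallyI[of "nat \<lceil>\<bar>t\<bar>\<rceil>"]) linarith
        then show ?thesis
        proof eventually_elim
          case (elim n)
          have "\<bar>real (Suc n) * t\<bar> \<le> real (Suc n) * real (Suc n)"
            unfolding abs_mult using elim by (intro mult_mono) auto
          then have "- (real (Suc n))\<^sup>2 \<le> real (Suc n) * t" "real (Suc n) * t \<le> (real (Suc n))\<^sup>2"
            by (auto simp: power2_eq_square abs_le_iff simp del: of_nat_Suc)
          then have "of_int (- (int (Suc n))\<^sup>2) \<le> real (Suc n) * t" "real (Suc n) * t \<le> of_int ((int (Suc n))\<^sup>2)"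
            by (simp_all del: of_nat_Suc)
          then show ?case unfolding atLeastAtMost_iff le_floor_iff floor_le_iff by (intro conjI) linarith+
        qed
      qed
      have "\<forall>\<^sub>F n in sequentially. idx n x \<in> I n"
        using eventually_conj[OF inI[of "fst x"] inI[of "snd x"]] by (auto simp: idx_def I_def elim!: eventually_mono)
      then have "\<forall>\<^sub>F n in sequentially. \<zeta> (pt n (idx n x)) = g n x"
        by eventually_elim (simp add: g_eq)
      with lim show "(\<lambda>n. g n x) \<longlonglongrightarrow> \<zeta> x" by (rule Lim_transform_eventually)
    qed
  qed measurable
  ultimately show ?thesis by simp
qed

text \<open>Cell masses are rounded to integer multiplicities of repeated points; repetitions are
  welcome, as a vortex may have a multiple zero.\<close>

lemma empirical_approximation:
  fixes P :: "(real \<times> real) measure"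
  assumes P: "prob_space P" "sets P = sets borel"
  shows "\<exists>ws :: nat \<Rightarrow> (real \<times> real) list. (\<forall>n. ws n \<noteq> []) \<and>
    (\<forall>\<zeta> Z. continuous_on UNIV \<zeta> \<longrightarrow> (\<forall>y. \<bar>\<zeta> y\<bar> \<le> (Z :: real)) \<longrightarrow>
       (\<lambda>n. (\<Sum>i<length (ws n). \<zeta> (ws n ! i)) / length (ws n)) \<longlonglongrightarrow> (\<integral>y. \<zeta> y \<partial>P))"
proof -
  interpret P: prob_space P by fact
  define cell where "cell n ab = {x :: real \<times> real. (\<lfloor>real (Suc n) * fst x\<rfloor>, \<lfloor>real (Suc n) * snd x\<rfloor>) = ab}" for n ab
  define pt where "pt n ab = (real_of_int (fst ab) / real (Suc n), real_of_int (snd ab) / real (Suc n))" for n and ab :: "int \<times> int"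
  define I where "I n = {- (int (Suc n))\<^sup>2 .. (int (Suc n))\<^sup>2} \<times> {- (int (Suc n))\<^sup>2 .. (int (Suc n))\<^sup>2}" for n
  have I: "finite (I n)" "(0, 0) \<in> I n" for n by (auto simp: I_def)
  \<comment> \<open>Rounding errs by at most 1 / M in each cell, which sums to 1 / (n + 1) over all
    of them.\<close>
  define M where "M n = Suc n * card (I n)" for n
  have M: "M n > 0" for n using I[of n] by (auto simp: M_def card_gt_0_iff)
  \<comment> \<open>The successor keeps each multiplicity positive, so the list of points is never
    empty.\<close>
  define k where "k n ab = Suc (nat \<lfloor>M n * measure P (cell n ab)\<rfloor>)" for n ab
  obtain xs where xs: "\<And>n. set (xs n) = I n" "\<And>n. distinct (xs n)"
    using finite_distinct_list[OF I(1)] by metis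
  define ws where "ws n = concat (map (\<lambda>ab. replicate (k n ab) (pt n ab)) (xs n))" for n
  have sum_ws: "(\<Sum>i<length (ws n). \<zeta> (ws n ! i)) = (\<Sum>ab\<in>I n. k n ab * \<zeta> (pt n ab))" for n and \<zeta> :: "_ \<Rightarrow> real"
  proof -
    have "(\<Sum>i<length (ws n). \<zeta> (ws n ! i)) = sum_list (map \<zeta> (ws n))"
      by (simp add: sum_list_sum_nth atLeast0LessThan)
    also have "\<dots> = sum_list (map (\<lambda>ab. k n ab * \<zeta> (pt n ab)) (xs n))"
    proof -
      have "sum_list (map \<zeta> (concat (map f ys))) = sum_list (map (\<lambda>x. sum_list (map \<zeta> (f x))) ys)"
        for f :: "int \<times> int \<Rightarrow> _" and ys by (induction ys) auto
      then show ?thesis by (simp add: ws_def sum_list_replicate)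
    qed
    also have "\<dots> = (\<Sum>ab\<in>I n. k n ab * \<zeta> (pt n ab))"
      using xs by (simp add: sum_list_distinct_conv_sum_set)
    finally show ?thesis .
  qed
  have scaled: "(\<lambda>n. (\<Sum>i<length (ws n). \<zeta> (ws n ! i)) / M n) \<longlonglongrightarrow> (\<integral>y. \<zeta> y \<partial>P)"
    if \<zeta>: "continuous_on UNIV \<zeta>" "\<And>y. \<bar>\<zeta> y\<bar> \<le> (Z :: real)" for \<zeta> Z
  proof -
    let ?S = "\<lambda>n. \<Sum>ab\<in>I n. measure P (cell n ab) * \<zeta> (pt n ab)"
    have "?S \<longlonglongrightarrow> (\<integral>y. \<zeta> y \<partial>P)"
      using grid_approximation[OF P \<zeta>] unfolding cell_def pt_def I_def .
    moreover have "(\<lambda>n. (\<Sum>i<length (ws n). \<zeta> (ws n ! i)) / M n - ?S n) \<longlonglongrightarrow> 0"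
    proof (rule Lim_null_comparison)
      show "\<forall>\<^sub>F n in sequentially. norm ((\<Sum>i<length (ws n). \<zeta> (ws n ! i)) / M n - ?S n) \<le> Z / Suc n"
      proof (intro always_eventually allI)
        fix n
        have k: "\<bar>k n ab / M n - measure P (cell n ab)\<bar> \<le> 1 / M n" for ab
        proof -
          have "real (k n ab) = of_int \<lfloor>M n * measure P (cell n ab)\<rfloor> + 1"
            by (simp add: k_def)
          then have "\<bar>real (k n ab) - M n * measure P (cell n ab)\<bar> \<le> 1" by linarith
          then have "\<bar>real (k n ab) - M n * measure P (cell n ab)\<bar> / M n \<le> 1 / M n" by (rule divide_right_mono) simp
          moreover have "k n ab / M n - measure P (cell n ab) = (real (k n ab) - M n * measure P (cell n ab)) / M n"
            using M[of n] by (simp add: field_simps)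
          ultimately show ?thesis using M[of n] by (simp add: abs_divide)
        qed
        have "(\<Sum>i<length (ws n). \<zeta> (ws n ! i)) / M n - ?S n = (\<Sum>ab\<in>I n. (k n ab / M n - measure P (cell n ab)) * \<zeta> (pt n ab))"
          unfolding sum_ws sum_divide_distrib by (simp add: sum_subtractf left_diff_distrib)
        also have "\<bar>\<dots>\<bar> \<le> (\<Sum>ab\<in>I n. 1 / M n * Z)"
          by (intro order_trans[OF sum_abs] sum_mono, unfold abs_mult, intro mult_mono k \<zeta>(2)) auto
        also have "\<dots> = Z / Suc n" using M[of n] by (simp add: M_def del: of_nat_Suc mult_Suc)
        finally show "norm ((\<Sum>i<length (ws n). \<zeta> (ws n ! i)) / M n - ?S n) \<le> Z / Suc n" by simp
      qed
      show "(\<lambda>n. Z / Suc n) \<longlonglongrightarrow> 0" by real_asymp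
    qed
    ultimately show ?thesis by (rule Lim_transform)
  qed
  \<comment> \<open>The number of points is not M itself; the constant test function 1 shows that
    their ratio tends to 1.\<close>
  have len: "(\<lambda>n. real (length (ws n)) / M n) \<longlonglongrightarrow> 1"
    using scaled[of "\<lambda>_. 1" 1] P.prob_space by simp
  show ?thesis
  proof (intro exI[of _ ws] conjI allI impI)
    show ne: "ws n \<noteq> []" for n
    proof -
      have "(0, 0) \<in> set (xs n)" using xs I by simp
      then show ?thesis by (force simp: ws_def k_def)
    qed
    fix \<zeta> :: "real \<times> real \<Rightarrow> real" and Z assume "continuous_on UNIV \<zeta>" "\<forall>y. \<bar>\<zeta> y\<bar> \<le> Z"
    then have \<zeta>: "continuous_on UNIV \<zeta>" "\<And>y. \<bar>\<zeta> y\<bar> \<le> Z" by blast+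
    have "(\<lambda>n. ((\<Sum>i<length (ws n). \<zeta> (ws n ! i)) / M n) / (length (ws n) / M n)) \<longlonglongrightarrow> (\<integral>y. \<zeta> y \<partial>P) / 1"
      by (intro tendsto_divide scaled[OF \<zeta>] len) simp
    then show "(\<lambda>n. (\<Sum>i<length (ws n). \<zeta> (ws n ! i)) / length (ws n)) \<longlonglongrightarrow> (\<integral>y. \<zeta> y \<partial>P)"
      using M by simp
  qed
qed

text \<open>A plain function of all three parameters, for statements in which they vary with n and
  no interpretation of the locale is open.\<close>

definition vortex_curvature :: "(nat \<Rightarrow> real \<times> real) \<Rightarrow> nat \<Rightarrow> real \<Rightarrow> real \<times> real \<Rightarrow> real" where
  "vortex_curvature w N r = vortex_config.D w N r"

lemma uniformly_continuous_compact_support: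
  fixes \<zeta> :: "real \<times> real \<Rightarrow> real"
  assumes "continuous_on UNIV \<zeta>" "\<And>y. norm y > \<rho> \<Longrightarrow> \<zeta> y = 0"
  shows "uniformly_continuous_on UNIV \<zeta>" "\<exists>Z. \<forall>y. \<bar>\<zeta> y\<bar> \<le> Z" "integrable lborel \<zeta>"
proof -
  \<comment> \<open>Thanks to the margin 1, two points closer than 1 either both lie in this ball or
    both have norm beyond \<rho>.\<close>
  let ?C = "cball 0 (\<rho> + 1) :: (real \<times> real) set"
  have c: "continuous_on ?C \<zeta>" using assms(1) by (rule continuous_on_subset) simp
  have "uniformly_continuous_on ?C \<zeta>" by (rule compact_uniformly_continuous[OF c compact_cball])
  show "uniformly_continuous_on UNIV \<zeta>"
    unfolding uniformly_continuous_on_def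
  proof (intro allI impI)
    fix e :: real assume "e > 0"
    then obtain d where d: "d > 0" "\<And>x y. x \<in> ?C \<Longrightarrow> y \<in> ?C \<Longrightarrow> dist y x < d \<Longrightarrow> dist (\<zeta> y) (\<zeta> x) < e"
      using \<open>uniformly_continuous_on ?C \<zeta>\<close> unfolding uniformly_continuous_on_def by metis
    have "dist (\<zeta> y) (\<zeta> x) < e" if xy: "dist y x < min d 1" for x y
    proof (cases "x \<in> ?C \<and> y \<in> ?C")
      case True
      then show ?thesis using d(2)[of x y] xy by simp
    next
      case False
      have "norm x \<le> norm y + dist y x" "norm y \<le> norm x + dist y x"
        unfolding dist_norm using norm_triangle_sub[of x y] norm_triangle_sub[of y x] by (simp_all add: norm_minus_commute)
      then have "norm x > \<rho>" "norm y > \<rho>" using False xy by (auto simp del: split_paired_All)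
      then show ?thesis using assms(2) \<open>e > 0\<close> by simp
    qed
    then show "\<exists>d>0. \<forall>x\<in>UNIV. \<forall>y\<in>UNIV. dist y x < d \<longrightarrow> dist (\<zeta> y) (\<zeta> x) < e"
      using d(1) by (intro exI[of _ "min d 1"]) simp
  qed
  have "bounded (\<zeta> ` ?C)" by (rule compact_imp_bounded[OF compact_continuous_image[OF c compact_cball]])
  then obtain Z where Z: "\<And>y. y \<in> ?C \<Longrightarrow> \<bar>\<zeta> y\<bar> \<le> Z"
    unfolding bounded_iff by (metis image_eqI real_norm_def)
  have Z': "\<bar>\<zeta> y\<bar> \<le> max Z 0" for y
  proof (cases "y \<in> ?C")
    case False
    then show ?thesis using assms(2)[of y] by simp
  qed (use Z in \<open>simp add: le_max_iff_disj\<close>)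
  then show "\<exists>Z. \<forall>y. \<bar>\<zeta> y\<bar> \<le> Z" by blast
  have "integrable lborel (\<lambda>y. indicator ?C y *\<^sub>R \<zeta> y)"
    by (rule borel_integrable_compact[OF compact_cball c])
  moreover have "indicator ?C y *\<^sub>R \<zeta> y = \<zeta> y" for y
    using assms(2)[of y] by (cases "y \<in> ?C") auto
  ultimately show "integrable lborel \<zeta>" by (simp only:)
qed

lemma gauss_avg_uniform:
  assumes "uniformly_continuous_on UNIV \<zeta>" "\<And>y. \<bar>\<zeta> y\<bar> \<le> Z" "e > 0"
  shows "\<exists>d>0. \<forall>s a. \<bar>s\<bar> < d \<longrightarrow> \<bar>gauss_avg s \<zeta> a - \<zeta> a\<bar> \<le> e"
  using finite_measure_average_uniform[OF gauss2.finite_measure_axioms sets_gauss2 assms]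
  by (simp add: gauss_avg_def)

lemma bump_average_uniform:
  assumes "uniformly_continuous_on UNIV \<zeta>" "\<And>y. \<bar>\<zeta> y\<bar> \<le> Z" "e > 0"
  shows "\<exists>d>0. \<forall>s a. \<bar>s\<bar> < d \<longrightarrow> \<bar>(\<integral>z. \<zeta> (a + s *\<^sub>R z) * bump z \<partial>lborel) - kappa * \<zeta> a\<bar> \<le> e"
proof -
  let ?P = "density lborel (\<lambda>z. ennreal (bump z))"
  have [measurable]: "\<zeta> \<in> borel_measurable borel"
    using uniformly_continuous_imp_continuous[OF assms(1)] by (rule borel_measurable_continuous_onI)
  have e: "emeasure ?P UNIV = ennreal kappa"
    using nn_integral_eq_integral[OF integrable_bump] by (simp add: emeasure_density kappa_def)
  have "finite_measure ?P" by (rule finite_measureI) (simp add: e)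
  moreover have "measure ?P UNIV = kappa" using e kappa_pos by (simp add: measure_def)
  moreover have "(\<integral>z. \<zeta> (a + s *\<^sub>R z) \<partial>?P) = (\<integral>z. \<zeta> (a + s *\<^sub>R z) * bump z \<partial>lborel)" for a s
    by (subst integral_density) (simp_all add: mult.commute)
  ultimately show ?thesis
    using finite_measure_average_uniform[of ?P \<zeta> Z e] assms by simp
qed

text \<open>A diagonal choice: at stage n the error is small at every averaging scale 1 / (j + 1)
  with j \<le> n and on the ball of radius n. A scale and a support fixed afterwards are therefore
  covered from some n on. L is whatever lower bound is to be imposed on r.\<close>

lemma choose_coupling:
  assumes "N \<ge> 1"
  shows "\<exists>k. real (Suc k) \<ge> L \<and> 2 * real N / real (Suc k) \<le> 1 / real (Suc n) \<and>
    (\<forall>j\<in>{..n}. vortex_config.err w N (real (Suc k)) (1 / real (Suc j)) (real n) \<le> 1 / real (Suc n))"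
proof -
  have "\<forall>\<^sub>F k in sequentially. real (Suc k) \<ge> L"
    using filterlim_compose[OF filterlim_real_sequentially filterlim_Suc] by (simp add: filterlim_at_top)
  moreover have "\<forall>\<^sub>F k in sequentially. 2 * real N / real (Suc k) < 1 / real (Suc n)"
  proof (rule order_tendstoD(2))
    show "(\<lambda>k. 2 * real N / real (Suc k)) \<longlonglongrightarrow> 0" by real_asymp
  qed simp
  moreover have "\<forall>\<^sub>F k in sequentially. \<forall>j\<in>{..n}. vortex_config.err w N (real (Suc k)) (1 / real (Suc j)) (real n) < 1 / real (Suc n)"
    by (intro eventually_ball_finite ballI order_tendstoD(2)[OF err_tendsto_0[OF assms]]) auto
  ultimately have "\<forall>\<^sub>F k in sequentially. real (Suc k) \<ge> L \<and> 2 * real N / real (Suc k) \<le> 1 / real (Suc n) \<and>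
    (\<forall>j\<in>{..n}. vortex_config.err w N (real (Suc k)) (1 / real (Suc j)) (real n) \<le> 1 / real (Suc n))"
    by eventually_elim (auto intro: less_imp_le simp del: of_nat_Suc)
  then show ?thesis by (auto simp: eventually_sequentially simp del: of_nat_Suc)
qed

text \<open>The explicit g0 mediates: \<open>test_D\<close> compares the curvature with g0, the
  narrow bumps compare g0 with the sum over the points, and the points approximate P.\<close>

lemma vortex_sequence:
  fixes P :: "(real \<times> real) measure"
  assumes P: "prob_space P" "sets P = sets borel"
  obtains w N r where "\<And>n. N n \<ge> (1 :: nat)" "\<And>n. r n \<ge> real (Suc n)" "\<And>n. r n \<ge> exp (real (N n))"
    "\<And>\<zeta> \<rho>. continuous_on UNIV \<zeta> \<Longrightarrow> (\<And>y. norm y > \<rho> \<Longrightarrow> \<zeta> y = 0) \<Longrightarrow>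
      (\<lambda>n. (\<integral>y. \<zeta> y * vortex_curvature (w n) (N n) (r n) y \<partial>lborel) / (N n * kappa)) \<longlonglongrightarrow> (\<integral>y. \<zeta> y \<partial>P)"
proof -
  obtain ws where ne: "\<And>n. ws n \<noteq> []" and ws: "\<And>\<zeta> Z. continuous_on UNIV \<zeta> \<Longrightarrow> (\<And>y. \<bar>\<zeta> y\<bar> \<le> (Z :: real)) \<Longrightarrow>
       (\<lambda>n. (\<Sum>i<length (ws n). \<zeta> (ws n ! i)) / length (ws n)) \<longlonglongrightarrow> (\<integral>y. \<zeta> y \<partial>P)"
    using empirical_approximation[OF P] by blast
  define w where "w n i = ws n ! i" for n i
  define N where "N n = length (ws n)" for n
  have N: "N n \<ge> 1" for n using ne[of n] by (simp add: N_def Suc_le_eq)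
  define good where "good n k \<longleftrightarrow> real (Suc k) \<ge> max (real (Suc n)) (exp (real (N n))) \<and> 2 * real (N n) / real (Suc k) \<le> 1 / real (Suc n) \<and>
    (\<forall>j\<in>{..n}. vortex_config.err (w n) (N n) (real (Suc k)) (1 / real (Suc j)) (real n) \<le> 1 / real (Suc n))" for n k
  have "\<forall>n. \<exists>k. good n k" unfolding good_def using choose_coupling[OF N] by blast
  then obtain k where good: "\<And>n. good n (k n)" by metis
  have k: "\<And>n. real (Suc (k n)) \<ge> max (real (Suc n)) (exp (real (N n)))"
    "\<And>n. 2 * real (N n) / real (Suc (k n)) \<le> 1 / real (Suc n)"
    "\<And>n j. j \<le> n \<Longrightarrow> vortex_config.err (w n) (N n) (real (Suc (k n))) (1 / real (Suc j)) (real n) \<le> 1 / real (Suc n)"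
    using good unfolding good_def by blast+
  define r where "r n = real (Suc (k n))" for n
  have vc: "vortex_config (N n) (r n)" for n using N by unfold_locales (auto simp: r_def)
  show ?thesis
  proof (rule that[of N r w])
    show "N n \<ge> 1" "r n \<ge> real (Suc n)" "r n \<ge> exp (real (N n))" for n
      using N k(1)[of n] by (simp_all add: r_def)
    fix \<zeta> :: "real \<times> real \<Rightarrow> real" and \<rho> :: real
    assume \<zeta>: "continuous_on UNIV \<zeta>" "\<And>y. norm y > \<rho> \<Longrightarrow> \<zeta> y = 0"
    have uc: "uniformly_continuous_on UNIV \<zeta>" and "\<exists>Z. \<forall>y. \<bar>\<zeta> y\<bar> \<le> Z" and int: "integrable lborel \<zeta>"
      by (rule uniformly_continuous_compact_support[OF \<zeta>(1)]; rule \<zeta>(2); assumption)+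
    then obtain Z where Z: "\<And>y. \<bar>\<zeta> y\<bar> \<le> Z" by blast
    have Z0: "Z \<ge> 0" using Z[of 0] by simp
    have bc: "bcont \<zeta>" by (rule bcontI[OF \<zeta>(1) Z])
    have [measurable]: "\<zeta> \<in> borel_measurable borel" using \<zeta>(1) by (rule borel_measurable_continuous_onI)
    define a where "a n = (\<integral>y. \<zeta> y * vortex_curvature (w n) (N n) (r n) y \<partial>lborel) / (N n * kappa)" for n
    define b where "b n = (\<Sum>i<N n. \<zeta> (w n i)) / N n" for n
    have "b \<longlonglongrightarrow> (\<integral>y. \<zeta> y \<partial>P)"
      using ws[OF \<zeta>(1) Z] by (simp add: b_def[abs_def] N_def w_def)
    moreover have "(\<lambda>n. a n - b n) \<longlonglongrightarrow> 0"
    proof (rule LIMSEQ_I)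
      fix e :: real assume e: "e > 0"
      \<comment> \<open>The budget: twice e / 8 for averaging the test function, e / 4 for
        \<open>err\<close> and e / 4 for the width of the bumps, in all 3 e / 4.\<close>
      obtain d where d: "d > 0" "\<And>s a. \<bar>s\<bar> < d \<Longrightarrow> \<bar>gauss_avg s \<zeta> a - \<zeta> a\<bar> \<le> e / 8"
        using gauss_avg_uniform[OF uc Z, of "e / 8"] e by auto
      obtain j where j: "1 / real (Suc j) < d" using nat_approx_posE[OF d(1)] by metis
      define s where "s = 1 / real (Suc j)"
      have s: "s > 0" "\<bar>s\<bar> < d" using j by (auto simp: s_def)
      obtain d' where d': "d' > 0" "\<And>s a. \<bar>s\<bar> < d' \<Longrightarrow> \<bar>(\<integral>z. \<zeta> (a + s *\<^sub>R z) * bump z \<partial>lborel) - kappa * \<zeta> a\<bar> \<le> kappa * e / 4"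
        using bump_average_uniform[OF uc Z, of "kappa * e / 4"] e kappa_pos by auto
      have lim1: "(\<lambda>n. sqrt (1 / real (Suc n))) \<longlonglongrightarrow> 0" by real_asymp
      have "(\<lambda>n. Z / s\<^sup>2 * (1 / real (Suc n)) / kappa) \<longlonglongrightarrow> Z / s\<^sup>2 * 0 / kappa"
        using kappa_pos by (intro tendsto_divide tendsto_mult tendsto_const) (real_asymp, simp)
      then have lim2: "(\<lambda>n. Z / s\<^sup>2 * (1 / real (Suc n)) / kappa) \<longlonglongrightarrow> 0" by simp
      have "\<forall>\<^sub>F n in sequentially. sqrt (1 / real (Suc n)) < d' \<and> Z / s\<^sup>2 * (1 / real (Suc n)) / kappa < e / 4 \<and> n \<ge> j \<and> real n \<ge> \<rho>"
        using e d'(1) by (intro eventually_conj order_tendstoD(2)[OF lim1] order_tendstoD(2)[OF lim2] eventually_ge_at_top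
          filterlim_real_sequentially[unfolded filterlim_at_top, rule_format]) auto
      then obtain n0 where n0: "\<And>n. n \<ge> n0 \<Longrightarrow> sqrt (1 / real (Suc n)) < d' \<and> Z / s\<^sup>2 * (1 / real (Suc n)) / kappa < e / 4 \<and> n \<ge> j \<and> real n \<ge> \<rho>"
        unfolding eventually_sequentially by blast
      have "norm (a n - b n - 0) < e" if "n \<ge> n0" for n
      proof -
        interpret vortex_config "w n" "N n" "r n" by (rule vc)
        note n = n0[OF that]
        have Nk: "real (N n) * kappa > 0" using N_pos kappa_pos by simp
        have supp: "\<zeta> y = 0" if "norm y > real n" for y using \<zeta>(2)[of y] n that by simp
        have "\<bar>(\<integral>y. \<zeta> y * D y \<partial>lborel) - (\<integral>y. \<zeta> y * g0 y \<partial>lborel)\<bar> \<le> 2 * (e / 8) * (N n * kappa) + Z / s\<^sup>2 * err s (real n)"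
          using s d(2) by (intro test_D bc Z supp int) auto
        also have "err s (real n) \<le> 1 / real (Suc n)"
          using k(3)[of j n] n by (simp only: s_def r_def)
        then have "Z / s\<^sup>2 * err s (real n) \<le> Z / s\<^sup>2 * (1 / real (Suc n))"
          using Z0 by (intro mult_left_mono) auto
        also have "\<dots> \<le> e / 4 * kappa"
        proof -
          have "Z / s\<^sup>2 * (1 / real (Suc n)) / kappa < e / 4" using n by blast
          then show ?thesis unfolding pos_divide_less_eq[OF kappa_pos] by (rule less_imp_le)
        qed
        also have "\<dots> \<le> e / 4 * (N n * kappa)" using N_pos kappa_pos e by simp
        finally have 1: "\<bar>(\<integral>y. \<zeta> y * D y \<partial>lborel) - (\<integral>y. \<zeta> y * g0 y \<partial>lborel)\<bar> \<le> e / 2 * (N n * kappa)" by (simp add: mult_ac)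
        have "sqrt \<mu> \<le> sqrt (1 / real (Suc n))" using k(2)[of n, folded r_def] by (simp add: \<mu>_def del: of_nat_Suc)
        then have "sqrt \<mu> < d'" using conjunct1[OF n] by (rule order.strict_trans1)
        then have sm: "\<bar>sqrt \<mu>\<bar> < d'" using \<mu>_pos by simp
        have "(\<integral>y. \<zeta> y * g0 y \<partial>lborel) - kappa * (\<Sum>i<N n. \<zeta> (w n i))
            = (\<Sum>i<N n. (\<integral>z. \<zeta> (w n i + sqrt \<mu> *\<^sub>R z) * bump z \<partial>lborel) - kappa * \<zeta> (w n i))"
          by (simp add: g0_integral[OF _ Z] sum_subtractf sum_distrib_left)
        also have "\<bar>\<dots>\<bar> \<le> (\<Sum>i<N n. kappa * e / 4)"
          by (intro order_trans[OF sum_abs] sum_mono d'(2) sm)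
        finally have 2: "\<bar>(\<integral>y. \<zeta> y * g0 y \<partial>lborel) - kappa * (\<Sum>i<N n. \<zeta> (w n i))\<bar> \<le> e / 4 * (N n * kappa)"
          by (simp add: mult_ac)
        have "\<bar>(\<integral>y. \<zeta> y * D y \<partial>lborel) - kappa * (\<Sum>i<N n. \<zeta> (w n i))\<bar> \<le> 3 / 4 * e * (N n * kappa)"
          proof -
          have "3 / 4 * e * (N n * kappa) = e / 2 * (N n * kappa) + e / 4 * (N n * kappa)" by simp
          with 1 2 show ?thesis by linarith
        qed
        moreover have "a n - b n = ((\<integral>y. \<zeta> y * D y \<partial>lborel) - kappa * (\<Sum>i<N n. \<zeta> (w n i))) / (N n * kappa)"
          using Nk kappa_pos by (simp add: a_def b_def vortex_curvature_def diff_divide_distrib)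
        ultimately have "\<bar>a n - b n\<bar> \<le> 3 / 4 * e"
          using Nk by (simp add: abs_divide pos_divide_le_eq)
        then show ?thesis using e by simp
      qed
      then show "\<exists>no. \<forall>n\<ge>no. norm (a n - b n - 0) < e" by blast
    qed
    ultimately show "(\<lambda>n. (\<integral>y. \<zeta> y * vortex_curvature (w n) (N n) (r n) y \<partial>lborel) / (N n * kappa)) \<longlonglongrightarrow> (\<integral>y. \<zeta> y \<partial>P)"
      unfolding a_def[symmetric] by (rule Lim_transform)
  qed
qed

text \<open>Convergence on compactly supported tests extends to bounded functions because no mass is
  lost: all measures have mass 1, a cut-off inside \<Omega> carries nearly all of P, hence nearly
  all of d n for large n. Multiplying F by such a cut-off extends it continuously by 0, whatever F
  does at the boundary of \<Omega>.\<close>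

lemma weak_convergence_on_open:
  fixes P :: "(real \<times> real) measure" and d :: "nat \<Rightarrow> real \<times> real \<Rightarrow> real" and F :: "real \<times> real \<Rightarrow> real"
  assumes P: "prob_space P" and sets [measurable_cong]: "sets P = sets borel"
    and \<Omega>: "open \<Omega>" "AE y in P. y \<in> \<Omega>"
    and d: "\<And>n. integrable lborel (d n)" "\<And>n y. d n y \<ge> 0" "\<And>n. (\<integral>y. d n y \<partial>lborel) = 1"
    and conv: "\<And>\<zeta> \<rho>. continuous_on UNIV \<zeta> \<Longrightarrow> (\<And>y. norm y > \<rho> \<Longrightarrow> \<zeta> y = 0) \<Longrightarrow>
      (\<lambda>n. \<integral>y. \<zeta> y * d n y \<partial>lborel) \<longlonglongrightarrow> (\<integral>y. \<zeta> y \<partial>P)"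
    and F: "continuous_on \<Omega> F" "\<And>y. y \<in> \<Omega> \<Longrightarrow> \<bar>F y\<bar> \<le> K"
  shows "(\<lambda>n. \<integral>y. indicator \<Omega> y * F y * d n y \<partial>lborel) \<longlonglongrightarrow> (\<integral>y. indicator \<Omega> y * F y \<partial>P)"
proof -
  interpret P: prob_space P by fact
  have space: "space P = UNIV" using sets_eq_imp_space_eq[OF sets] by simp
  \<comment> \<open>\<open>infdist\<close> to the empty set is 0, so the case \<Omega> = UNIV must
    be set apart.\<close>
  define \<iota> where "\<iota> y = (if \<Omega> = UNIV then 1 else infdist y (- \<Omega>))" for y
  have cont_\<iota>: "continuous_on UNIV \<iota>" unfolding \<iota>_def by (cases "\<Omega> = UNIV") (auto intro!: continuous_intros)
  have \<iota>_pos: "\<iota> y > 0" if "y \<in> \<Omega>" for y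
    using that \<Omega>(1) in_closed_iff_infdist_zero[of "- \<Omega>" y] infdist_nonneg[of y "- \<Omega>"]
    by (auto simp: \<iota>_def less_le)
  have \<iota>_0: "\<iota> y = 0" if "y \<notin> \<Omega>" for y
    using that \<Omega>(1) in_closed_iff_infdist_zero[of "- \<Omega>" y] by (auto simp: \<iota>_def)
  have \<iota>_nonneg: "\<iota> y \<ge> 0" for y using \<iota>_pos[of y] \<iota>_0[of y] by (cases "y \<in> \<Omega>") auto
  \<comment> \<open>The first factor vanishes off \<Omega>, the second far out; on \<Omega> both are
    eventually 1.\<close>
  define \<xi> where "\<xi> k y = min 1 (real k * \<iota> y) * max 0 (min 1 (real k + 1 - norm y))" for k and y :: "real \<times> real"
  have cont_\<xi>: "continuous_on UNIV (\<xi> k)" for k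
    unfolding \<xi>_def by (intro continuous_intros cont_\<iota>)
  have \<xi>01: "0 \<le> \<xi> k y" "\<xi> k y \<le> 1" for k y
    unfolding \<xi>_def using \<iota>_nonneg by (auto intro!: mult_nonneg_nonneg mult_le_one)
  have \<xi>0: "\<xi> k y = 0" if "norm y > real k + 1" for k y using that by (simp add: \<xi>_def)
  have \<xi>out: "\<xi> k y = 0" if "y \<notin> \<Omega>" for k y using \<iota>_0[OF that] by (simp add: \<xi>_def)
  have \<xi>lim: "(\<lambda>k. \<xi> k y) \<longlonglongrightarrow> 1" if y: "y \<in> \<Omega>" for y
  proof -
    obtain m :: nat where m: "1 \<le> real m * \<iota> y" using ex_less_of_nat_mult[OF \<iota>_pos[OF y], of 1] by (auto intro: less_imp_le)
    have "\<forall>\<^sub>F k in sequentially. \<xi> k y = 1"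
    proof (rule eventually_sequentiallyI[of "max m (nat \<lceil>norm y\<rceil>)"])
      fix k assume k: "max m (nat \<lceil>norm y\<rceil>) \<le> k"
      have "real m * \<iota> y \<le> real k * \<iota> y" using k \<iota>_nonneg by (intro mult_right_mono) auto
      moreover have "norm y \<le> real k" using k by linarith
      ultimately show "\<xi> k y = 1" using m by (simp add: \<xi>_def)
    qed
    then show ?thesis by (rule tendsto_eventually)
  qed
  have [measurable]: "\<xi> k \<in> borel_measurable borel" for k using cont_\<xi> by (rule borel_measurable_continuous_onI)
  have [measurable]: "\<Omega> \<in> sets borel" using \<Omega>(1) by simp
  define F' where "F' y = indicator \<Omega> y * F y" for y
  have K: "\<bar>F' y\<bar> \<le> \<bar>K\<bar>" for y using F(2)[of y] by (auto simp: F'_def split: split_indicator)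
  have [measurable]: "F' \<in> borel_measurable borel"
    using borel_measurable_continuous_on_indicator[OF _ F(1)] by (simp add: F'_def[abs_def])
  have cont_F\<xi>: "continuous_on UNIV (\<lambda>y. \<xi> k y * F' y)" for k
  proof -
    have "isCont (\<lambda>y. \<xi> k y * F' y) y" for y
    proof (cases "y \<in> \<Omega>")
      case True
      have "\<forall>\<^sub>F x in nhds y. x \<in> \<Omega>" using \<Omega>(1) True by (rule eventually_nhds_in_open)
      then have "\<forall>\<^sub>F x in nhds y. \<xi> k x * F' x = \<xi> k x * F x" by eventually_elim (simp add: F'_def)
      moreover have "isCont F y" using F(1) \<Omega>(1) True by (simp add: continuous_on_eq_continuous_at)
      moreover have "isCont (\<xi> k) y" using cont_\<xi>[of k] by (metis UNIV_I continuous_on_eq_continuous_at open_UNIV)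
      ultimately show ?thesis
        using isCont_cong[of "\<lambda>x. \<xi> k x * F' x" "\<lambda>x. \<xi> k x * F x" y] continuous_mult[of "at y" "\<xi> k" F] by blast
    next
      case False
      have "(\<xi> k \<longlongrightarrow> \<xi> k y) (at y)" using cont_\<xi>[of k] by (metis UNIV_I continuous_on_eq_continuous_at open_UNIV isCont_def)
      then have "((\<lambda>x. \<bar>\<xi> k x\<bar> * \<bar>K\<bar>) \<longlongrightarrow> 0) (at y)"
        using \<xi>out[OF False] by (auto intro!: tendsto_mult_left_zero tendsto_rabs_zero)
      then have "((\<lambda>x. \<xi> k x * F' x) \<longlongrightarrow> 0) (at y)"
        by (rule Lim_null_comparison[rotated]) (intro always_eventually allI, simp only: real_norm_def abs_mult, intro mult_left_mono K abs_ge_zero)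
      then show ?thesis using \<xi>out[OF False] by (simp add: isCont_def)
    qed
    then show ?thesis by (simp add: continuous_at_imp_continuous_on)
  qed
  have conv1: "(\<lambda>n. \<integral>y. \<xi> k y * d n y \<partial>lborel) \<longlonglongrightarrow> (\<integral>y. \<xi> k y \<partial>P)" for k
    by (rule conv[OF cont_\<xi>]) (rule \<xi>0)
  have conv2: "(\<lambda>n. \<integral>y. \<xi> k y * F' y * d n y \<partial>lborel) \<longlonglongrightarrow> (\<integral>y. \<xi> k y * F' y \<partial>P)" for k
    by (rule conv[OF cont_F\<xi>, of "real k + 1"]) (simp add: \<xi>0)
  have iP: "integrable P f" if [measurable]: "f \<in> borel_measurable borel" and "\<And>y. \<bar>f y\<bar> \<le> C" for f :: "real \<times> real \<Rightarrow> real" and C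
    by (rule P.integrable_const_bound[of _ C]) (use that in auto)
  have id: "integrable lborel (\<lambda>y. f y * d n y)" if [measurable]: "f \<in> borel_measurable borel" and b: "\<And>y. \<bar>f y\<bar> \<le> C" for f :: "real \<times> real \<Rightarrow> real" and C n
  proof (rule Bochner_Integration.integrable_bound)
    show "integrable lborel (\<lambda>y. C * d n y)" using d(1) by simp
    show "(\<lambda>y. f y * d n y) \<in> borel_measurable lborel" using d(1)[of n] by measurable
    have "norm (f y * d n y) \<le> norm (C * d n y)" for y
      using b[of y] d(2)[of n y] by (auto simp: abs_mult intro!: mult_right_mono)
    then show "AE y in lborel. norm (f y * d n y) \<le> norm (C * d n y)" by (intro AE_I2)
  qed
  have \<xi>P: "(\<lambda>k. \<integral>y. \<xi> k y \<partial>P) \<longlonglongrightarrow> (\<integral>y. 1 \<partial>P)"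
    by (rule integral_dominated_convergence[where w="\<lambda>_. 1"])
      (use \<Omega>(2) \<xi>lim \<xi>01 in \<open>auto elim: eventually_mono\<close>)
  have bnd1: "\<bar>\<xi> k y * F' y\<bar> \<le> \<bar>K\<bar>" for k y
    unfolding abs_mult using \<xi>01[of k y] K[of y] mult_mono[of "\<bar>\<xi> k y\<bar>" 1 "\<bar>F' y\<bar>" "\<bar>K\<bar>"] by simp
  have bnd2: "\<bar>F' y - \<xi> k y * F' y\<bar> \<le> \<bar>K\<bar> * (1 - \<xi> k y)" for k y
  proof -
    have "\<bar>F' y - \<xi> k y * F' y\<bar> = \<bar>F' y\<bar> * (1 - \<xi> k y)"
    proof -
      have "F' y - \<xi> k y * F' y = F' y * (1 - \<xi> k y)" by (simp add: algebra_simps)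
      then show ?thesis using \<xi>01(2)[of k y] by (simp add: abs_mult)
    qed
    also have "\<dots> \<le> \<bar>K\<bar> * (1 - \<xi> k y)" using K \<xi>01(2)[of k y] by (intro mult_right_mono) auto
    finally show ?thesis .
  qed
  have abs\<xi>: "\<bar>\<xi> k y\<bar> \<le> 1" for k y using \<xi>01[of k y] by simp
  have iF: "integrable P F'" by (rule iP[OF _ K]) measurable
  have i\<xi>F: "integrable P (\<lambda>y. \<xi> k y * F' y)" for k by (rule iP[OF _ bnd1]) measurable
  have i\<xi>: "integrable P (\<xi> k)" for k by (rule iP[OF _ abs\<xi>]) measurable
  have dF: "integrable lborel (\<lambda>y. F' y * d n y)" for n by (rule id[OF _ K]) measurable
  have d\<xi>F: "integrable lborel (\<lambda>y. \<xi> k y * F' y * d n y)" for k n by (rule id[OF _ bnd1]) measurable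
  have d\<xi>: "integrable lborel (\<lambda>y. \<xi> k y * d n y)" for k n by (rule id[OF _ abs\<xi>]) measurable
  have diffP: "\<bar>(\<integral>y. F' y \<partial>P) - (\<integral>y. \<xi> k y * F' y \<partial>P)\<bar> \<le> \<bar>K\<bar> * (1 - (\<integral>y. \<xi> k y \<partial>P))" for k
  proof -
    have "(\<integral>y. F' y \<partial>P) - (\<integral>y. \<xi> k y * F' y \<partial>P) = (\<integral>y. F' y - \<xi> k y * F' y \<partial>P)"
      using iF i\<xi>F by simp
    also have "\<bar>\<dots>\<bar> \<le> (\<integral>y. \<bar>K\<bar> * (1 - \<xi> k y) \<partial>P)"
      by (intro order_trans[OF integral_abs_bound integral_mono] bnd2 integrable_abs integrable_mult_right
          Bochner_Integration.integrable_diff iF i\<xi>F i\<xi>) simp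
    also have "\<dots> = \<bar>K\<bar> * (1 - (\<integral>y. \<xi> k y \<partial>P))" using i\<xi>[of k] P.prob_space by simp
    finally show ?thesis .
  qed
  have diffd: "\<bar>(\<integral>y. F' y * d n y \<partial>lborel) - (\<integral>y. \<xi> k y * F' y * d n y \<partial>lborel)\<bar> \<le> \<bar>K\<bar> * (1 - (\<integral>y. \<xi> k y * d n y \<partial>lborel))" for k n
  proof -
    have "(\<integral>y. F' y * d n y \<partial>lborel) - (\<integral>y. \<xi> k y * F' y * d n y \<partial>lborel) = (\<integral>y. F' y * d n y - \<xi> k y * F' y * d n y \<partial>lborel)"
      using dF d\<xi>F by simp
    also have "\<bar>\<dots>\<bar> \<le> (\<integral>y. \<bar>K\<bar> * (d n y - \<xi> k y * d n y) \<partial>lborel)"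
    proof (rule order_trans[OF integral_abs_bound integral_mono])
      show "\<bar>F' y * d n y - \<xi> k y * F' y * d n y\<bar> \<le> \<bar>K\<bar> * (d n y - \<xi> k y * d n y)" for y
      proof -
        have "F' y * d n y - \<xi> k y * F' y * d n y = (F' y - \<xi> k y * F' y) * d n y" by (simp add: algebra_simps)
        then have "\<bar>F' y * d n y - \<xi> k y * F' y * d n y\<bar> = \<bar>F' y - \<xi> k y * F' y\<bar> * d n y"
          using d(2)[of n y] by (simp add: abs_mult)
        also have "\<dots> \<le> \<bar>K\<bar> * (1 - \<xi> k y) * d n y" by (rule mult_right_mono[OF bnd2 d(2)])
        finally show ?thesis by (simp add: algebra_simps)
      qed
    qed (intro integrable_abs integrable_mult_right Bochner_Integration.integrable_diff dF d\<xi>F d\<xi> d(1))+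
    also have "\<dots> = \<bar>K\<bar> * (1 - (\<integral>y. \<xi> k y * d n y \<partial>lborel))" using d\<xi> d by simp
    finally show ?thesis .
  qed
  have "(\<lambda>n. \<integral>y. F' y * d n y \<partial>lborel) \<longlonglongrightarrow> (\<integral>y. F' y \<partial>P)"
  proof (rule LIMSEQ_I)
    fix e :: real assume e: "e > 0"
    \<comment> \<open>Three errors of at most e / 4 each: the mass missed by the cut-off under P,
      the same under d n, and the convergence for the cut-off integrand.\<close>
    define \<delta> where "\<delta> = e / (4 * (\<bar>K\<bar> + 1))"
    have \<delta>: "\<delta> > 0" "\<bar>K\<bar> * \<delta> \<le> e / 4" using e by (auto simp: \<delta>_def field_simps)
    have "\<forall>\<^sub>F k in sequentially. (\<integral>y. \<xi> k y \<partial>P) > 1 - \<delta>"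
      using \<xi>P \<delta> P.prob_space by (intro order_tendstoD(1)) auto
    then obtain k where k: "(\<integral>y. \<xi> k y \<partial>P) > 1 - \<delta>" by (auto simp: eventually_sequentially)
    have "\<forall>\<^sub>F n in sequentially. (\<integral>y. \<xi> k y * d n y \<partial>lborel) > 1 - \<delta>"
      by (rule order_tendstoD(1)[OF conv1 k])
    moreover have "\<forall>\<^sub>F n in sequentially. \<bar>(\<integral>y. \<xi> k y * F' y * d n y \<partial>lborel) - (\<integral>y. \<xi> k y * F' y \<partial>P)\<bar> < e / 4"
      using tendstoD[OF conv2[of k], of "e / 4"] e by (simp add: dist_real_def)
    ultimately have "\<forall>\<^sub>F n in sequentially. norm ((\<integral>y. F' y * d n y \<partial>lborel) - (\<integral>y. F' y \<partial>P)) < e"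
    proof eventually_elim
      case (elim n)
      have "\<bar>K\<bar> * (1 - (\<integral>y. \<xi> k y * d n y \<partial>lborel)) \<le> \<bar>K\<bar> * \<delta>" "\<bar>K\<bar> * (1 - (\<integral>y. \<xi> k y \<partial>P)) \<le> \<bar>K\<bar> * \<delta>"
        using elim k by (auto intro!: mult_left_mono)
      then show ?case using diffP[of k] diffd[of n k] \<delta>(2) elim(2) e unfolding real_norm_def by linarith
    qed
    then show "\<exists>no. \<forall>n\<ge>no. norm ((\<integral>y. F' y * d n y \<partial>lborel) - (\<integral>y. F' y \<partial>P)) < e"
      by (simp add: eventually_sequentially)
  qed
  then show ?thesis by (simp add: F'_def)
qed

section \<open>Smooth functions on the flow box\<close>

text \<open>Derivatives at points of an open set are local, so agreement on it passes to all
  orders.\<close>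

lemma Ck_on_cong:
  assumes "open U"
  shows "(\<And>p. p \<in> U \<Longrightarrow> f p = g p) \<Longrightarrow> Ck_on k U f \<Longrightarrow> Ck_on k U g"
proof (induction k arbitrary: f g)
  case 0
  then show ?case using continuous_on_cong[of U U f g] by simp
next
  case (Suc j)
  have d: "f differentiable (at p)" if "p \<in> U" for p using Suc.prems that by simp
  have eq: "frechet_derivative f (at p) = frechet_derivative g (at p)" if "p \<in> U" for p
    by (rule frechet_derivative_transform_within_open[OF d assms]) (use that Suc.prems in auto)
  have dg: "g differentiable (at p)" if "p \<in> U" for p
    using has_derivative_transform_within_open[OF _ assms that, of f _ UNIV g] d[OF that] Suc.prems(1)
    unfolding differentiable_def by blast
  moreover have "Ck_on j U (\<lambda>p. frechet_derivative g (at p) b)" if "b \<in> Basis" for b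
    by (rule Suc.IH[of "\<lambda>p. frechet_derivative f (at p) b"]) (use eq Suc.prems that in auto)
  ultimately show ?case by simp
qed

lemma Ck_on_SucI:
  assumes "open U" "\<And>p. p \<in> U \<Longrightarrow> (f has_derivative f' p) (at p)" "\<And>b. b \<in> Basis \<Longrightarrow> Ck_on k U (\<lambda>p. f' p b)"
  shows "Ck_on (Suc k) U f"
proof -
  have "Ck_on k U (\<lambda>p. frechet_derivative f (at p) b)" if "b \<in> Basis" for b
    by (rule Ck_on_cong[OF assms(1) _ assms(3)[OF that]]) (use frechet_derivative_at[OF assms(2)] in auto)
  then show ?thesis using assms(2) by (auto simp: differentiable_def)
qed

lemma Ck_on_Suc_derivative:
  assumes "Ck_on (Suc k) U f" "p \<in> U"
  shows "(f has_derivative frechet_derivative f (at p)) (at p)"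
  using assms by (simp add: frechet_derivative_works)

lemma Ck_on_SucD: "Ck_on (Suc k) U f \<Longrightarrow> Ck_on k U f"
proof (induction k arbitrary: f)
  case 0
  then show ?case
    by (auto intro!: continuous_at_imp_continuous_on differentiable_imp_continuous_within)
qed auto

lemma Ck_on_le: "Ck_on k U f \<Longrightarrow> j \<le> k \<Longrightarrow> Ck_on j U f"
proof (induction k)
  case (Suc k)
  then show ?case using Ck_on_SucD[of k U f] by (cases "j = Suc k") (auto simp del: Ck_on.simps)
qed simp

lemma Ck_on_continuous: "Ck_on k U f \<Longrightarrow> continuous_on U f"
  using Ck_on_le[of k U f 0] by simp

lemma Ck_on_const: "open U \<Longrightarrow> Ck_on k U (\<lambda>p. c)"
proof (induction k arbitrary: c)
  case (Suc k)
  then show ?case by (intro Ck_on_SucI[where f'="\<lambda>_ _. 0"]) auto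
qed simp

lemma Ck_on_bounded_linear:
  assumes "open U" "bounded_linear L"
  shows "Ck_on k U f \<Longrightarrow> Ck_on k U (\<lambda>p. L (f p))"
proof (induction k arbitrary: f)
  case 0
  then show ?case using bounded_linear.continuous_on[OF assms(2)] by simp
next
  case (Suc k)
  show ?case
    by (rule Ck_on_SucI[OF assms(1) bounded_linear.has_derivative[OF assms(2) Ck_on_Suc_derivative[OF Suc.prems]]])
      (use Suc in auto)
qed

lemma Ck_on_add:
  assumes "open U"
  shows "Ck_on k U f \<Longrightarrow> Ck_on k U g \<Longrightarrow> Ck_on k U (\<lambda>p. f p + g p)"
proof (induction k arbitrary: f g)
  case 0
  then show ?case by (simp add: continuous_on_add)
next
  case (Suc k)
  show ?case
    by (rule Ck_on_SucI[OF assms has_derivative_add[OF Ck_on_Suc_derivative[OF Suc.prems(1)] Ck_on_Suc_derivative[OF Suc.prems(2)]]])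
      (use Suc in auto)
qed

lemma Ck_on_sum:
  assumes "open U" "\<And>i. i \<in> I \<Longrightarrow> Ck_on k U (f i)"
  shows "Ck_on k U (\<lambda>p. \<Sum>i\<in>I. f i p)"
  using assms(2) by (induction I rule: infinite_finite_induct) (auto intro: Ck_on_const Ck_on_add assms(1))

lemma Ck_on_bilinear:
  assumes "open U" "bounded_bilinear B"
  shows "Ck_on k U f \<Longrightarrow> Ck_on k U g \<Longrightarrow> Ck_on k U (\<lambda>p. B (f p) (g p))"
proof (induction k arbitrary: f g)
  case 0
  then show ?case using bounded_bilinear.continuous_on[OF assms(2)] by simp
next
  case (Suc k)
  show ?case
    by (rule Ck_on_SucI[OF assms(1) bounded_bilinear.FDERIV[OF assms(2) Ck_on_Suc_derivative[OF Suc.prems(1)] Ck_on_Suc_derivative[OF Suc.prems(2)]]])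
      (use Suc Ck_on_SucD[OF Suc.prems(1)] Ck_on_SucD[OF Suc.prems(2)] in \<open>auto intro!: Ck_on_add assms(1)\<close>)
qed

lemmas Ck_on_mult = Ck_on_bilinear[OF _ bounded_bilinear_mult]
lemmas Ck_on_scaleR = Ck_on_bilinear[OF _ bounded_bilinear_scaleR]

text \<open>The chain rule is expanded in the basis of the middle space: the induction hypothesis
  reaches the derivative of f only along fixed basis vectors, whereas the direction given by the
  derivative of \<open>Y\<close> moves with the point.\<close>

lemma Ck_on_compose:
  assumes "open U" "open V"
  shows "Ck_on k V f \<Longrightarrow> Ck_on k U Y \<Longrightarrow> Y ` U \<subseteq> V \<Longrightarrow> Ck_on k U (\<lambda>p. f (Y p))"
proof (induction k arbitrary: f)
  case 0
  then show ?case using continuous_on_compose2 by (metis Ck_on.simps(1))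
next
  case (Suc k)
  let ?F = "\<lambda>p. \<lambda>h. \<Sum>c\<in>Basis. (frechet_derivative Y (at p) h \<bullet> c) *\<^sub>R frechet_derivative f (at (Y p)) c"
  have der: "((\<lambda>p. f (Y p)) has_derivative ?F p) (at p)" if "p \<in> U" for p
  proof -
    have Yp: "Y p \<in> V" using that Suc.prems by auto
    have df: "(f has_derivative frechet_derivative f (at (Y p))) (at (Y p))"
      by (rule Ck_on_Suc_derivative[OF Suc.prems(1) Yp])
    then have lin: "linear (frechet_derivative f (at (Y p)))" by (rule has_derivative_linear)
    have rep: "frechet_derivative f (at (Y p)) v = (\<Sum>c\<in>Basis. (v \<bullet> c) *\<^sub>R frechet_derivative f (at (Y p)) c)" for v
    proof -
      have "frechet_derivative f (at (Y p)) v = frechet_derivative f (at (Y p)) (\<Sum>c\<in>Basis. (v \<bullet> c) *\<^sub>R c)"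
        by (simp only: euclidean_representation)
      then show ?thesis unfolding linear_sum[OF lin] linear_cmul[OF lin] .
    qed
    have "(\<lambda>h. frechet_derivative f (at (Y p)) (frechet_derivative Y (at p) h)) = ?F p" by (rule ext, rule rep)
    then show ?thesis
      using has_derivative_compose[OF Ck_on_Suc_derivative[OF Suc.prems(2) that] df] by simp
  qed
  show ?case
  proof (rule Ck_on_SucI[OF assms(1) der])
    fix b :: 'a assume b: "b \<in> Basis"
    show "Ck_on k U (\<lambda>p. ?F p b)"
    proof (intro Ck_on_sum assms(1) Ck_on_scaleR)
      fix c :: 'b assume c: "c \<in> Basis"
      show "Ck_on k U (\<lambda>p. frechet_derivative Y (at p) b \<bullet> c)"
        by (rule Ck_on_bounded_linear[OF assms(1) bounded_linear_inner_left]) (use Suc.prems b in simp)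
      show "Ck_on k U (\<lambda>p. frechet_derivative f (at (Y p)) c)"
        by (rule Suc.IH) (use Suc.prems c Ck_on_SucD[OF Suc.prems(2)] in auto)
    qed
  qed
qed

lemma Ck_on_exp: "Ck_on k UNIV (exp :: real \<Rightarrow> real)"
proof (induction k)
  case (Suc k)
  show ?case
    by (rule Ck_on_SucI[OF open_UNIV DERIV_exp[unfolded has_field_derivative_def]])
      (auto intro!: Ck_on_mult Suc Ck_on_const simp: Suc)
qed (simp add: continuous_on_exp)

lemma Ck_on_ident: "open U \<Longrightarrow> Ck_on k U (\<lambda>p. p)"
proof (cases k)
  case (Suc j)
  assume "open U"
  then show ?thesis unfolding Suc
    by (intro Ck_on_SucI[where f'="\<lambda>_ h. h"] Ck_on_const) auto
qed simp

lemma Ck_on_linear: "open U \<Longrightarrow> bounded_linear L \<Longrightarrow> Ck_on k U L"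
  by (rule Ck_on_bounded_linear[OF _ _ Ck_on_ident])

lemma Ck_on_vec:
  fixes f :: "'n::finite \<Rightarrow> 'a::euclidean_space \<Rightarrow> 'b::euclidean_space"
  assumes "open U" "\<And>i. Ck_on k U (f i)"
  shows "Ck_on k U (\<lambda>p. \<chi> i. f i p)"
proof -
  have lin: "bounded_linear (axis i :: 'b \<Rightarrow> 'b ^ 'n)" for i
    by (rule linear_conv_bounded_linear[THEN iffD1]) (auto intro!: linearI simp: axis_def vec_eq_iff)
  have "Ck_on k U (\<lambda>p. \<Sum>i\<in>UNIV. axis i (f i p) :: 'b ^ 'n)"
    by (intro Ck_on_sum assms Ck_on_bounded_linear[OF _ lin])
  moreover have "(\<Sum>i\<in>UNIV. axis i (f i p) :: 'b ^ 'n) = (\<chi> i. f i p)" for p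
    by (simp add: vec_eq_iff axis_def sum.delta if_distrib cong: if_cong)
  ultimately show ?thesis by simp
qed

lemma Ck_on_Pair:
  fixes f :: "'a::euclidean_space \<Rightarrow> 'b::euclidean_space" and g :: "'a \<Rightarrow> 'c::euclidean_space"
  assumes "open U" "Ck_on k U f" "Ck_on k U g"
  shows "Ck_on k U (\<lambda>p. (f p, g p))"
proof -
  have l: "bounded_linear (\<lambda>x :: 'b. (x, 0 :: 'c))" "bounded_linear (\<lambda>y :: 'c. (0 :: 'b, y))"
    by (intro bounded_linear_Pair bounded_linear_ident bounded_linear_zero)+
  show ?thesis
    using Ck_on_add[OF assms(1) Ck_on_bounded_linear[OF assms(1) l(1) assms(2)] Ck_on_bounded_linear[OF assms(1) l(2) assms(3)]]
    by simp
qed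

lemma Ck_on_prod:
  fixes f :: "'i \<Rightarrow> 'a::euclidean_space \<Rightarrow> 'b::{real_normed_algebra, comm_ring_1}"
  assumes "open U" "\<And>i. i \<in> I \<Longrightarrow> Ck_on k U (f i)"
  shows "Ck_on k U (\<lambda>p. \<Prod>i\<in>I. f i p)"
  using assms(2) by (induction I rule: infinite_finite_induct) (auto intro: Ck_on_const Ck_on_mult assms(1))

lemma Ck_on_has_grad:
  "Cb k f \<Longrightarrow> Ck_on k UNIV f"
proof (induction k arbitrary: f)
  case (Suc k)
  obtain f1 f2 where f: "has_grad f f1 f2" "Cb k f1" "Cb k f2" using Suc.prems by (rule Cb_SucE)
  show ?case
    by (rule Ck_on_SucI[OF open_UNIV has_gradD[OF f(1)]]) (auto simp: Basis_prod_def intro!: Suc.IH f)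
qed (simp add: bcont_def)

lemma pd_eq:
  assumes "(f has_derivative f') (at p)"
  shows "pd i f p = f' (axis i 1)"
  using frechet_derivative_at[OF assms] by (simp add: pd_def)

lemma has_derivative_pd:
  assumes "f differentiable (at p)"
  shows "(f has_derivative (\<lambda>h. \<Sum>i\<in>UNIV. h $ i *\<^sub>R pd i f p)) (at p)"
proof -
  have d: "(f has_derivative frechet_derivative f (at p)) (at p)" using assms by (simp add: frechet_derivative_works)
  then have lin: "linear (frechet_derivative f (at p))" by (rule has_derivative_linear)
  have "frechet_derivative f (at p) h = (\<Sum>i\<in>UNIV. h $ i *\<^sub>R pd i f p)" for h
  proof -
    have "h = (\<Sum>i\<in>UNIV. h $ i *\<^sub>R axis i 1)"
      by (simp add: vec_eq_iff axis_def sum.delta if_distrib cong: if_cong)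
    then have "frechet_derivative f (at p) h = frechet_derivative f (at p) (\<Sum>i\<in>UNIV. h $ i *\<^sub>R axis i 1)" by simp
    then show ?thesis by (simp add: linear_sum[OF lin] linear_cmul[OF lin] pd_def)
  qed
  then have "frechet_derivative f (at p) = (\<lambda>h. \<Sum>i\<in>UNIV. h $ i *\<^sub>R pd i f p)" by (rule ext)
  with d show ?thesis by simp
qed

lemma Ck_on_pd: "Ck_on (Suc k) U f \<Longrightarrow> Ck_on k U (pd i f)"
  by (simp add: pd_def[abs_def] axis_in_Basis_iff)

lemma Ck_on_Suc_pdI:
  fixes f' :: "3 \<Rightarrow> real^3 \<Rightarrow> 'b::real_normed_vector"
  assumes "open U" "\<And>p. p \<in> U \<Longrightarrow> (f has_derivative (\<lambda>h. \<Sum>i\<in>UNIV. h $ i *\<^sub>R f' i p)) (at p)"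
    and "\<And>i. Ck_on k U (f' i)"
  shows "Ck_on (Suc k) U f"
proof (rule Ck_on_SucI[OF assms(1,2)])
  fix b :: "real^3" assume "b \<in> Basis"
  then show "Ck_on k U (\<lambda>p. \<Sum>i\<in>UNIV. b $ i *\<^sub>R f' i p)"
    by (intro Ck_on_sum assms(1) Ck_on_bounded_linear[OF assms(1) bounded_linear_scaleR_right] assms(3))
qed

lemma pd_cong:
  assumes "open U" "p \<in> U" "\<And>q. q \<in> U \<Longrightarrow> f q = g q" "f differentiable (at p)"
  shows "pd i f p = pd i g p"
  unfolding pd_def using frechet_derivative_transform_within_open[OF assms(4,1,2,3)] by simp

section \<open>The box and primitives in the third coordinate\<close>

lemma in_box_iff: "p \<in> Defs.box \<longleftrightarrow> 0 < p $ 1 \<and> p $ 1 < 1 \<and> (p $ 2)\<^sup>2 + (p $ 3)\<^sup>2 < 1"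
proof -
  have n: "(z :: real^2) \<in> disk \<longleftrightarrow> (z $ 1)\<^sup>2 + (z $ 2)\<^sup>2 < 1" for z
    by (simp add: disk_def norm_vec_def L2_set_def sum_2)
  show ?thesis
  proof
    assume "p \<in> Defs.box"
    then show "0 < p $ 1 \<and> p $ 1 < 1 \<and> (p $ 2)\<^sup>2 + (p $ 3)\<^sup>2 < 1"
      by (auto simp: Defs.box_def box_point_def n)
  next
    assume a: "0 < p $ 1 \<and> p $ 1 < 1 \<and> (p $ 2)\<^sup>2 + (p $ 3)\<^sup>2 < 1"
    have "p = box_point (p $ 1) (vector [p $ 2, p $ 3])"
      by (simp add: box_point_def vec_eq_iff forall_3)
    with a show "p \<in> Defs.box"
      unfolding Defs.box_def by (auto simp: n intro!: exI[of _ "p $ 1"] exI[of _ "vector [p $ 2, p $ 3]"])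
  qed
qed

lemma open_box [simp]: "open Defs.box"
proof -
  have "Defs.box = {p. 0 < p $ 1} \<inter> {p. p $ 1 < 1} \<inter> {p. (p $ 2)\<^sup>2 + (p $ 3)\<^sup>2 < 1}"
    by (auto simp: in_box_iff)
  moreover have "open ({p :: real^3. 0 < p $ 1} \<inter> {p. p $ 1 < 1} \<inter> {p. (p $ 2)\<^sup>2 + (p $ 3)\<^sup>2 < 1})"
    by (intro open_Int open_Collect_less continuous_intros)
  ultimately show ?thesis by (simp only:)
qed

lemma convex_box: "convex Defs.box"
proof (rule convexI)
  fix p q :: "real^3" and u v :: real
  assume pq: "p \<in> Defs.box" "q \<in> Defs.box" and uv: "0 \<le> u" "0 \<le> v" "u + v = 1"
  have disc: "(a, b) \<in> ball 0 1 \<longleftrightarrow> a\<^sup>2 + b\<^sup>2 < 1" for a b :: real by (simp add: norm_Pair)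
  have "u *\<^sub>R (p $ 2, p $ 3) + v *\<^sub>R (q $ 2, q $ 3) \<in> ball 0 1"
    by (rule convexD[OF convex_ball]) (use pq uv in \<open>simp_all only: disc in_box_iff\<close>)
  then have "(u * p $ 2 + v * q $ 2)\<^sup>2 + (u * p $ 3 + v * q $ 3)\<^sup>2 < 1"
    by (simp only: disc scaleR_Pair add_Pair real_scaleR_def)
  moreover have "u *\<^sub>R (p $ 1) + v *\<^sub>R (q $ 1) \<in> {0<..<1}"
    by (rule convexD[OF convex_real_interval(8)]) (use pq uv in \<open>simp_all add: in_box_iff\<close>)
  ultimately show "u *\<^sub>R p + v *\<^sub>R q \<in> Defs.box" by (simp add: in_box_iff)
qed

definition scale3 :: "real \<Rightarrow> real^3 \<Rightarrow> real^3" where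
  "scale3 t p = (\<chi> i. if i = 3 then t * p $ i else p $ i)"

text \<open>Substituting t p3 for the variable of integration turns the primitive from 0 to p3 into
  an integral over the fixed interval [0, 1], ready for differentiation under the integral. Each
  derivative in the third coordinate brings out a factor t; the powers t ^ j make the family closed
  under this.\<close>

definition pint :: "nat \<Rightarrow> (real^3 \<Rightarrow> real) \<Rightarrow> real^3 \<Rightarrow> real" where
  "pint j f p = integral {0..1} (\<lambda>t. t ^ j * f (scale3 t p))"

definition prim :: "(real^3 \<Rightarrow> real) \<Rightarrow> real^3 \<Rightarrow> real" where
  "prim f p = p $ 3 * pint 0 f p"

lemma scale3_in_box:
  assumes "p \<in> Defs.box" "t \<in> {0..1}"
  shows "scale3 t p \<in> Defs.box"
proof -
  have "(t * p $ 3)\<^sup>2 \<le> (p $ 3)\<^sup>2"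
    unfolding power_mult_distrib using assms(2) by (intro mult_left_le_one_le power_le_one) auto
  then show ?thesis using assms(1) by (simp add: in_box_iff scale3_def)
qed

lemma continuous_on_scale3: "continuous_on S (\<lambda>x. scale3 (snd x) (fst x))"
  unfolding scale3_def
proof (rule continuous_on_vec_lambda)
  fix i :: 3
  show "continuous_on S (\<lambda>x. if i = 3 then snd x * fst x $ i else fst x $ i)"
    by (cases "i = 3") (auto intro!: continuous_intros)
qed

lemma continuous_on_scaled:
  assumes "continuous_on Defs.box (f :: real^3 \<Rightarrow> real)" "p \<in> Defs.box"
  shows "continuous_on {0..1} (\<lambda>t. f (scale3 t p))"
proof (rule continuous_on_compose2[OF assms(1)])
  show "continuous_on {0..1} (\<lambda>t. scale3 t p)"
    unfolding scale3_def
  proof (rule continuous_on_vec_lambda)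
    fix i :: 3
    show "continuous_on {0..1} (\<lambda>t. if i = 3 then t * p $ i else p $ i)"
      by (cases "i = 3") (auto intro!: continuous_intros)
  qed
  show "(\<lambda>t. scale3 t p) ` {0..1} \<subseteq> Defs.box"
    using scale3_in_box[OF assms(2)] by blast
qed

lemma sum_axis:
  fixes F :: "3 \<Rightarrow> 'b::real_vector"
  shows "(\<Sum>i\<in>UNIV. (axis k (a :: real) :: real^3) $ i *\<^sub>R F i) = a *\<^sub>R F k"
proof -
  have "(axis k a :: real^3) $ i *\<^sub>R F i = (if i = k then a *\<^sub>R F k else 0)" for i
    by (simp add: axis_def)
  then show ?thesis by (simp add: sum.delta)
qed

lemma bounded_linear_scale3: "bounded_linear (scale3 t)"
  unfolding scale3_def
  by (rule linear_conv_bounded_linear[THEN iffD1]) (auto intro!: linearI simp: vec_eq_iff algebra_simps)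

lemma has_derivative_pint:
  assumes f: "Ck_on (Suc 0) Defs.box f" and p: "p \<in> Defs.box"
  shows "(pint j f has_derivative (\<lambda>h. \<Sum>i\<in>UNIV. h $ i *\<^sub>R pint (if i = 3 then Suc j else j) (pd i f) p)) (at p)"
proof -
  define co where "co i x t = t ^ (if i = 3 then Suc j else j) * pd i f (scale3 t x)" for i x t
  \<comment> \<open>The derivative in x as an element of the Banach space of bounded linear maps,
    which is where \<open>leibniz_rule\<close> integrates it.\<close>
  define fx where "fx x t = (\<Sum>i\<in>UNIV. co i x t *\<^sub>R blinfun_inner_left (axis i 1 :: real^3))" for x t
  have cont_comp: "continuous_on (Defs.box \<times> {0..1}) (\<lambda>x. g (scale3 (snd x) (fst x)))"
    if "continuous_on Defs.box g" for g :: "real^3 \<Rightarrow> real"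
    by (rule continuous_on_compose2[OF that continuous_on_scale3]) (auto intro!: scale3_in_box)
  have cont_t: "continuous_on {0..1} (\<lambda>t. t ^ k * g (scale3 t x))"
    if "continuous_on Defs.box g" "x \<in> Defs.box" for g :: "real^3 \<Rightarrow> real" and x k
    by (intro continuous_intros continuous_on_scaled that)
  have cf: "continuous_on Defs.box f" "continuous_on Defs.box (pd i f)" for i
    using Ck_on_continuous[OF f] Ck_on_continuous[OF Ck_on_pd[OF f]] by auto
  have app: "blinfun_apply (fx x t) h = (\<Sum>i\<in>UNIV. h $ i *\<^sub>R co i x t)" for x t h
    by (simp add: fx_def blinfun.sum_left blinfun.scaleR_left inner_axis mult.commute)
  have "((\<lambda>x. integral (cbox 0 1) (\<lambda>t. t ^ j * f (scale3 t x))) has_derivative blinfun_apply (integral (cbox 0 1) (fx p))) (at p within Defs.box)"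
  proof (rule leibniz_rule[OF _ _ _ p convex_box])
    fix x t assume x: "x \<in> Defs.box" and t: "t \<in> cbox 0 (1::real)"
    have "f differentiable (at (scale3 t x))"
      using f scale3_in_box[OF x] t by simp
    note d = has_derivative_compose[OF bounded_linear_imp_has_derivative[OF bounded_linear_scale3] has_derivative_pd[OF this]]
    have "((\<lambda>x. t ^ j * f (scale3 t x)) has_derivative (\<lambda>h. t ^ j * (\<Sum>i\<in>UNIV. scale3 t h $ i *\<^sub>R pd i f (scale3 t x)))) (at x)"
      by (rule has_derivative_mult_right[OF d])
    then have "((\<lambda>x. t ^ j * f (scale3 t x)) has_derivative blinfun_apply (fx x t)) (at x)"
      by (rule has_derivative_eq_rhs) (auto simp: app co_def scale3_def fun_eq_iff sum_distrib_left intro!: sum.cong)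
    then show "((\<lambda>x. t ^ j * f (scale3 t x)) has_derivative blinfun_apply (fx x t)) (at x within Defs.box)"
      by (rule has_derivative_at_withinI)
  next
    fix x assume "x \<in> Defs.box"
    then show "(\<lambda>t. t ^ j * f (scale3 t x)) integrable_on cbox 0 1"
      using cont_t[OF cf(1)] by (intro integrable_continuous) simp
  next
    show "continuous_on (Defs.box \<times> cbox 0 1) (\<lambda>(x, t). fx x t)"
      unfolding fx_def co_def case_prod_unfold
      using cont_comp[OF cf(2)] by (auto intro!: continuous_intros)
  qed
  moreover have "blinfun_apply (integral (cbox 0 1) (fx p)) h = (\<Sum>i\<in>UNIV. h $ i *\<^sub>R pint (if i = 3 then Suc j else j) (pd i f) p)" for h
  proof -
    have "continuous_on {0..1} (fx p)"
      unfolding fx_def co_def by (intro continuous_intros cont_t cf p)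
    then have "fx p integrable_on cbox 0 1" by (intro integrable_continuous) simp
    then have "blinfun_apply (integral (cbox 0 1) (fx p)) h = integral {0..1} (\<lambda>t. \<Sum>i\<in>UNIV. h $ i *\<^sub>R co i p t)"
      by (subst blinfun_apply_integral) (simp_all add: app)
    also have "\<dots> = (\<Sum>i\<in>UNIV. integral {0..1} (\<lambda>t. h $ i *\<^sub>R co i p t))"
      unfolding co_def by (intro integral_sum integrable_continuous_real continuous_intros cont_t cf p) simp
    finally show ?thesis by (simp add: pint_def co_def)
  qed
  then have "blinfun_apply (integral (cbox 0 1) (fx p)) = (\<lambda>h. \<Sum>i\<in>UNIV. h $ i *\<^sub>R pint (if i = 3 then Suc j else j) (pd i f) p)"
    by (rule ext)
  ultimately show ?thesis
    unfolding at_within_open[OF p open_box] cbox_interval pint_def[abs_def] by (simp only:)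
qed

lemma Ck_on_pint:
  "(\<And>k. Ck_on k Defs.box f) \<Longrightarrow> Ck_on k Defs.box (pint j f)"
proof (induction k arbitrary: f j)
  case 0
  have "isCont (pint j f) p" if "p \<in> Defs.box" for p
    using has_derivative_continuous[OF has_derivative_pint[OF 0 that]] .
  then show ?case by (simp add: continuous_at_imp_continuous_on)
next
  case (Suc k)
  show ?case
    by (rule Ck_on_Suc_pdI[OF open_box has_derivative_pint[OF Suc.prems]])
      (auto intro!: Suc.IH Ck_on_pd Suc.prems)
qed

lemma Ck_on_nth: "open U \<Longrightarrow> Ck_on k U (\<lambda>p :: real^3. p $ i)"
  by (rule Ck_on_linear) (auto intro: bounded_linear_vec_nth)

lemma Ck_on_prim:
  assumes "\<And>k. Ck_on k Defs.box f"
  shows "Ck_on k Defs.box (prim f)"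
  unfolding prim_def[abs_def] by (intro Ck_on_mult Ck_on_nth Ck_on_pint assms open_box)

text \<open>In the third coordinate, the fundamental theorem is applied to t f (p1, p2, t p3) on
  [0, 1]; the derivative of this function consists of the two terms that the product rule for p3
  times \<open>pint\<close> leaves under the integral.\<close>

lemma pd_prim:
  assumes f: "\<And>k. Ck_on k Defs.box f" and p: "p \<in> Defs.box"
  shows "pd 3 (prim f) p = f p" and "i \<noteq> 3 \<Longrightarrow> pd i (prim f) p = prim (pd i f) p"
proof -
  have der: "(prim f has_derivative (\<lambda>h. p $ 3 * (\<Sum>i\<in>UNIV. h $ i *\<^sub>R pint (if i = 3 then Suc 0 else 0) (pd i f) p) + h $ 3 * pint 0 f p)) (at p)"
    unfolding prim_def[abs_def]
    by (rule has_derivative_mult[OF bounded_linear_imp_has_derivative[OF bounded_linear_vec_nth] has_derivative_pint[OF f p]])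
  have pd: "pd i (prim f) p = p $ 3 * pint (if i = 3 then Suc 0 else 0) (pd i f) p + (if i = 3 then pint 0 f p else 0)" for i
    unfolding pd_eq[OF der] sum_axis by (simp add: axis_def)
  then show "i \<noteq> 3 \<Longrightarrow> pd i (prim f) p = prim (pd i f) p" by (simp add: prim_def)
  have "((\<lambda>t. f (scale3 t p) + t * (p $ 3 * pd 3 f (scale3 t p))) has_integral (1 * f (scale3 1 p) - 0 * f (scale3 0 p))) {0..1}"
  proof (rule fundamental_theorem_of_calculus)
    fix t :: real assume t: "t \<in> {0..1}"
    have "f differentiable (at (scale3 t p))"
      using f[of "Suc 0"] scale3_in_box[OF p t] by simp
    note d = has_derivative_pd[OF this]
    have "((\<lambda>t. scale3 t p) has_derivative (\<lambda>s. axis 3 (s * p $ 3))) (at t within {0..1})"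
    proof -
      have eq: "(\<lambda>t. scale3 t p) = (\<lambda>t. axis 3 (t * p $ 3) + scale3 0 p)"
        by (rule ext) (simp add: scale3_def axis_def vec_eq_iff)
      have bl: "bounded_linear (\<lambda>s. axis 3 (s * p $ 3) :: real^3)"
        by (rule linear_conv_bounded_linear[THEN iffD1]) (auto intro!: linearI simp: axis_def vec_eq_iff algebra_simps)
      show ?thesis unfolding eq
        by (rule has_derivative_eq_rhs[OF has_derivative_add[OF bounded_linear_imp_has_derivative[OF bl] has_derivative_const]]) simp
    qed
    from has_derivative_compose[OF this d]
    have "((\<lambda>t. f (scale3 t p)) has_derivative (\<lambda>s. s * (p $ 3 * pd 3 f (scale3 t p)))) (at t within {0..1})"
      unfolding sum_axis by (simp add: mult.assoc)
    from has_derivative_mult[OF has_derivative_ident this]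
    show "((\<lambda>t. t * f (scale3 t p)) has_vector_derivative f (scale3 t p) + t * (p $ 3 * pd 3 f (scale3 t p))) (at t within {0..1})"
      unfolding has_vector_derivative_def by (rule has_derivative_eq_rhs) (simp add: fun_eq_iff algebra_simps)
  qed simp
  from integral_unique[OF this]
  have "integral {0..1} (\<lambda>t. f (scale3 t p) + t * (p $ 3 * pd 3 f (scale3 t p))) = f (scale3 1 p)" by simp
  moreover have "scale3 1 p = p" by (simp add: scale3_def vec_eq_iff)
  moreover have "integral {0..1} (\<lambda>t. f (scale3 t p) + t * (p $ 3 * pd 3 f (scale3 t p))) = pint 0 f p + p $ 3 * pint (Suc 0) (pd 3 f) p"
  proof -
    have i: "(\<lambda>t. f (scale3 t p)) integrable_on {0..1}" "(\<lambda>t. t * (p $ 3 * pd 3 f (scale3 t p))) integrable_on {0..1}"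
      by (intro integrable_continuous_real continuous_intros continuous_on_scaled p Ck_on_continuous[OF f] Ck_on_continuous[OF Ck_on_pd[OF f]])+
    have "integral {0..1} (\<lambda>t. t * (p $ 3 * pd 3 f (scale3 t p))) = p $ 3 * integral {0..1} (\<lambda>t. t * pd 3 f (scale3 t p))"
      by (subst integral_mult_right[symmetric]) (simp add: mult.left_commute)
    then show ?thesis unfolding integral_add[OF i] by (simp add: pint_def)
  qed
  ultimately show "pd 3 (prim f) p = f p" using pd[of 3] by simp
qed

lemma vector_eq_lambda:
  "(vector [a, b] :: 'a::zero^2) = (\<chi> i. if i = 1 then a else b)"
  "(vector [a, b, c] :: 'a::zero^3) = (\<chi> i. if i = 1 then a else if i = 2 then b else c)"
  by (simp_all add: vec_eq_iff forall_2 forall_3)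

lemma Ck_on_if: "Ck_on k U f \<Longrightarrow> Ck_on k U g \<Longrightarrow> Ck_on k U (\<lambda>p. if P then f p else g p)"
  by (cases P) auto

section \<open>The adapted metric\<close>

text \<open>All that is retained of the manifold: m is the density of the volume form in the flow
  box.\<close>

locale flow_chart =
  fixes m :: "real^3 \<Rightarrow> real"
  assumes smooth_m: "\<And>k. Ck_on k Defs.box m"
    and m_pos: "\<And>p. p \<in> Defs.box \<Longrightarrow> m p > 0"
    and m_invariant: "\<And>p. p \<in> Defs.box \<Longrightarrow> pd 1 m p = 0"
begin

definition Y :: "real^3 \<Rightarrow> real" where "Y = prim m"
text \<open>The x-derivative of Y (\<open>pd_Y\<close>), written as a primitive so that its
  smoothness and its own derivatives come from the lemmas on \<open>prim\<close>.\<close>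

definition q :: "real^3 \<Rightarrow> real" where "q = prim (pd 2 m)"

text \<open>n is the differential of Y, and g = dt^2 + dx^2 + dY^2.\<close>

definition n :: "real^3 \<Rightarrow> real^3" where "n p = vector [0, q p, m p]"

definition g :: "real^3 \<Rightarrow> real^3^3" where
  "g p = vector [vector [1, 0, 0], vector [0, 1 + (q p)\<^sup>2, q p * m p], vector [0, q p * m p, (m p)\<^sup>2]]"

definition ginv :: "real^3 \<Rightarrow> real^3^3" where
  "ginv p = vector [vector [1, 0, 0], vector [0, 1, - q p / m p], vector [0, - q p / m p, (1 + (q p)\<^sup>2) / (m p)\<^sup>2]]"

lemma smooth_Y: "Ck_on k Defs.box Y" and smooth_q: "Ck_on k Defs.box q"
  unfolding Y_def q_def by (intro Ck_on_prim smooth_m Ck_on_pd)+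

lemma diff_box: "Ck_on (Suc 0) Defs.box f \<Longrightarrow> p \<in> Defs.box \<Longrightarrow> f differentiable (at p)"
  by simp

text \<open>The mean value theorem along a segment in direction t, on which only the vanishing first
  partial enters.\<close>

lemma m_slice:
  assumes "p \<in> Defs.box" "s \<in> {0<..<1}"
  shows "(\<chi> i. if i = 1 then s else p $ i) \<in> Defs.box" "m (\<chi> i. if i = 1 then s else p $ i) = m p"
proof -
  let ?p = "\<chi> i. if i = 1 then s else p $ i :: real^3"
  show in_box: "?p \<in> Defs.box" using assms by (simp add: in_box_iff)
  have dm: "(m has_derivative (\<lambda>h. \<Sum>i\<in>UNIV. h $ i *\<^sub>R pd i m x)) (at x within Defs.box)" if "x \<in> Defs.box" for x
    by (rule has_derivative_at_withinI[OF has_derivative_pd[OF diff_box[OF smooth_m that]]])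
  have seg: "p + t *\<^sub>R (?p - p) \<in> Defs.box" if "t \<in> {0..1}" for t
    using convexD_alt[OF convex_box assms(1) in_box, of t] that by (simp add: algebra_simps)
  have "((\<lambda>t. m (p + t *\<^sub>R (?p - p))) has_derivative (\<lambda>h. \<Sum>i\<in>UNIV. (h *\<^sub>R (?p - p)) $ i *\<^sub>R pd i m (p + t *\<^sub>R (?p - p)))) (at t within {0..1})"
    if "0 \<le> t" "t \<le> 1" for t
  proof -
    have t: "t \<in> {0..1}" using that by simp
    have "((\<lambda>t. p + t *\<^sub>R (?p - p)) has_derivative (\<lambda>h. h *\<^sub>R (?p - p))) (at t within {0..1})"
      by (auto intro!: derivative_eq_intros)
    from has_derivative_compose[OF this has_derivative_pd[OF diff_box[OF smooth_m seg[OF t]]]] show ?thesis .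
  qed
  from mvt_very_simple[OF zero_le_one this]
  obtain \<theta> where \<theta>: "\<theta> \<in> {0..1}" "m (p + 1 *\<^sub>R (?p - p)) - m (p + 0 *\<^sub>R (?p - p))
      = (\<Sum>i\<in>UNIV. ((1 - 0) *\<^sub>R (?p - p)) $ i *\<^sub>R pd i m (p + \<theta> *\<^sub>R (?p - p)))" by blast
  from \<theta>(2) show "m ?p = m p" using m_invariant[OF seg[OF \<theta>(1)]] by (simp add: sum_3)
qed

text \<open>m factors through the projection to the slice t = 1/2, and therefore so does its
  x-derivative; this spares the exchange of mixed partials.\<close>

lemma pd_1_pd_2_m:
  assumes p: "p \<in> Defs.box"
  shows "pd 1 (pd 2 m) p = 0"
proof -
  define \<pi> where "\<pi> x = (\<chi> i. if i = 1 then 1/2 else x $ i :: real^3)" for x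
  have \<pi>box: "x \<in> Defs.box \<Longrightarrow> \<pi> x \<in> Defs.box" and m\<pi>: "x \<in> Defs.box \<Longrightarrow> m x = m (\<pi> x)" for x
    using m_slice[of x "1/2"] by (auto simp: \<pi>_def)
  have d\<pi>: "(\<pi> has_derivative (\<lambda>h. \<chi> i. if i = 1 then 0 else h $ i)) (at x)" for x
  proof -
    have "\<pi> = (\<lambda>x. (\<chi> i. if i = 1 then 0 else x $ i) + axis 1 (1/2))" by (auto simp: \<pi>_def axis_def vec_eq_iff)
    moreover have "bounded_linear (\<lambda>x. (\<chi> i. if i = 1 then 0 else x $ i) :: real^3)"
      by (rule linear_conv_bounded_linear[THEN iffD1]) (auto intro!: linearI simp: vec_eq_iff)
    ultimately show ?thesis by (auto intro!: derivative_eq_intros bounded_linear_imp_has_derivative)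
  qed
  have eq: "pd 2 m x = pd 2 m (\<pi> x)" if x: "x \<in> Defs.box" for x
  proof -
    have "pd 2 m x = pd 2 (\<lambda>x. m (\<pi> x)) x"
      by (rule pd_cong[OF open_box x m\<pi> diff_box[OF smooth_m x]])
    also have "\<dots> = pd 2 m (\<pi> x)"
      unfolding pd_eq[OF has_derivative_compose[OF d\<pi> has_derivative_pd[OF diff_box[OF smooth_m \<pi>box[OF x]]]]]
      by (simp add: sum_3 axis_def)
    finally show ?thesis .
  qed
  have s: "Ck_on (Suc 0) Defs.box (pd 2 m)" by (rule Ck_on_pd[OF smooth_m])
  have "pd 1 (pd 2 m) p = pd 1 (\<lambda>x. pd 2 m (\<pi> x)) p"
    by (rule pd_cong[OF open_box p eq diff_box[OF s p]])
  also have "\<dots> = 0"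
    unfolding pd_eq[OF has_derivative_compose[OF d\<pi> has_derivative_pd[OF diff_box[OF s \<pi>box[OF p]]]]]
    by (simp add: sum_3 axis_def)
  finally show ?thesis .
qed

lemma prim_0: "(\<And>p. p \<in> Defs.box \<Longrightarrow> f p = 0) \<Longrightarrow> p \<in> Defs.box \<Longrightarrow> prim f p = 0"
  unfolding prim_def pint_def using integral_cong[of "{0..1}" "\<lambda>t. t ^ 0 * f (scale3 t p)" "\<lambda>_. 0"] scale3_in_box by simp

lemma pd_Y: "p \<in> Defs.box \<Longrightarrow> pd 1 Y p = 0" "p \<in> Defs.box \<Longrightarrow> pd 2 Y p = q p" "p \<in> Defs.box \<Longrightarrow> pd 3 Y p = m p"
  unfolding Y_def q_def using pd_prim[OF smooth_m] prim_0[of "pd 1 m"] m_invariant by auto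

lemma pd_q: "p \<in> Defs.box \<Longrightarrow> pd 1 q p = 0" "p \<in> Defs.box \<Longrightarrow> pd 3 q p = pd 2 m p"
  unfolding q_def using pd_prim[OF Ck_on_pd[OF smooth_m]] prim_0[of "pd 1 (pd 2 m)"] pd_1_pd_2_m by auto

lemma derivative_Y: "p \<in> Defs.box \<Longrightarrow> (Y has_derivative (\<lambda>h. h $ 2 * q p + h $ 3 * m p)) (at p)"
  using has_derivative_pd[OF diff_box[OF smooth_Y]] by (simp add: sum_3 pd_Y)

lemma derivative_plane:
  assumes "p \<in> Defs.box" "\<And>y. (f has_derivative f' y) (at y)"
  shows "((\<lambda>p. f (p $ 2, Y p)) has_derivative (\<lambda>h. f' (p $ 2, Y p) (h $ 2, h $ 2 * q p + h $ 3 * m p))) (at p)"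
  by (rule has_derivative_compose[OF _ assms(2)])
    (intro has_derivative_Pair derivative_Y assms(1) bounded_linear_imp_has_derivative bounded_linear_vec_nth)

lemma smooth_plane: "Ck_on k UNIV f \<Longrightarrow> Ck_on k Defs.box (\<lambda>p. f (p $ 2, Y p))"
  by (rule Ck_on_compose[OF open_box open_UNIV]) (auto intro!: Ck_on_Pair Ck_on_nth smooth_Y)

lemma smooth_g: "Ck_on k Defs.box g"
  unfolding g_def[abs_def] vector_eq_lambda power2_eq_square
  by (intro Ck_on_vec Ck_on_if Ck_on_const Ck_on_add Ck_on_mult smooth_q smooth_m open_box)

lemma g_sym: "g p $ i $ j = (if i = j \<and> i \<noteq> 3 then 1 else 0) + n p $ i * n p $ j"
  using exhaust_3[of i] exhaust_3[of j] by (auto simp: g_def n_def power2_eq_square)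

lemma gprod_eq: "gprod g p V W = V $ 1 * W $ 1 + V $ 2 * W $ 2 + (n p \<bullet> V) * (n p \<bullet> W)"
  by (simp add: gprod_def inner_vec_def matrix_vector_mult_def g_sym sum_3 algebra_simps)

lemma n_inner: "n p \<bullet> V = q p * V $ 2 + m p * V $ 3"
  by (simp add: n_def inner_vec_def sum_3)

lemma det_g: "det (g p) = (m p)\<^sup>2"
  by (simp add: det_3 g_def power2_eq_square algebra_simps)

lemma sqrt_det_g: "p \<in> Defs.box \<Longrightarrow> sqrt (det (g p)) = m p"
  using m_pos[of p] by (simp add: det_g)

lemma adapted: "adapted_metric m g"
proof -
  have "gprod g p V V > 0" if "p \<in> Defs.box" "V \<noteq> 0" for p V
  proof -
    have "gprod g p V V = (V $ 1)\<^sup>2 + (V $ 2)\<^sup>2 + (n p \<bullet> V)\<^sup>2" by (simp add: gprod_eq power2_eq_square)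
    moreover have "V $ 1 \<noteq> 0 \<or> V $ 2 \<noteq> 0 \<or> n p \<bullet> V \<noteq> 0"
      using that m_pos[of p] by (auto simp: n_inner vec_eq_iff forall_3)
    ultimately show ?thesis
      by (smt (verit) zero_le_power2 zero_less_power2)
  qed
  moreover have "transpose (g p) = g p" for p
    by (simp add: transpose_def vec_eq_iff forall_3 g_def)
  moreover have "gprod g p dt_field dt_field = 1" for p
    by (simp add: gprod_eq dt_field_def axis_def n_inner)
  ultimately show ?thesis
    unfolding adapted_metric_def riemannian_metric_def smooth_on_def using smooth_g sqrt_det_g by auto
qed

lemma matrix_inv_g:
  assumes "p \<in> Defs.box"
  shows "matrix_inv (g p) = ginv p"
proof -
  have m: "m p \<noteq> 0" using m_pos[OF assms] by simp
  have A: "g p ** ginv p = mat 1" "ginv p ** g p = mat 1"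
    using m by (simp_all add: matrix_matrix_mult_def mat_def vec_eq_iff forall_3 sum_3 g_def ginv_def power2_eq_square divide_simps)
      (simp_all add: algebra_simps)
  have "g p ** matrix_inv (g p) = mat 1 \<and> matrix_inv (g p) ** g p = mat 1"
    unfolding matrix_inv_def by (rule someI[of _ "ginv p"]) (use A in simp)
  then have "matrix_inv (g p) ** (g p ** ginv p) = ginv p" by (simp add: matrix_mul_assoc)
  then show ?thesis by (simp add: A)
qed

text \<open>The metric dual of dY is (1 / m) times the third coordinate field, which is the field
  d/dY of the flattened coordinates.\<close>

lemma ginv_n: "p \<in> Defs.box \<Longrightarrow> (\<Sum>l\<in>UNIV. ginv p $ k $ l * n p $ l) = (if k = 3 then 1 / m p else 0)"
  using exhaust_3[of k] m_pos[of p] by (auto simp: sum_3 ginv_def n_def power2_eq_square divide_simps)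

text \<open>The Hessian of Y in the chart. Its symmetry is the closedness of dY.\<close>

definition H :: "3 \<Rightarrow> 3 \<Rightarrow> real^3 \<Rightarrow> real" where
  "H i j p = pd i (\<lambda>x. n x $ j) p"

lemma derivative_n: "p \<in> Defs.box \<Longrightarrow> ((\<lambda>x. n x $ j) has_derivative (\<lambda>h. \<Sum>i\<in>UNIV. h $ i *\<^sub>R H i j p)) (at p)"
proof -
  assume p: "p \<in> Defs.box"
  have "(\<lambda>x. n x $ j) differentiable (at p)"
    using exhaust_3[of j] diff_box[OF smooth_q p] diff_box[OF smooth_m p] by (auto simp: n_def)
  then show ?thesis unfolding H_def by (rule has_derivative_pd)
qed

lemma H_sym: "p \<in> Defs.box \<Longrightarrow> H i j p = H j i p"
  using exhaust_3[of i] exhaust_3[of j] m_invariant[of p] pd_q[of p]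
  by (auto simp: H_def n_def) (simp_all add: pd_def)

lemma pd_g: "p \<in> Defs.box \<Longrightarrow> pd i (\<lambda>x. g x $ j $ l) p = H i j p * n p $ l + n p $ j * H i l p"
proof -
  assume p: "p \<in> Defs.box"
  have d: "((\<lambda>x. g x $ j $ l) has_derivative
      (\<lambda>h. 0 + (n p $ j * (\<Sum>i\<in>UNIV. h $ i *\<^sub>R H i l p) + (\<Sum>i\<in>UNIV. h $ i *\<^sub>R H i j p) * n p $ l))) (at p)"
    unfolding g_sym by (intro has_derivative_add has_derivative_const has_derivative_mult derivative_n p)
  show ?thesis unfolding pd_eq[OF d] sum_axis by simp
qed

text \<open>The metric is Euclidean in the coordinates t, x, Y, so the symbols are the Hessian of Y
  times the dual of dY. In the computation the symmetry of H cancels all but one pair of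
  terms.\<close>

lemma christoffel_g:
  assumes p: "p \<in> Defs.box"
  shows "christoffel g p k i j = (if k = 3 then H i j p / m p else 0)"
proof -
  have "christoffel g p k i j = (1/2) * (\<Sum>l\<in>UNIV. ginv p $ k $ l * (2 * H i j p * n p $ l))"
    unfolding christoffel_def matrix_inv_g[OF p] pd_g[OF p]
  proof (intro arg_cong[of _ _ "\<lambda>x. 1/2 * x"] sum.cong refl arg_cong[of _ _ "\<lambda>x. _ * x"])
    fix l
    have h: "H j i p = H i j p" "H l i p = H i l p" "H l j p = H j l p" by (rule H_sym[OF p])+
    show "H i j p * n p $ l + n p $ j * H i l p + (H j i p * n p $ l + n p $ i * H j l p) - (H l i p * n p $ j + n p $ i * H l j p)
      = 2 * H i j p * n p $ l"
      unfolding h by (simp add: algebra_simps)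
  qed
  also have "\<dots> = H i j p * (\<Sum>l\<in>UNIV. ginv p $ k $ l * n p $ l)"
    by (simp add: sum_distrib_left mult_ac)
  finally show ?thesis by (simp add: ginv_n[OF p])
qed

lemma levi_civita_g:
  "p \<in> Defs.box \<Longrightarrow> levi_civita g V W p = frechet_derivative W (at p) V
     + axis 3 ((\<Sum>i\<in>UNIV. \<Sum>j\<in>UNIV. H i j p * V $ i * W p $ j) / m p)"
  by (simp add: levi_civita_def christoffel_g vec_eq_iff axis_def sum_divide_distrib)

lemma lam_g: "lam g p = vector [1, 0, 0]"
  by (simp add: lam_def gprod_eq dt_field_def axis_def n_inner vec_eq_iff forall_3)

section \<open>Clifford multiplication\<close>

definition E1 :: "complex^2^2" where "E1 = vector [vector [\<i>, 0], vector [0, - \<i>]]"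
definition E2 :: "complex^2^2" where "E2 = vector [vector [0, -1], vector [1, 0]]"
definition E3 :: "complex^2^2" where "E3 = vector [vector [0, \<i>], vector [\<i>, 0]]"

text \<open>V enters by its components in the orthonormal coframe dt, dx, dY. The matrices square to
  - 1 and satisfy E1 E2 = - E3, hence E1 E2 E3 = 1; E1 is diagonal as \<open>eigen_split\<close>
  demands.\<close>

definition S :: "real^3 \<Rightarrow> real^3 \<Rightarrow> complex^2^2" where
  "S p V = V $ 1 *\<^sub>R E1 + V $ 2 *\<^sub>R E2 + (n p \<bullet> V) *\<^sub>R E3"

lemma S_eq: "S p V = vector [vector [\<i> * V $ 1, - complex_of_real (V $ 2) + \<i> * (n p \<bullet> V)],
    vector [complex_of_real (V $ 2) + \<i> * (n p \<bullet> V), - \<i> * V $ 1]]"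
  by (simp add: S_def E1_def E2_def E3_def vec_eq_iff forall_2 scaleR_conv_of_real[where 'a=complex] mult.commute)

lemma smooth_S: "Ck_on k Defs.box (\<lambda>p. S p V)"
  unfolding S_def n_inner
  by (intro Ck_on_add Ck_on_scaleR Ck_on_mult Ck_on_const smooth_q smooth_m open_box)

lemma linear_S: "linear (S p)"
  by (rule linearI) (simp_all add: S_def inner_add_right scaleR_add_left scaleR_add_right)

lemma eigen_split_S: "eigen_split S"
  by (simp add: eigen_split_def S_eq dt_field_def axis_def n_inner)

definition sig :: "real \<Rightarrow> real \<Rightarrow> real \<Rightarrow> complex^2^2" where
  "sig x y z = vector [vector [\<i> * x, - complex_of_real y + \<i> * z], vector [complex_of_real y + \<i> * z, - \<i> * x]]"

text \<open>Quaternion multiplication with the opposite orientation: minus the dot product minus the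
  cross product.\<close>

lemma sig_mult:
  "sig x y z ** sig x' y' z' = mat (complex_of_real (- (x * x' + y * y' + z * z')))
     + sig (- (y * z' - z * y')) (- (z * x' - x * z')) (- (x * y' - y * x'))"
  by (simp add: sig_def matrix_matrix_mult_def mat_def vec_eq_iff forall_2 sum_2) (simp add: complex_eq_iff)

text \<open>In the coframe the frame e becomes a Euclidean orthonormal triple with positive
  determinant, hence with determinant 1, so its third vector c is the cross product of the other
  two. By \<open>sig_mult\<close> the product is that of - c and c, which is 1.\<close>

lemma S_triple:
  assumes "oriented_orthonormal g p e" "p \<in> Defs.box"
  shows "S p (e 1) ** S p (e 2) ** S p (e 3) = mat 1"
proof -
  define f where "f i = (vector [e i $ 1, e i $ 2, n p \<bullet> e i] :: real^3)" for i
  have orth: "f i \<bullet> f j = (if i = j then 1 else 0)" for i j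
    using assms(1) by (simp add: oriented_orthonormal_def gprod_eq f_def inner_vec_def sum_3)
  have det: "det (\<chi> i. f i) = m p * det (\<chi> i. e i)"
    by (simp add: det_3 f_def n_inner algebra_simps)
  have "(\<chi> i. f i) ** transpose (\<chi> i. f i) = mat 1"
    using orth by (simp add: matrix_matrix_mult_def transpose_def mat_def vec_eq_iff inner_vec_def)
  then have "orthogonal_matrix (\<chi> i. f i)" by (simp add: orthogonal_matrix matrix_left_right_inverse)
  then have "det (\<chi> i. f i) = 1 \<or> det (\<chi> i. f i) = -1" by (rule det_orthogonal_matrix)
  moreover have "det (\<chi> i. f i) > 0"
    using det assms m_pos[of p] by (simp add: oriented_orthonormal_def)
  ultimately have det1: "det (\<chi> i. f i) = 1" by auto
  define a b c where "a = f 1" and "b = f 2" and "c = f 3"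
  have ab: "a \<bullet> a = 1" "b \<bullet> b = 1" "c \<bullet> c = 1" "a \<bullet> b = 0" "a \<bullet> c = 0" "b \<bullet> c = 0"
    using orth by (simp_all add: a_def b_def c_def)
  have d: "cross3 a b \<bullet> c = 1"
    using det1 by (simp add: a_def b_def c_def det_3 cross3_def inner_vec_def sum_3 algebra_simps)
  have "(cross3 a b) \<bullet> (cross3 a b) = (a \<bullet> a) * (b \<bullet> b) - (a \<bullet> b)\<^sup>2"
    by (simp add: cross3_def inner_vec_def sum_3 power2_eq_square algebra_simps)
  \<comment> \<open>The squared length is 1 - 2 + 1.\<close>
  then have "(cross3 a b - c) \<bullet> (cross3 a b - c) = 0"
    using ab d by (simp add: inner_diff_left inner_diff_right inner_commute)
  then have cross: "cross3 a b = c" by simp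
  have sig: "S p (e i) = sig (f i $ 1) (f i $ 2) (f i $ 3)" for i
    by (simp add: S_eq f_def sig_def)
  have c: "c $ 1 = a $ 2 * b $ 3 - a $ 3 * b $ 2" "c $ 2 = a $ 3 * b $ 1 - a $ 1 * b $ 3" "c $ 3 = a $ 1 * b $ 2 - a $ 2 * b $ 1"
    using cross by (auto simp: cross3_def)
  have ab0: "a $ 1 * b $ 1 + a $ 2 * b $ 2 + a $ 3 * b $ 3 = 0" using ab(4) by (simp add: inner_vec_def sum_3)
  have cc: "c $ 1 * c $ 1 + c $ 2 * c $ 2 + c $ 3 * c $ 3 = 1" using ab(3) by (simp add: inner_vec_def sum_3)
  have "S p (e 1) ** S p (e 2) = sig (- c $ 1) (- c $ 2) (- c $ 3)"
    unfolding sig a_def[symmetric] b_def[symmetric] sig_mult c ab0 by (simp add: mat_def vec_eq_iff)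
  then have "S p (e 1) ** S p (e 2) ** S p (e 3) = sig (- c $ 1) (- c $ 2) (- c $ 3) ** sig (c $ 1) (c $ 2) (c $ 3)"
    by (simp add: sig c_def)
  also have "\<dots> = mat 1"
  proof -
    have "- c $ 1 * c $ 1 + - c $ 2 * c $ 2 + - c $ 3 * c $ 3 = - 1" using cc by simp
    then show ?thesis unfolding sig_mult by (simp add: sig_def mat_def vec_eq_iff forall_2)
  qed
  finally show ?thesis .
qed

lemma spinc_S: "spinc_structure g S"
proof -
  have "hadj (S p V) = - S p V" for p V
    by (simp add: hadj_def S_eq vec_eq_iff forall_2)
  moreover have "S p V ** S p W + S p W ** S p V = mat (complex_of_real (- 2 * gprod g p V W))" for p V W
  proof -
    have "S p V ** S p W = mat (complex_of_real (- gprod g p V W))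
       + sig (- (V $ 2 * (n p \<bullet> W) - (n p \<bullet> V) * W $ 2)) (- ((n p \<bullet> V) * W $ 1 - V $ 1 * (n p \<bullet> W))) (- (V $ 1 * W $ 2 - V $ 2 * W $ 1))" for V W
      using sig_mult[of "V $ 1" "V $ 2" "n p \<bullet> V" "W $ 1" "W $ 2" "n p \<bullet> W"]
      by (simp add: S_eq sig_def gprod_eq)
    then show ?thesis
      by (simp add: sig_def gprod_eq mat_def vec_eq_iff forall_2) (simp add: complex_eq_iff algebra_simps)
  qed
  ultimately show ?thesis
    unfolding spinc_structure_def smooth_on_def using smooth_S linear_S S_triple by auto
qed

end

section \<open>Spin connection, Dirac operator and curvature\<close>

lemma Ck_on_gradI:
  assumes "has_grad f f1 f2" "Ck_on k UNIV f1" "Ck_on k UNIV f2"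
  shows "Ck_on (Suc k) UNIV f"
  by (rule Ck_on_SucI[OF open_UNIV has_gradD[OF assms(1)]]) (auto simp: Basis_prod_def assms)

lemma bounded_bilinear_matrix_vector_complex:
  "bounded_bilinear ((*v) :: complex^2^2 \<Rightarrow> complex^2 \<Rightarrow> complex^2)"
  by (rule bilinear_conv_bounded_bilinear[THEN iffD1])
    (auto simp: bilinear_def matrix_vector_mult_def vec_eq_iff sum_2 forall_2 algebra_simps scaleR_conv_of_real[where 'a=complex] intro!: linearI)

lemma mat_mult_vector: "mat c *v x = c *s (x :: complex^2)"
  by (simp add: mat_def matrix_vector_mult_def vec_eq_iff forall_2 sum_2)

context flow_chart
begin

text \<open>In the spin frame of dt, dx, dY the Levi-Civita connection vanishes, so both summands carry the
  same form.\<close>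

definition conn :: "(real^3 \<Rightarrow> real^3) \<Rightarrow> real^3 \<Rightarrow> real^3 \<Rightarrow> complex^2^2" where
  "conn A p V = mat (- \<i> * complex_of_real (A p \<bullet> V))"

lemma smooth_conn:
  assumes "Ck_on k Defs.box A"
  shows "Ck_on k Defs.box (\<lambda>p. conn A p V)"
proof -
  have "bounded_linear (\<lambda>a :: real^3. - \<i> * complex_of_real (a \<bullet> V))"
    by (rule linear_conv_bounded_linear[THEN iffD1]) (auto intro!: linearI simp: inner_add_left algebra_simps scaleR_conv_of_real[where 'a=complex])
  from Ck_on_bounded_linear[OF open_box this assms] show ?thesis
    unfolding conn_def mat_def by (intro Ck_on_vec Ck_on_if Ck_on_const open_box)
qed

text \<open>Only the covector n varies with the point in S, so besides S of the derivative of W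
  there is one term, the Hessian of Y along E3.\<close>

lemma derivative_S:
  assumes p: "p \<in> Defs.box" and W: "(W has_derivative W') (at p)"
  shows "((\<lambda>x. S x (W x)) has_derivative
    (\<lambda>h. S p (W' h) + (\<Sum>i\<in>UNIV. \<Sum>j\<in>UNIV. H i j p * h $ i * W p $ j) *\<^sub>R E3)) (at p)"
proof -
  have Wi: "((\<lambda>x. W x $ i) has_derivative (\<lambda>h. W' h $ i)) (at p)" for i
    by (rule bounded_linear.has_derivative[OF bounded_linear_vec_nth W])
  have "((\<lambda>x. \<Sum>j\<in>UNIV. n x $ j * W x $ j) has_derivative
      (\<lambda>h. \<Sum>j\<in>UNIV. n p $ j * W' h $ j + (\<Sum>i\<in>UNIV. h $ i *\<^sub>R H i j p) * W p $ j)) (at p)"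
    by (intro has_derivative_sum has_derivative_mult derivative_n p Wi)
  then have "((\<lambda>x. n x \<bullet> W x) has_derivative
      (\<lambda>h. n p \<bullet> W' h + (\<Sum>i\<in>UNIV. \<Sum>j\<in>UNIV. H i j p * h $ i * W p $ j))) (at p)"
    unfolding inner_vec_def inner_real_def
    by (rule has_derivative_eq_rhs) (simp add: sum_3 algebra_simps fun_eq_iff)
  from has_derivative_add[OF has_derivative_add[OF has_derivative_scaleR_left[OF Wi[of 1], of E1] has_derivative_scaleR_left[OF Wi[of 2], of E2]]
      has_derivative_scaleR_left[OF this, of E3]]
  show ?thesis
    unfolding S_def by (rule has_derivative_eq_rhs) (simp add: algebra_simps fun_eq_iff)
qed

lemma S_axis3: "p \<in> Defs.box \<Longrightarrow> S p (axis 3 (x / m p)) = x *\<^sub>R E3"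
  using m_pos[of p] by (simp add: S_def n_inner axis_def)

text \<open>The extra term of \<open>derivative_S\<close> is S applied to the Christoffel term. The
  connection form is scalar and commutes with Clifford multiplication, so A is arbitrary.\<close>

lemma leibniz_conn:
  assumes W: "smooth_on Defs.box W" and \<psi>: "smooth_on Defs.box \<psi>" and p: "p \<in> Defs.box"
  shows "cov_deriv (conn A) V (\<lambda>q. S q (W q) *v \<psi> q) p =
    S p (levi_civita g V W p) *v \<psi> p + S p (W p) *v cov_deriv (conn A) V \<psi> p"
proof -
  have "Ck_on (Suc 0) Defs.box W" "Ck_on (Suc 0) Defs.box \<psi>" using W \<psi> by (auto simp: smooth_on_def simp del: Ck_on.simps)
  note dW = Ck_on_Suc_derivative[OF this(1) p] and d\<psi> = Ck_on_Suc_derivative[OF this(2) p]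
  let ?\<kappa> = "\<Sum>i\<in>UNIV. \<Sum>j\<in>UNIV. H i j p * V $ i * W p $ j"
  have "frechet_derivative (\<lambda>q. S q (W q) *v \<psi> q) (at p) V
    = S p (W p) *v frechet_derivative \<psi> (at p) V + (S p (frechet_derivative W (at p) V) + ?\<kappa> *\<^sub>R E3) *v \<psi> p"
    using frechet_derivative_at[OF bounded_bilinear.FDERIV[OF bounded_bilinear_matrix_vector_complex derivative_S[OF p dW] d\<psi>]]
    by (simp add: fun_eq_iff)
  moreover have "S p (levi_civita g V W p) = S p (frechet_derivative W (at p) V) + ?\<kappa> *\<^sub>R E3"
    unfolding levi_civita_g[OF p] linear_add[OF linear_S] S_axis3[OF p] ..
  moreover define c where "c = - \<i> * complex_of_real (A p \<bullet> V)"
  then have "conn A p V *v x = c *s x" for x by (simp only: conn_def mat_mult_vector)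
  ultimately show ?thesis
    by (simp add: cov_deriv_def matrix_vector_right_distrib vector_scalar_commute)
qed

lemma spinc_connection_conn:
  assumes "\<And>k. Ck_on k Defs.box A"
  shows "spinc_connection g S (\<lambda>_. 0) A (conn A)"
proof -
  have "linear (conn A p)" for p
    by (rule linearI) (simp_all add: conn_def mat_def vec_eq_iff inner_add_right scaleR_conv_of_real[where 'a=complex] algebra_simps)
  moreover have "hadj (conn A p V) = - conn A p V" for p V
    by (simp add: hadj_def conn_def mat_def vec_eq_iff)
  moreover have "trace (conn A p V) = - \<i> * complex_of_real ((0 + 2 *\<^sub>R A p) \<bullet> V)" for p V
    by (simp add: trace_def conn_def mat_def sum_2)
  ultimately show ?thesis
    unfolding spinc_connection_def using leibniz_conn smooth_conn[OF assms] by (auto simp: smooth_on_def)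
qed

text \<open>The constant section (1, 0) is parallel for the zero form.\<close>

lemma canonical_0: "canonical_connection g S (\<lambda>_. 0)"
proof -
  have s0: "Ck_on k Defs.box (\<lambda>_ :: real^3. 0 :: real^3)" for k by (rule Ck_on_const) simp
  have "dirac g S (conn (\<lambda>_. 0)) (\<lambda>q. vector [1, 0]) p = 0" for p
    by (simp add: dirac_def cov_deriv_def conn_def mat_mult_vector)
  then show ?thesis
    unfolding canonical_connection_def smooth_on_def using spinc_connection_conn[OF s0] s0 by auto
qed

text \<open>The frame dual to dt, dx, dY is d/dt, d/dx2 - (q / m) d/dx3 and (1 / m) d/dx3. On a
  spinor with values in E the two components of the Dirac operator are i times the covariant
  t-derivative and the Cauchy-Riemann operator of the other two fields.\<close>

lemma dirac_first_component:
  assumes p: "p \<in> Defs.box" and \<alpha>: "(\<alpha> has_derivative \<alpha>') (at p)"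
    and 1: "\<alpha>' (axis 1 1) - \<i> * A p $ 1 * \<alpha> p = 0"
    and 2: "(\<alpha>' (axis 2 1) - \<i> * A p $ 2 * \<alpha> p) - (q p / m p) * (\<alpha>' (axis 3 1) - \<i> * A p $ 3 * \<alpha> p)
      + \<i> * (1 / m p) * (\<alpha>' (axis 3 1) - \<i> * A p $ 3 * \<alpha> p) = 0"
  shows "dirac g S (conn A) (\<lambda>x. vector [\<alpha> x, 0]) p = 0"
proof -
  have m: "m p \<noteq> 0" using m_pos[OF p] by simp
  define x where "x j = \<alpha>' (axis j 1) - \<i> * A p $ j * \<alpha> p" for j
  have bl: "bounded_linear (\<lambda>z :: complex. vector [z, 0] :: complex^2)"
    by (rule linear_conv_bounded_linear[THEN iffD1]) (auto intro!: linearI simp: vec_eq_iff forall_2)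
  have cov: "cov_deriv (conn A) (axis j 1) (\<lambda>x. vector [\<alpha> x, 0]) p = vector [x j, 0]" for j
    unfolding cov_deriv_def frechet_derivative_at[OF bounded_linear.has_derivative[OF bl \<alpha>], symmetric]
    by (simp add: conn_def mat_mult_vector x_def vec_eq_iff forall_2 inner_axis)
  have Sx: "S p (axis i 1) *v vector [z, 0] = vector [if i = 1 then \<i> * z else 0, (if i = 2 then z else 0) + \<i> * n p $ i * z]" for i z
    by (simp add: S_eq matrix_vector_mult_def vec_eq_iff forall_2 sum_2 axis_def inner_axis[unfolded axis_def] inner_axis algebra_simps)
  have x1: "x 1 = 0" using 1 by (simp add: x_def)
  have x2: "x 2 - (q p / m p) * x 3 + \<i> * (1 / m p) * x 3 = 0" using 2 by (simp add: x_def)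
  have "dirac g S (conn A) (\<lambda>x. vector [\<alpha> x, 0]) p = (\<Sum>i\<in>UNIV. \<Sum>j\<in>UNIV. ginv p $ i $ j *\<^sub>R
     vector [if i = 1 then \<i> * x j else 0, (if i = 2 then x j else 0) + \<i> * n p $ i * x j])"
    unfolding dirac_def matrix_inv_g[OF p] cov Sx ..
  also have "\<dots> = vector [\<i> * x 1, x 2 - (q p / m p) * x 3 + \<i> * (1 / m p) * x 3]"
  proof -
    have e: "complex_of_real (n p $ 1) = 0" "n p $ 2 = q p" "n p $ 3 = m p" by (simp_all add: n_def)
    show ?thesis
      using m by (simp add: sum_3 ginv_def e vec_eq_iff forall_2 scaleR_conv_of_real[where 'a=complex] divide_simps power2_eq_square)
        (simp add: algebra_simps)
  qed
  also have "\<dots> = 0" by (simp only: x1 x2) (simp add: vec_eq_iff forall_2)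
  finally show ?thesis .
qed

lemma spinor_form_first: "spinor_form S (\<lambda>x. vector [\<alpha> x, 0]) p = vector [(cmod (\<alpha> p))\<^sup>2, 0, 0]"
proof -
  have "(cmod z)\<^sup>2 = Re z * Re z + Im z * Im z" for z by (metis cmod_power2 power2_eq_square)
  then show ?thesis
    by (simp add: spinor_form_def hprod_def S_eq matrix_vector_mult_def sum_2 vec_eq_iff forall_3 axis_def algebra_simps)
qed

lemma hodge_g:
  assumes p: "p \<in> Defs.box"
  shows "hodge_2 g p (vector [vector [0, 0, 0], vector [0, 0, f], vector [0, - f, 0]]) = vector [f / m p, 0, 0]"
proof -
  have m: "m p \<noteq> 0" using m_pos[OF p] by simp
  let ?F = "vector [vector [0, 0, 0], vector [0, 0, f], vector [0, - f, 0]] :: real^3^3"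
  have "ginv p ** ?F ** transpose (ginv p) = vector [vector [0, 0, 0], vector [0, 0, f / (m p)\<^sup>2], vector [0, - f / (m p)\<^sup>2, 0]]"
    using m by (simp add: ginv_def matrix_matrix_mult_def transpose_def vec_eq_iff forall_3 sum_3 divide_simps power2_eq_square)
      (simp add: algebra_simps)
  then show ?thesis
    unfolding hodge_2_def Let_def matrix_inv_g[OF p] sqrt_det_g[OF p] using m
    by (simp add: vec_eq_iff forall_3 power2_eq_square)
qed

text \<open>The form A1 dx + A2 dY.\<close>

definition pullback :: "(real \<times> real \<Rightarrow> real) \<Rightarrow> (real \<times> real \<Rightarrow> real) \<Rightarrow> real^3 \<Rightarrow> real^3" where
  "pullback A1 A2 p = vector [0, A1 (p $ 2, Y p) + q p * A2 (p $ 2, Y p), m p * A2 (p $ 2, Y p)]"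

lemma smooth_pullback:
  assumes "Ck_on k UNIV A1" "Ck_on k UNIV A2"
  shows "Ck_on k Defs.box (pullback A1 A2)"
  unfolding pullback_def[abs_def] vector_eq_lambda
  by (intro Ck_on_vec Ck_on_if Ck_on_const Ck_on_add Ck_on_mult smooth_q smooth_m smooth_plane assms open_box)

lemma pd_plane:
  assumes p: "p \<in> Defs.box" and f: "has_grad f f1 f2"
  shows "((\<lambda>p. f (p $ 2, Y p)) has_derivative (\<lambda>h. h $ 2 * f1 (p $ 2, Y p) + (h $ 2 * q p + h $ 3 * m p) * f2 (p $ 2, Y p))) (at p)"
  using derivative_plane[OF p has_gradD[OF f]] by simp

text \<open>Exterior derivatives commute with pullback, and dx \<and> dY is m dx2 \<and> dx3. In
  components, the terms with derivatives of q and m cancel because dY is closed.\<close>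

lemma curvature_pullback:
  assumes p: "p \<in> Defs.box" and A: "has_grad A1 A11 A12" "has_grad A2 A21 A22"
  defines "f \<equiv> m p * (A21 (p $ 2, Y p) - A12 (p $ 2, Y p))"
  shows "ext_d (pullback A1 A2) p = vector [vector [0, 0, 0], vector [0, 0, f], vector [0, - f, 0]]"
proof -
  let ?y = "(p $ 2, Y p)"
  have dq: "(q has_derivative (\<lambda>h. \<Sum>i\<in>UNIV. h $ i *\<^sub>R pd i q p)) (at p)" "(m has_derivative (\<lambda>h. \<Sum>i\<in>UNIV. h $ i *\<^sub>R pd i m p)) (at p)"
    by (intro has_derivative_pd diff_box smooth_q smooth_m p)+
  have c1: "(\<lambda>x. pullback A1 A2 x $ 1) = (\<lambda>x. 0)" "(\<lambda>x. pullback A1 A2 x $ 2) = (\<lambda>p. A1 (p $ 2, Y p) + q p * A2 (p $ 2, Y p))"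
    "(\<lambda>x. pullback A1 A2 x $ 3) = (\<lambda>p. m p * A2 (p $ 2, Y p))" by (simp_all add: pullback_def)
  have p1: "pd i (\<lambda>x. pullback A1 A2 x $ 1) p = 0" for i unfolding c1 pd_def by simp
  have d2: "((\<lambda>x. pullback A1 A2 x $ 2) has_derivative (\<lambda>h. (h $ 2 * A11 ?y + (h $ 2 * q p + h $ 3 * m p) * A12 ?y)
     + (q p * (h $ 2 * A21 ?y + (h $ 2 * q p + h $ 3 * m p) * A22 ?y) + (\<Sum>i\<in>UNIV. h $ i *\<^sub>R pd i q p) * A2 ?y))) (at p)"
    unfolding c1 by (intro has_derivative_add has_derivative_mult pd_plane p A dq)
  have d3: "((\<lambda>x. pullback A1 A2 x $ 3) has_derivative (\<lambda>h.
     m p * (h $ 2 * A21 ?y + (h $ 2 * q p + h $ 3 * m p) * A22 ?y) + (\<Sum>i\<in>UNIV. h $ i *\<^sub>R pd i m p) * A2 ?y)) (at p)"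
    unfolding c1 by (intro has_derivative_mult pd_plane p A dq)
  have v: "pd 1 (\<lambda>x. pullback A1 A2 x $ 2) p = 0" "pd 1 (\<lambda>x. pullback A1 A2 x $ 3) p = 0"
    "pd 2 (\<lambda>x. pullback A1 A2 x $ 3) p - pd 3 (\<lambda>x. pullback A1 A2 x $ 2) p = f"
    unfolding pd_eq[OF d2] pd_eq[OF d3] sum_axis using p
    by (simp_all add: axis_def m_invariant pd_q f_def algebra_simps)
  then have v': "pd 3 (\<lambda>x. pullback A1 A2 x $ 2) p - pd 2 (\<lambda>x. pullback A1 A2 x $ 3) p = - f" by simp
  show ?thesis
    by (simp add: ext_d_def vec_eq_iff forall_3 p1 v v')
qed

text \<open>\<open>holo\<close> and \<open>curv\<close> are the vortex equations on the plane. For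
  t-invariant data with second component 0, the remaining components of the Seiberg-Witten equations
  hold trivially.\<close>

lemma sw_from_plane:
  assumes A: "has_grad A1 A11 A12" "has_grad A2 A21 A22" and sA: "\<And>k. Ck_on k UNIV A1" "\<And>k. Ck_on k UNIV A2"
    and a: "\<And>y. (a has_derivative (\<lambda>h. complex_of_real (fst h) * ax y + complex_of_real (snd h) * ay y)) (at y)" and sa: "\<And>k. Ck_on k UNIV a"
    and holo: "\<And>y. (ax y - \<i> * A1 y * a y) + \<i> * (ay y - \<i> * A2 y * a y) = 0"
    and curv: "\<And>y. A21 y - A12 y = r * (1 - (cmod (a y))\<^sup>2)"
  shows "sw_solution g S r (\<lambda>p. vector [a (p $ 2, Y p), 0]) (pullback A1 A2)"
    and "p \<in> Defs.box \<Longrightarrow> energy_density g (pullback A1 A2) p = m p * (r * (1 - (cmod (a (p $ 2, Y p)))\<^sup>2))"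
proof -
  have sAb: "Ck_on k Defs.box (pullback A1 A2)" for k by (intro smooth_pullback sA)
  have s\<psi>: "Ck_on k Defs.box (\<lambda>p. vector [a (p $ 2, Y p), 0] :: complex^2)" for k
    unfolding vector_eq_lambda by (intro Ck_on_vec Ck_on_if Ck_on_const smooth_plane sa open_box)
  have F: "ext_d (pullback A1 A2) p = vector [vector [0, 0, 0], vector [0, 0, m p * (r * (1 - (cmod (a (p $ 2, Y p)))\<^sup>2))],
      vector [0, - (m p * (r * (1 - (cmod (a (p $ 2, Y p)))\<^sup>2))), 0]]" if "p \<in> Defs.box" for p
    unfolding curvature_pullback[OF that A] curv ..
  have hodge: "hodge_2 g p (ext_d (pullback A1 A2) p) = r *\<^sub>R (lam g p - spinor_form S (\<lambda>p. vector [a (p $ 2, Y p), 0]) p)" if "p \<in> Defs.box" for p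
    unfolding F[OF that] hodge_g[OF that] lam_g spinor_form_first using m_pos[OF that]
    by (simp add: vec_eq_iff forall_3)
  have dir: "dirac g S (conn (pullback A1 A2)) (\<lambda>p. vector [a (p $ 2, Y p), 0]) p = 0" if p: "p \<in> Defs.box" for p
  proof (rule dirac_first_component[OF p derivative_plane[OF p a]])
    let ?y = "(p $ 2, Y p)"
    have m: "m p \<noteq> 0" using m_pos[OF p] by simp
    show "complex_of_real (fst ((axis 1 1 :: real^3) $ 2, (axis 1 1 :: real^3) $ 2 * q p + (axis 1 1 :: real^3) $ 3 * m p)) * ax ?y + complex_of_real (snd ((axis 1 1 :: real^3) $ 2, (axis 1 1 :: real^3) $ 2 * q p + (axis 1 1 :: real^3) $ 3 * m p)) * ay ?y
        - \<i> * pullback A1 A2 p $ 1 * a ?y = 0"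
      by (simp add: axis_def pullback_def)
    \<comment> \<open>The terms with q cancel, as the pulled back form and the dual frame belong to
      the same coordinates.\<close>
    have "ax ?y + q p * ay ?y - \<i> * (A1 ?y + q p * A2 ?y) * a ?y - q p / m p * (m p * ay ?y - \<i> * (m p * A2 ?y) * a ?y)
       + \<i> * (1 / m p) * (m p * ay ?y - \<i> * (m p * A2 ?y) * a ?y) = (ax ?y - \<i> * A1 ?y * a ?y) + \<i> * (ay ?y - \<i> * A2 ?y * a ?y)"
      using m by (simp add: field_simps)
    then show "complex_of_real (fst ((axis 2 1 :: real^3) $ 2, (axis 2 1 :: real^3) $ 2 * q p + (axis 2 1 :: real^3) $ 3 * m p)) * ax ?y + complex_of_real (snd ((axis 2 1 :: real^3) $ 2, (axis 2 1 :: real^3) $ 2 * q p + (axis 2 1 :: real^3) $ 3 * m p)) * ay ?y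
        - \<i> * pullback A1 A2 p $ 2 * a ?y
      - complex_of_real (q p / m p) * (complex_of_real (fst ((axis 3 1 :: real^3) $ 2, (axis 3 1 :: real^3) $ 2 * q p + (axis 3 1 :: real^3) $ 3 * m p)) * ax ?y + complex_of_real (snd ((axis 3 1 :: real^3) $ 2, (axis 3 1 :: real^3) $ 2 * q p + (axis 3 1 :: real^3) $ 3 * m p)) * ay ?y
        - \<i> * pullback A1 A2 p $ 3 * a ?y)
      + \<i> * complex_of_real (1 / m p) * (complex_of_real (fst ((axis 3 1 :: real^3) $ 2, (axis 3 1 :: real^3) $ 2 * q p + (axis 3 1 :: real^3) $ 3 * m p)) * ax ?y + complex_of_real (snd ((axis 3 1 :: real^3) $ 2, (axis 3 1 :: real^3) $ 2 * q p + (axis 3 1 :: real^3) $ 3 * m p)) * ay ?y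
        - \<i> * pullback A1 A2 p $ 3 * a ?y) = 0"
      unfolding holo by (simp add: axis_def pullback_def)
  qed
  show "sw_solution g S r (\<lambda>p. vector [a (p $ 2, Y p), 0]) (pullback A1 A2)"
    unfolding sw_solution_def smooth_on_def
    by (intro conjI allI ballI exI[of _ "\<lambda>_. 0"] exI[of _ "conn (pullback A1 A2)"] open_box sAb s\<psi> hodge canonical_0
        spinc_connection_conn[OF sAb] dir)
  show "energy_density g (pullback A1 A2) p = m p * (r * (1 - (cmod (a (p $ 2, Y p)))\<^sup>2))" if "p \<in> Defs.box"
    unfolding energy_density_def lam_g F[OF that] by (simp add: wedge_1_2_def)
qed

end

section \<open>From u to a section and a connection\<close>

context vortex_config
begin

text \<open>The denominators of Q are absorbed into v, so that the zeros sit in the holomorphic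
  factor: |a|^2 = exp v |pol|^2.\<close>

definition v :: "real \<times> real \<Rightarrow> real" where
  "v p = u p + (\<Sum>i<N. (-1) * ln (sqd (w i) p + \<mu>))"

definition pol :: "complex \<Rightarrow> complex" where
  "pol z = (\<Prod>i<N. z - Complex (fst (w i)) (snd (w i)))"

definition amp :: "real \<times> real \<Rightarrow> complex" where
  "amp p = complex_of_real (exp (v p / 2)) * pol (Complex (fst p) (snd p))"

lemma cmod_amp: "(cmod (amp p))\<^sup>2 = Q p * exp (u p)"
proof -
  have "(cmod (pol (Complex (fst p) (snd p))))\<^sup>2 = (\<Prod>i<N. sqd (w i) p)"
    by (simp add: pol_def prod_norm[symmetric] prod_power_distrib cmod_power2 sqd_def)
  moreover have "(exp (v p / 2))\<^sup>2 = exp (u p) * (\<Prod>i<N. rat \<mu> (w i) p)"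
  proof -
    have e: "exp ((-1) * ln (sqd a p + \<mu>)) = rat \<mu> a p" for a
      using sqd_add_pos[OF \<mu>_pos, of a p] by (simp add: exp_minus rat_def inverse_eq_divide)
    have "(exp (v p / 2))\<^sup>2 = exp (v p)" by (simp add: power2_eq_square mult_exp_exp)
    also have "\<dots> = exp (u p) * (\<Prod>i<N. exp ((-1) * ln (sqd (w i) p + \<mu>)))"
      unfolding v_def exp_add exp_sum[OF finite_lessThan] ..
    finally show ?thesis unfolding e .
  qed
  ultimately show ?thesis
    by (simp add: amp_def norm_mult power_mult_distrib Q_def factor_eq prod.distrib)
qed

lemma pol_derivative: "\<exists>d. (pol has_field_derivative d) (at z)"
proof -
  have "\<exists>d. ((\<lambda>z. \<Prod>i<k. z - b i) has_field_derivative d) (at z)" for k and b :: "nat \<Rightarrow> complex"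
  proof (induction k)
    case (Suc k)
    then obtain d where "((\<lambda>z. \<Prod>i<k. z - b i) has_field_derivative d) (at z)" by blast
    moreover have "((\<lambda>z. z - b k) has_field_derivative 1) (at z)" by (auto intro!: derivative_eq_intros)
    ultimately have "((\<lambda>z. (\<Prod>i<k. z - b i) * (z - b k)) has_field_derivative d * (z - b k) + 1 * (\<Prod>i<k. z - b i)) (at z)"
      by (rule DERIV_mult)
    then show ?case unfolding prod.lessThan_Suc by blast
  qed (auto intro!: exI derivative_eq_intros)
  then show ?thesis by (simp add: pol_def[abs_def])
qed

lemma bounded_linear_Complex: "bounded_linear (\<lambda>p. Complex (fst p) (snd p))"
  by (rule linear_conv_bounded_linear[THEN iffD1]) (auto intro!: linearI simp: complex_eq_iff)

text \<open>The operator d/dx + i d/dy annihilates the holomorphic factor, so on \<open>amp\<close>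
  it acts as multiplication by half of its value on v.\<close>

lemma vortex_data:
  obtains vx vy vxx vxy vyx vyy ax ay where
    "has_grad v vx vy" "has_grad vx vxx vxy" "has_grad vy vyx vyy"
    "\<And>k. Ck_on k UNIV vx" "\<And>k. Ck_on k UNIV vy" "\<And>p. vxx p + vyy p = - D p"
    "\<And>y. (amp has_derivative (\<lambda>h. complex_of_real (fst h) * ax y + complex_of_real (snd h) * ay y)) (at y)"
    "\<And>y. ax y + \<i> * ay y = (complex_of_real (vx y) / 2 + \<i> * (complex_of_real (vy y) / 2)) * amp y"
    "\<And>k. Ck_on k UNIV amp"
proof -
  obtain u1 u2 where u: "has_grad u u1 u2" "Cb (Suc 0) u1" "Cb (Suc 0) u2" using Cb_u by (rule Cb_SucE)
  obtain u11 u12 where u1: "has_grad u1 u11 u12" using u(2) by (rule Cb_SucE)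
  obtain u21 u22 where u2: "has_grad u2 u21 u22" using u(3) by (rule Cb_SucE)
  have Cu: "Cb k u1" "Cb k u2" for k using Cb_gradD[OF Cb_u u(1)] by auto
  have cm: "has_grad f f1 f2 \<Longrightarrow> has_grad (\<lambda>p. a * f p) (\<lambda>p. a * f1 p) (\<lambda>p. a * f2 p)" for f f1 f2 and a :: real
    using has_grad_mult[OF has_grad_const[of a], of f f1 f2] by simp
  define vx where "vx p = u1 p + (\<Sum>i<N. (-1) * (2 * ratx \<mu> (w i) p))" for p
  define vy where "vy p = u2 p + (\<Sum>i<N. (-1) * (2 * raty \<mu> (w i) p))" for p
  define vxx where "vxx p = u11 p + (\<Sum>i<N. (-1) * (2 * (rat \<mu> (w i) p - 2 * (ratx \<mu> (w i) p * ratx \<mu> (w i) p))))" for p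
  define vxy where "vxy p = u12 p + (\<Sum>i<N. (-1) * (2 * (-2 * (ratx \<mu> (w i) p * raty \<mu> (w i) p))))" for p
  define vyx where "vyx p = u21 p + (\<Sum>i<N. (-1) * (2 * (-2 * (ratx \<mu> (w i) p * raty \<mu> (w i) p))))" for p
  define vyy where "vyy p = u22 p + (\<Sum>i<N. (-1) * (2 * (rat \<mu> (w i) p - 2 * (raty \<mu> (w i) p * raty \<mu> (w i) p))))" for p
  have gv: "has_grad v vx vy"
    unfolding v_def[abs_def] vx_def[abs_def] vy_def[abs_def] by (intro has_grad_add has_grad_sum cm has_grad_ln_sqd u \<mu>_pos)
  have gvx: "has_grad vx vxx vxy"
    unfolding vxx_def[abs_def] vx_def[abs_def] vxy_def[abs_def] by (intro has_grad_add has_grad_sum cm has_grad_ratx u1 \<mu>_pos)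
  have gvy: "has_grad vy vyx vyy"
    unfolding vyy_def[abs_def] vy_def[abs_def] vyx_def[abs_def] by (intro has_grad_add has_grad_sum cm has_grad_raty u2 \<mu>_pos)
  have Cbv: "Cb k vx" "Cb k vy" for k
    unfolding vx_def[abs_def] vy_def[abs_def]
    by (intro Cb_add Cb_sum Cb_cmult Cu; simp add: Cb_rat[OF \<mu>_pos])+
  have sv: "Ck_on k UNIV vx" "Ck_on k UNIV vy" for k using Ck_on_has_grad Cbv by auto
  have sv0: "Ck_on k UNIV v" for k
    using Ck_on_SucD[OF Ck_on_gradI[OF gv sv]] .
  have lap: "vxx p + vyy p = - D p" for p
  proof -
    have "vxx p + vyy p = (u11 p + u22 p) - (\<Sum>i<N. 2 * (rat \<mu> (w i) p - 2 * (ratx \<mu> (w i) p * ratx \<mu> (w i) p)) + 2 * (rat \<mu> (w i) p - 2 * (raty \<mu> (w i) p * raty \<mu> (w i) p)))"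
      unfolding vxx_def vyy_def by (simp add: sum.distrib sum_negf sum_subtractf sum_distrib_left[symmetric])
    also have "\<dots> = (u11 p + u22 p) - g0 p"
      unfolding g0_def using sqd_add_pos[OF \<mu>_pos, of "w _" p] by (intro arg_cong2[where f="(-)"] refl sum.cong laplacian_ln_sqd) (simp add: less_imp_neq[symmetric])
    finally show ?thesis unfolding laplacian_u[OF u(1) u1 u2] by (simp add: D_def algebra_simps)
  qed
  obtain P' where P': "\<And>z. (pol has_field_derivative P' z) (at z)" using pol_derivative by metis
  define e where "e y = complex_of_real (exp (v y / 2))" for y
  let ?z = "\<lambda>y :: real \<times> real. Complex (fst y) (snd y)"
  define ax where "ax y = e y * (vx y / 2) * pol (?z y) + e y * P' (?z y)" for y
  define ay where "ay y = e y * (vy y / 2) * pol (?z y) + e y * (P' (?z y) * \<i>)" for y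
  have de: "(e has_derivative (\<lambda>h. complex_of_real (fst h * (exp (v y / 2) * (1/2) * vx y) + snd h * (exp (v y / 2) * (1/2) * vy y)))) (at y)" for y
  proof -
    have "has_grad (\<lambda>y. exp (v y / 2)) (\<lambda>y. exp (v y / 2) * (1/2) * vx y) (\<lambda>y. exp (v y / 2) * (1/2) * vy y)"
      by (rule has_grad_chain[OF gv, where h="\<lambda>t. exp (t / 2)"]) (auto intro!: derivative_eq_intros)
    from bounded_linear.has_derivative[OF bounded_linear_of_real has_gradD[OF this]] show ?thesis
      unfolding e_def[abs_def] .
  qed
  have dp: "((\<lambda>y. pol (?z y)) has_derivative (\<lambda>h. P' (?z y) * ?z h)) (at y)" for y
    using has_derivative_compose[OF bounded_linear_imp_has_derivative[OF bounded_linear_Complex] P'[of "?z y", unfolded has_field_derivative_def]]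
    by simp
  have da: "(amp has_derivative (\<lambda>h. complex_of_real (fst h) * ax y + complex_of_real (snd h) * ay y)) (at y)" for y
  proof -
    have amp: "amp = (\<lambda>y. e y * pol (?z y))" by (simp only: amp_def[abs_def] e_def)
    show ?thesis unfolding amp
      by (rule has_derivative_eq_rhs[OF has_derivative_mult[OF de dp]])
        (simp add: fun_eq_iff ax_def ay_def e_def Complex_eq algebra_simps)
  qed
  have holo: "ax y + \<i> * ay y = (complex_of_real (vx y) / 2 + \<i> * (complex_of_real (vy y) / 2)) * amp y" for y
    by (simp add: ax_def ay_def amp_def e_def algebra_simps)
  have sa: "Ck_on k UNIV amp" for k
  proof -
    have "Ck_on k UNIV (\<lambda>y. exp ((1/2) * v y))"
      by (rule Ck_on_compose[OF open_UNIV open_UNIV Ck_on_exp]) (intro Ck_on_mult Ck_on_const sv0 open_UNIV subset_UNIV)+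
    then have "Ck_on k UNIV (\<lambda>y. complex_of_real (exp (v y / 2)))"
      using Ck_on_bounded_linear[OF open_UNIV bounded_linear_of_real] by simp
    moreover have "Ck_on k UNIV (\<lambda>y. ?z y + (- Complex (fst (w i)) (snd (w i))))" for i
      by (intro Ck_on_add Ck_on_const Ck_on_linear bounded_linear_Complex open_UNIV)
    then have "Ck_on k UNIV (\<lambda>y. pol (?z y))"
      unfolding pol_def by (intro Ck_on_prod open_UNIV) simp
    ultimately show ?thesis
      unfolding amp_def[abs_def] by (intro Ck_on_mult open_UNIV)
  qed
  from that[OF gv gvx gvy sv lap da holo sa] show ?thesis .
qed

end

lemma (in flow_chart) vortex_solution:
  assumes "vortex_config N r"
  shows "\<exists>\<psi> A. sw_solution g S r \<psi> A \<and>
    (\<forall>p\<in>Defs.box. energy_density g A p = m p * (vortex_curvature w N r (p $ 2, Y p) / 2))"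
proof -
  interpret V: vortex_config w N r by fact
  obtain vx vy vxx vxy vyx vyy ax ay where
    "has_grad V.v vx vy" and g: "has_grad vx vxx vxy" "has_grad vy vyx vyy"
    and s: "\<And>k. Ck_on k UNIV vx" "\<And>k. Ck_on k UNIV vy" and lap: "\<And>p. vxx p + vyy p = - V.D p"
    and a: "\<And>y. (V.amp has_derivative (\<lambda>h. complex_of_real (fst h) * ax y + complex_of_real (snd h) * ay y)) (at y)"
    and ho: "\<And>y. ax y + \<i> * ay y = (complex_of_real (vx y) / 2 + \<i> * (complex_of_real (vy y) / 2)) * V.amp y"
    and sa: "\<And>k. Ck_on k UNIV V.amp" by (rule V.vortex_data) (rule that, assumption+)
  have cm: "has_grad f f1 f2 \<Longrightarrow> has_grad (\<lambda>p. a * f p) (\<lambda>p. a * f1 p) (\<lambda>p. a * f2 p)" for f f1 f2 and a :: real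
    using has_grad_mult[OF has_grad_const[of a], of f f1 f2] by simp
  have sc: "Ck_on k UNIV f \<Longrightarrow> Ck_on k UNIV (\<lambda>p. a * f p)" for k a and f :: "real \<times> real \<Rightarrow> real"
    by (intro Ck_on_mult Ck_on_const open_UNIV)
  \<comment> \<open>The connection is A1 = vy / 2, A2 = - vx / 2: it cancels that multiplier, and
    its curl is minus half the Laplacian of v, that is D / 2.\<close>
  have holo: "(ax y - \<i> * complex_of_real (1 / 2 * vy y) * V.amp y) + \<i> * (ay y - \<i> * complex_of_real (- 1 / 2 * vx y) * V.amp y) = 0" for y
    using ho[of y] by (simp add: algebra_simps)
  have curv: "- 1 / 2 * vxx y - 1 / 2 * vyy y = r * (1 - (cmod (V.amp y))\<^sup>2)" for y
    using lap[of y] unfolding V.cmod_amp V.D_def by (simp add: algebra_simps)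
  note sw = sw_from_plane[OF cm[OF g(2)] cm[OF g(1)] sc[OF s(2)] sc[OF s(1)] a sa holo curv]
  have e: "r * (1 - (cmod (V.amp y))\<^sup>2) = vortex_curvature w N r y / 2" for y
    unfolding V.cmod_amp vortex_curvature_def V.D_def by simp
  show ?thesis
    using sw(1) sw(2)[unfolded e] by blast
qed

section \<open>Flattening coordinates\<close>

text \<open>Links the iterated product, on which Fubini's theorem acts, with \<open>real^3\<close>;
  by \<open>lborel_cons3\<close> it preserves Lebesgue measure.\<close>

definition cons3 :: "real \<times> real \<times> real \<Rightarrow> real^3" where
  "cons3 z = vector [fst z, fst (snd z), snd (snd z)]"

lemma cons3_nth [simp]: "cons3 z $ 1 = fst z" "cons3 z $ 2 = fst (snd z)" "cons3 z $ 3 = snd (snd z)"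
  by (simp_all add: cons3_def)

lemma continuous_on_cons3: "continuous_on A cons3"
  unfolding cons3_def[abs_def] vector_eq_lambda
proof (rule continuous_on_vec_lambda)
  fix i :: 3
  show "continuous_on A (\<lambda>z. if i = 1 then fst z else if i = 2 then fst (snd z) else snd (snd z))"
    by (cases "i = 1"; cases "i = 2"; simp; intro continuous_intros)
qed

lemma measurable_cons3 [measurable]: "cons3 \<in> borel_measurable borel"
  by (intro borel_measurable_continuous_onI continuous_on_cons3)

lemma emeasure_lborel_Times:
  fixes A :: "'a::euclidean_space set" and B :: "'b::euclidean_space set"
  assumes "A \<in> sets borel" "B \<in> sets borel"
  shows "emeasure lborel (A \<times> B) = emeasure lborel A * emeasure lborel B"
  using lborel.emeasure_pair_measure_Times[of A lborel B] assms unfolding lborel_prod by simp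

lemma prod_Basis_3: "(\<Prod>b\<in>Basis. (x :: real^3) \<bullet> b) = x $ 1 * x $ 2 * x $ 3"
proof -
  have "(Basis :: (real^3) set) = {axis 1 1, axis 2 1, axis 3 1}"
    by (auto simp: Basis_vec_def UNIV_3)
  from this show ?thesis unfolding \<open>Basis = _\<close> by (simp add: axis_eq_axis inner_axis mult.assoc)
qed

lemma lborel_cons3: "distr lborel borel cons3 = lborel"
proof (rule lborel_eqI[symmetric])
  fix l u :: "real^3" assume "\<And>b. b \<in> Basis \<Longrightarrow> l \<bullet> b \<le> u \<bullet> b"
  from this[of "axis i 1" for i] have le: "l $ i \<le> u $ i" for i
    by (auto simp: inner_axis axis_in_Basis_iff)
  have "cons3 -` Topology_Euclidean_Space.box l u = {l $ 1<..<u $ 1} \<times> ({l $ 2<..<u $ 2} \<times> {l $ 3<..<u $ 3})"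
    by (auto simp: mem_box_cart forall_3)
  then show "emeasure (distr lborel borel cons3) (Topology_Euclidean_Space.box l u) = ennreal (\<Prod>b\<in>Basis. (u - l) \<bullet> b)"
    unfolding prod_Basis_3
    by (simp add: emeasure_distr emeasure_lborel_Times le ennreal_mult[symmetric] mult.assoc borel_Times)
qed simp

context flow_chart
begin

definition flat :: "real^3 \<Rightarrow> real^3" where "flat p = vector [p $ 1, p $ 2, Y p]"
definition plane :: "(real \<times> real) set" where "plane = (\<lambda>p. (p $ 2, Y p)) ` Defs.box"
definition unflat :: "real^3 \<Rightarrow> real^3" where "unflat = inv_into Defs.box flat"

lemma flat_nth [simp]: "flat p $ 1 = p $ 1" "flat p $ 2 = p $ 2" "flat p $ 3 = Y p"
  by (simp_all add: flat_def)

lemma Y_slice: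
  assumes p: "p \<in> Defs.box" and s: "s \<in> {0<..<1}"
  shows "Y (\<chi> i. if i = 1 then s else p $ i) = Y p"
proof -
  have "scale3 t (\<chi> i. if i = 1 then s else p $ i) = (\<chi> i. if i = 1 then s else scale3 t p $ i)" for t
    by (simp add: scale3_def vec_eq_iff forall_3)
  then show ?thesis
    unfolding Y_def prim_def pint_def using m_slice(2)[OF scale3_in_box[OF p] s]
    by (auto intro!: arg_cong2[where f="(*)"] Henstock_Kurzweil_Integration.integral_cong)
qed

text \<open>Points with the same image differ at most in the third coordinate, and Y is strictly
  increasing in it because its derivative m is positive.\<close>

lemma inj_flat: "inj_on flat Defs.box"
proof (rule inj_onI)
  fix p p' assume p: "p \<in> Defs.box" "p' \<in> Defs.box" and eq: "flat p = flat p'"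
  have e: "p $ 1 = p' $ 1" "p $ 2 = p' $ 2" "Y p = Y p'" using eq by (metis flat_nth)+
  have seg: "p + t *\<^sub>R (p' - p) \<in> Defs.box" if "t \<in> {0..1}" for t
    using convexD_alt[OF convex_box p, of t] that by (simp add: algebra_simps)
  let ?D = "\<lambda>t h. (h *\<^sub>R (p' - p)) $ 2 * q (p + t *\<^sub>R (p' - p)) + (h *\<^sub>R (p' - p)) $ 3 * m (p + t *\<^sub>R (p' - p))"
  have "((\<lambda>t. Y (p + t *\<^sub>R (p' - p))) has_derivative ?D t) (at t within {0..1})" if "0 \<le> t" "t \<le> 1" for t
  proof -
    have t: "t \<in> {0..1}" using that by simp
    have "((\<lambda>t. p + t *\<^sub>R (p' - p)) has_derivative (\<lambda>h. h *\<^sub>R (p' - p))) (at t within {0..1})"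
      by (auto intro!: derivative_eq_intros)
    from has_derivative_compose[OF this derivative_Y[OF seg[OF t]]] show ?thesis .
  qed
  from mvt_very_simple[OF zero_le_one this]
  obtain \<theta> where \<theta>: "\<theta> \<in> {0..1}" "Y (p + 1 *\<^sub>R (p' - p)) - Y (p + 0 *\<^sub>R (p' - p)) = ?D \<theta> (1 - 0)" by blast
  then have "(p' $ 3 - p $ 3) * m (p + \<theta> *\<^sub>R (p' - p)) = 0" using e by simp
  then have "p $ 3 = p' $ 3" using m_pos[OF seg[OF \<theta>(1)]] by simp
  then show "p = p'" using e by (simp add: vec_eq_iff forall_3)
qed

lemma unflat_flat: "p \<in> Defs.box \<Longrightarrow> unflat (flat p) = p"
  unfolding unflat_def by (rule inv_into_f_f[OF inj_flat])

lemma derivative_flat: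
  assumes p: "p \<in> Defs.box"
  shows "(flat has_derivative (\<lambda>h. vector [h $ 1, h $ 2, h $ 2 * q p + h $ 3 * m p])) (at p)"
proof -
  have nth: "((\<lambda>x :: real^3. x $ i) has_derivative (\<lambda>h. h $ i)) (at p)" for i
    by (rule bounded_linear_imp_has_derivative[OF bounded_linear_vec_nth])
  have "((\<lambda>x. flat x $ i) has_derivative (\<lambda>h. vector [h $ 1, h $ 2, h $ 2 * q p + h $ 3 * m p] $ i)) (at p)" for i :: 3
    using exhaust_3[of i] nth derivative_Y[OF p] by auto
  then show ?thesis
    unfolding has_derivative_componentwise_within[of flat] by (auto simp: Basis_vec_def inner_axis)
qed

lemma det_flat: "det (matrix (\<lambda>h :: real^3. vector [h $ 1, h $ 2, h $ 2 * q p + h $ 3 * m p])) = m p"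
  by (simp add: det_3 matrix_def axis_def)

lemma continuous_on_Y: "continuous_on Defs.box Y" and continuous_on_m: "continuous_on Defs.box m"
  using smooth_Y[of 0] smooth_m[of 0] by simp_all

lemma continuous_on_flat: "continuous_on Defs.box flat"
  using derivative_flat by (meson continuous_at_imp_continuous_on has_derivative_continuous)

text \<open>Y does not depend on t, so the image of the box is the product of (0, 1) and
  \<open>plane\<close>, the form in which Fubini's theorem can be used.\<close>

lemma mem_flat_image: "cons3 (t, y) \<in> flat ` Defs.box \<longleftrightarrow> t \<in> {0<..<1} \<and> y \<in> plane"
proof
  assume "cons3 (t, y) \<in> flat ` Defs.box"
  then obtain p where p: "p \<in> Defs.box" "cons3 (t, y) = flat p" by blast
  then have "t = p $ 1" "y = (p $ 2, Y p)" by (metis cons3_nth(1) flat_nth(1) fst_conv, metis cons3_nth(2,3) flat_nth(2,3) fst_conv snd_conv prod.collapse)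
  then show "t \<in> {0<..<1} \<and> y \<in> plane" using p(1) by (auto simp: in_box_iff plane_def)
next
  assume *: "t \<in> {0<..<1} \<and> y \<in> plane"
  then obtain p where p: "p \<in> Defs.box" "y = (p $ 2, Y p)" by (auto simp: plane_def)
  let ?p = "\<chi> i. if i = 1 then t else p $ i"
  have "cons3 (t, y) = flat ?p" using Y_slice[OF p(1), of t] p * by (simp add: vec_eq_iff forall_3)
  then show "cons3 (t, y) \<in> flat ` Defs.box" using m_slice(1)[OF p(1), of t] * by blast
qed

text \<open>Invariance of domain gives this from continuity and injectivity, and likewise the
  continuity of \<open>unflat\<close> below.\<close>

lemma open_flat_image: "open (flat ` Defs.box)"
  by (rule invariance_of_domain[OF continuous_on_flat open_box inj_flat])

lemma open_plane: "open plane"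
proof -
  have "plane = (\<lambda>y. cons3 (1 / 2, y)) -` (flat ` Defs.box)" by (intro set_eqI) (simp add: mem_flat_image)
  moreover have "continuous_on UNIV (\<lambda>y. cons3 (1 / 2, y))"
    by (rule continuous_on_compose2[OF continuous_on_cons3[of UNIV]]) (auto intro!: continuous_intros)
  ultimately show ?thesis using open_vimage[OF open_flat_image] by metis
qed

lemma continuous_on_unflat: "continuous_on (flat ` Defs.box) unflat"
proof -
  obtain g where g: "homeomorphism Defs.box (flat ` Defs.box) flat g"
    using invariance_of_domain_homeomorphism[OF open_box continuous_on_flat _ inj_flat] by auto
  have "continuous_on (flat ` Defs.box) g" "\<And>x. x \<in> flat ` Defs.box \<Longrightarrow> unflat x = g x"
    using g by (auto simp: homeomorphism_def unflat_flat)
  then show ?thesis by (simp cong: continuous_on_cong)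
qed

lemma flat_change_of_variables:
  fixes G :: "real^3 \<Rightarrow> real"
  assumes "G absolutely_integrable_on (flat ` Defs.box)"
  shows "(\<lambda>p. m p * G (flat p)) absolutely_integrable_on Defs.box"
    and "integral Defs.box (\<lambda>p. m p * G (flat p)) = integral (flat ` Defs.box) G"
proof -
  \<comment> \<open>The change of variables theorem is about functions into some
    \<open>real^'n\<close>, so the scalar G passes through \<open>real^1\<close>.\<close>
  let ?f = "\<lambda>x. vec (G x) :: real^1"
  have box: "Defs.box \<in> sets lebesgue" using open_box by simp
  have "?f absolutely_integrable_on (flat ` Defs.box)"
    using assms by (simp add: absolutely_integrable_on_1_iff)
  then have "(\<lambda>x. \<bar>det (matrix (\<lambda>h :: real^3. vector [h $ 1, h $ 2, h $ 2 * q x + h $ 3 * m x] :: real^3))\<bar> *\<^sub>R ?f (flat x)) absolutely_integrable_on Defs.box \<and>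
      integral Defs.box (\<lambda>x. \<bar>det (matrix (\<lambda>h :: real^3. vector [h $ 1, h $ 2, h $ 2 * q x + h $ 3 * m x] :: real^3))\<bar> *\<^sub>R ?f (flat x)) = integral (flat ` Defs.box) ?f"
    by (subst has_absolute_integral_change_of_variables[OF box has_derivative_at_withinI[OF derivative_flat] inj_flat]) auto
  moreover have "\<bar>det (matrix (\<lambda>h :: real^3. vector [h $ 1, h $ 2, h $ 2 * q x + h $ 3 * m x] :: real^3))\<bar> *\<^sub>R ?f (flat x) = vec (m x * G (flat x))"
    if "x \<in> Defs.box" for x
    unfolding det_flat using m_pos[OF that] by (simp add: vec_eq_iff)
  ultimately have "(\<lambda>x. vec (m x * G (flat x)) :: real^1) absolutely_integrable_on Defs.box \<and>
      integral Defs.box (\<lambda>x. vec (m x * G (flat x)) :: real^1) = integral (flat ` Defs.box) ?f"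
    by (simp cong: set_integrable_cong Henstock_Kurzweil_Integration.integral_cong)
  then show "(\<lambda>p. m p * G (flat p)) absolutely_integrable_on Defs.box"
    "integral Defs.box (\<lambda>p. m p * G (flat p)) = integral (flat ` Defs.box) G"
    by (simp_all add: absolutely_integrable_on_1_iff integral_on_1_eq)
qed

text \<open>The integral of f over the flow line above y; flow lines have length 1, so it is a
  mean.\<close>

definition fibre_mean :: "(real^3 \<Rightarrow> real) \<Rightarrow> real \<times> real \<Rightarrow> real" where
  "fibre_mean f y = (\<integral>t. indicator {0<..<1} t * f (unflat (cons3 (t, y))) \<partial>lborel)"

lemma continuous_on_flat_coords:
  assumes "continuous_on Defs.box f"
  shows "continuous_on (flat ` Defs.box) (\<lambda>x. f (unflat x))"
  by (rule continuous_on_compose2[OF assms continuous_on_unflat]) (auto simp: unflat_flat)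

lemma continuous_on_slices:
  assumes f: "continuous_on Defs.box f"
  shows "t \<in> {0<..<1} \<Longrightarrow> continuous_on plane (\<lambda>y. f (unflat (cons3 (t, y))))"
    and "y \<in> plane \<Longrightarrow> continuous_on {0<..<1} (\<lambda>t. f (unflat (cons3 (t, y))))"
  by (rule continuous_on_compose2[OF continuous_on_flat_coords[OF f]
        continuous_on_compose2[OF continuous_on_cons3[of UNIV]]]; auto simp: mem_flat_image intro!: continuous_intros)+

lemma unflat_in_box: "x \<in> flat ` Defs.box \<Longrightarrow> unflat x \<in> Defs.box"
  by (auto simp: unflat_flat)

lemma
  assumes f: "continuous_on Defs.box f" and K: "\<And>p. p \<in> Defs.box \<Longrightarrow> \<bar>f p\<bar> \<le> K"
  shows continuous_on_fibre_mean: "continuous_on plane (fibre_mean f)"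
    and fibre_mean_bound: "y \<in> plane \<Longrightarrow> \<bar>fibre_mean f y\<bar> \<le> K"
proof -
  have meas: "(\<lambda>t. indicator {0<..<1} t * f (unflat (cons3 (t, y)))) \<in> borel_measurable lborel" if "y \<in> plane" for y
    using borel_measurable_continuous_on_indicator[OF _ continuous_on_slices(2)[OF f that]] by simp
  have bd: "\<bar>indicator {0<..<1} t * f (unflat (cons3 (t, y)))\<bar> \<le> indicator {0<..<1} t * K" if "y \<in> plane" for t y
    using K[OF unflat_in_box, of "cons3 (t, y)"] that by (auto simp: indicator_def mem_flat_image)
  have int: "integrable lborel (\<lambda>t :: real. indicator {0<..<1} t * K)" "(\<integral>t. indicator {0<..<1 :: real} t * K \<partial>lborel) = K"
    by auto
  show "\<bar>fibre_mean f y\<bar> \<le> K" if "y \<in> plane"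
  proof -
    have "\<bar>fibre_mean f y\<bar> \<le> (\<integral>t. \<bar>indicator {0<..<1} t * f (unflat (cons3 (t, y)))\<bar> \<partial>lborel)"
      unfolding fibre_mean_def by (rule integral_abs_bound)
    also have "\<dots> \<le> (\<integral>t. indicator {0<..<1 :: real} t * K \<partial>lborel)"
      by (rule integral_mono'[OF int(1)]) (use bd[OF that] order_trans[OF abs_ge_zero bd[OF that]] in auto)
    finally show ?thesis unfolding int .
  qed
  show "continuous_on plane (fibre_mean f)"
    unfolding continuous_on_sequentially
  proof (intro ballI allI impI, elim conjE)
    fix x a assume a: "a \<in> plane" and x: "\<forall>n. x n \<in> plane" "x \<longlonglongrightarrow> a"
    have "(\<lambda>n. \<integral>t. indicator {0<..<1} t * f (unflat (cons3 (t, x n))) \<partial>lborel) \<longlonglongrightarrow>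
        (\<integral>t. indicator {0<..<1} t * f (unflat (cons3 (t, a))) \<partial>lborel)"
    proof (rule integral_dominated_convergence[OF meas[OF a] meas int(1)])
      show "AE t in lborel. (\<lambda>n. indicator {0<..<1} t * f (unflat (cons3 (t, x n)))) \<longlonglongrightarrow> indicator {0<..<1} t * f (unflat (cons3 (t, a)))"
      proof (rule AE_I2)
        fix t :: real
        show "(\<lambda>n. indicator {0<..<1} t * f (unflat (cons3 (t, x n)))) \<longlonglongrightarrow> indicator {0<..<1} t * f (unflat (cons3 (t, a)))"
        proof (cases "t \<in> {0<..<1}")
          case True
          show ?thesis
            by (intro tendsto_mult tendsto_const continuous_on_tendsto_compose[OF continuous_on_slices(1)[OF f True] x(2) a]) (simp add: x)
        qed simp
      qed
    qed (use x bd in auto)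
    then show "(fibre_mean f \<circ> x) \<longlonglongrightarrow> fibre_mean f a" by (simp add: fibre_mean_def o_def)
  qed
qed

text \<open>The Jacobian of the flattening is m, which absorbs the density. As d does not depend on
  t, Fubini leaves only the mean of f along the flow lines.\<close>

lemma plane_integral:
  assumes f: "continuous_on Defs.box f" and K: "\<And>p. p \<in> Defs.box \<Longrightarrow> \<bar>f p\<bar> \<le> K"
    and d: "continuous_on UNIV d" "integrable lborel d"
  shows "set_integrable lborel Defs.box (\<lambda>p. f p * (m p * d (p $ 2, Y p)))"
    and "(LINT p:Defs.box|lborel. f p * (m p * d (p $ 2, Y p))) = (\<integral>y. indicator plane y * fibre_mean f y * d y \<partial>lborel)"
proof -
  let ?W = "flat ` Defs.box"
  define G where "G w = f (unflat w) * d (w $ 2, w $ 3)" for w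
  define H where "H t y = indicator ?W (cons3 (t, y)) * G (cons3 (t, y))" for t y
  have [measurable]: "d \<in> borel_measurable borel" by (rule borel_measurable_continuous_onI[OF d(1)])
  have "continuous_on ?W G"
    unfolding G_def[abs_def]
    by (intro continuous_on_mult continuous_on_flat_coords f continuous_on_compose2[OF d(1)] continuous_on_Pair continuous_on_component continuous_on_id) auto
  then have mG: "(\<lambda>w. indicator ?W w *\<^sub>R G w) \<in> borel_measurable borel"
    by (intro borel_measurable_continuous_on_indicator borel_open open_flat_image)
  have mH: "case_prod H \<in> borel_measurable borel"
  proof -
    have "case_prod H = (\<lambda>z. (\<lambda>w. indicator ?W w *\<^sub>R G w) (cons3 z))" by (auto simp: H_def)
    then show ?thesis using measurable_compose[OF measurable_cons3 mG] by simp
  qed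
  have iD: "integrable (lborel \<Otimes>\<^sub>M lborel) (\<lambda>(t :: real, y). indicator {0<..<1} t * (K * d y))"
  proof (rule lborel_pair.Fubini_integrable)
    show "integrable lborel (\<lambda>t :: real. \<integral>y. norm (case (t, y) of (t, y) \<Rightarrow> indicator {0<..<1} t * (K * d y)) \<partial>lborel)"
      by (simp add: abs_mult)
  qed (use d(2) in auto)
  have bdH: "norm (H t y) \<le> norm (indicator {0<..<1} t * (K * d y))" for t y
  proof (cases "cons3 (t, y) \<in> ?W")
    case True
    from K[OF unflat_in_box[OF this]] have "\<bar>f (unflat (cons3 (t, y)))\<bar> * \<bar>d y\<bar> \<le> \<bar>K\<bar> * \<bar>d y\<bar>"
      by (intro mult_right_mono) auto
    with True show ?thesis by (simp add: H_def G_def mem_flat_image abs_mult)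
  qed (simp add: H_def)
  have iH: "integrable (lborel \<Otimes>\<^sub>M lborel) (case_prod H)"
    by (rule Bochner_Integration.integrable_bound[OF iD]) (use mH bdH in \<open>auto simp: lborel_prod\<close>)
  have iG: "integrable lborel (\<lambda>w. indicator ?W w *\<^sub>R G w)" and eG: "(\<integral>w. indicator ?W w *\<^sub>R G w \<partial>lborel) = (\<integral>z. case_prod H z \<partial>lborel)"
  proof -
    have e: "case_prod H = (\<lambda>z. indicator ?W (cons3 z) *\<^sub>R G (cons3 z))" by (auto simp: H_def)
    have m3: "cons3 \<in> lborel \<rightarrow>\<^sub>M borel" by simp
    show "integrable lborel (\<lambda>w. indicator ?W w *\<^sub>R G w)"
      using iH unfolding lborel_prod e integrable_distr_eq[OF m3 mG, symmetric] lborel_cons3 .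
    show "(\<integral>w. indicator ?W w *\<^sub>R G w \<partial>lborel) = (\<integral>z. case_prod H z \<partial>lborel)"
      using integral_distr[OF m3 mG] unfolding lborel_cons3 e .
  qed
  have sG: "set_integrable lborel ?W G" using iG by (simp add: set_integrable_def)
  have "G absolutely_integrable_on ?W"
    using iG mG by (simp add: set_integrable_def integrable_completion)
  note cv = flat_change_of_variables[OF this]
  have eq: "m p * G (flat p) = f p * (m p * d (p $ 2, Y p))" if "p \<in> Defs.box" for p
    using that by (simp add: G_def unflat_flat)
  let ?h = "\<lambda>p. f p * (m p * d (p $ 2, Y p))"
  have a: "?h absolutely_integrable_on Defs.box" "integral Defs.box ?h = integral ?W G"
    using cv by (simp_all add: eq cong: set_integrable_cong Henstock_Kurzweil_Integration.integral_cong)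
  have "continuous_on Defs.box ?h"
    by (intro continuous_on_mult f continuous_on_m continuous_on_compose2[OF d(1)] continuous_on_Pair continuous_on_component continuous_on_id continuous_on_Y) auto
  then have "(\<lambda>p. indicator Defs.box p *\<^sub>R ?h p) \<in> borel_measurable borel"
    by (intro borel_measurable_continuous_on_indicator borel_open open_box)
  \<comment> \<open>Borel measurability brings integrability down from the completed measure to
    \<open>lborel\<close>.\<close>
  then show sh: "set_integrable lborel Defs.box ?h"
    using a(1) by (simp add: set_integrable_def integrable_completion)
  have "(LINT p:Defs.box|lborel. ?h p) = (LINT w:?W|lborel. G w)"
    unfolding set_borel_integral_eq_integral(2)[OF sh] set_borel_integral_eq_integral(2)[OF sG] a(2) ..
  also have "\<dots> = (\<integral>y. (\<integral>t. H t y \<partial>lborel) \<partial>lborel)"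
    unfolding set_lebesgue_integral_def eG by (rule lborel_pair.integral_snd[OF iH, unfolded lborel_prod, symmetric])
  also have "(\<lambda>y. \<integral>t. H t y \<partial>lborel) = (\<lambda>y. indicator plane y * fibre_mean f y * d y)"
  proof
    fix y
    have "H t y = indicator plane y * (indicator {0<..<1} t * f (unflat (cons3 (t, y)))) * d y" for t
      by (auto simp: H_def G_def indicator_def mem_flat_image)
    then show "(\<integral>t. H t y \<partial>lborel) = indicator plane y * fibre_mean f y * d y" by (simp add: fibre_mean_def)
  qed
  finally show "(LINT p:Defs.box|lborel. ?h p) = (\<integral>y. indicator plane y * fibre_mean f y * d y \<partial>lborel)" .
qed

end

lemma ln_powr_tendsto_0: "\<theta> > 0 \<Longrightarrow> ((\<lambda>x :: real. ln x * x powr (- \<theta>)) \<longlongrightarrow> 0) at_top"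
  by real_asymp

lemma continuous_on_box_point: "continuous_on A (\<lambda>z. box_point (snd z) (fst z))"
proof -
  have "box_point (snd z) (fst z) = cons3 (snd z, fst z $ 1, fst z $ 2)" for z
    by (simp add: box_point_def cons3_def)
  then show ?thesis
    by (simp only:) (rule continuous_on_compose2[OF continuous_on_cons3[of UNIV]];
      auto intro!: continuous_on_Pair continuous_on_snd continuous_on_fst continuous_on_component continuous_on_id)
qed

lemma box_point_in_box: "t \<in> {0<..<1} \<Longrightarrow> z \<in> disk \<Longrightarrow> box_point t z \<in> Defs.box"
  by (auto simp: Defs.box_def)

section \<open>Passage to the limit in the flow box\<close>

context flow_chart
begin

text \<open>The slice t = 1/2 is arbitrary, as Y is constant along flow lines. The image of the
  given measure under this map is the planar measure that the vortices approximate.\<close>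

definition coord :: "real^2 \<Rightarrow> real \<times> real" where
  "coord z = (z $ 1, Y (box_point (1 / 2) z))"

lemma coord_in_plane: "z \<in> disk \<Longrightarrow> coord z \<in> plane"
  using box_point_in_box[of "1 / 2" z] by (auto simp: coord_def plane_def box_point_def intro!: image_eqI)

lemma unflat_coord:
  assumes "t \<in> {0<..<1}" "z \<in> disk"
  shows "unflat (cons3 (t, coord z)) = box_point t z"
proof -
  have b: "box_point (1 / 2) z \<in> Defs.box" "box_point t z \<in> Defs.box" using assms box_point_in_box by auto
  have "(\<chi> i. if i = 1 then t else box_point (1 / 2) z $ i) = box_point t z"
    by (simp add: box_point_def vec_eq_iff forall_3)
  with Y_slice[OF b(1) assms(1)] have "Y (box_point t z) = Y (box_point (1 / 2) z)" by simp
  then have "cons3 (t, coord z) = flat (box_point t z)"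
    by (simp add: vec_eq_iff forall_3 coord_def) (simp add: box_point_def)
  with unflat_flat[OF b(2)] show ?thesis by simp
qed

lemma continuous_on_coord: "continuous_on disk coord"
proof -
  have "continuous_on disk (\<lambda>z. box_point (1 / 2) z)"
  proof -
    have "continuous_on disk (\<lambda>z :: real^2. (z, 1 / 2 :: real))" by (intro continuous_intros)
    from continuous_on_compose2[OF continuous_on_box_point[of UNIV] this] show ?thesis by simp
  qed
  then have "continuous_on disk (\<lambda>z. Y (box_point (1 / 2) z))"
    by (rule continuous_on_compose2[OF continuous_on_Y]) (auto intro: box_point_in_box)
  then show ?thesis
    unfolding coord_def[abs_def] by (intro continuous_on_Pair continuous_on_component continuous_on_id)
qed

text \<open>The counterpart of \<open>plane_integral\<close> for the limit measure: both integrals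
  become those of the same fibre mean over \<open>plane\<close>.\<close>

lemma flow_box_integral:
  fixes f :: "real^3 \<Rightarrow> real"
  assumes \<sigma>: "probability_on_disk \<sigma>"
    and f: "continuous_on Defs.box f" and K: "\<And>p. p \<in> Defs.box \<Longrightarrow> \<bar>f p\<bar> \<le> K"
  shows "(\<integral>(z, t). f (box_point t z) \<partial>(\<sigma> \<Otimes>\<^sub>M restrict_space lborel {0<..<1}))
    = (\<integral>y. indicator plane y * fibre_mean f y \<partial>(distr \<sigma> borel coord))"
proof -
  interpret \<sigma>: prob_space \<sigma> using \<sigma> by (simp add: probability_on_disk_def)
  have sets: "sets \<sigma> = sets (restrict_space borel disk)" using \<sigma> by (simp add: probability_on_disk_def)
  have space: "space \<sigma> = disk" using sets_eq_imp_space_eq[OF sets] by (simp add: space_restrict_space)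
  define T :: "real measure" where "T = restrict_space lborel {0<..<1}"
  have spaceT: "space T = {0<..<1}" by (simp add: T_def space_restrict_space)
  interpret T: prob_space T
    by (rule prob_spaceI) (simp add: T_def emeasure_restrict_space space_restrict_space)
  interpret P: pair_prob_space \<sigma> T ..
  have mc: "coord \<in> \<sigma> \<rightarrow>\<^sub>M borel"
    unfolding measurable_cong_sets[OF sets refl] by (rule borel_measurable_continuous_on_restrict[OF continuous_on_coord])
  have "(\<lambda>x. indicator plane x *\<^sub>R fibre_mean f x) \<in> borel_measurable borel"
    by (intro borel_measurable_continuous_on_indicator borel_open open_plane continuous_on_fibre_mean[OF f K])
  then have mF: "(\<lambda>y. indicator plane y * fibre_mean f y) \<in> borel_measurable borel" by simp
  have id: "(\<lambda>z. z) \<in> \<sigma> \<rightarrow>\<^sub>M borel" "(\<lambda>t. t) \<in> T \<rightarrow>\<^sub>M borel"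
    unfolding measurable_cong_sets[OF sets refl] T_def by (auto intro: measurable_restrict_space1)
  have "(\<lambda>w. (fst w, snd w)) \<in> \<sigma> \<Otimes>\<^sub>M T \<rightarrow>\<^sub>M borel \<Otimes>\<^sub>M borel"
    by (intro measurable_Pair measurable_compose[OF measurable_fst id(1)] measurable_compose[OF measurable_snd id(2)])
  then have "(\<lambda>w. w) \<in> \<sigma> \<Otimes>\<^sub>M T \<rightarrow>\<^sub>M borel" by (simp add: borel_prod)
  from measurable_compose[OF this borel_measurable_continuous_onI[OF continuous_on_box_point]]
  have "(\<lambda>w. box_point (snd w) (fst w)) \<in> \<sigma> \<Otimes>\<^sub>M T \<rightarrow>\<^sub>M restrict_space borel Defs.box"
    by (intro measurable_restrict_space2) (auto simp: space_pair_measure space spaceT box_point_in_box)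
  from measurable_compose[OF this borel_measurable_continuous_on_restrict[OF f]]
  have mf: "(\<lambda>(z, t). f (box_point t z)) \<in> borel_measurable (\<sigma> \<Otimes>\<^sub>M T)" by (simp add: case_prod_beta')
  have "integrable (\<sigma> \<Otimes>\<^sub>M T) (\<lambda>(z, t). f (box_point t z))"
    by (rule P.integrable_const_bound[of _ K, OF AE_I2 mf])
      (auto simp: space_pair_measure space spaceT intro!: K box_point_in_box)
  then have "(\<integral>(z, t). f (box_point t z) \<partial>(\<sigma> \<Otimes>\<^sub>M T)) = (\<integral>z. (\<integral>t. f (box_point t z) \<partial>T) \<partial>\<sigma>)"
    by (rule P.integral_fst[symmetric])
  also have "\<dots> = (\<integral>z. indicator plane (coord z) * fibre_mean f (coord z) \<partial>\<sigma>)"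
  proof (rule Bochner_Integration.integral_cong[OF refl])
    fix z assume "z \<in> space \<sigma>"
    then have z: "z \<in> disk" by (simp add: space)
    have "(\<integral>t. f (box_point t z) \<partial>T) = (\<integral>t. indicator {0<..<1} t * f (box_point t z) \<partial>lborel)"
      unfolding T_def by (subst integral_restrict_space) simp_all
    also have "\<dots> = fibre_mean f (coord z)"
      unfolding fibre_mean_def by (rule Bochner_Integration.integral_cong) (auto simp: indicator_def unflat_coord z)
    finally show "(\<integral>t. f (box_point t z) \<partial>T) = indicator plane (coord z) * fibre_mean f (coord z)"
      using coord_in_plane[OF z] by simp
  qed
  also have "\<dots> = (\<integral>y. indicator plane y * fibre_mean f y \<partial>(distr \<sigma> borel coord))"
    by (rule integral_distr[OF mc mF, symmetric])
  finally show ?thesis unfolding T_def .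
qed

text \<open>The image of the given measure sits in the open set \<open>plane\<close>, so
  \<open>weak_convergence_on_open\<close> applies to the fibre mean of f. The normaliser N kappa is
  the curvature of the entire plane; taking f = 1 shows that asymptotically none of it lies outside
  \<open>plane\<close>.\<close>

lemma vortex_energy_limit:
  fixes w :: "nat \<Rightarrow> nat \<Rightarrow> real \<times> real" and N :: "nat \<Rightarrow> nat" and r :: "nat \<Rightarrow> real"
  assumes \<sigma>: "probability_on_disk \<sigma>"
    and N: "\<And>n. N n \<ge> 1" and r: "\<And>n. r n > 0"
    and conv: "\<And>\<zeta> \<rho>. continuous_on UNIV \<zeta> \<Longrightarrow> (\<And>y. norm y > \<rho> \<Longrightarrow> \<zeta> y = 0) \<Longrightarrow>
      (\<lambda>n. (\<integral>y. \<zeta> y * vortex_curvature (w n) (N n) (r n) y \<partial>lborel) / (real (N n) * kappa)) \<longlonglongrightarrow> (\<integral>y. \<zeta> y \<partial>distr \<sigma> borel coord)"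
    and f: "continuous_on Defs.box f" and K: "\<And>p. p \<in> Defs.box \<Longrightarrow> \<bar>f p\<bar> \<le> K"
  shows "(\<lambda>n. (LINT p:Defs.box|lborel. f p * (m p * vortex_curvature (w n) (N n) (r n) (p $ 2, Y p))) / (real (N n) * kappa))
      \<longlonglongrightarrow> (\<integral>(z, t). f (box_point t z) \<partial>(\<sigma> \<Otimes>\<^sub>M restrict_space lborel {0<..<1}))"
    and "set_integrable lborel Defs.box (\<lambda>p. f p * (m p * vortex_curvature (w k) (N k) (r k) (p $ 2, Y p)))"
proof -
  let ?d = "\<lambda>n. vortex_curvature (w n) (N n) (r n)" and ?P = "distr \<sigma> borel coord"
  interpret \<sigma>: prob_space \<sigma> using \<sigma> by (simp add: probability_on_disk_def)
  have sets: "sets \<sigma> = sets (restrict_space borel disk)" using \<sigma> by (simp add: probability_on_disk_def)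
  have space: "space \<sigma> = disk" using sets_eq_imp_space_eq[OF sets] by (simp add: space_restrict_space)
  have mc: "coord \<in> \<sigma> \<rightarrow>\<^sub>M borel"
    unfolding measurable_cong_sets[OF sets refl] by (rule borel_measurable_continuous_on_restrict[OF continuous_on_coord])
  have P: "prob_space ?P" "sets ?P = sets borel" using \<sigma>.prob_space_distr[OF mc] by auto
  have vc: "vortex_config (N n) (r n)" for n using N r by unfold_locales auto
  have ck: "real (N n) * kappa > 0" for n using N[of n] kappa_pos by simp
  have d: "integrable lborel (?d n)" "(\<integral>y. ?d n y \<partial>lborel) = real (N n) * kappa" "?d n y \<ge> 0" "continuous_on UNIV (?d n)" for n y
    unfolding vortex_curvature_def using vortex_config.D_mass[OF vc] vortex_config.D_nonneg[OF vc] Cb_bcont[OF vortex_config.Cb_D[OF vc]]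
    by (auto simp: bcont_def)
  have pl: "AE y in ?P. y \<in> plane"
    by (subst AE_distr_iff[OF mc]) (auto simp: open_plane space intro!: AE_I2 coord_in_plane)
  have "(\<lambda>n. \<integral>y. indicator plane y * fibre_mean f y * (?d n y / (real (N n) * kappa)) \<partial>lborel) \<longlonglongrightarrow> (\<integral>y. indicator plane y * fibre_mean f y \<partial>?P)"
  proof (rule weak_convergence_on_open[OF P open_plane pl])
    show "continuous_on plane (fibre_mean f)" by (rule continuous_on_fibre_mean[OF f K])
    show "\<bar>fibre_mean f y\<bar> \<le> K" if "y \<in> plane" for y using fibre_mean_bound[OF f K that] .
    show "(\<lambda>n. \<integral>y. \<zeta> y * (?d n y / (real (N n) * kappa)) \<partial>lborel) \<longlonglongrightarrow> (\<integral>y. \<zeta> y \<partial>?P)"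
      if "continuous_on UNIV \<zeta>" "\<And>y. norm y > \<rho> \<Longrightarrow> \<zeta> y = 0" for \<zeta> :: "real \<times> real \<Rightarrow> real" and \<rho>
      using conv[OF that] by simp
    show "(\<integral>y. ?d n y / (real (N n) * kappa) \<partial>lborel) = 1" for n using d(2)[of n] N[of n] kappa_pos by simp
    show "0 \<le> ?d n y / (real (N n) * kappa)" for n y using d(3)[of n y] ck[of n] by simp
  qed (use d(1) in simp)
  moreover note I = plane_integral[OF f K d(4) d(1)]
  ultimately show "(\<lambda>n. (LINT p:Defs.box|lborel. f p * (m p * ?d n (p $ 2, Y p))) / (real (N n) * kappa))
      \<longlonglongrightarrow> (\<integral>(z, t). f (box_point t z) \<partial>(\<sigma> \<Otimes>\<^sub>M restrict_space lborel {0<..<1}))"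
    by (subst flow_box_integral[OF \<sigma> f K]) (simp_all add: I(2))
  show "set_integrable lborel Defs.box (\<lambda>p. f p * (m p * ?d k (p $ 2, Y p)))" by (rule I(1))
qed

text \<open>Dropping finitely many terms ensures that no energy vanishes.\<close>

lemma vortex_family:
  assumes \<sigma>: "probability_on_disk \<sigma>"
  shows "\<exists>r \<psi> A. filterlim r at_top sequentially \<and> (\<forall>n. sw_solution g S (r n) (\<psi> n) (A n)) \<and>
    normalized_energy_converges g A \<sigma> \<and> (\<forall>\<theta>>0. (\<lambda>n. energy g (A n) * r n powr (- \<theta>)) \<longlonglongrightarrow> 0)"
proof -
  interpret \<sigma>: prob_space \<sigma> using \<sigma> by (simp add: probability_on_disk_def)
  have sets: "sets \<sigma> = sets (restrict_space borel disk)" using \<sigma> by (simp add: probability_on_disk_def)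
  have mc: "coord \<in> \<sigma> \<rightarrow>\<^sub>M borel"
    unfolding measurable_cong_sets[OF sets refl] by (rule borel_measurable_continuous_on_restrict[OF continuous_on_coord])
  have P: "prob_space (distr \<sigma> borel coord)" "sets (distr \<sigma> borel coord) = sets borel" using \<sigma>.prob_space_distr[OF mc] by auto
  show ?thesis
  proof (rule vortex_sequence[OF P])
    fix w :: "nat \<Rightarrow> nat \<Rightarrow> real \<times> real" and N :: "nat \<Rightarrow> nat" and r :: "nat \<Rightarrow> real"
    assume N: "\<And>n. N n \<ge> (1 :: nat)" and rn: "\<And>n. r n \<ge> real (Suc n)" and re: "\<And>n. r n \<ge> exp (real (N n))"
      and conv: "\<And>\<zeta> \<rho>. continuous_on UNIV \<zeta> \<Longrightarrow> (\<And>y. norm y > \<rho> \<Longrightarrow> \<zeta> y = 0) \<Longrightarrow>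
      (\<lambda>n. (\<integral>y. \<zeta> y * vortex_curvature (w n) (N n) (r n) y \<partial>lborel) / (real (N n) * kappa)) \<longlonglongrightarrow> (\<integral>y. \<zeta> y \<partial>distr \<sigma> borel coord)"
    have rp: "r n > 0" for n using rn[of n] by simp
    have lim: "(\<lambda>n. (LINT p:Defs.box|lborel. f p * (m p * vortex_curvature (w n) (N n) (r n) (p $ 2, Y p))) / (real (N n) * kappa))
        \<longlonglongrightarrow> (\<integral>(z, t). f (box_point t z) \<partial>(\<sigma> \<Otimes>\<^sub>M restrict_space lborel {0<..<1}))"
      and si: "set_integrable lborel Defs.box (\<lambda>p. f p * (m p * vortex_curvature (w k) (N k) (r k) (p $ 2, Y p)))"
      if "continuous_on Defs.box f" "\<And>p. p \<in> Defs.box \<Longrightarrow> \<bar>f p\<bar> \<le> K" for f K k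
      by (rule vortex_energy_limit[OF \<sigma> N rp], fact conv, fact, fact)+
    have vc: "vortex_config (N k) (r k)" for k using N rp by unfold_locales auto
    have "\<exists>\<psi> A. sw_solution g S (r k) \<psi> A \<and>
        (\<forall>p\<in>Defs.box. energy_density g A p = m p * (vortex_curvature (w k) (N k) (r k) (p $ 2, Y p) / 2))" for k
      by (rule vortex_solution[OF vc])
    then obtain \<psi> A where *: "\<And>k. sw_solution g S (r k) (\<psi> k) (A k) \<and>
        (\<forall>p\<in>Defs.box. energy_density g (A k) p = m p * (vortex_curvature (w k) (N k) (r k) (p $ 2, Y p) / 2))"
      by metis
    have sol: "sw_solution g S (r k) (\<psi> k) (A k)" for k using * by blast
    have ed: "energy_density g (A k) p = m p * (vortex_curvature (w k) (N k) (r k) (p $ 2, Y p) / 2)" if "p \<in> Defs.box" for k p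
      using * that by blast
    define J where "J f n = (LINT p:Defs.box|lborel. f p * (m p * vortex_curvature (w n) (N n) (r n) (p $ 2, Y p)))" for f n
    define c where "c n = real (N n) * kappa" for n
    have c: "c n > 0" for n using N[of n] kappa_pos by (simp add: c_def)
    have eng: "(LINT p:Defs.box|lborel. f p * energy_density g (A n) p) = J f n / 2" for f n
    proof -
      have "(LINT p:Defs.box|lborel. f p * energy_density g (A n) p)
          = (LINT p:Defs.box|lborel. f p * (m p * vortex_curvature (w n) (N n) (r n) (p $ 2, Y p)) / 2)"
        by (rule set_lebesgue_integral_cong) (use open_box in \<open>auto simp: ed\<close>)
      then show ?thesis by (simp add: J_def)
    qed
    have E: "energy g (A n) = J (\<lambda>_. 1) n / 2" for n
      using eng[of "\<lambda>_. 1"] by (simp add: energy_def)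
    have T: "prob_space (\<sigma> \<Otimes>\<^sub>M restrict_space lborel {0 <..< 1 :: real})"
    proof -
      interpret T: prob_space "restrict_space lborel {0 <..< 1 :: real}"
        by (rule prob_spaceI) (simp add: emeasure_restrict_space space_restrict_space)
      interpret P: pair_prob_space \<sigma> "restrict_space lborel {0 <..< 1 :: real}" ..
      show ?thesis by unfold_locales
    qed
    \<comment> \<open>The energy is asymptotic to N kappa / 2, so normalising by the energy or by N
      kappa comes to the same up to that factor.\<close>
    have one: "(\<lambda>n. J (\<lambda>_. 1) n / c n) \<longlonglongrightarrow> 1"
      using lim[of "\<lambda>_. 1" 1] prob_space.prob_space[OF T] by (simp add: J_def c_def case_prod_beta')
    then have "\<forall>\<^sub>F n in sequentially. J (\<lambda>_. 1) n / c n > 0" by (rule order_tendstoD) simp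
    then obtain n0 where n0: "\<And>n. n \<ge> n0 \<Longrightarrow> J (\<lambda>_. 1) n / c n > 0" by (auto simp: eventually_sequentially)
    have J0: "J (\<lambda>_. 1) n \<noteq> 0" if "n \<ge> n0" for n using n0[OF that] by auto
    have rtop: "filterlim r at_top sequentially"
      by (rule filterlim_at_top_mono[OF filterlim_real_sequentially]) (auto intro!: always_eventually order_trans[OF _ rn])
    \<comment> \<open>The energy is of order N and N \<le> ln r, which every positive power of r
      beats.\<close>
    have decay: "(\<lambda>n. energy g (A n) * r n powr (- \<theta>)) \<longlonglongrightarrow> 0" if "\<theta> > 0" for \<theta>
    proof -
      have "(\<lambda>n. real (N n) * r n powr (- \<theta>)) \<longlonglongrightarrow> 0"
      proof (rule tendsto_sandwich[OF _ _ tendsto_const])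
        show "(\<lambda>n. ln (r n) * r n powr (- \<theta>)) \<longlonglongrightarrow> 0"
          by (rule filterlim_compose[OF ln_powr_tendsto_0[OF that] rtop])
        have "real (N n) \<le> ln (r n)" for n using re[of n] rp[of n] by (simp add: ln_ge_iff)
        then show "\<forall>\<^sub>F n in sequentially. real (N n) * r n powr (- \<theta>) \<le> ln (r n) * r n powr (- \<theta>)"
          by (intro always_eventually allI mult_right_mono) auto
      qed auto
      from tendsto_mult[OF one tendsto_mult[OF tendsto_const[of "kappa / 2"] this]]
      have "(\<lambda>n. J (\<lambda>_. 1) n / c n * (kappa / 2 * (real (N n) * r n powr (- \<theta>)))) \<longlonglongrightarrow> 0" by simp
      moreover have "J (\<lambda>_. 1) n / c n * (kappa / 2 * (real (N n) * r n powr (- \<theta>))) = energy g (A n) * r n powr (- \<theta>)" for n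
        using N[of n] kappa_pos unfolding E by (simp add: c_def)
      ultimately show ?thesis by simp
    qed
    have nec: "normalized_energy_converges g (\<lambda>n. A (n + n0)) \<sigma>"
      unfolding normalized_energy_converges_def
    proof (intro conjI allI impI, goal_cases)
      case (1 n)
      have "set_integrable lborel Defs.box (\<lambda>p. 1 * (m p * vortex_curvature (w (n + n0)) (N (n + n0)) (r (n + n0)) (p $ 2, Y p)))"
        by (rule si[of _ 1]) auto
      then have "set_integrable lborel Defs.box (\<lambda>p. 1 * (m p * vortex_curvature (w (n + n0)) (N (n + n0)) (r (n + n0)) (p $ 2, Y p)) / 2)"
        by (rule set_integrable_divide) 
      then show ?case by (rule set_integrable_cong[THEN iffD1, rotated -1]) (auto simp: ed)
    next
      case (2 n)
      show ?case using J0[of "n + n0"] by (simp add: E)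
    next
      case (3 f)
      then obtain K where K: "\<And>p. p \<in> Defs.box \<Longrightarrow> \<bar>f p\<bar> \<le> K" unfolding bounded_iff by auto
      have "(\<lambda>n. J f n / c n) \<longlonglongrightarrow> (\<integral>(z, t). f (box_point t z) \<partial>(\<sigma> \<Otimes>\<^sub>M restrict_space lborel {0<..<1}))"
        using lim[of f K] 3 K by (simp add: J_def c_def)
      from LIMSEQ_ignore_initial_segment[OF tendsto_divide[OF this one], of n0]
      have l: "(\<lambda>n. (J f (n + n0) / c (n + n0)) / (J (\<lambda>_. 1) (n + n0) / c (n + n0))) \<longlonglongrightarrow>
          (\<integral>(z, t). f (box_point t z) \<partial>(\<sigma> \<Otimes>\<^sub>M restrict_space lborel {0<..<1}))" by simp
      have "(LINT p:Defs.box|lborel. f p * (energy_density g (A (n + n0)) p / energy g (A (n + n0))))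
          = (J f (n + n0) / c (n + n0)) / (J (\<lambda>_. 1) (n + n0) / c (n + n0))" for n
      proof -
        have "(LINT p:Defs.box|lborel. f p * (energy_density g (A (n + n0)) p / energy g (A (n + n0))))
            = (LINT p:Defs.box|lborel. f p * energy_density g (A (n + n0)) p) / energy g (A (n + n0))"
          by simp
        also have "\<dots> = (J f (n + n0) / 2) / (J (\<lambda>_. 1) (n + n0) / 2)" unfolding eng E ..
        finally show ?thesis using c[of "n + n0"] by simp
      qed
      with l show ?case by simp
    qed
    show ?thesis
    proof (intro exI conjI allI impI)
      show "filterlim (\<lambda>n. r (n + n0)) at_top sequentially"
        by (rule filterlim_compose[OF rtop filterlim_add_const_nat_at_top])
      show "sw_solution g S (r (n + n0)) (\<psi> (n + n0)) (A (n + n0))" for n by (rule sol)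
      show "normalized_energy_converges g (\<lambda>n. A (n + n0)) \<sigma>" by (rule nec)
      show "(\<lambda>n. energy g (A (n + n0)) * r (n + n0) powr (- \<theta>)) \<longlonglongrightarrow> 0" if "\<theta> > 0" for \<theta>
        by (rule LIMSEQ_ignore_initial_segment[OF decay[OF that]])
    qed
  qed
qed

end

text \<open>With X = d/dt the divergence of the density times X is just the t-derivative of the
  density.\<close>

lemma flow_chart_of_flow_box:
  assumes "volume_form Atl \<mu>" "volume_preserving Atl \<mu> X" "flow_box Atl X c"
  shows "flow_chart (\<mu> c)"
proof
  have c: "c \<in> Atl" "chart_image c = Defs.box" "\<And>p. p \<in> Defs.box \<Longrightarrow> X c p = axis 1 1"
    using assms(3) by (auto simp: flow_box_def dt_field_def)
  show ck: "Ck_on k Defs.box (\<mu> c)" for k using assms(1) c by (auto simp: volume_form_def smooth_on_def simp del: Ck_on.simps)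
  show "\<mu> c p > 0" if "p \<in> Defs.box" for p using assms(1) c that by (auto simp: volume_form_def)
  show "pd 1 (\<mu> c) p = 0" if p: "p \<in> Defs.box" for p
  proof -
    have d: "\<mu> c differentiable (at p)" using ck[of "Suc 0"] p by simp
    have d': "(\<lambda>y. if i = 1 then \<mu> c y else 0) differentiable (at p)" for i :: 3
      using d by (cases "i = 1") auto
    have "pd i (\<lambda>y. \<mu> c y * X c y $ i) p = (if i = 1 then pd 1 (\<mu> c) p else 0)" for i
    proof -
      have "pd i (\<lambda>y. \<mu> c y * X c y $ i) p = pd i (\<lambda>y. if i = 1 then \<mu> c y else 0) p"
        by (rule pd_cong[OF open_box p, symmetric]) (use d' in \<open>auto simp: c(3) axis_def\<close>)
      then show ?thesis by (auto simp: pd_def)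
    qed
    moreover have "(\<Sum>i\<in>UNIV. pd i (\<lambda>y. \<mu> c y * X c y $ i) p) = 0"
      using assms(2) c p by (auto simp: volume_preserving_def)
    ultimately show ?thesis by (simp add: sum_3)
  qed
qed

theorem theorem1p8:
  fixes M :: "'m topology"
    and Atl :: "'m chart set"
    and \<mu> :: "'m chart \<Rightarrow> real^3 \<Rightarrow> real"
    and X :: "'m chart \<Rightarrow> real^3 \<Rightarrow> real^3"
    and c :: "'m chart"
    and \<sigma> :: "(real^2) measure"
  assumes "closed_oriented_3manifold M Atl"
    and "volume_form Atl \<mu>"
    and "vector_field Atl X"
    and "nowhere_vanishing Atl X"
    and "volume_preserving Atl \<mu> X"
    and "flow_box Atl X c"
    and "probability_on_disk \<sigma>"
  shows "\<exists>g S. adapted_metric (\<mu> c) g \<and> spinc_structure g S \<and> eigen_split S \<and>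
    (\<exists>r \<psi> A. filterlim r at_top sequentially \<and>
       (\<forall>n. sw_solution g S (r n) (\<psi> n) (A n)) \<and>
       normalized_energy_converges g A \<sigma>) \<and>
    (\<forall>d>0. frostman d \<sigma> \<longrightarrow>
       (\<exists>r \<psi> A. filterlim r at_top sequentially \<and>
          (\<forall>n. sw_solution g S (r n) (\<psi> n) (A n)) \<and>
          normalized_energy_converges g A \<sigma> \<and>
          (\<lambda>n. energy g (A n) * r n powr (- min (1/4) (d / (2 * (d + 1))))) \<longlonglongrightarrow> 0))"
proof -
  interpret flow_chart "\<mu> c" using assms by (intro flow_chart_of_flow_box)
  obtain r \<psi> A where *: "filterlim r at_top sequentially" "\<forall>n. sw_solution g S (r n) (\<psi> n) (A n)"
      "normalized_energy_converges g A \<sigma>" and decay: "\<And>\<theta>. \<theta> > 0 \<Longrightarrow> (\<lambda>n. energy g (A n) * r n powr (- \<theta>)) \<longlonglongrightarrow> 0"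
    using vortex_family[OF assms(7)] by blast
  \<comment> \<open>The exponent is positive as the minimum of two positive numbers.\<close>
  have "(\<lambda>n. energy g (A n) * r n powr (- min (1/4) (d / (2 * (d + 1))))) \<longlonglongrightarrow> 0" if "d > 0" for d
    using that by (intro decay) simp
  with * show ?thesis
    using adapted spinc_S eigen_split_S by blast
qed

end
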